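(* Let $I=[\eta,\xi]\subset\mathbb{R}$ be a compact interval, let $0<c_1\le c_2$, and let $f\in\mathcal{F}(I;c_1,c_2)$ have a Lipschitz continuous second derivative. Then for any $\varepsilon>0$, any $\delta$ with $0<\delta\le 1/2$ and any integer $Q>1$, $$\hat{N}_f(Q,\delta)=\frac{1}{\zeta(3)}|I|\delta Q^2+O\left(\delta^{1/2}\left(\log\frac1\delta\right)Q^{3/2}+Q^{1+\varepsilon}\right),$$ where the implied constant depends only on $I$, $c_1$, $c_2$, $\varepsilon$ and the Lipschitz constant of $f''$ (in particular it is independent of $f$, $\delta$ and $Q$).
   Context: $\mathcal{F}(I;c_1,c_2)$ denotes the set of $C^2$ functions $f:I\to\mathbb{R}$ with $c_1\le |f''(x)|\le c_2$ for all $x\in I$. $|I|$ is the length of $I$, and $\zeta$ is the Riemann zeta function. For $Q\ge1$ and $\delta>0$, $$\hat{N}_f(Q,\delta)=\#\left\{\left(\tfrac aq,\tfrac bq\right)\in\mathbb{Q}^2:\ q\le Q,\ a/q\in I,\ \gcd(a,b,q)=1,\ \left|f\left(\tfrac aq\right)-\tfrac bq\right|<\tfrac{\delta}{q}\right\},$$ where $a,b\in\mathbb{Z}$, $q\in\mathbb{N}$. *)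

theory Defs
  imports "HOL-Analysis.Analysis"
begin

(* The Dirichlet series: this is the Riemann zeta function only for s > 1. *)
definition zeta :: "real \<Rightarrow> real" where
  "zeta s = (\<Sum>n. 1 / real (Suc n) powr s)"

(* Derivatives are relative to S, hence one-sided at the endpoints of a compact interval;
   the values of f outside S are irrelevant. *)
definition deriv_on :: "real set \<Rightarrow> (real \<Rightarrow> real) \<Rightarrow> real \<Rightarrow> real" where
  "deriv_on S f x = vector_derivative f (at x within S)"

definition C2_on :: "real set \<Rightarrow> (real \<Rightarrow> real) \<Rightarrow> bool" where
  "C2_on S f \<longleftrightarrow> f differentiable_on S \<and> deriv_on S f differentiable_on S \<and>
     continuous_on S (deriv_on S (deriv_on S f))"

definition curved_functions :: "real set \<Rightarrow> real \<Rightarrow> real \<Rightarrow> (real \<Rightarrow> real) set" where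
  "curved_functions S c1 c2 =
     {f. C2_on S f \<and>
         (\<forall>x\<in>S. c1 \<le> \<bar>deriv_on S (deriv_on S f) x\<bar> \<and> \<bar>deriv_on S (deriv_on S f) x\<bar> \<le> c2)}"

definition near_points ::
  "(real \<Rightarrow> real) \<Rightarrow> real set \<Rightarrow> real \<Rightarrow> real \<Rightarrow> (rat \<times> rat) set" where
  "near_points f S Q \<delta> =
     {(of_int a / of_nat q, of_int b / of_nat q) | (a::int) (b::int) (q::nat).
        q > 0 \<and> real q \<le> Q \<and> of_int a / real q \<in> S \<and> gcd (gcd a b) (int q) = 1 \<and>
        \<bar>f (of_int a / real q) - of_int b / real q\<bar> < \<delta> / real q}"

definition N_hat :: "(real \<Rightarrow> real) \<Rightarrow> real set \<Rightarrow> real \<Rightarrow> real \<Rightarrow> nat" where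
  "N_hat f S Q \<delta> = card (near_points f S Q \<delta>)"

end

theory Submission
  imports Defs "HOL-Computational_Algebra.Squarefree"
begin

text \<open>
  By Moebius inversion it suffices to count all lattice points $(q, a, b)$, not only the primitive ones.
  The condition $|q f(a/q) - b| < \delta$ is smoothed by trapezoids of slope $Q$, which leaves the exponential
  sums $\sum_{q, a} e(j q f(a/q))$.  Fejer smoothing in $a$ replaces such a sum by the integrals
  $\int \sum_q q\, e(q (j f(x) - h x))\, dx$.  One integration by parts away from the stationary point
  $f'(x) = h/j$ bounds the integral by an average of $|\sum_q e(q (j f^*(h/j) - j \tau))|$, where $f^*$ is the
  Legendre transform of $f$; so everything reduces to counting the $(j, h)$ for which $j (f^*(h/j) - \tau)$ is
  close to an integer.  For this a bound of Huxley type suffices.  Three neighbouring primitive points close to a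
  curved graph lie on a rational line, and a line carrying many points is itself a point close to the
  dual graph, with smaller denominator; this gives a recursion in the dyadic size of the denominator.
\<close>

section \<open>Curved functions and their Legendre duals\<close>

text \<open>The recursion passes from a curve to its dual at every level, so the class of curves
  must not deteriorate under the Legendre transform. Two-sided quadratic bounds on the whole line
  with the constants \<open>c\<close> and \<open>1 / c\<close> achieve this: dualising exchanges the
  two bounds, \<open>c\<close> stays the same, and surjectivity of the slope gives the dual a
  meaning at every slope, so no interval has to be tracked. The class is also closed under adding
  constants. This is what makes plain integration by parts sufficient, without a stationary phase
  expansion: the translates of the dual over which the tail is averaged all obey the same count. The
  error has its shape from the sum over j, where the trapezoid supplies the weight min(\<delta>,
  1/j, Q/j^2). Up to constants a block j ~ J contributes Q^(3/2) J^(1/2) log J before weighting,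
  plus terms that matter only near J = Q. The former peaks at J = 1/\<delta> and gives
  \<delta>^(1/2) log(1/\<delta>) Q^(3/2), its logarithm being a harmonic sum over common divisors;
  the latter give Q^(1+\<epsilon>).\<close>

definition curv :: "real \<Rightarrow> (real \<Rightarrow> real) \<Rightarrow> (real \<Rightarrow> real) \<Rightarrow> bool" where
  "curv c f f' \<longleftrightarrow> surj f' \<and>
     (\<forall>x y. f x + f' x * (y - x) + c / 2 * (y - x)\<^sup>2 \<le> f y \<and>
            f y \<le> f x + f' x * (y - x) + (y - x)\<^sup>2 / (2 * c))"

definition legendre :: "(real \<Rightarrow> real) \<Rightarrow> (real \<Rightarrow> real) \<Rightarrow> real \<Rightarrow> real" where
  "legendre f f' p = p * inv f' p - f (inv f' p)"

lemma curv_lower: "curv c f f' \<Longrightarrow> f x + f' x * (y - x) + c / 2 * (y - x)\<^sup>2 \<le> f y"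
  and curv_upper: "curv c f f' \<Longrightarrow> f y \<le> f x + f' x * (y - x) + (y - x)\<^sup>2 / (2 * c)"
  and curv_surj: "curv c f f' \<Longrightarrow> surj f'"
  by (simp_all add: curv_def)

lemma curv_mono:
  assumes "curv c f f'" "x \<le> y"
  shows "c * (y - x) \<le> f' y - f' x"
proof (cases "x = y")
  case False
  have "f x + f' x * (y - x) + c / 2 * (y - x)\<^sup>2 + f' y * (x - y) + c / 2 * (y - x)\<^sup>2 \<le> f x"
    using curv_lower[OF assms(1), of x y] curv_lower[OF assms(1), of y x]
    by (simp add: power2_commute)
  then have "(c * (y - x)) * (y - x) \<le> (f' y - f' x) * (y - x)"
    by (simp add: algebra_simps power2_eq_square)
  then show ?thesis using False assms(2) by (simp add: mult_le_cancel_right)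
qed simp

lemma curv_lipschitz:
  assumes "curv c f f'" "x \<le> y"
  shows "f' y - f' x \<le> (y - x) / c"
proof (cases "x = y")
  case False
  have "f x \<le> f x + f' x * (y - x) + (y - x)\<^sup>2 / (2 * c) + f' y * (x - y) + (y - x)\<^sup>2 / (2 * c)"
    using curv_upper[OF assms(1), of x y] curv_upper[OF assms(1), of y x]
    by (simp add: power2_commute)
  also have "\<dots> = f x + (y - x) * ((y - x) / c - (f' y - f' x))"
  proof (cases "c = 0")
    case False
    have "(y - x)\<^sup>2 / (2 * c) = (y - x)\<^sup>2 / c / 2" by simp
    then have "(y - x)\<^sup>2 / (2 * c) + (y - x)\<^sup>2 / (2 * c) = (y - x) * ((y - x) / c)"
      by (simp add: power2_eq_square)
    then show ?thesis by (simp add: algebra_simps)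
  qed (simp add: algebra_simps)
  finally have "0 \<le> (y - x) * ((y - x) / c - (f' y - f' x))" by simp
  then show ?thesis using False assms(2) by (simp add: zero_le_mult_iff)
qed simp

lemma curv_inj:
  assumes "curv c f f'" "c > 0"
  shows "inj f'"
proof (rule injI)
  fix x y assume *: "f' x = f' y"
  show "x = y"
  proof (rule ccontr)
    assume "x \<noteq> y"
    then consider "x < y" | "y < x" by linarith
    then show False
    proof cases
      case 1
      then have "0 < c * (y - x)" using assms(2) by simp
      then show False using curv_mono[OF assms(1), of x y] * 1 by simp
    next
      case 2
      then have "0 < c * (x - y)" using assms(2) by simp
      then show False using curv_mono[OF assms(1), of y x] * 2 by simp
    qed
  qed
qed

lemma curv_inv: "curv c f f' \<Longrightarrow> f' (inv f' p) = p"
  by (simp add: curv_surj surj_f_inv_f)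

lemma curv_shift: "curv c f f' \<Longrightarrow> curv c (\<lambda>x. f x + t) f'"
  unfolding curv_def by (auto simp: algebra_simps)

text \<open>The two quadratic bounds trade places. The lower bound for the dual combines the upper
  model of \<open>f\<close> at the point of slope \<open>p\<close> with convexity at the point of
  slope \<open>r\<close>; the upper bound combines strong convexity of \<open>f\<close> with Young's
  inequality.\<close>

lemma curv_legendre:
  assumes "curv c f f'" "c > 0"
  shows "curv c (legendre f f') (inv f')"
  unfolding curv_def
proof (intro conjI allI)
  show "surj (inv f')" using curv_inj[OF assms] by (rule inj_imp_surj_inv)
  fix p r
  define x where "x = inv f' p"
  define z where "z = inv f' r"
  have fx: "f' x = p" and fz: "f' z = r" using curv_inv[OF assms(1)] by (simp_all add: x_def z_def)
  \<comment> \<open>This test point maximises \<open>r * y\<close> minus the quadratic upper model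
    of \<open>f\<close> at \<open>x\<close>.\<close>
  define y where "y = x + c * (r - p)"
  have "0 \<le> c / 2 * (y - z)\<^sup>2" using assms(2) by simp
  then have 1: "f z + r * (y - z) \<le> f y" using curv_lower[OF assms(1), of z y] fz by simp
  have 2: "f y \<le> f x + p * (c * (r - p)) + (c * (r - p))\<^sup>2 / (2 * c)"
    using curv_upper[OF assms(1), of y x] fx by (simp add: y_def)
  have 3: "(c * (r - p))\<^sup>2 / (2 * c) = c / 2 * (r - p)\<^sup>2"
    using assms(2) by (simp add: power2_eq_square)
  have 4: "r * (y - z) = r * x + r * (c * (r - p)) - r * z" by (simp add: y_def algebra_simps)
  have 5: "r * (c * (r - p)) - p * (c * (r - p)) = 2 * (c / 2 * (r - p)\<^sup>2)"
    by (simp add: power2_eq_square algebra_simps)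
  have 6: "x * (r - p) = r * x - p * x" by (simp add: algebra_simps)
  show "legendre f f' p + inv f' p * (r - p) + c / 2 * (r - p)\<^sup>2 \<le> legendre f f' r"
    unfolding legendre_def x_def[symmetric] z_def[symmetric]
    using 1 2 3 4 5 6 by linarith
  have 7: "f x + p * (z - x) + c / 2 * (z - x)\<^sup>2 \<le> f z"
    using curv_lower[OF assms(1), of x z] fx by simp
  have 8: "(r - p) * (z - x) \<le> c / 2 * (z - x)\<^sup>2 + (r - p)\<^sup>2 / (2 * c)"
  proof -
    have "0 \<le> (c * (z - x) - (r - p))\<^sup>2 / (2 * c)" using assms(2) by simp
    also have "\<dots> = ((c * (z - x))\<^sup>2 - 2 * (c * (z - x)) * (r - p) + (r - p)\<^sup>2) / (2 * c)"
      by (simp add: power2_diff)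
    also have "\<dots> = (c * (z - x))\<^sup>2 / (2 * c) - 2 * (c * (z - x)) * (r - p) / (2 * c) + (r - p)\<^sup>2 / (2 * c)"
      by (simp add: add_divide_distrib diff_divide_distrib)
    also have "(c * (z - x))\<^sup>2 / (2 * c) = c / 2 * (z - x)\<^sup>2"
      using assms(2) by (simp add: power2_eq_square)
    also have "2 * (c * (z - x)) * (r - p) / (2 * c) = (r - p) * (z - x)"
      using assms(2) by simp
    finally show ?thesis by simp
  qed
  have 9: "r * z = r * x + p * (z - x) + (r - p) * (z - x)" by (simp add: algebra_simps)
  have aux: "R - F \<le> X - A + Y + T"
    if "A + P + S \<le> F" "D \<le> S + T" "R = W + P + D" "Y = W - X" for A D F P R S T W X Y :: real
    using that by linarith
  show "legendre f f' r \<le> legendre f f' p + inv f' p * (r - p) + (r - p)\<^sup>2 / (2 * c)"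
    unfolding legendre_def x_def[symmetric] z_def[symmetric]
    by (rule aux[OF 7 8 9 6])
qed

lemma card_separated_le:
  fixes X :: "real set"
  assumes "finite X" "X \<noteq> {}" "s > 0"
    and sep: "\<And>x y. x \<in> X \<Longrightarrow> y \<in> X \<Longrightarrow> x < y \<Longrightarrow> s \<le> y - x"
    and diam: "\<And>x y. x \<in> X \<Longrightarrow> y \<in> X \<Longrightarrow> x < y \<Longrightarrow> y - x \<le> l" and "l \<ge> 0"
  shows "real (card X) \<le> 1 + l / s"
proof -
  define g where "g x = \<lfloor>(x - Min X) / s\<rfloor>" for x
  have "inj_on g X"
  proof (rule linorder_inj_onI)
    fix x y assume xy: "x < y" "x \<in> X" "y \<in> X"
    have "(x - Min X) / s + 1 \<le> (y - Min X) / s"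
    proof -
      have "(x - Min X) / s + 1 = (x - Min X + s) / s" using \<open>s > 0\<close> by (simp add: add_divide_distrib)
      also have "\<dots> \<le> (y - Min X) / s"
        using sep[OF xy(2,3,1)] \<open>s > 0\<close> by (intro divide_right_mono) auto
      finally show ?thesis .
    qed
    then show "g x \<noteq> g y" unfolding g_def by linarith
  qed auto
  moreover have "g ` X \<subseteq> {0..\<lfloor>l / s\<rfloor>}"
  proof
    fix t assume "t \<in> g ` X"
    then obtain x where x: "x \<in> X" "t = g x" by auto
    have m: "Min X \<in> X" "Min X \<le> x" using assms(1,2) x by auto
    have "x - Min X \<le> l" using diam[OF m(1) x(1)] m(2) \<open>l \<ge> 0\<close> by (cases "Min X = x") auto
    then have "(x - Min X) / s \<le> l / s" using \<open>s > 0\<close> by (simp add: divide_right_mono)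
    moreover have "0 \<le> (x - Min X) / s" using m \<open>s > 0\<close> by simp
    ultimately show "t \<in> {0..\<lfloor>l / s\<rfloor>}" by (simp add: x(2) g_def floor_mono)
  qed
  ultimately have "card X \<le> card {0..\<lfloor>l / s\<rfloor>}"
    by (metis card_image card_mono finite_atLeastAtMost_int)
  also have "card {0..\<lfloor>l / s\<rfloor>} = nat (\<lfloor>l / s\<rfloor> + 1)" by simp
  finally have "real (card X) \<le> of_int (\<lfloor>l / s\<rfloor> + 1)"
  proof -
    assume "card X \<le> nat (\<lfloor>l / s\<rfloor> + 1)"
    moreover have "0 \<le> \<lfloor>l / s\<rfloor>" using \<open>l \<ge> 0\<close> \<open>s > 0\<close> by simp
    ultimately have "int (card X) \<le> \<lfloor>l / s\<rfloor> + 1" by linarith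
    then show ?thesis by linarith
  qed
  then show ?thesis by linarith
qed

section \<open>Rational points near a curve\<close>

text \<open>Any three such points in a window of length at most $c / 2^{n+1}$ are collinear, since their
  determinant is an integer of modulus less than 1.  The line is $j b = h a - k q$; when it meets the strip
  in several points, $(j, h, k)$ is itself a point near the dual curve, with $j$ smaller than $q$.\<close>
definition prim_near :: "(real \<Rightarrow> real) \<Rightarrow> real \<Rightarrow> nat \<Rightarrow> real \<Rightarrow> (int \<times> int \<times> int) set" where
  "prim_near f u n \<Delta> = {(q, a, b). 2 ^ n < 2 * q \<and> q \<le> 2 ^ n \<and>
     u \<le> of_int a / of_int q \<and> of_int a / of_int q \<le> u + 1 \<and> gcd q (gcd a b) = 1 \<and>
     \<bar>of_int q * f (of_int a / of_int q) - of_int b\<bar> \<le> \<Delta>}"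

lemma finite_int_real_interval: "finite {k::int. (x::real) \<le> of_int k \<and> of_int k \<le> (y::real)}"
  by (rule finite_subset[of _ "{\<lceil>x\<rceil>..\<lfloor>y\<rfloor>}"]) (auto simp: ceiling_le_iff le_floor_iff)

lemma finite_prim_near: "finite (prim_near f u n \<Delta>)"
proof (rule finite_subset)
  let ?A = "\<lambda>q::int. {a::int. u * of_int q \<le> of_int a \<and> of_int a \<le> (u + 1) * of_int q}"
  let ?B = "\<lambda>(q::int) (a::int). {b::int. of_int q * f (of_int a / of_int q) - \<Delta> \<le> of_int b \<and>
      of_int b \<le> of_int q * f (of_int a / of_int q) + \<Delta>}"
  show "prim_near f u n \<Delta> \<subseteq> (SIGMA q:{1..2^n}. SIGMA a:?A q. ?B q a)"
  proof
    fix v assume v: "v \<in> prim_near f u n \<Delta>"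
    obtain q a b where veq: "v = (q, a, b)" by (cases v)
    from v have "(q, a, b) \<in> prim_near f u n \<Delta>" by (simp add: veq)
    then have h: "2 ^ n < 2 * q" "q \<le> 2 ^ n" "u \<le> of_int a / of_int q" "of_int a / of_int q \<le> u + 1"
      "\<bar>of_int q * f (of_int a / of_int q) - of_int b\<bar> \<le> \<Delta>"
      by (auto simp: prim_near_def)
    have "(0::int) < 2 ^ n" by simp
    then have q: "q > 0" using h(1) by linarith
    then show "v \<in> (SIGMA q:{1..2^n}. SIGMA a:?A q. ?B q a)"
      unfolding veq using h by (auto simp: pos_le_divide_eq pos_divide_le_eq abs_le_iff)
  qed
  show "finite (SIGMA q:{1..2^n}. SIGMA a:?A q. ?B q a)"
    by (intro finite_SigmaI finite_int_real_interval) auto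
qed

lemma gcd3_mult_left: "gcd (g * a) (gcd (g * b) (g * c)) = \<bar>g\<bar> * gcd a (gcd b c)" for a b c g :: int
proof -
  have "gcd (g * b) (g * c) = \<bar>g\<bar> * gcd b c" by (simp add: gcd_mult_left abs_mult)
  then have "gcd (g * a) (gcd (g * b) (g * c)) = gcd (\<bar>g\<bar> * a) (\<bar>g\<bar> * gcd b c)"
    by (cases "g \<ge> 0") auto
  then show ?thesis by (simp add: gcd_mult_left abs_mult)
qed

text \<open>The coefficients are the cross product of the two integer vectors, divided by its
  content and with the sign that makes \<open>j\<close> positive. The hypothesis says that its last
  coordinate does not vanish, so the line is not vertical. The premise on \<open>q\<close>,
  \<open>a\<close>, \<open>b\<close> is the vanishing of the determinant of the three
  vectors.\<close>

lemma line_through: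
  fixes q1 a1 b1 q2 a2 b2 :: int
  assumes "q1 * a2 \<noteq> q2 * a1"
  shows "\<exists>j h k. 0 < j \<and> gcd j (gcd h k) = 1 \<and>
    (\<forall>q a b. (a1 * b2 - a2 * b1) * q + (b1 * q2 - b2 * q1) * a + (q1 * a2 - q2 * a1) * b = 0
       \<longrightarrow> j * b = h * a - k * q)"
proof -
  define N where "N = q1 * a2 - q2 * a1"
  define M where "M = b2 * q1 - b1 * q2"
  define K where "K = a1 * b2 - a2 * b1"
  define g where "g = gcd N (gcd M K)"
  have N: "N \<noteq> 0" using assms by (simp add: N_def)
  have g: "g > 0" using N by (simp add: g_def gcd_pos_int)
  have d: "g dvd N" "g dvd M" "g dvd K"
    unfolding g_def by (auto intro: dvd_trans[OF gcd_dvd2 gcd_dvd1] dvd_trans[OF gcd_dvd2 gcd_dvd2])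
  obtain N' where N': "N = g * N'" using d(1) by (rule dvdE)
  obtain M' where M': "M = g * M'" using d(2) by (rule dvdE)
  obtain K' where K': "K = g * K'" using d(3) by (rule dvdE)
  have "g * gcd N' (gcd M' K') = gcd N (gcd M K)"
    using g by (simp only: N' M' K' gcd3_mult_left)
  then have "g * gcd N' (gcd M' K') = g * 1" by (simp add: g_def)
  then have pr: "gcd N' (gcd M' K') = 1" using g by simp
  have eq: "N' * b = M' * a - K' * q" if "K * q + (- M) * a + N * b = 0" for q a b
  proof -
    have "g * (N' * b) = g * (M' * a - K' * q)" using that by (simp add: N' M' K' algebra_simps)
    then show ?thesis using g by simp
  qed
  define s where "s = sgn N'"
  have N'0: "N' \<noteq> 0" using N N' by auto
  have s: "s = 1 \<or> s = -1" using N'0 by (auto simp: s_def sgn_if)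
  show ?thesis
  proof (intro exI conjI allI impI)
    show "0 < s * N'" using N'0 by (auto simp: s_def sgn_if)
    show "gcd (s * N') (gcd (s * M') (s * K')) = 1" using s pr by auto
    fix q a b assume "(a1 * b2 - a2 * b1) * q + (b1 * q2 - b2 * q1) * a + (q1 * a2 - q2 * a1) * b = 0"
    then have "K * q + (- M) * a + N * b = 0" by (simp add: N_def M_def K_def)
    from eq[OF this] show "(s * N') * b = (s * M') * a - (s * K') * q"
      using s by auto
  qed
qed

text \<open>Eliminating one unknown from the two line equations shows that j divides both h m and k
  m for the minor \<open>m\<close>, and it divides j m trivially; primitivity of the coefficients
  leaves j | m. Two points of the line with different abscissas are therefore at least j / (q q')
  apart.\<close>

lemma line_spacing:
  fixes j h k q a b q' a' b' :: int
  assumes "gcd j (gcd h k) = 1" "j * b = h * a - k * q" "j * b' = h * a' - k * q'"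
  shows "j dvd q * a' - q' * a"
proof -
  define m where "m = q * a' - q' * a"
  have "h * m = (h * a' - k * q') * q - (h * a - k * q) * q'" by (simp add: m_def algebra_simps)
  also have "\<dots> = j * b' * q - j * b * q'" by (simp only: assms(2,3))
  also have "\<dots> = j * (b' * q - b * q')" by (simp add: algebra_simps)
  finally have 1: "j dvd h * m" by simp
  have "k * m = (h * a' - k * q') * a - (h * a - k * q) * a'" by (simp add: m_def algebra_simps)
  also have "\<dots> = j * b' * a - j * b * a'" by (simp only: assms(2,3))
  also have "\<dots> = j * (b' * a - b * a')" by (simp add: algebra_simps)
  finally have 2: "j dvd k * m" by simp
  have "j dvd gcd (j * m) (gcd (h * m) (k * m))" using 1 2 by simp
  also have "gcd (j * m) (gcd (h * m) (k * m)) = \<bar>m\<bar> * gcd j (gcd h k)"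
    using gcd3_mult_left[of m j h k] by (simp only: mult.commute)
  finally show ?thesis using assms(1) by (simp add: m_def)
qed

text \<open>Two effects add up when a chord is compared with the slope at \<open>x0\<close>: the
  slope has already drifted between \<open>x0\<close> and \<open>x\<close>, and it drifts further
  between \<open>x\<close> and \<open>x'\<close>. Later the first term keeps \<open>x\<close> close
  to the point of tangency and the second keeps \<open>x'\<close> close to \<open>x\<close>.\<close>

lemma curv_gap_lower:
  assumes "curv c f f'" and "(x0 \<le> x \<and> x \<le> x') \<or> (x' \<le> x \<and> x \<le> x0)"
  shows "c * \<bar>x - x0\<bar> * \<bar>x' - x\<bar> + c / 2 * (x' - x)\<^sup>2 \<le> f x' - f x - f' x0 * (x' - x)"
proof -
  have "c * \<bar>x - x0\<bar> * \<bar>x' - x\<bar> \<le> (f' x - f' x0) * (x' - x)"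
    using assms(2)
  proof
    assume *: "x0 \<le> x \<and> x \<le> x'"
    then have "c * (x - x0) * (x' - x) \<le> (f' x - f' x0) * (x' - x)"
      using curv_mono[OF assms(1), of x0 x] by (intro mult_right_mono) auto
    then show ?thesis using * by simp
  next
    assume *: "x' \<le> x \<and> x \<le> x0"
    then have "c * (x0 - x) * (x - x') \<le> (f' x0 - f' x) * (x - x')"
      using curv_mono[OF assms(1), of x x0] by (intro mult_right_mono) auto
    moreover have "(f' x0 - f' x) * (x - x') = (f' x - f' x0) * (x' - x)" by (simp add: algebra_simps)
    ultimately show ?thesis using * by simp
  qed
  moreover have "f x + f' x * (x' - x) + c / 2 * (x' - x)\<^sup>2 \<le> f x'"
    using curv_lower[OF assms(1)] .
  moreover have "(f' x - f' x0) * (x' - x) = f' x * (x' - x) - f' x0 * (x' - x)" by (simp add: algebra_simps)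
  ultimately show ?thesis by simp
qed

lemma ex_dyadic: "0 < j \<Longrightarrow> \<exists>i. 2 ^ i < 2 * j \<and> j \<le> 2 ^ i" for j :: int
proof (cases "j = 1")
  case True then show ?thesis by (intro exI[of _ 0]) auto
next
  case False
  assume "0 < j"
  then have "2 \<le> nat j" using False by linarith
  then obtain i where "(2::nat) ^ i < nat j" "nat j \<le> 2 ^ (i + 1)"
    using ex_power_ivl2[of 2 "nat j"] by auto
  then have "2 ^ i < j" "j \<le> 2 ^ (i + 1)"
    using \<open>0 < j\<close> by (auto simp: zless_nat_eq_int_zless nat_le_iff)
  then show ?thesis by (intro exI[of _ "i + 1"]) auto
qed

section \<open>Clusters of near points on rational lines\<close>

context
  fixes c \<rho> u \<Delta> :: real and n :: nat and f f' :: "real \<Rightarrow> real"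
  assumes cv: "curv c f f'" and c: "0 < c" "c \<le> 1"
    and \<Delta>: "0 \<le> \<Delta>" "\<Delta> * 2 ^ n \<le> \<rho>" and \<rho>: "\<rho> \<le> c ^ 3 / 48"
begin

lemma c_cube_le: "c ^ 3 \<le> 1" "c ^ 3 \<le> c"
proof -
  show "c ^ 3 \<le> 1" using c by (simp add: power_le_one)
  show "c ^ 3 \<le> c" using c power_decreasing[of 1 3 c] by simp
qed

lemma near_real:
  assumes "(q, a, b) \<in> prim_near f u n \<Delta>"
  shows "0 < q" "real_of_int q \<le> 2 ^ n" "2 ^ n < 2 * real_of_int q"
    "\<bar>f (of_int a / of_int q) - of_int b / of_int q\<bar> \<le> 2 * \<Delta> / 2 ^ n"
    "u \<le> of_int a / of_int q" "of_int a / of_int q \<le> u + 1"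
proof -
  have h: "2 ^ n < 2 * q" "q \<le> 2 ^ n" "\<bar>of_int q * f (of_int a / of_int q) - of_int b\<bar> \<le> \<Delta>"
    using assms by (auto simp: prim_near_def)
  have "(0::int) < 2 ^ n" by simp
  then show q: "0 < q" using h(1) by linarith
  have "real_of_int q \<le> real_of_int (2 ^ n)" using h(2) by (simp only: of_int_le_iff)
  then show q1: "real_of_int q \<le> 2 ^ n" by simp
  have "real_of_int (2 ^ n) < real_of_int (2 * q)" using h(1) by (simp only: of_int_less_iff)
  then show q2: "2 ^ n < 2 * real_of_int q" by simp
  have "of_int q * \<bar>f (of_int a / of_int q) - of_int b / of_int q\<bar> =
      \<bar>of_int q * (f (of_int a / of_int q) - of_int b / of_int q)\<bar>"
    using q by (simp add: abs_mult)
  also have "of_int q * (f (of_int a / of_int q) - of_int b / of_int q) =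
      of_int q * f (of_int a / of_int q) - of_int b" using q by (simp add: right_diff_distrib)
  finally have "of_int q * \<bar>f (of_int a / of_int q) - of_int b / of_int q\<bar> \<le> \<Delta>" using h(3) by simp
  moreover have "2 ^ n / 2 * \<bar>f (of_int a / of_int q) - of_int b / of_int q\<bar> \<le>
      of_int q * \<bar>f (of_int a / of_int q) - of_int b / of_int q\<bar>"
    using q2 by (intro mult_right_mono) auto
  ultimately show "\<bar>f (of_int a / of_int q) - of_int b / of_int q\<bar> \<le> 2 * \<Delta> / 2 ^ n"
    by (simp add: field_simps)
  show "u \<le> of_int a / of_int q" "of_int a / of_int q \<le> u + 1"
    using assms by (auto simp: prim_near_def)
qed

lemma near_coplanar:
  assumes v1: "(q1, a1, b1) \<in> prim_near f u n \<Delta>" and v2: "(q2, a2, b2) \<in> prim_near f u n \<Delta>"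
    and v3: "(q3, a3, b3) \<in> prim_near f u n \<Delta>"
    and d2: "\<bar>of_int a2 / of_int q2 - of_int a1 / of_int q1\<bar> \<le> c / (2 * 2 ^ n)"
    and d3: "\<bar>of_int a3 / of_int q3 - of_int a1 / of_int q1\<bar> \<le> c / (2 * 2 ^ n)"
  shows "(a1 * b2 - a2 * b1) * q3 + (b1 * q2 - b2 * q1) * a3 + (q1 * a2 - q2 * a1) * b3 = 0"
    (is "?D = 0")
proof -
  define J :: real where "J = 2 ^ n"
  have J: "J > 0" by (simp add: J_def)
  note n1 = near_real[OF v1] and n2 = near_real[OF v2] and n3 = near_real[OF v3]
  define x1 where "x1 = real_of_int a1 / of_int q1"
  define x2 where "x2 = real_of_int a2 / of_int q2"
  define x3 where "x3 = real_of_int a3 / of_int q3"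
  define y1 where "y1 = real_of_int b1 / of_int q1"
  define y2 where "y2 = real_of_int b2 / of_int q2"
  define y3 where "y3 = real_of_int b3 / of_int q3"
  define E where "E = 2 * \<Delta> / J"
  have E: "E \<ge> 0" using \<Delta> J by (simp add: E_def)
  \<comment> \<open>Subtracting the tangent at \<open>x1\<close> is a shear and leaves the
    determinant unchanged; what remains is quadratic in the length of the window, up to the
    approximation error.\<close>
  define r where "r x y = y - y1 - f' x1 * (x - x1)" for x y
  have rb: "\<bar>r x y\<bar> \<le> (c / (2 * J))\<^sup>2 / (2 * c) + 2 * E"
    if "\<bar>f x - y\<bar> \<le> E" "\<bar>x - x1\<bar> \<le> c / (2 * J)" for x y
  proof -
    have e1: "\<bar>f x1 - y1\<bar> \<le> E" using n1(4) by (simp add: x1_def y1_def E_def J_def)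
    have "0 \<le> c / 2 * (x - x1)\<^sup>2" using c by simp
    then have "0 \<le> f x - f x1 - f' x1 * (x - x1)" using curv_lower[OF cv, of x1 x] by linarith
    moreover have "f x - f x1 - f' x1 * (x - x1) \<le> (x - x1)\<^sup>2 / (2 * c)" using curv_upper[OF cv, of x x1] by linarith
    moreover have "(x - x1)\<^sup>2 / (2 * c) \<le> (c / (2 * J))\<^sup>2 / (2 * c)"
      using power_mono[OF that(2), of 2] c by (intro divide_right_mono) auto
    ultimately show ?thesis using e1 that(1) unfolding r_def by linarith
  qed
  define R where "R = (c / (2 * J))\<^sup>2 / (2 * c) + 2 * E"
  have r3: "\<bar>r x3 y3\<bar> \<le> R" unfolding R_def
    using n3(4) d3 by (intro rb) (simp_all add: x1_def x3_def y3_def E_def J_def)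
  have r2: "\<bar>r x2 y2\<bar> \<le> R" unfolding R_def
    using n2(4) d2 by (intro rb) (simp_all add: x1_def x2_def y2_def E_def J_def)
  have "real_of_int ?D = of_int q1 * of_int q2 * of_int q3 * ((x2 - x1) * (y3 - y1) - (x3 - x1) * (y2 - y1))"
  proof -
    have "real_of_int a1 = of_int q1 * x1" "real_of_int a2 = of_int q2 * x2" "real_of_int a3 = of_int q3 * x3"
      "real_of_int b1 = of_int q1 * y1" "real_of_int b2 = of_int q2 * y2" "real_of_int b3 = of_int q3 * y3"
      using n1(1) n2(1) n3(1) by (simp_all add: x1_def x2_def x3_def y1_def y2_def y3_def)
    then show ?thesis by (simp add: algebra_simps)
  qed
  also have "(x2 - x1) * (y3 - y1) - (x3 - x1) * (y2 - y1) = (x2 - x1) * r x3 y3 - (x3 - x1) * r x2 y2"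
    by (simp add: r_def algebra_simps)
  finally have "\<bar>real_of_int ?D\<bar> = of_int q1 * of_int q2 * of_int q3 * \<bar>(x2 - x1) * r x3 y3 - (x3 - x1) * r x2 y2\<bar>"
    using n1(1) n2(1) n3(1) by (simp add: abs_mult)
  also have "\<dots> \<le> J * J * J * (c / (2 * J) * R + c / (2 * J) * R)"
  proof (intro mult_mono)
    have "\<bar>(x2 - x1) * r x3 y3\<bar> \<le> c / (2 * J) * R"
      unfolding abs_mult using d2 r3 c J by (intro mult_mono) (auto simp: x1_def x2_def J_def)
    moreover have "\<bar>(x3 - x1) * r x2 y2\<bar> \<le> c / (2 * J) * R"
      unfolding abs_mult using d3 r2 c J by (intro mult_mono) (auto simp: x1_def x3_def J_def)
    ultimately show "\<bar>(x2 - x1) * r x3 y3 - (x3 - x1) * r x2 y2\<bar> \<le> c / (2 * J) * R + c / (2 * J) * R"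
      by linarith
  qed (use n1(1,2) n2(1,2) n3(1,2) J in \<open>auto simp: J_def\<close>)
  also have "\<dots> = c\<^sup>2 / 8 + 4 * c * (\<Delta> * J)"
    using J c by (simp add: R_def E_def field_simps power2_eq_square)
  \<comment> \<open>At most 1/8 + 1/12, by \<open>c \<le> 1\<close> and the bound on
    \<open>\<rho>\<close>.\<close>
  also have "\<dots> < 1"
  proof -
    have "c\<^sup>2 \<le> 1" using c by (simp add: power_le_one)
    moreover have "c * (\<Delta> * J) \<le> 1 * (1 / 48)"
      using c \<Delta> \<rho> c_cube_le J by (intro mult_mono) (auto simp: J_def)
    ultimately show ?thesis by simp
  qed
  finally have "\<bar>real_of_int ?D\<bar> < 1" .
  then show ?thesis by linarith
qed

text \<open>With equal abscissas the ordinates differ by an integer multiple of 1/(q1 q2), yet by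
  less than that, so they agree too. The vectors are then proportional, and proportional primitive
  vectors with positive first entry coincide.\<close>

lemma near_distinct:
  assumes v1: "(q1, a1, b1) \<in> prim_near f u n \<Delta>" and v2: "(q2, a2, b2) \<in> prim_near f u n \<Delta>"
    and ne: "(q1, a1, b1) \<noteq> (q2, a2, b2)"
  shows "q1 * a2 \<noteq> q2 * a1"
proof
  assume eq: "q1 * a2 = q2 * a1"
  define J :: real where "J = 2 ^ n"
  have J: "J > 0" by (simp add: J_def)
  note n1 = near_real[OF v1] and n2 = near_real[OF v2]
  have x: "real_of_int a1 / of_int q1 = of_int a2 / of_int q2"
    using eq n1(1) n2(1) by (simp add: field_simps flip: of_int_mult)
  have "\<bar>real_of_int b1 / of_int q1 - of_int b2 / of_int q2\<bar> \<le> 4 * \<Delta> / J"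
    using n1(4) n2(4) x by (simp add: J_def)
  then have "of_int q1 * of_int q2 * \<bar>real_of_int b1 / of_int q1 - of_int b2 / of_int q2\<bar> \<le> J * J * (4 * \<Delta> / J)"
    using n1(1,2) n2(1,2) J \<Delta> by (intro mult_mono) (auto simp: J_def)
  also have "\<dots> = 4 * (\<Delta> * J)" using J by simp
  also have "\<dots> < 1" using \<Delta> \<rho> c_cube_le by (simp add: J_def)
  also have "of_int q1 * of_int q2 * \<bar>real_of_int b1 / of_int q1 - of_int b2 / of_int q2\<bar> =
     \<bar>of_int q1 * of_int q2 * (real_of_int b1 / of_int q1 - of_int b2 / of_int q2)\<bar>"
    using n1(1) n2(1) by (simp add: abs_mult)
  also have "of_int q1 * of_int q2 * (real_of_int b1 / of_int q1 - of_int b2 / of_int q2) = of_int (b1 * q2 - b2 * q1)"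
    using n1(1) n2(1) by (simp add: field_simps)
  finally have beq: "b1 * q2 = b2 * q1" by linarith
  have "q1 = q1 * gcd q2 (gcd a2 b2)" "q2 = q2 * gcd q1 (gcd a1 b1)"
    using v1 v2 by (auto simp: prim_near_def)
  then have "q1 = gcd (q1 * q2) (gcd (q1 * a2) (q1 * b2))" "q2 = gcd (q2 * q1) (gcd (q2 * a1) (q2 * b1))"
    using n1(1) n2(1) by (simp_all only: gcd3_mult_left)
  then have "q1 = q2" using eq beq by (simp add: mult.commute)
  then show False using ne eq beq n1(1) by simp
qed

text \<open>Both points lie on a line of slope \<open>f' x0\<close>, so between them the graph
  departs from this slope by at most the two approximation errors, while
  \<open>curv_gap_lower\<close> forces a departure that grows with both distances. Together with the
  spacing j / 4^n this traps \<open>x\<close> near \<open>x0\<close>, and then \<open>k / j\<close>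
  must be close to the value of the dual at \<open>h / j\<close>. The points are taken on one side
  of \<open>x0\<close> because a chord across the point of tangency can be parallel to the tangent
  at any length.\<close>

lemma near_same_side:
  assumes v: "(q, a, b) \<in> prim_near f u n \<Delta>" and v': "(q', a', b') \<in> prim_near f u n \<Delta>"
    and j: "0 < j" "gcd j (gcd h k) = 1" and l: "j * b = h * a - k * q" "j * b' = h * a' - k * q'"
    and x0: "f' x0 = of_int h / of_int j"
    and x: "x = of_int a / of_int q" "x' = of_int a' / of_int q'"
    and side: "(x0 \<le> x \<and> x < x') \<or> (x' < x \<and> x \<le> x0)"
  shows "of_int j \<le> \<bar>x' - x\<bar> * (2 ^ n * 2 ^ n)"
    and "\<bar>x' - x\<bar> \<le> sqrt (8 * (\<Delta> * 2 ^ n) / c) / 2 ^ n"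
    and "\<bar>x - x0\<bar> \<le> 4 * (\<Delta> * 2 ^ n) / (c * of_int j)"
    and "\<bar>of_int j * legendre f f' (of_int h / of_int j) - of_int k\<bar> \<le> 24 * (\<Delta> * 2 ^ n)\<^sup>2 / (c ^ 3 * of_int j)"
proof -
  define J :: real where "J = 2 ^ n"
  have J: "J > 0" by (simp add: J_def)
  define r where "r = \<Delta> * J"
  have r: "r \<ge> 0" using \<Delta> J by (simp add: r_def)
  define jr where "jr = real_of_int j"
  have jr: "jr > 0" using j(1) by (simp add: jr_def)
  define d where "d = \<bar>x' - x\<bar>"
  have d: "d > 0" using side by (auto simp: d_def)
  define p where "p = real_of_int h / of_int j"
  note n1 = near_real[OF v] and n2 = near_real[OF v']
  define y where "y = real_of_int b / of_int q"
  define y' where "y' = real_of_int b' / of_int q'"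
  have xq: "real_of_int a = of_int q * x" "real_of_int a' = of_int q' * x'"
    "real_of_int b = of_int q * y" "real_of_int b' = of_int q' * y'"
    using n1(1) n2(1) by (simp_all add: x y_def y'_def)
  have yl: "y = p * x - of_int k / jr"
  proof -
    have "real_of_int (j * b) = of_int (h * a - k * q)" using l(1) by (simp only:)
    then have "jr * (of_int q * y) = of_int h * (of_int q * x) - of_int k * of_int q"
      by (simp add: jr_def flip: xq)
    then have "of_int q * (jr * y) = of_int q * (of_int h * x - of_int k)" by (simp add: algebra_simps)
    then have "jr * y = of_int h * x - of_int k" using n1(1) by simp
    then show ?thesis using jr by (simp add: p_def jr_def field_simps)
  qed
  have yl': "y' = p * x' - of_int k / jr"
  proof -
    have "real_of_int (j * b') = of_int (h * a' - k * q')" using l(2) by (simp only:)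
    then have "jr * (of_int q' * y') = of_int h * (of_int q' * x') - of_int k * of_int q'"
      by (simp add: jr_def flip: xq)
    then have "of_int q' * (jr * y') = of_int q' * (of_int h * x' - of_int k)" by (simp add: algebra_simps)
    then have "jr * y' = of_int h * x' - of_int k" using n2(1) by simp
    then show ?thesis using jr by (simp add: p_def jr_def field_simps)
  qed
  have "j dvd q * a' - q' * a" using line_spacing[OF j(2) l] .
  moreover have m: "real_of_int (q * a' - q' * a) = of_int q * of_int q' * (x' - x)"
    by (simp add: xq algebra_simps)
  have "q * a' - q' * a \<noteq> 0"
  proof
    assume "q * a' - q' * a = 0"
    then show False using m d n1(1) n2(1) by (simp add: d_def)
  qed
  ultimately have "j \<le> \<bar>q * a' - q' * a\<bar>" by (intro zdvd_imp_le) simp_all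
  then have "jr \<le> \<bar>real_of_int (q * a' - q' * a)\<bar>" unfolding jr_def by linarith
  also have "\<dots> = of_int q * of_int q' * d" unfolding m using n1(1) n2(1) by (simp add: abs_mult d_def)
  also have "\<dots> \<le> J * J * d"
    using n1(1,2) n2(1,2) d J by (intro mult_mono) (auto simp: J_def)
  finally have s1: "jr \<le> d * (J * J)" by (simp add: mult.commute)
  then show "of_int j \<le> \<bar>x' - x\<bar> * (2 ^ n * 2 ^ n)" by (simp add: jr_def d_def J_def)
  have gap: "c * \<bar>x - x0\<bar> * d + c / 2 * d\<^sup>2 \<le> 4 * r / (J * J)"
  proof -
    have "c * \<bar>x - x0\<bar> * \<bar>x' - x\<bar> + c / 2 * (x' - x)\<^sup>2 \<le> f x' - f x - f' x0 * (x' - x)"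
      using side by (intro curv_gap_lower[OF cv]) auto
    also have "\<dots> = (f x' - y') - (f x - y)" by (simp add: x0[folded p_def] yl yl' algebra_simps)
    also have "\<dots> \<le> 4 * \<Delta> / J"
      using n1(4) n2(4) unfolding x[symmetric] y_def[symmetric] y'_def[symmetric] J_def[symmetric] by linarith
    also have "\<dots> = 4 * r / (J * J)" using J by (simp add: r_def)
    finally show ?thesis by (simp add: d_def)
  qed
  have "d\<^sup>2 \<le> 8 * r / c / (J * J)"
  proof -
    have "0 \<le> c * \<bar>x - x0\<bar> * d" using c d by simp
    then have "c / 2 * d\<^sup>2 \<le> 4 * r / (J * J)" using gap by linarith
    then show ?thesis using c J by (simp add: field_simps)
  qed
  then have d2: "d\<^sup>2 \<le> 8 * r / c / J\<^sup>2" by (simp add: power2_eq_square)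
  then have "d \<le> sqrt (8 * r / c / J\<^sup>2)" by (rule real_le_rsqrt)
  also have "\<dots> = sqrt (8 * r / c) / J" using J real_sqrt_divide[of "8 * r / c" "J\<^sup>2"] by simp
  finally show "\<bar>x' - x\<bar> \<le> sqrt (8 * (\<Delta> * 2 ^ n) / c) / 2 ^ n" by (simp add: d_def r_def J_def)
  have s3: "\<bar>x - x0\<bar> \<le> 4 * r / (c * jr)"
  proof -
    have "0 \<le> c / 2 * d\<^sup>2" using c by simp
    then have "c * \<bar>x - x0\<bar> * d \<le> 4 * r / (J * J)" using gap by linarith
    then have "c * \<bar>x - x0\<bar> * (d * (J * J)) \<le> 4 * r" using J by (simp add: field_simps)
    moreover have "c * \<bar>x - x0\<bar> * jr \<le> c * \<bar>x - x0\<bar> * (d * (J * J))"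
      using s1 c by (intro mult_left_mono) auto
    ultimately have "c * \<bar>x - x0\<bar> * jr \<le> 4 * r" by linarith
    then show ?thesis using c jr by (simp add: field_simps)
  qed
  then show "\<bar>x - x0\<bar> \<le> 4 * (\<Delta> * 2 ^ n) / (c * of_int j)" by (simp add: r_def J_def jr_def)
  have ix0: "inv f' p = x0" using x0 by (metis curv_inj[OF cv c(1)] inv_f_f p_def)
  define P where "P = f x - f x0 - p * (x - x0)"
  have P0: "0 \<le> P"
  proof -
    have "0 \<le> c / 2 * (x - x0)\<^sup>2" using c by simp
    then show ?thesis using curv_lower[OF cv, of x0 x] x0 by (simp add: P_def p_def)
  qed
  have "P \<le> (x - x0)\<^sup>2 / (2 * c)" using curv_upper[OF cv, of x x0] x0 by (simp add: P_def p_def)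
  also have "\<dots> \<le> (4 * r / (c * jr))\<^sup>2 / (2 * c)"
    using power_mono[OF s3, of 2] c by (intro divide_right_mono) auto
  also have "\<dots> = 8 * r\<^sup>2 / (c ^ 3 * jr\<^sup>2)" using c jr by (simp add: field_simps power2_eq_square power3_eq_cube)
  finally have P1: "P \<le> 8 * r\<^sup>2 / (c ^ 3 * jr\<^sup>2)" .
  have fy: "\<bar>f x - y\<bar> \<le> 2 * r / J\<^sup>2"
    using n1(4) J unfolding x[symmetric] y_def[symmetric] by (simp add: r_def J_def power2_eq_square)
  \<comment> \<open>The defect of the dual point splits into the departure \<open>P\<close> of the
    graph from its tangent at \<open>x0\<close> and the approximation error at
    \<open>x\<close>.\<close>
  have leg: "jr * legendre f f' p - of_int k = jr * (P - (f x - y))"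
    using jr by (simp add: legendre_def ix0 P_def yl algebra_simps)
  have "\<bar>P - (f x - y)\<bar> \<le> 8 * r\<^sup>2 / (c ^ 3 * jr\<^sup>2) + 2 * r / J\<^sup>2" using P0 P1 fy by linarith
  then have "jr * \<bar>P - (f x - y)\<bar> \<le> jr * (8 * r\<^sup>2 / (c ^ 3 * jr\<^sup>2) + 2 * r / J\<^sup>2)"
    using jr by (intro mult_left_mono) auto
  also have "\<dots> = 8 * r\<^sup>2 / (c ^ 3 * jr) + 2 * r * (jr * jr / J\<^sup>2) / jr"
    using jr by (simp add: field_simps power2_eq_square)
  \<comment> \<open>Spacing from below and distance from above combine to jr^2 \<le> (8 r / c) J^2,
    which makes the approximation error comparable to the term that comes from
    \<open>P\<close>.\<close>
  also have "\<dots> \<le> 8 * r\<^sup>2 / (c ^ 3 * jr) + 2 * r * (8 * r / c ^ 3) / jr"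
  proof -
    have "jr * jr \<le> (d * (J * J)) * (d * (J * J))" using s1 jr by (intro mult_mono) auto
    also have "\<dots> = d\<^sup>2 * J\<^sup>2 * J\<^sup>2" by (simp add: power2_eq_square)
    also have "\<dots> \<le> 8 * r / c / J\<^sup>2 * J\<^sup>2 * J\<^sup>2" using d2 by (intro mult_right_mono) auto
    also have "\<dots> = 8 * r / c * J\<^sup>2" using J by simp
    finally have "jr * jr / J\<^sup>2 \<le> 8 * r / c" using J by (simp add: pos_divide_le_eq)
    also have "\<dots> \<le> 8 * r / c ^ 3"
      using c_cube_le c r by (intro divide_left_mono) auto
    finally show ?thesis using jr r c by (intro add_mono divide_right_mono mult_left_mono) auto
  qed
  also have "\<dots> = 24 * r\<^sup>2 / (c ^ 3 * jr)" using c jr by (simp add: field_simps power2_eq_square)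
  also have "jr * \<bar>P - (f x - y)\<bar> = \<bar>jr * legendre f f' p - of_int k\<bar>"
    unfolding leg using jr by (simp add: abs_mult)
  finally show "\<bar>of_int j * legendre f f' (of_int h / of_int j) - of_int k\<bar> \<le> 24 * (\<Delta> * 2 ^ n)\<^sup>2 / (c ^ 3 * of_int j)"
    by (simp add: jr_def p_def r_def J_def)
qed

definition on_line :: "int \<times> int \<times> int \<Rightarrow> int \<times> int \<times> int \<Rightarrow> bool" where
  "on_line w v = (case w of (j, h, k) \<Rightarrow> case v of (q, a, b) \<Rightarrow> j * b = h * a - k * q)"

definition slope :: "int \<times> int \<times> int \<Rightarrow> real" where
  "slope v = (case v of (q, a, b) \<Rightarrow> of_int a / of_int q)"

lemma inj_slope: "inj_on slope (prim_near f u n \<Delta>)"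
proof (rule inj_onI, rule ccontr)
  fix v v' assume vv: "v \<in> prim_near f u n \<Delta>" "v' \<in> prim_near f u n \<Delta>" "slope v = slope v'" "v \<noteq> v'"
  obtain q a b where v: "v = (q, a, b)" by (cases v)
  obtain q' a' b' where v': "v' = (q', a', b')" by (cases v')
  have "q * a' \<noteq> q' * a" using near_distinct vv v v' by blast
  moreover have "0 < q" "0 < q'" using near_real(1) vv v v' by blast+
  then have "real_of_int a * of_int q' = of_int a' * of_int q" using vv(3) by (simp add: slope_def v v' field_simps)
  then have "real_of_int (a * q') = of_int (a' * q)" by simp
  then have "a * q' = a' * q" by (simp only: of_int_eq_iff)
  ultimately show False by (simp add: mult.commute)
qed

text \<open>On either side of the point \<open>x0\<close> where the graph has the slope of the line,
  \<open>near_same_side\<close> gives both a minimal gap and a maximal diameter, hence a count. The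
  two sides account for the 2 and for the factor 2.\<close>

lemma line_card:
  assumes j: "0 < j" "gcd j (gcd h k) = 1"
  shows "real (card {v \<in> prim_near f u n \<Delta>. on_line (j, h, k) v}) \<le>
     2 + 2 * sqrt (8 * (\<Delta> * 2 ^ n) / c) * 2 ^ n / of_int j"
proof -
  define L where "L = {v \<in> prim_near f u n \<Delta>. on_line (j, h, k) v}"
  define x0 where "x0 = inv f' (of_int h / of_int j)"
  have x0: "f' x0 = of_int h / of_int j" unfolding x0_def by (rule curv_inv[OF cv])
  define l where "l = sqrt (8 * (\<Delta> * 2 ^ n) / c)"
  have l: "l \<ge> 0" using c \<Delta> by (simp add: l_def)
  have finL: "finite L" by (simp add: L_def finite_prim_near)
  have nn: "of_int j / (2 ^ n * 2 ^ n) \<le> \<bar>t' - t\<bar> \<and> \<bar>t' - t\<bar> \<le> l / 2 ^ n"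
    if tt: "t \<in> slope ` L" "t' \<in> slope ` L" "(x0 \<le> t \<and> t < t') \<or> (t' < t \<and> t \<le> x0)" for t t'
  proof -
    obtain q a b where v: "(q, a, b) \<in> prim_near f u n \<Delta>" "j * b = h * a - k * q" "t = of_int a / of_int q"
      using tt(1) by (auto simp: L_def on_line_def slope_def)
    obtain q' a' b' where v': "(q', a', b') \<in> prim_near f u n \<Delta>" "j * b' = h * a' - k * q'" "t' = of_int a' / of_int q'"
      using tt(2) by (auto simp: L_def on_line_def slope_def)
    note ss = near_same_side[OF v(1) v'(1) j v(2) v'(2) x0 v(3) v'(3) tt(3)]
    show ?thesis using ss(1,2) by (simp add: pos_divide_le_eq l_def)
  qed
  have jp: "0 < real_of_int j / (2 ^ n * 2 ^ n)" using j(1) by simp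
  have side: "real (card A) \<le> 1 + l * 2 ^ n / of_int j"
    if A: "A \<subseteq> slope ` L" and s: "(\<forall>t\<in>A. x0 \<le> t) \<or> (\<forall>t\<in>A. t \<le> x0)" for A
  proof (cases "A = {}")
    case True then show ?thesis using l j(1) by simp
  next
    case False
    have "of_int j / (2 ^ n * 2 ^ n) \<le> t' - t \<and> t' - t \<le> l / 2 ^ n" if "t \<in> A" "t' \<in> A" "t < t'" for t t'
      using s
    proof
      assume "\<forall>t\<in>A. x0 \<le> t"
      then show ?thesis using nn[of t t'] that A by auto
    next
      assume "\<forall>t\<in>A. t \<le> x0"
      then show ?thesis using nn[of t' t] that A by auto
    qed
    then have "real (card A) \<le> 1 + (l / 2 ^ n) / (of_int j / (2 ^ n * 2 ^ n))"
      using A finL False jp l by (intro card_separated_le) (auto intro: finite_subset)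
    then show ?thesis using j(1) by (simp add: field_simps)
  qed
  have "card L = card (slope ` L)"
    using inj_slope by (intro card_image[symmetric]) (auto simp: L_def inj_on_def)
  also have "slope ` L = {t \<in> slope ` L. x0 \<le> t} \<union> {t \<in> slope ` L. t \<le> x0}" by auto
  also have "card \<dots> \<le> card {t \<in> slope ` L. x0 \<le> t} + card {t \<in> slope ` L. t \<le> x0}" by (rule card_Un_le)
  finally have "real (card L) \<le> real (card {t \<in> slope ` L. x0 \<le> t}) + real (card {t \<in> slope ` L. t \<le> x0})"
    by linarith
  also have "\<dots> \<le> (1 + l * 2 ^ n / of_int j) + (1 + l * 2 ^ n / of_int j)"
    by (intro add_mono side) auto
  finally show ?thesis by (simp add: L_def l_def mult_ac)
qed

text \<open>This is the descent: the line through a crowded cell is a near point of the dual at a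
  strictly lower level. Of three points, two lie on the same side of the point of tangency, so
  \<open>near_same_side\<close> applies to them; the level drops because j \<le> 2^n / 2.\<close>

lemma crowded_cell:
  assumes A: "A \<subseteq> prim_near f u n \<Delta>" "card A > 2"
    and close: "\<And>v v'. v \<in> A \<Longrightarrow> v' \<in> A \<Longrightarrow> \<bar>slope v' - slope v\<bar> \<le> c / (2 * 2 ^ n)"
  shows "\<exists>i<n. \<exists>m\<le>nat \<lfloor>3 / c\<rfloor>. \<exists>j h k. (j, h, k) \<in> prim_near (legendre f f') (f' (u - 1) + real m) i (\<rho> / 2 ^ i) \<and>
     of_int j \<le> sqrt (8 * (\<Delta> * 2 ^ n) / c) * 2 ^ n \<and> (\<forall>v\<in>A. on_line (j, h, k) v)"
proof -
  have "3 \<le> card A" using A(2) by simp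
  then obtain T where T: "T \<subseteq> A" "card T = 3" by (rule obtain_subset_with_card_n)
  then obtain v1 v2 v3 where vs: "v1 \<in> A" "v2 \<in> A" "v3 \<in> A" "v1 \<noteq> v2" "v2 \<noteq> v3" "v1 \<noteq> v3"
    by (auto simp: card_3_iff)
  obtain q1 a1 b1 where v1: "v1 = (q1, a1, b1)" by (cases v1)
  obtain q2 a2 b2 where v2: "v2 = (q2, a2, b2)" by (cases v2)
  have near: "v \<in> prim_near f u n \<Delta>" if "v \<in> A" for v using A that by auto
  have "q1 * a2 \<noteq> q2 * a1" using near_distinct near vs v1 v2 by blast
  from line_through[OF this, of b2 b1] obtain j h k where j: "0 < j" "gcd j (gcd h k) = 1"
    and line: "\<forall>q a b. (a1 * b2 - a2 * b1) * q + (b1 * q2 - b2 * q1) * a + (q1 * a2 - q2 * a1) * b = 0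
       \<longrightarrow> j * b = h * a - k * q" by (elim exE conjE)
  have on: "on_line (j, h, k) v" if "v \<in> A" for v
  proof -
    obtain q a b where v: "v = (q, a, b)" by (cases v)
    have "(a1 * b2 - a2 * b1) * q + (b1 * q2 - b2 * q1) * a + (q1 * a2 - q2 * a1) * b = 0"
      using near[OF vs(1)] near[OF vs(2)] near[OF that] close[OF vs(1) vs(2)] close[OF vs(1) that]
      unfolding v v1 v2 by (intro near_coplanar) (auto simp: slope_def)
    then show ?thesis using line by (simp add: on_line_def v)
  qed
  define x0 where "x0 = inv f' (of_int h / of_int j)"
  have x0: "f' x0 = of_int h / of_int j" unfolding x0_def by (rule curv_inv[OF cv])
  have sl: "slope v1 \<noteq> slope v2" "slope v2 \<noteq> slope v3" "slope v1 \<noteq> slope v3"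
    using inj_onD[OF inj_slope] near[OF vs(1)] near[OF vs(2)] near[OF vs(3)] vs(4-6) by blast+
  have "\<exists>v v'. v \<in> A \<and> v' \<in> A \<and> ((x0 \<le> slope v \<and> slope v < slope v') \<or> (slope v' < slope v \<and> slope v \<le> x0))"
  proof -
    have *: "\<exists>v v'. v \<in> A \<and> v' \<in> A \<and> ((x0 \<le> slope v \<and> slope v < slope v') \<or> (slope v' < slope v \<and> slope v \<le> x0))"
      if "w \<in> A" "w' \<in> A" "slope w \<noteq> slope w'" "(x0 \<le> slope w \<and> x0 \<le> slope w') \<or> (slope w \<le> x0 \<and> slope w' \<le> x0)" for w w'
      using that by (metis linorder_neqE_linordered_idom)
    show ?thesis
      using *[OF vs(1,2) sl(1)] *[OF vs(2,3) sl(2)] *[OF vs(1,3) sl(3)]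
        linear[of x0 "slope v1"] linear[of x0 "slope v2"] linear[of x0 "slope v3"] by satx
  qed
  then obtain v v' where vv: "v \<in> A" "v' \<in> A"
    and side: "(x0 \<le> slope v \<and> slope v < slope v') \<or> (slope v' < slope v \<and> slope v \<le> x0)" by blast
  obtain q a b where v: "v = (q, a, b)" by (cases v)
  obtain q' a' b' where v': "v' = (q', a', b')" by (cases v')
  have ol: "j * b = h * a - k * q" "j * b' = h * a' - k * q'"
    using on[OF vv(1)] on[OF vv(2)] by (simp_all add: on_line_def v v')
  have n1: "(q, a, b) \<in> prim_near f u n \<Delta>" and n2: "(q', a', b') \<in> prim_near f u n \<Delta>"
    using near vv v v' by auto
  have xx: "slope v = of_int a / of_int q" "slope v' = of_int a' / of_int q'" by (simp_all add: slope_def v v')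
  note ss = near_same_side[OF n1 n2 j ol x0 xx side]
  define r where "r = \<Delta> * 2 ^ n"
  have r: "0 \<le> r" "r \<le> \<rho>" using \<Delta> by (simp_all add: r_def)
  define l where "l = sqrt (8 * r / c)"
  have jl: "of_int j \<le> l * 2 ^ n"
  proof -
    have "of_int j \<le> \<bar>slope v' - slope v\<bar> * (2 ^ n * 2 ^ n)" by (rule ss(1))
    also have "\<dots> \<le> l / 2 ^ n * (2 ^ n * 2 ^ n)"
      using ss(2) by (intro mult_right_mono) (auto simp: l_def r_def)
    finally show ?thesis by simp
  qed
  \<comment> \<open>The bound on \<open>\<rho>\<close> makes \<open>l\<close> at most 1/2, whence j
    \<le> 2^n / 2 and the dyadic level of \<open>j\<close> is below \<open>n\<close>.\<close>
  have "8 * r / c \<le> 8 * (c ^ 3 / 48) / c" using r \<rho> c by (intro divide_right_mono) auto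
  also have "\<dots> = c\<^sup>2 / 6" using c by (simp add: power2_eq_square power3_eq_cube)
  also have "\<dots> \<le> 1 / 4" using c power_le_one[of c 2] by simp
  finally have "l \<le> sqrt (1 / 4)" unfolding l_def by (rule real_sqrt_le_mono)
  also have "sqrt (1 / 4) = (1 / 2 :: real)" by (simp add: real_sqrt_divide)
  finally have l2: "l * 2 ^ n \<le> 2 ^ n / 2" by simp
  obtain i where i: "2 ^ i < 2 * j" "j \<le> 2 ^ i" using ex_dyadic[OF j(1)] by blast
  have ir: "2 ^ i < 2 * real_of_int j"
  proof -
    have "real_of_int (2 ^ i) < real_of_int (2 * j)" using i(1) by (simp only: of_int_less_iff)
    then show ?thesis by simp
  qed
  then have "(2::real) ^ i < 2 ^ n" using jl l2 by linarith
  then have "i < n" by simp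
  have jr: "real_of_int j > 0" using j(1) by simp
  have loc: "\<bar>slope v - x0\<bar> \<le> 1"
  proof -
    have "\<bar>slope v - x0\<bar> \<le> 4 * r / (c * of_int j)" using ss(3) by (simp add: r_def)
    also have "\<dots> \<le> 4 * r / (c * 1)" using c j r by (intro divide_left_mono mult_left_mono) auto
    also have "\<dots> \<le> 4 * (c / 48) / c" using c r \<rho> c_cube_le divide_right_mono[of "4 * r" "4 * (c / 48)" c] by simp
    also have "\<dots> \<le> 1" using c by simp
    finally show ?thesis .
  qed
  have "u \<le> slope v" "slope v \<le> u + 1" using near_real(5,6)[OF n1] xx by auto
  then have x0b: "u - 1 \<le> x0" "x0 \<le> u + 2" using loc by linarith+
  \<comment> \<open>The slope of the line is \<open>f' x0\<close> with \<open>x0\<close> in a window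
    of length 3, so it exceeds \<open>f' (u - 1)\<close> by at most 3/c. The unit windows of the
    dual in which it may fall are enumerated by \<open>m\<close>.\<close>
  define t where "t = f' x0 - f' (u - 1)"
  have t0: "0 \<le> t"
  proof -
    have "0 \<le> c * (x0 - (u - 1))" using c x0b by simp
    then show ?thesis using curv_mono[OF cv x0b(1)] by (simp add: t_def)
  qed
  have "t \<le> (x0 - (u - 1)) / c" using curv_lipschitz[OF cv x0b(1)] by (simp add: t_def)
  also have "\<dots> \<le> 3 / c" using x0b c by (intro divide_right_mono) auto
  finally have t3: "t \<le> 3 / c" .
  define m where "m = nat \<lfloor>t\<rfloor>"
  have m: "real m \<le> t" "t \<le> real m + 1" unfolding m_def using t0 by linarith+
  have m3: "m \<le> nat \<lfloor>3 / c\<rfloor>" unfolding m_def using t3 by (intro nat_mono floor_mono)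
  have "\<bar>of_int j * legendre f f' (of_int h / of_int j) - of_int k\<bar> \<le> 24 * r\<^sup>2 / (c ^ 3 * of_int j)"
    using ss(4) by (simp add: r_def)
  also have "\<dots> \<le> 24 * r\<^sup>2 / (c ^ 3 * (2 ^ i / 2))"
    using c jr ir r by (intro divide_left_mono mult_left_mono) auto
  \<comment> \<open>One of the two factors \<open>r\<close> is spent on cancelling the constant,
    which is the origin of the 48. The dual points thus meet the same threshold
    \<open>\<rho>\<close> at their own level.\<close>
  also have "\<dots> = (48 * r / c ^ 3) * r / 2 ^ i" using c by (simp add: field_simps power2_eq_square)
  also have "\<dots> \<le> 1 * \<rho> / 2 ^ i"
  proof (intro divide_right_mono mult_mono)
    show "48 * r / c ^ 3 \<le> 1" using r \<rho> c by (simp add: pos_divide_le_eq)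
  qed (use r in auto)
  finally have "\<bar>of_int j * legendre f f' (of_int h / of_int j) - of_int k\<bar> \<le> \<rho> / 2 ^ i" by simp
  then have "(j, h, k) \<in> prim_near (legendre f f') (f' (u - 1) + real m) i (\<rho> / 2 ^ i)"
    using i j m x0 by (auto simp: prim_near_def t_def)
  moreover have "of_int j \<le> sqrt (8 * (\<Delta> * 2 ^ n) / c) * 2 ^ n" using jl by (simp add: l_def r_def)
  ultimately show ?thesis using \<open>i < n\<close> m3 on by blast
qed

text \<open>Cells with at most two points cost a multiple of 2^n in total. The points of crowded
  cells are counted line by line: a line of level i carries at most 8 l 2^n / 2^i of them, and the
  lines are near points of the dual, counted by \<open>b i\<close> in each of at most 4/c unit
  windows of slopes.\<close>

lemma prim_near_recursion:
  assumes b: "\<And>i m. i < n \<Longrightarrow>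
     real (card (prim_near (legendre f f') (f' (u - 1) + real m) i (\<rho> / 2 ^ i))) \<le> b i"
  shows "real (card (prim_near f u n \<Delta>)) \<le>
     8 / c * 2 ^ n + 32 / c * sqrt (8 * (\<Delta> * 2 ^ n) / c) * (\<Sum>i<n. 2 ^ n / 2 ^ i * b i)"
proof -
  define J :: real where "J = 2 ^ n"
  have J: "J > 0" "J \<ge> 1" by (simp_all add: J_def)
  define S where "S = prim_near f u n \<Delta>"
  define l where "l = sqrt (8 * (\<Delta> * 2 ^ n) / c)"
  have l: "l \<ge> 0" using c \<Delta> by (simp add: l_def)
  have finS: "finite S" by (simp add: S_def finite_prim_near)
  define th where "th = c / (2 * J)"
  have th: "th > 0" using c J by (simp add: th_def)
  define cell where "cell v = \<lfloor>(slope v - u) / th\<rfloor>" for v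
  define A where "A t = {v \<in> S. cell v = t}" for t
  define I where "I = {0..\<lfloor>1 / th\<rfloor>}"
  define V where "V i = (\<Union>m\<le>nat \<lfloor>3 / c\<rfloor>. prim_near (legendre f f') (f' (u - 1) + real m) i (\<rho> / 2 ^ i))" for i
  \<comment> \<open>Under this restriction on \<open>fst w\<close> the additive 2 of
    \<open>line_card\<close> is absorbed into its second term, so that a line is charged only in
    proportion to 2^n / 2^i.\<close>
  define L where "L w = {v \<in> S. on_line w v \<and> real_of_int (fst w) \<le> l * J}" for w
  have cellI: "cell v \<in> I" if "v \<in> S" for v
  proof -
    obtain q a b where v: "v = (q, a, b)" by (cases v)
    have "u \<le> slope v" "slope v \<le> u + 1"
      using near_real(5,6)[of q a b] that by (auto simp: S_def v slope_def)
    then have "0 \<le> (slope v - u) / th" "(slope v - u) / th \<le> 1 / th"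
      using th by (auto intro: divide_right_mono)
    then show ?thesis by (simp add: I_def cell_def floor_mono)
  qed
  have close: "\<bar>slope v' - slope v\<bar> \<le> c / (2 * 2 ^ n)" if "v \<in> A t" "v' \<in> A t" for v v' t
  proof -
    have "\<lfloor>(slope v - u) / th\<rfloor> = \<lfloor>(slope v' - u) / th\<rfloor>" using that by (simp add: A_def cell_def)
    then have "\<bar>(slope v' - u) / th - (slope v - u) / th\<bar> \<le> 1" by linarith
    moreover have "(slope v' - u) / th - (slope v - u) / th = (slope v' - slope v) / th"
      by (simp add: diff_divide_distrib)
    ultimately have "\<bar>slope v' - slope v\<bar> / th \<le> 1" using th by (simp add: abs_divide)
    then have "\<bar>slope v' - slope v\<bar> \<le> 1 * th" using th by (simp only: pos_divide_le_eq)
    then show ?thesis by (simp add: th_def J_def)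
  qed
  have sub: "S \<subseteq> (\<Union>t\<in>{t\<in>I. card (A t) \<le> 2}. A t) \<union> (\<Union>i<n. \<Union>w\<in>V i. L w)"
  proof
    fix v assume v: "v \<in> S"
    show "v \<in> (\<Union>t\<in>{t\<in>I. card (A t) \<le> 2}. A t) \<union> (\<Union>i<n. \<Union>w\<in>V i. L w)"
    proof (cases "card (A (cell v)) \<le> 2")
      case True then show ?thesis using cellI[OF v] v by (auto simp: A_def)
    next
      case False
      have "A (cell v) \<subseteq> prim_near f u n \<Delta>" by (auto simp: A_def S_def)
      from crowded_cell[OF this] False close obtain i m j h k where
        *: "i < n" "m \<le> nat \<lfloor>3 / c\<rfloor>" "(j, h, k) \<in> prim_near (legendre f f') (f' (u - 1) + real m) i (\<rho> / 2 ^ i)"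
        "of_int j \<le> l * J" "\<forall>v\<in>A (cell v). on_line (j, h, k) v"
        unfolding l_def J_def by (metis linorder_not_less)
      have "v \<in> A (cell v)" using v by (simp add: A_def)
      then have "on_line (j, h, k) v" using *(5) by (rule bspec[rotated])
      then have "v \<in> L (j, h, k)" using *(4) v by (simp add: L_def)
      moreover have "(j, h, k) \<in> V i" using *(2,3) by (auto simp: V_def)
      ultimately show ?thesis using *(1) by blast
    qed
  qed
  have finA: "finite (A t)" for t using finS by (simp add: A_def)
  have finI: "finite I" by (simp add: I_def)
  have finV: "finite (V i)" for i by (simp add: V_def finite_prim_near)
  have finL: "finite (L w)" for w using finS by (simp add: L_def)
  have cardI: "real (card I) \<le> 3 * J / c"
  proof -
    have "0 \<le> 1 / th" using th by simp
    then have "real (card I) = of_int \<lfloor>1 / th\<rfloor> + 1" by (simp add: I_def)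
    also have "\<dots> \<le> 1 / th + 1" by simp
    also have "1 / th = 2 * J / c" by (simp add: th_def)
    also have "1 \<le> J / c" using c J by simp
    finally show ?thesis by simp
  qed
  have cardV: "real (card (V i)) \<le> 4 / c * b i" if "i < n" for i
  proof -
    have b0: "b i \<ge> 0" using b[OF that, of 0] by (smt (verit) of_nat_0_le_iff)
    have "real (card (V i)) \<le> real (\<Sum>m\<le>nat \<lfloor>3 / c\<rfloor>. card (prim_near (legendre f f') (f' (u - 1) + real m) i (\<rho> / 2 ^ i)))"
      unfolding V_def of_nat_le_iff by (rule card_UN_le) simp
    also have "\<dots> \<le> (\<Sum>m\<le>nat \<lfloor>3 / c\<rfloor>. b i)" unfolding of_nat_sum by (intro sum_mono b that)
    also have "\<dots> = (real (nat \<lfloor>3 / c\<rfloor>) + 1) * b i" by simp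
    also have "\<dots> \<le> (4 / c) * b i"
    proof (intro mult_right_mono b0)
      have "0 \<le> 3 / c" "1 \<le> 1 / c" using c by auto
      then have "real (nat \<lfloor>3 / c\<rfloor>) + 1 \<le> 3 / c + 1 / c" by linarith
      then show "real (nat \<lfloor>3 / c\<rfloor>) + 1 \<le> 4 / c" by (simp flip: add_divide_distrib)
    qed
    finally show ?thesis .
  qed
  have cardL: "real (card (L w)) \<le> 8 * l * (J / 2 ^ i)" if w: "w \<in> V i" for w i
  proof -
    obtain j h k where wj: "w = (j, h, k)" by (cases w)
    obtain m where "(j, h, k) \<in> prim_near (legendre f f') (f' (u - 1) + real m) i (\<rho> / 2 ^ i)"
      using w by (auto simp: V_def wj)
    then have ji: "2 ^ i < 2 * j" "gcd j (gcd h k) = 1" by (auto simp: prim_near_def)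
    have "(0::int) < 2 ^ i" by simp
    then have j: "0 < j" using ji(1) by linarith
    have "real_of_int (2 ^ i) < real_of_int (2 * j)" using ji(1) by (simp only: of_int_less_iff)
    then have jr: "2 ^ i < 2 * real_of_int j" by simp
    show ?thesis
    proof (cases "real_of_int j \<le> l * J")
      case True
      have "L w \<subseteq> {v \<in> prim_near f u n \<Delta>. on_line (j, h, k) v}" by (auto simp: L_def S_def wj)
      then have "real (card (L w)) \<le> real (card {v \<in> prim_near f u n \<Delta>. on_line (j, h, k) v})"
        unfolding of_nat_le_iff by (intro card_mono) (simp_all add: finite_prim_near)
      also have "\<dots> \<le> 2 + 2 * l * 2 ^ n / of_int j" unfolding l_def by (rule line_card[OF j ji(2)])
      also have "\<dots> \<le> 4 * l * J / of_int j" using True j by (simp add: field_simps J_def)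
      also have "\<dots> \<le> 4 * l * J / (2 ^ i / 2)"
        using jr j l J by (intro divide_left_mono) auto
      finally show ?thesis by simp
    next
      case False
      then have "L w = {}" by (auto simp: L_def wj)
      then show ?thesis using l J by simp
    qed
  qed
  have "real (card S) \<le> real (card (\<Union>t\<in>{t\<in>I. card (A t) \<le> 2}. A t) + card (\<Union>i<n. \<Union>w\<in>V i. L w))"
    unfolding of_nat_le_iff
    by (rule order_trans[OF card_mono[OF _ sub] card_Un_le]) (use finA finI finV finL in auto)
  also have "\<dots> = real (card (\<Union>t\<in>{t\<in>I. card (A t) \<le> 2}. A t)) + real (card (\<Union>i<n. \<Union>w\<in>V i. L w))" by simp
  also have "real (card (\<Union>t\<in>{t\<in>I. card (A t) \<le> 2}. A t)) \<le> 2 * (3 * J / c)"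
  proof -
    have "card (\<Union>t\<in>{t\<in>I. card (A t) \<le> 2}. A t) \<le> (\<Sum>t\<in>{t\<in>I. card (A t) \<le> 2}. card (A t))"
      using finI by (intro card_UN_le) auto
    also have "\<dots> \<le> (\<Sum>t\<in>{t\<in>I. card (A t) \<le> 2}. 2)" by (intro sum_mono) auto
    also have "\<dots> \<le> 2 * card I" using card_mono[OF finI, of "{t\<in>I. card (A t) \<le> 2}"] by simp
    finally have "real (card (\<Union>t\<in>{t\<in>I. card (A t) \<le> 2}. A t)) \<le> 2 * real (card I)" by linarith
    then show ?thesis using cardI by linarith
  qed
  also have "real (card (\<Union>i<n. \<Union>w\<in>V i. L w)) \<le> (\<Sum>i<n. 4 / c * b i * (8 * l * (J / 2 ^ i)))"
  proof -
    have "real (card (\<Union>i<n. \<Union>w\<in>V i. L w)) \<le> real (\<Sum>i<n. card (\<Union>w\<in>V i. L w))"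
      unfolding of_nat_le_iff by (rule card_UN_le) simp
    also have "\<dots> = (\<Sum>i<n. real (card (\<Union>w\<in>V i. L w)))" by simp
    also have "\<dots> \<le> (\<Sum>i<n. 4 / c * b i * (8 * l * (J / 2 ^ i)))"
    proof (rule sum_mono)
      fix i assume i: "i \<in> {..<n}"
      have "real (card (\<Union>w\<in>V i. L w)) \<le> real (\<Sum>w\<in>V i. card (L w))"
        unfolding of_nat_le_iff by (rule card_UN_le[OF finV])
      also have "\<dots> \<le> (\<Sum>w\<in>V i. 8 * l * (J / 2 ^ i))" unfolding of_nat_sum by (intro sum_mono cardL)
      also have "\<dots> = real (card (V i)) * (8 * l * (J / 2 ^ i))" by simp
      also have "\<dots> \<le> 4 / c * b i * (8 * l * (J / 2 ^ i))"
        using cardV i l J by (intro mult_right_mono) auto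
      finally show "real (card (\<Union>w\<in>V i. L w)) \<le> 4 / c * b i * (8 * l * (J / 2 ^ i))" .
    qed
    finally show ?thesis .
  qed
  also have "(\<Sum>i<n. 4 / c * b i * (8 * l * (J / 2 ^ i))) = 32 / c * l * (\<Sum>i<n. J / 2 ^ i * b i)"
    by (simp add: sum_distrib_left mult_ac)
  finally have "real (card S) \<le> 2 * (3 * J / c) + 32 / c * l * (\<Sum>i<n. J / 2 ^ i * b i)" by simp
  moreover have "2 * (3 * J / c) \<le> 8 / c * J" using c J by (simp add: field_simps)
  ultimately show ?thesis by (simp add: S_def l_def J_def)
qed

end

section \<open>Huxley-type bound for primitive near points\<close>

lemma geometric_bound:
  fixes b :: real
  assumes "b > 1" "K \<le> b - 1"
  shows "1 + K * (\<Sum>i<n. b ^ i) \<le> b ^ n"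
proof -
  have "K * (\<Sum>i<n. b ^ i) \<le> (b - 1) * (\<Sum>i<n. b ^ i)"
    using assms by (intro mult_right_mono sum_nonneg) auto
  also have "\<dots> = b ^ n - 1" by (simp add: power_diff_1_eq)
  finally show ?thesis by simp
qed

text \<open>The threshold is so small that the constant of the recursion is at most
  \<open>b - 1\<close>, and then the geometric sum closes the induction with ratio \<open>b\<close>.
  Dual points arrive with error \<open>w / 2 ^ i\<close>, exactly on the threshold of their own
  level, so one \<open>w\<close> serves at every level. The induction generalises the curve because
  each step replaces it by its dual.\<close>

lemma prim_near_bound_small:
  assumes c: "0 < c" "c \<le> 1" and b: "b > 1"
  shows "\<exists>\<rho>>0. \<rho> \<le> c ^ 3 / 48 \<and> (\<forall>f f' u n \<Delta>. curv c f f' \<longrightarrow> 0 \<le> \<Delta> \<longrightarrow> \<Delta> * 2 ^ n \<le> \<rho> \<longrightarrow>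
     real (card (prim_near f u n \<Delta>)) \<le> 8 / c * 2 ^ n * b ^ n)"
proof -
  \<comment> \<open>The first entry is the hypothesis of the recursion; the second solves 32/c
    sqrt(8 w / c) \<le> b - 1 for \<open>w\<close>.\<close>
  define w where "w = min (c ^ 3 / 48) (c / 8 * ((b - 1) * c / 32)\<^sup>2)"
  have w: "w > 0" "w \<le> c ^ 3 / 48" using c b by (simp_all add: w_def)
  have K: "32 / c * sqrt (8 * w / c) \<le> b - 1"
  proof -
    have "w \<le> c / 8 * ((b - 1) * c / 32)\<^sup>2" by (simp add: w_def)
    then have "8 * w / c \<le> ((b - 1) * c / 32)\<^sup>2" using c by (simp add: field_simps)
    then have "sqrt (8 * w / c) \<le> (b - 1) * c / 32" using b c by (intro real_le_lsqrt) auto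
    then have "32 / c * sqrt (8 * w / c) \<le> 32 / c * ((b - 1) * c / 32)" using c by (intro mult_left_mono) auto
    then show ?thesis using c by simp
  qed
  have main: "real (card (prim_near f u n \<Delta>)) \<le> 8 / c * 2 ^ n * b ^ n"
    if "curv c f f'" "0 \<le> \<Delta>" "\<Delta> * 2 ^ n \<le> w" for f f' u n \<Delta>
    using that
  proof (induction n arbitrary: f f' u \<Delta> rule: less_induct)
    case (less n)
    have l: "curv c (legendre f f') (inv f')" using curv_legendre[OF less.prems(1) c(1)] .
    have B: "real (card (prim_near (legendre f f') (f' (u - 1) + real m) i (w / 2 ^ i))) \<le> 8 / c * 2 ^ i * b ^ i"
      if "i < n" for i m
      using that l w by (intro less.IH) auto
    have "real (card (prim_near f u n \<Delta>)) \<le>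
       8 / c * 2 ^ n + 32 / c * sqrt (8 * (\<Delta> * 2 ^ n) / c) * (\<Sum>i<n. 2 ^ n / 2 ^ i * (8 / c * 2 ^ i * b ^ i))"
      by (rule prim_near_recursion[OF less.prems(1) c less.prems(2,3) w(2) B])
    also have "(\<Sum>i<n. 2 ^ n / 2 ^ i * (8 / c * 2 ^ i * b ^ i)) = 8 / c * 2 ^ n * (\<Sum>i<n. b ^ i)"
      unfolding sum_distrib_left by (intro sum.cong) auto
    also have "8 / c * 2 ^ n + 32 / c * sqrt (8 * (\<Delta> * 2 ^ n) / c) * (8 / c * 2 ^ n * (\<Sum>i<n. b ^ i)) \<le>
       8 / c * 2 ^ n + 32 / c * sqrt (8 * w / c) * (8 / c * 2 ^ n * (\<Sum>i<n. b ^ i))"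
      using less.prems c b
      by (intro add_mono mult_right_mono mult_left_mono real_sqrt_le_mono divide_right_mono mult_nonneg_nonneg sum_nonneg) auto
    also have "\<dots> = 8 / c * 2 ^ n * (1 + 32 / c * sqrt (8 * w / c) * (\<Sum>i<n. b ^ i))"
      by (simp add: distrib_left)
    also have "\<dots> \<le> 8 / c * 2 ^ n * b ^ n"
      using c by (intro mult_left_mono geometric_bound[OF b K]) auto
    finally show ?case .
  qed
  show ?thesis using w main by blast
qed

text \<open>Small \<Delta>: one more step of the recursion with the true \<Delta> gains the factor
  sqrt(\<Delta> 2^n), which s \<le> 1 + s^2 then turns into a term linear in \<Delta>. Large
  \<Delta>: the strip is cut into O(\<Delta> 2^n / w) thin strips, each a vertical translate to
  which the small case applies.\<close>

lemma prim_near_bound: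
  assumes c: "0 < c" "c \<le> 1" and b: "b > 1"
  shows "\<exists>C>0. \<forall>f f' u n \<Delta>. curv c f f' \<longrightarrow> 0 \<le> \<Delta> \<longrightarrow>
     real (card (prim_near f u n \<Delta>)) \<le> C * (2 ^ n + \<Delta> * 4 ^ n * b ^ n)"
proof -
  \<comment> \<open>The square root is undone when the gain of the recursion is squared
    below.\<close>
  define b' where "b' = sqrt b"
  have b': "b' > 1" "b' * b' = b" using b by (simp_all add: b'_def)
  obtain w where w: "w > 0" "w \<le> c ^ 3 / 48" and small: "\<And>f f' u n \<Delta>. curv c f f' \<Longrightarrow> 0 \<le> \<Delta> \<Longrightarrow> \<Delta> * 2 ^ n \<le> w \<Longrightarrow>
     real (card (prim_near f u n \<Delta>)) \<le> 8 / c * 2 ^ n * b' ^ n"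
    using prim_near_bound_small[OF c b'(1)] by blast
  define C1 where "C1 = 32 / c * sqrt (8 / c) * (8 / c) / (b' - 1)"
  have C1: "C1 \<ge> 0" using c b' by (simp add: C1_def)
  define C2 where "C2 = 5 / w * (8 / c)"
  have C2: "C2 \<ge> 0" using c w by (simp add: C2_def)
  define C where "C = 8 / c + C1 + C2"
  have C: "C > 0" using C1 C2 c by (simp add: C_def add_pos_nonneg)
  have "real (card (prim_near f u n \<Delta>)) \<le> C * (2 ^ n + \<Delta> * 4 ^ n * b ^ n)"
    if cv: "curv c f f'" and D: "0 \<le> \<Delta>" for f f' u n \<Delta>
  proof (cases "\<Delta> * 2 ^ n \<le> w")
    case True
    define J :: real where "J = 2 ^ n"
    have J: "J > 0" by (simp add: J_def)
    have l: "curv c (legendre f f') (inv f')" using curv_legendre[OF cv c(1)] .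
    have B: "real (card (prim_near (legendre f f') (f' (u - 1) + real m) i (w / 2 ^ i))) \<le> 8 / c * 2 ^ i * b' ^ i" for i m
      using l w by (intro small) auto
    have "real (card (prim_near f u n \<Delta>)) \<le>
       8 / c * 2 ^ n + 32 / c * sqrt (8 * (\<Delta> * 2 ^ n) / c) * (\<Sum>i<n. 2 ^ n / 2 ^ i * (8 / c * 2 ^ i * b' ^ i))"
      by (rule prim_near_recursion[OF cv c D True w(2) B])
    also have "(\<Sum>i<n. 2 ^ n / 2 ^ i * (8 / c * 2 ^ i * b' ^ i)) = 8 / c * 2 ^ n * (\<Sum>i<n. b' ^ i)"
      unfolding sum_distrib_left by (intro sum.cong) auto
    also have "8 / c * 2 ^ n + 32 / c * sqrt (8 * (\<Delta> * 2 ^ n) / c) * (8 / c * 2 ^ n * (\<Sum>i<n. b' ^ i)) \<le>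
        8 / c * 2 ^ n + 32 / c * sqrt (8 * (\<Delta> * 2 ^ n) / c) * (8 / c * 2 ^ n * (b' ^ n / (b' - 1)))"
    proof (intro add_left_mono mult_left_mono)
      have "(\<Sum>i<n. b' ^ i) = (b' ^ n - 1) / (b' - 1)" using b' by (simp add: geometric_sum)
      also have "\<dots> \<le> b' ^ n / (b' - 1)" using b' by (intro divide_right_mono) auto
      finally show "(\<Sum>i<n. b' ^ i) \<le> b' ^ n / (b' - 1)" .
    qed (use c D in auto)
    also have "sqrt (8 * (\<Delta> * 2 ^ n) / c) = sqrt (8 / c) * sqrt (\<Delta> * J)"
      by (simp add: real_sqrt_mult[symmetric] J_def)
    also have "8 / c * 2 ^ n + 32 / c * (sqrt (8 / c) * sqrt (\<Delta> * J)) * (8 / c * 2 ^ n * (b' ^ n / (b' - 1))) =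
       8 / c * J + C1 * J * (sqrt (\<Delta> * J) * b' ^ n)"
      by (simp add: J_def C1_def mult_ac)
    finally have "real (card (prim_near f u n \<Delta>)) \<le> 8 / c * J + C1 * J * (sqrt (\<Delta> * J) * b' ^ n)" .
    also have "sqrt (\<Delta> * J) * b' ^ n \<le> 1 + \<Delta> * J * b ^ n"
    proof -
      define s where "s = sqrt (\<Delta> * J) * b' ^ n"
      have "s\<^sup>2 = \<Delta> * J * b ^ n"
        using D J by (simp add: s_def power_mult_distrib flip: b'(2)) (simp add: power2_eq_square power_mult_distrib)
      moreover have "2 * s \<le> s\<^sup>2 + 1" using zero_le_power2[of "s - 1"] by (simp add: power2_diff)
      then have "s \<le> 1 + s\<^sup>2" using zero_le_power2[of s] by linarith
      ultimately show ?thesis by (simp add: s_def)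
    qed
    finally have "real (card (prim_near f u n \<Delta>)) \<le> 8 / c * J + C1 * J * (1 + \<Delta> * J * b ^ n)"
      using C1 J by (simp add: mult_left_mono)
    also have "\<dots> \<le> (8 / c + C1) * (J + \<Delta> * (J * J) * b ^ n)"
      using c D J b C1 by (simp add: algebra_simps)
    also have "\<dots> \<le> C * (J + \<Delta> * (J * J) * b ^ n)"
      using C2 D J b by (intro mult_right_mono add_nonneg_nonneg mult_nonneg_nonneg) (auto simp: C_def)
    also have "J * J = 4 ^ n" by (simp add: J_def flip: power_mult_distrib)
    finally show ?thesis by (simp add: J_def)
  next
    case False
    define J :: real where "J = 2 ^ n"
    have J: "J > 0" by (simp add: J_def)
    \<comment> \<open>Vertical translates by multiples of \<open>h\<close> start at
      \<open>2 * \<Delta> / J\<close>, the largest deviation possible when q > J/2. A deviation of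
      at most \<open>h\<close> becomes an error of at most \<open>w / J\<close> after multiplication
      by q \<le> J.\<close>
    define h where "h = w / (J * J)"
    have h: "h > 0" using w J by (simp add: h_def)
    define N where "N = \<lfloor>4 * \<Delta> * J / w\<rfloor>"
    define P where "P s = prim_near (\<lambda>x. f x + (2 * \<Delta> / J - of_int s * h)) u n (w / J)" for s :: int
    have "prim_near f u n \<Delta> \<subseteq> (\<Union>s\<in>{0..N}. P s)"
    proof
      fix v assume v: "v \<in> prim_near f u n \<Delta>"
      obtain q a b where vq: "v = (q, a, b)" by (cases v)
      define x where "x = real_of_int a / of_int q"
      have q: "2 ^ n < 2 * q" "q \<le> 2 ^ n" and e: "\<bar>of_int q * f x - of_int b\<bar> \<le> \<Delta>"
        using v by (auto simp: vq prim_near_def x_def)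
      have "(0::int) < 2 ^ n" by simp
      then have q0: "0 < q" using q(1) by linarith
      have "real_of_int (2 ^ n) < real_of_int (2 * q)" "real_of_int q \<le> real_of_int (2 ^ n)"
        using q by (simp_all only: of_int_less_iff of_int_le_iff)
      then have qr: "J < 2 * real_of_int q" "real_of_int q \<le> J" by (simp_all add: J_def)
      define g where "g = f x - of_int b / of_int q"
      have "of_int q * \<bar>g\<bar> = \<bar>of_int q * g\<bar>" using q0 by (simp add: abs_mult)
      also have "of_int q * g = of_int q * f x - of_int b" using q0 by (simp add: g_def right_diff_distrib)
      finally have qg: "of_int q * \<bar>g\<bar> \<le> \<Delta>" using e by simp
      have "J / 2 * \<bar>g\<bar> \<le> of_int q * \<bar>g\<bar>" using qr by (intro mult_right_mono) auto
      then have g: "\<bar>g\<bar> \<le> 2 * \<Delta> / J" using qg J by (simp add: field_simps)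
      define s where "s = \<lfloor>(g + 2 * \<Delta> / J) / h\<rfloor>"
      have s0: "0 \<le> s" using g h by (simp add: s_def)
      have "(g + 2 * \<Delta> / J) / h \<le> (4 * \<Delta> / J) / h" using g h by (intro divide_right_mono) linarith+
      also have "\<dots> = 4 * \<Delta> * J / w" using J w by (simp add: h_def field_simps)
      finally have sN: "s \<le> N" unfolding s_def N_def by (rule floor_mono)
      have "of_int s \<le> (g + 2 * \<Delta> / J) / h" "(g + 2 * \<Delta> / J) / h < of_int s + 1"
        by (simp_all add: s_def)
      then have "of_int s * h \<le> g + 2 * \<Delta> / J" "g + 2 * \<Delta> / J < (of_int s + 1) * h"
        using h by (simp_all add: pos_le_divide_eq pos_divide_less_eq)
      then have gs: "\<bar>g + (2 * \<Delta> / J - of_int s * h)\<bar> \<le> h" by (simp add: algebra_simps)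
      have "\<bar>of_int q * (f x + (2 * \<Delta> / J - of_int s * h)) - of_int b\<bar> = of_int q * \<bar>g + (2 * \<Delta> / J - of_int s * h)\<bar>"
      proof -
        have "of_int q * (f x + (2 * \<Delta> / J - of_int s * h)) - of_int b = of_int q * (g + (2 * \<Delta> / J - of_int s * h))"
          using q0 by (simp add: g_def algebra_simps)
        then show ?thesis using q0 by (simp add: abs_mult)
      qed
      also have "\<dots> \<le> J * h" using qr gs h J q0 by (intro mult_mono) auto
      also have "\<dots> = w / J" using J by (simp add: h_def)
      finally have "v \<in> P s" using v by (auto simp: P_def vq prim_near_def x_def)
      then show "v \<in> (\<Union>s\<in>{0..N}. P s)" using s0 sN by auto
    qed
    then have "card (prim_near f u n \<Delta>) \<le> card (\<Union>s\<in>{0..N}. P s)"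
      by (intro card_mono) (auto simp: P_def finite_prim_near)
    also have "\<dots> \<le> (\<Sum>s\<in>{0..N}. card (P s))" by (rule card_UN_le) simp
    finally have "real (card (prim_near f u n \<Delta>)) \<le> (\<Sum>s\<in>{0..N}. real (card (P s)))"
      unfolding of_nat_sum[symmetric] by (simp only: of_nat_le_iff)
    also have "\<dots> \<le> (\<Sum>s\<in>{0..N}. 8 / c * J * b' ^ n)"
      unfolding P_def J_def using w by (intro sum_mono small[OF curv_shift[OF cv]]) auto
    also have "\<dots> = real (card {0..N}) * (8 / c * J * b' ^ n)" by simp
    also have "\<dots> \<le> (5 * \<Delta> * J / w) * (8 / c * J * b ^ n)"
    proof (intro mult_mono)
      have "0 \<le> 4 * \<Delta> * J / w" using D J w by simp
      then have "real (card {0..N}) = of_int N + 1" by (simp add: N_def)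
      also have "\<dots> \<le> 4 * \<Delta> * J / w + 1" by (simp add: N_def)
      also have "1 \<le> \<Delta> * J / w" using False w by (simp add: J_def)
      finally show "real (card {0..N}) \<le> 5 * \<Delta> * J / w" by (simp add: mult_ac flip: add_divide_distrib)
      have "b' \<le> b" using b' by (metis less_eq_real_def mult_left_mono mult.right_neutral order_less_trans zero_less_one)
      then show "b' ^ n \<le> b ^ n" using b' by (intro power_mono) auto
    qed (use c J D w b b' in auto)
    also have "\<dots> = C2 * (\<Delta> * (J * J) * b ^ n)" by (simp add: C2_def)
    also have "\<dots> \<le> C * (\<Delta> * (J * J) * b ^ n)"
      using C1 c D J b by (intro mult_right_mono) (auto simp: C_def)
    also have "\<dots> \<le> C * (J + \<Delta> * (J * J) * b ^ n)" using C J by (intro mult_left_mono) auto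
    also have "J * J = 4 ^ n" by (simp add: J_def flip: power_mult_distrib)
    finally show ?thesis by (simp add: J_def)
  qed
  then show ?thesis using C by blast
qed

section \<open>Near points that need not be primitive\<close>

definition near_all :: "(real \<Rightarrow> real) \<Rightarrow> real \<Rightarrow> nat \<Rightarrow> real \<Rightarrow> (int \<times> int \<times> int) set" where
  "near_all f u M \<Delta> = {(q, a, b). 1 \<le> q \<and> q \<le> 2 ^ M \<and>
     u \<le> of_int a / of_int q \<and> of_int a / of_int q \<le> u + 1 \<and>
     \<bar>of_int q * f (of_int a / of_int q) - of_int b\<bar> \<le> \<Delta>}"

lemma sum_powers_le:
  fixes X :: real
  assumes "finite I" "\<And>i. i \<in> I \<Longrightarrow> 2 ^ i \<le> X" "0 \<le> X"
  shows "(\<Sum>i\<in>I. (2::real) ^ i) \<le> 2 * X"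
proof (cases "I = {}")
  case True then show ?thesis using assms(3) by simp
next
  case False
  have "(\<Sum>i\<in>I. (2::real) ^ i) \<le> (\<Sum>i<Suc (Max I). 2 ^ i)"
    using assms(1) by (intro sum_mono2) (auto simp: less_Suc_eq_le)
  also have "\<dots> = 2 ^ Suc (Max I) - 1" using geometric_sum[of "2::real" "Suc (Max I)"] by simp
  also have "\<dots> \<le> 2 * 2 ^ Max I" by simp
  also have "\<dots> \<le> 2 * X" using assms(2)[of "Max I"] False assms(1) by simp
  finally show ?thesis .
qed

lemma sum_inverse_le_ln:
  assumes "n > 0"
  shows "(\<Sum>d=1..n. 1 / real d) \<le> 1 + ln (real n)"
proof -
  have "harm (Suc (n - 1)) - ln (real (Suc (n - 1))) \<le> harm (Suc 0) - ln (real (Suc 0))"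
    using decseq_harm_diff_ln by (rule decseqD) simp
  then have "harm n - ln (real n) \<le> 1" using assms by (simp add: harm_Suc harm_expand)
  then show ?thesis by (simp add: harm_def inverse_eq_divide)
qed

lemma sum_inverse_le: "(\<Sum>d=1..2 ^ M. 1 / real d) \<le> 1 + real M"
proof -
  have "(\<Sum>d=1..2 ^ M. 1 / real d) \<le> 1 + ln (real (2 ^ M))" by (rule sum_inverse_le_ln) simp
  also have "ln (real (2 ^ M)) = real M * ln 2" by (simp add: ln_realpow)
  also have "\<dots> \<le> real M * 1" using ln_2_less_1 by (intro mult_left_mono) auto
  finally show ?thesis by simp
qed

lemma sum_inverse_cube_le: "(\<Sum>d=1..n. 1 / real d ^ 3) \<le> 2"
proof -
  have "(\<Sum>d=1..n. 1 / real d ^ 3) \<le> 2 - 1 / (real n + 1)" for n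
  proof (induction n)
    case (Suc n)
    define x where "x = real n + 1"
    have x: "x \<ge> 1" by (simp add: x_def)
    have "1 / x ^ 3 \<le> 1 / (x * (x + 1)) + (if n = 0 then 1 else 0)"
    proof (cases "n = 0")
      case False
      then have "x \<ge> 2" by (simp add: x_def)
      then have "x * (x + 1) \<le> x * (x * x)" using mult_right_mono[of 2 x x] x by (intro mult_left_mono) linarith+
      then show ?thesis using False x by (simp add: divide_simps power3_eq_cube)
    qed (simp add: x_def)
    moreover have "1 / (x * (x + 1)) = 1 / x - 1 / (x + 1)" using x by (simp add: field_simps)
    ultimately show ?case using Suc by (cases "n = 0") (auto simp: x_def add_ac)
  qed simp
  then show ?thesis by (rule order_trans) auto
qed

text \<open>Dividing by the gcd \<open>d\<close> divides the error by \<open>d\<close> as well and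
  leaves a primitive point. The extra 1 in the exponent is the loss from rounding q / d up to a
  power of two.\<close>

lemma near_all_subset:
  "near_all f u M \<Delta> \<subseteq> (\<Union>d\<in>{1..2 ^ M}. \<Union>i\<in>{i. i \<le> M + 1 \<and> 2 ^ i \<le> 2 ^ (M + 1) / real d}.
     (\<lambda>(q, a, b). (int d * q, int d * a, int d * b)) ` prim_near f u i (\<Delta> / real d))"
proof
  fix v assume v: "v \<in> near_all f u M \<Delta>"
  obtain q a b where vq: "v = (q, a, b)" by (cases v)
  define x where "x = real_of_int a / of_int q"
  have h: "1 \<le> q" "q \<le> 2 ^ M" "u \<le> x" "x \<le> u + 1" "\<bar>of_int q * f x - of_int b\<bar> \<le> \<Delta>"
    using v by (auto simp: near_all_def vq x_def)
  define g where "g = gcd q (gcd a b)"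
  have g: "g > 0" using h(1) by (auto simp: g_def gcd_pos_int)
  have gd: "g dvd q" "g dvd a" "g dvd b"
    unfolding g_def by (auto intro: dvd_trans[OF gcd_dvd2 gcd_dvd1] dvd_trans[OF gcd_dvd2 gcd_dvd2])
  obtain q' where q': "q = g * q'" using gd(1) by (rule dvdE)
  obtain a' where a': "a = g * a'" using gd(2) by (rule dvdE)
  obtain b' where b': "b = g * b'" using gd(3) by (rule dvdE)
  have "gcd (g * q') (gcd (g * a') (g * b')) = g * gcd q' (gcd a' b')" using g by (simp only: gcd3_mult_left)
  then have "g * gcd q' (gcd a' b') = g * 1" unfolding q'[symmetric] a'[symmetric] b'[symmetric] g_def[symmetric] by simp
  then have pr: "gcd q' (gcd a' b') = 1" using g by simp
  have q0: "q' > 0"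
  proof (rule ccontr)
    assume "\<not> q' > 0"
    then have "g * q' \<le> 0" using g by (intro mult_nonneg_nonpos) auto
    then show False using h(1) q' by simp
  qed
  have x': "x = real_of_int a' / of_int q'" using g by (simp add: x_def a' q')
  define d where "d = nat g"
  have d: "int d = g" "d \<ge> 1" "real d = of_int g" "d > 0" using g by (auto simp: d_def)
  have "g \<le> q" using gd(1) h(1) by (simp add: zdvd_imp_le)
  then have "int d \<le> 2 ^ M" using h(2) d by linarith
  then have "int d \<le> int (2 ^ M)" by simp
  then have dM: "d \<le> 2 ^ M" by (simp only: of_nat_le_iff)
  obtain i where i: "2 ^ i < 2 * q'" "q' \<le> 2 ^ i" using ex_dyadic[OF q0] by blast
  have "real_of_int (2 ^ i) < real_of_int (2 * q')" "real_of_int q \<le> real_of_int (2 ^ M)"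
    using i h(2) by (simp_all only: of_int_less_iff of_int_le_iff)
  then have ir: "2 ^ i < 2 * real_of_int q'" "real_of_int g * of_int q' \<le> 2 ^ M" by (simp_all add: q')
  have "real d * 2 ^ i \<le> real d * (2 * real_of_int q')" using ir(1) d by (intro mult_left_mono) auto
  also have "\<dots> \<le> 2 ^ (M + 1)" using ir(2) d by simp
  finally have i1: "2 ^ i \<le> 2 ^ (M + 1) / real d" using d by (simp add: pos_le_divide_eq mult.commute)
  also have "\<dots> \<le> 2 ^ (M + 1) / 1" using d by (intro divide_left_mono) auto
  finally have "(2::real) ^ i \<le> 2 ^ (M + 1)" by simp
  then have i2: "i \<le> M + 1" by (rule power_le_imp_le_exp[rotated]) simp
  have "\<bar>of_int q * f x - of_int b\<bar> = of_int g * \<bar>of_int q' * f x - of_int b'\<bar>"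
    using g by (simp add: q' b' abs_mult mult.assoc flip: right_diff_distrib)
  then have "\<bar>of_int q' * f x - of_int b'\<bar> \<le> \<Delta> / real d"
    using h(5) g d by (simp add: pos_le_divide_eq mult.commute)
  then have "(q', a', b') \<in> prim_near f u i (\<Delta> / real d)"
    using i pr h(3,4) by (simp add: prim_near_def x')
  moreover have "v = (int d * q', int d * a', int d * b')" by (simp add: vq d q' a' b')
  ultimately show "v \<in> (\<Union>d\<in>{1..2 ^ M}. \<Union>i\<in>{i. i \<le> M + 1 \<and> 2 ^ i \<le> 2 ^ (M + 1) / real d}.
     (\<lambda>(q, a, b). (int d * q, int d * a, int d * b)) ` prim_near f u i (\<Delta> / real d))"
    using d(2) dM i1 i2 by (intro UN_I[of d] UN_I[of i] image_eqI[of _ _ "(q', a', b')"]) simp_all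
qed

lemma finite_near_all: "finite (near_all f u M \<Delta>)"
  by (rule finite_subset[OF near_all_subset]) (auto simp: finite_prim_near)

text \<open>Summed over the levels, the first term of the primitive bound becomes a multiple of 2^M
  / d and the second one of \<Delta> 4^M / d^3. The harmonic sum over \<open>d\<close> produces the
  factor \<open>1 + real M\<close>, which ends up as the logarithm in the theorem; the other sum
  over \<open>d\<close> converges.\<close>

lemma near_all_bound:
  assumes c: "0 < c" "c \<le> 1" and b: "b > 1"
  shows "\<exists>C>0. \<forall>f f' u M \<Delta>. curv c f f' \<longrightarrow> 0 \<le> \<Delta> \<longrightarrow>
     real (card (near_all f u M \<Delta>)) \<le> C * (2 ^ M * (1 + real M) + \<Delta> * 4 ^ M * b ^ M)"
proof -
  obtain C where C: "C > 0" and prim: "\<And>f f' u n \<Delta>. curv c f f' \<Longrightarrow> 0 \<le> \<Delta> \<Longrightarrow>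
     real (card (prim_near f u n \<Delta>)) \<le> C * (2 ^ n + \<Delta> * 4 ^ n * b ^ n)"
    using prim_near_bound[OF c b] by blast
  have "real (card (near_all f u M \<Delta>)) \<le> C * (4 + 32 * b) * (2 ^ M * (1 + real M) + \<Delta> * 4 ^ M * b ^ M)"
    if cv: "curv c f f'" and D: "0 \<le> \<Delta>" for f f' u M \<Delta>
  proof -
    define I where "I d = {i. i \<le> M + 1 \<and> 2 ^ i \<le> 2 ^ (M + 1) / real d}" for d
    have finI: "finite (I d)" for d by (simp add: I_def)
    let ?P = "\<lambda>d i. (\<lambda>(q, a, b). (int d * q, int d * a, int d * b)) ` prim_near f u i (\<Delta> / real d)"
    have "card (near_all f u M \<Delta>) \<le> card (\<Union>d\<in>{1..2 ^ M}. \<Union>i\<in>I d. ?P d i)"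
      unfolding I_def by (rule card_mono[OF _ near_all_subset]) (auto simp: finite_prim_near)
    also have "\<dots> \<le> (\<Sum>d=1..2 ^ M. card (\<Union>i\<in>I d. ?P d i))" by (rule card_UN_le) simp
    also have "\<dots> \<le> (\<Sum>d=1..2 ^ M. \<Sum>i\<in>I d. card (?P d i))"
      by (intro sum_mono card_UN_le finI)
    also have "\<dots> \<le> (\<Sum>d=1..2 ^ M. \<Sum>i\<in>I d. card (prim_near f u i (\<Delta> / real d)))"
      by (intro sum_mono card_image_le finite_prim_near)
    finally have "real (card (near_all f u M \<Delta>)) \<le> real (\<Sum>d=1..2 ^ M. \<Sum>i\<in>I d. card (prim_near f u i (\<Delta> / real d)))"
      by (simp only: of_nat_le_iff)
    also have "\<dots> = (\<Sum>d=1..2 ^ M. \<Sum>i\<in>I d. real (card (prim_near f u i (\<Delta> / real d))))" by simp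
    also have "\<dots> \<le> (\<Sum>d=1..2 ^ M. C * (4 * 2 ^ M * (1 / real d) + \<Delta> * (16 * 4 ^ M) * b ^ (M + 1) * (1 / real d ^ 3)))"
    proof (rule sum_mono)
      fix d :: nat assume "d \<in> {1..2 ^ M}"
      then have d: "d \<ge> 1" by simp
      have s2: "(\<Sum>i\<in>I d. (2::real) ^ i) \<le> 2 * (2 ^ (M + 1) / real d)"
        by (rule sum_powers_le[OF finI]) (auto simp: I_def)
      \<comment> \<open>A sum of squares of nonnegative terms is at most the square of their sum, so
        the powers of 4 reduce to those of 2.\<close>
      have s4: "(\<Sum>i\<in>I d. (4::real) ^ i) \<le> (2 * (2 ^ (M + 1) / real d))\<^sup>2"
      proof -
        have "(\<Sum>i\<in>I d. (4::real) ^ i) = (\<Sum>i\<in>I d. 2 ^ i * 2 ^ i)"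
          by (intro sum.cong) (auto simp flip: power_mult_distrib)
        also have "\<dots> \<le> (\<Sum>i\<in>I d. 2 ^ i * (\<Sum>i\<in>I d. 2 ^ i))"
          using finI by (intro sum_mono mult_left_mono member_le_sum) auto
        also have "\<dots> = (\<Sum>i\<in>I d. 2 ^ i)\<^sup>2" by (simp add: power2_eq_square sum_distrib_right)
        also have "\<dots> \<le> (2 * (2 ^ (M + 1) / real d))\<^sup>2" using s2 by (intro power_mono sum_nonneg) auto
        finally show ?thesis .
      qed
      have "(\<Sum>i\<in>I d. real (card (prim_near f u i (\<Delta> / real d)))) \<le>
         (\<Sum>i\<in>I d. C * (2 ^ i + \<Delta> / real d * 4 ^ i * b ^ (M + 1)))"
      proof (rule sum_mono)
        fix i assume i: "i \<in> I d"
        have "real (card (prim_near f u i (\<Delta> / real d))) \<le> C * (2 ^ i + \<Delta> / real d * 4 ^ i * b ^ i)"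
          using D by (intro prim[OF cv]) auto
        also have "\<dots> \<le> C * (2 ^ i + \<Delta> / real d * 4 ^ i * b ^ (M + 1))"
          using C D b i by (intro mult_left_mono add_left_mono power_increasing) (auto simp: I_def)
        finally show "real (card (prim_near f u i (\<Delta> / real d))) \<le> C * (2 ^ i + \<Delta> / real d * 4 ^ i * b ^ (M + 1))" .
      qed
      also have "\<dots> = C * ((\<Sum>i\<in>I d. 2 ^ i) + \<Delta> / real d * b ^ (M + 1) * (\<Sum>i\<in>I d. 4 ^ i))"
        unfolding sum_distrib_left sum.distrib[symmetric] by (intro sum.cong refl) (simp add: distrib_left mult_ac)
      also have "\<dots> \<le> C * (2 * (2 ^ (M + 1) / real d) + \<Delta> / real d * b ^ (M + 1) * (2 * (2 ^ (M + 1) / real d))\<^sup>2)"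
        using C D b s2 s4 by (intro mult_left_mono add_mono) auto
      also have "\<dots> = C * (4 * 2 ^ M * (1 / real d) + \<Delta> * (16 * 4 ^ M) * b ^ (M + 1) * (1 / real d ^ 3))"
      proof -
        have "((2::real) ^ (M + 1))\<^sup>2 = 4 * 4 ^ M" by (simp add: power2_eq_square flip: power_mult_distrib)
        then show ?thesis by (simp add: power_mult_distrib power_divide power2_eq_square power3_eq_cube mult_ac)
      qed
      finally show "(\<Sum>i\<in>I d. real (card (prim_near f u i (\<Delta> / real d)))) \<le>
        C * (4 * 2 ^ M * (1 / real d) + \<Delta> * (16 * 4 ^ M) * b ^ (M + 1) * (1 / real d ^ 3))" .
    qed
    also have "\<dots> = C * (4 * 2 ^ M * (\<Sum>d=1..2 ^ M. 1 / real d) + \<Delta> * (16 * 4 ^ M) * b ^ (M + 1) * (\<Sum>d=1..2 ^ M. 1 / real d ^ 3))"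
      unfolding sum_distrib_left sum.distrib[symmetric] by (rule refl)
    also have "\<dots> \<le> C * (4 * 2 ^ M * (1 + real M) + \<Delta> * (16 * 4 ^ M) * b ^ (M + 1) * 2)"
      using C D b by (intro mult_left_mono add_mono sum_inverse_le sum_inverse_cube_le) auto
    also have "\<dots> = C * (4 * (2 ^ M * (1 + real M)) + (32 * b) * (\<Delta> * 4 ^ M * b ^ M))" by (simp add: mult_ac)
    also have "\<dots> \<le> C * ((4 + 32 * b) * (2 ^ M * (1 + real M)) + (4 + 32 * b) * (\<Delta> * 4 ^ M * b ^ M))"
      using C D b by (intro mult_left_mono add_mono mult_right_mono) auto
    also have "\<dots> = C * (4 + 32 * b) * (2 ^ M * (1 + real M) + \<Delta> * 4 ^ M * b ^ M)" by (simp add: algebra_simps)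
    finally show ?thesis .
  qed
  moreover have "C * (4 + 32 * b) > 0" using C b by simp
  ultimately show ?thesis by blast
qed

section \<open>Distance to the integers and resonance sums\<close>

definition nearest :: "real \<Rightarrow> real" where
  "nearest t = \<bar>t - of_int (round t)\<bar>"

lemma nearest_le_half: "nearest t \<le> 1 / 2"
  unfolding nearest_def using of_int_round_abs_le[of t] by (simp add: abs_minus_commute)

lemma nearest_le: "nearest t \<le> \<bar>t - of_int k\<bar>"
  unfolding nearest_def using round_diff_minimal[of t k] by (simp add: abs_minus_commute)

lemma nearest_shift: "nearest t \<le> nearest (t + y) + \<bar>y\<bar>"
  using nearest_le[of t "round (t + y)"] unfolding nearest_def by linarith

text \<open>Size of the geometric sum of \<open>e2pi (q * t)\<close> over \<open>q \<le> Q\<close>, up to a constant.\<close>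
definition resonance :: "nat \<Rightarrow> real \<Rightarrow> real" where
  "resonance Q t = 1 / max (1 / real Q) (nearest t)"

lemma resonance_pos: "Q > 0 \<Longrightarrow> 0 < resonance Q t"
  by (simp add: resonance_def less_max_iff_disj)

lemma resonance_le:
  assumes "Q > 0"
  shows "resonance Q t \<le> real Q"
proof -
  have "1 / max (1 / real Q) (nearest t) \<le> 1 / (1 / real Q)"
    using assms by (intro divide_left_mono) (auto simp: less_max_iff_disj)
  then show ?thesis by (simp add: resonance_def)
qed

text \<open>The truncation at 1/Q in the definition absorbs shifts of this size. Near a stationary
  point it allows the phase to be frozen.\<close>

lemma resonance_shift:
  assumes "Q > 0" "\<bar>y\<bar> \<le> 1 / real Q"
  shows "resonance Q (t + y) \<le> 2 * resonance Q t"
proof -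
  have *: "0 < max (1 / real Q) s" for s using assms(1) by (simp add: less_max_iff_disj)
  have "max (1 / real Q) (nearest t) \<le> 2 * max (1 / real Q) (nearest (t + y))"
    using nearest_shift[of t y] assms by auto
  then show ?thesis using *[of "nearest t"] *[of "nearest (t + y)"]
    by (simp add: resonance_def field_simps)
qed

lemma finite_powers_le: "finite {i. 2 ^ i \<le> (Q::nat)}"
proof (rule finite_subset)
  show "{i. 2 ^ i \<le> Q} \<subseteq> {..Q}"
  proof
    fix i assume "i \<in> {i. 2 ^ i \<le> Q}"
    then have "2 ^ i \<le> Q" by simp
    with less_imp_le[OF less_exp] have "i \<le> Q" by (rule order_trans)
    then show "i \<in> {..Q}" by simp
  qed
qed simp

text \<open>A layer cake: the single layer with 2^i just below the value of \<open>resonance\<close>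
  already dominates, and summing over all layers removes the dependence of i on t, so that sums over
  t can be exchanged with the sum over layers.\<close>

lemma resonance_le_layers:
  assumes Q: "Q > 0"
  shows "resonance Q t \<le> (\<Sum>i\<in>{i. 2 ^ i \<le> Q}. 2 ^ (i + 1) * (if nearest t \<le> 1 / 2 ^ i then 1 else 0))"
proof -
  define z where "z = max (1 / real Q) (nearest t)"
  have z: "z > 0" "z \<le> 1" "1 / real Q \<le> z" "nearest t \<le> z"
    using Q nearest_le_half[of t] by (auto simp: z_def less_max_iff_disj)
  have "1 \<le> 1 / z" using z by simp
  then have "1 \<le> nat \<lfloor>1 / z\<rfloor>" by linarith
  then obtain i where i: "2 ^ i \<le> nat \<lfloor>1 / z\<rfloor>" "nat \<lfloor>1 / z\<rfloor> < 2 ^ (i + 1)"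
    using ex_power_ivl1[of 2 "nat \<lfloor>1 / z\<rfloor>"] by auto
  have i1: "(2::real) ^ i \<le> 1 / z"
  proof -
    have "real (2 ^ i) \<le> real (nat \<lfloor>1 / z\<rfloor>)" using i(1) by (simp only: of_nat_le_iff)
    also have "\<dots> \<le> 1 / z" using z by (intro of_nat_floor) simp
    finally show ?thesis by simp
  qed
  have i2: "1 / z \<le> 2 ^ (i + 1)"
  proof -
    have "real (nat \<lfloor>1 / z\<rfloor> + 1) \<le> real (2 ^ (i + 1))" using i(2) by (simp only: of_nat_le_iff)
    then have "real (nat \<lfloor>1 / z\<rfloor>) + 1 \<le> 2 ^ (i + 1)" by simp
    then show ?thesis using z by linarith
  qed
  have "z \<le> 1 / 2 ^ i" using i1 z by (simp add: field_simps)
  then have n: "nearest t \<le> 1 / 2 ^ i" using z by linarith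
  have "1 / z \<le> real Q" using z Q by (simp add: field_simps)
  then have "real (2 ^ i) \<le> real Q" unfolding of_nat_power of_nat_numeral using i1 by linarith
  then have iQ: "2 ^ i \<le> Q" by (simp only: of_nat_le_iff)
  have fin: "finite {i. 2 ^ i \<le> Q}" by (rule finite_powers_le)
  have "resonance Q t \<le> 2 ^ (i + 1) * (if nearest t \<le> 1 / 2 ^ i then 1 else 0)"
    using i2 n by (simp add: resonance_def z_def)
  also have "\<dots> \<le> (\<Sum>i\<in>{i. 2 ^ i \<le> Q}. 2 ^ (i + 1) * (if nearest t \<le> 1 / 2 ^ i then 1 else 0))"
    using iQ fin by (intro member_le_sum) auto
  finally show ?thesis .
qed

text \<open>The pairs are not reduced fractions: the frequencies j and h arise independently of each
  other, and this is why all near points have to be counted and not only the primitive ones.\<close>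

definition slopes :: "real \<Rightarrow> nat \<Rightarrow> (int \<times> int) set" where
  "slopes u M = {(j, h). 1 \<le> j \<and> j \<le> 2 ^ M \<and> u \<le> of_int h / of_int j \<and> of_int h / of_int j \<le> u + 1}"

lemma finite_slopes: "finite (slopes u M)"
proof (rule finite_subset)
  show "slopes u M \<subseteq> (SIGMA j:{1..2 ^ M}. {h. u * of_int j \<le> of_int h \<and> of_int h \<le> (u + 1) * of_int j})"
    by (auto simp: slopes_def pos_le_divide_eq pos_divide_le_eq)
  show "finite (SIGMA j:{1..2 ^ M}. {h. u * of_int j \<le> of_int h \<and> of_int h \<le> (u + 1) * of_int j})"
    by (intro finite_SigmaI finite_int_real_interval) auto
qed

text \<open>In layer i the pairs are counted by \<open>near_all_bound\<close> with \<Delta> =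
  2^(-i), and each carries the weight 2^(i+1). The first term of the count then adds up
  geometrically to a multiple of Q; the second is the same in each layer and picks up the number of
  layers, which is O(1 + log Q).\<close>

lemma resonance_sum_bound:
  assumes c: "0 < c" "c \<le> 1" and b: "b > 1"
  shows "\<exists>C>0. \<forall>f f' u M Q. curv c f f' \<longrightarrow> 0 < Q \<longrightarrow>
     (\<Sum>(j, h)\<in>slopes u M. resonance Q (of_int j * f (of_int h / of_int j)))
       \<le> C * (real Q * 2 ^ M * (1 + real M) + (1 + ln (real Q)) * 4 ^ M * b ^ M)"
proof -
  obtain C where C: "C > 0" and all: "\<And>f f' u M \<Delta>. curv c f f' \<Longrightarrow> 0 \<le> \<Delta> \<Longrightarrow>
     real (card (near_all f u M \<Delta>)) \<le> C * (2 ^ M * (1 + real M) + \<Delta> * 4 ^ M * b ^ M)"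
    using near_all_bound[OF c b] by blast
  have "(\<Sum>(j, h)\<in>slopes u M. resonance Q (of_int j * f (of_int h / of_int j)))
       \<le> C * 6 * (real Q * 2 ^ M * (1 + real M) + (1 + ln (real Q)) * 4 ^ M * b ^ M)"
    if cv: "curv c f f'" and Q: "0 < Q" for f f' u M Q
  proof -
    define I where "I = {i. 2 ^ i \<le> Q}"
    have finI: "finite I"
      unfolding I_def by (rule finite_powers_le)
    let ?t = "\<lambda>(j::int, h::int). real_of_int j * f (of_int h / of_int j)"
    have count: "real (card {p \<in> slopes u M. nearest (?t p) \<le> \<Delta>}) \<le> C * (2 ^ M * (1 + real M) + \<Delta> * 4 ^ M * b ^ M)"
      if "\<Delta> \<ge> 0" for \<Delta>
    proof -
      have "card {p \<in> slopes u M. nearest (?t p) \<le> \<Delta>} \<le> card (near_all f u M \<Delta>)"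
      proof (rule card_inj_on_le[of "\<lambda>p. (fst p, snd p, round (?t p))"])
        show "inj_on (\<lambda>p. (fst p, snd p, round (?t p))) {p \<in> slopes u M. nearest (?t p) \<le> \<Delta>}"
          by (rule inj_onI) (auto simp: prod_eq_iff)
        show "(\<lambda>p. (fst p, snd p, round (?t p))) ` {p \<in> slopes u M. nearest (?t p) \<le> \<Delta>} \<subseteq> near_all f u M \<Delta>"
          by (auto simp: slopes_def near_all_def nearest_def)
      qed (rule finite_near_all)
      then have "real (card {p \<in> slopes u M. nearest (?t p) \<le> \<Delta>}) \<le> real (card (near_all f u M \<Delta>))"
        by (simp only: of_nat_le_iff)
      then show ?thesis using all[OF cv that, of u M] by (rule order_trans)
    qed
    have "(\<Sum>p\<in>slopes u M. resonance Q (?t p)) \<le>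
        (\<Sum>p\<in>slopes u M. \<Sum>i\<in>I. 2 ^ (i + 1) * (if nearest (?t p) \<le> 1 / 2 ^ i then 1 else 0))"
      unfolding I_def by (intro sum_mono resonance_le_layers Q)
    also have "\<dots> = (\<Sum>i\<in>I. 2 ^ (i + 1) * (\<Sum>p\<in>slopes u M. if nearest (?t p) \<le> 1 / 2 ^ i then 1 else 0))"
      unfolding sum_distrib_left by (rule sum.swap)
    also have "\<dots> = (\<Sum>i\<in>I. 2 ^ (i + 1) * real (card {p \<in> slopes u M. nearest (?t p) \<le> 1 / 2 ^ i}))"
    proof -
      have "(\<Sum>p\<in>slopes u M. if P p then 1 else 0) = real (card {p \<in> slopes u M. P p})" for P
        by (subst sum.inter_filter[symmetric, OF finite_slopes]) simp
      then show ?thesis by (intro sum.cong arg_cong2[of _ _ _ _ "times"] refl)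
    qed
    also have "\<dots> \<le> (\<Sum>i\<in>I. 2 ^ (i + 1) * (C * (2 ^ M * (1 + real M) + 1 / 2 ^ i * 4 ^ M * b ^ M)))"
      by (intro sum_mono mult_left_mono count) auto
    also have "\<dots> = (\<Sum>i\<in>I. 2 * C * (2 ^ M * (1 + real M)) * 2 ^ i + 2 * C * (4 ^ M * b ^ M))"
      by (intro sum.cong) (auto simp: field_simps)
    also have "\<dots> = 2 * C * (2 ^ M * (1 + real M)) * (\<Sum>i\<in>I. 2 ^ i) + 2 * C * (4 ^ M * b ^ M) * real (card I)"
      by (simp add: sum.distrib sum_distrib_left)
    also have "\<dots> \<le> 2 * C * (2 ^ M * (1 + real M)) * (2 * real Q) + 2 * C * (4 ^ M * b ^ M) * (3 * (1 + ln (real Q)))"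
    proof (intro add_mono mult_left_mono)
      show "(\<Sum>i\<in>I. (2::real) ^ i) \<le> 2 * real Q"
      proof (rule sum_powers_le[OF finI])
        fix i assume "i \<in> I"
        then have "real (2 ^ i) \<le> real Q" unfolding I_def of_nat_le_iff by simp
        then show "(2::real) ^ i \<le> real Q" by simp
      qed simp
      have "I \<subseteq> {..nat \<lfloor>2 * ln (real Q)\<rfloor>}"
      proof
        fix i assume "i \<in> I"
        then have "real (2 ^ i) \<le> real Q" unfolding I_def of_nat_le_iff by simp
        then have "ln (2 ^ i) \<le> ln (real Q)" using Q by simp
        then have "real i * ln 2 \<le> ln (real Q)" by (simp add: ln_realpow)
        moreover have "real i * (1 / 2) \<le> real i * ln 2" using ln2_ge_two_thirds by (intro mult_left_mono) auto
        ultimately have "real i \<le> 2 * ln (real Q)" by linarith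
        then show "i \<in> {..nat \<lfloor>2 * ln (real Q)\<rfloor>}" by (simp add: le_nat_iff le_floor_iff)
      qed
      then have "card I \<le> nat \<lfloor>2 * ln (real Q)\<rfloor> + 1" using card_mono[of "{..nat \<lfloor>2 * ln (real Q)\<rfloor>}" I] by simp
      moreover have "0 \<le> 2 * ln (real Q)" using Q by simp
      ultimately have "real (card I) \<le> 2 * ln (real Q) + 1" by linarith
      also have "\<dots> \<le> 3 * (1 + ln (real Q))" using Q by simp
      finally show "real (card I) \<le> 3 * (1 + ln (real Q))" .
    qed (use C b in auto)
    also have "\<dots> \<le> C * 6 * (real Q * 2 ^ M * (1 + real M) + (1 + ln (real Q)) * 4 ^ M * b ^ M)"
      using C Q b by (simp add: algebra_simps)
    finally show ?thesis by (simp add: case_prod_unfold)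
  qed
  then show ?thesis using C by (intro exI[of _ "C * 6"]) auto
qed

section \<open>Exponential sums\<close>

definition e2pi :: "real \<Rightarrow> complex" where
  "e2pi t = cis (2 * pi * t)"

lemma norm_e2pi [simp]: "norm (e2pi t) = 1" by (simp add: e2pi_def)
lemma e2pi_add: "e2pi (s + t) = e2pi s * e2pi t" by (simp add: e2pi_def cis_mult distrib_left)
lemma e2pi_0 [simp]: "e2pi 0 = 1" by (simp add: e2pi_def)
lemma e2pi_int [simp]: "e2pi (of_int k) = 1" by (simp add: e2pi_def cis_multiple_2pi)
lemma e2pi_minus: "e2pi (- t) = cnj (e2pi t)" by (simp add: e2pi_def cis_cnj)
lemma e2pi_mult_nat: "e2pi (real n * t) = e2pi t ^ n"
proof -
  have "e2pi t ^ n = cis (real n * (2 * pi * t))" unfolding e2pi_def by (rule Complex.DeMoivre)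
  also have "real n * (2 * pi * t) = 2 * pi * (real n * t)" by simp
  finally show ?thesis by (simp only: e2pi_def)
qed
lemma e2pi_add_int [simp]: "e2pi (t + of_int k) = e2pi t" by (simp add: e2pi_add)
lemma continuous_on_e2pi [continuous_intros]: "continuous_on S g \<Longrightarrow> continuous_on S (\<lambda>x. e2pi (g x))"
  unfolding e2pi_def by (intro continuous_intros)

lemma e2pi_has_vector_derivative:
  assumes "(g has_real_derivative g') (at x within S)"
  shows "((\<lambda>x. e2pi (g x)) has_vector_derivative (2 * pi * g') *\<^sub>R (\<i> * e2pi (g x))) (at x within S)"
proof -
  have "((\<lambda>x. 2 * pi * g x) has_real_derivative (2 * pi * g')) (at x within S)"
    using assms by (auto intro!: derivative_eq_intros)
  then have "((\<lambda>x. complex_of_real (2 * pi * g x)) has_vector_derivative of_real (2 * pi * g')) (at x within S)"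
    by (intro has_vector_derivative_of_real) (simp add: has_real_derivative_iff_has_vector_derivative)
  moreover have "((\<lambda>z. exp (\<i> * z)) has_field_derivative \<i> * exp (\<i> * of_real (2 * pi * g x)))
      (at (of_real (2 * pi * g x)) within (\<lambda>x. complex_of_real (2 * pi * g x)) ` S)"
    by (auto intro!: derivative_eq_intros)
  ultimately have "((\<lambda>z. exp (\<i> * z)) \<circ> (\<lambda>x. complex_of_real (2 * pi * g x)) has_vector_derivative
      of_real (2 * pi * g') * (\<i> * exp (\<i> * of_real (2 * pi * g x)))) (at x within S)"
    by (rule field_vector_diff_chain_within)
  then show ?thesis unfolding e2pi_def cis_conv_exp o_def by (simp only: scaleR_conv_of_real)
qed

lemma norm_e2pi_minus_1: "norm (e2pi s - 1) = 2 * \<bar>sin (pi * s)\<bar>"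
proof -
  have "e2pi s - 1 = e2pi (s / 2) * (e2pi (s / 2) - e2pi (- (s / 2)))"
    by (simp add: right_diff_distrib flip: e2pi_add)
  also have "e2pi (s / 2) - e2pi (- (s / 2)) = 2 * \<i> * of_real (sin (pi * s))"
    by (simp add: e2pi_def complex_eq_iff)
  finally show ?thesis by (simp add: norm_mult)
qed

lemma norm_e2pi_diff_le: "norm (e2pi s - e2pi t) \<le> 2 * pi * \<bar>s - t\<bar>"
proof -
  have "e2pi s - e2pi t = e2pi t * (e2pi (s - t) - 1)" by (simp add: right_diff_distrib flip: e2pi_add)
  then have "norm (e2pi s - e2pi t) = 2 * \<bar>sin (pi * (s - t))\<bar>" by (simp add: norm_mult norm_e2pi_minus_1)
  also have "\<dots> \<le> 2 * \<bar>pi * (s - t)\<bar>" by (intro mult_left_mono abs_sin_x_le_abs_x) auto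
  finally show ?thesis by (simp add: abs_mult)
qed

lemma mult_cos_le_sin:
  assumes "0 \<le> x" "x \<le> pi"
  shows "x * cos x \<le> sin x"
proof -
  have "sin 0 - 0 * cos 0 \<le> sin x - x * cos x"
  proof (rule DERIV_nonneg_imp_nondecreasing[OF assms(1)])
    fix t assume t: "0 \<le> t" "t \<le> x"
    have "((\<lambda>x. sin x - x * cos x) has_real_derivative t * sin t) (at t)"
      by (auto intro!: derivative_eq_intros)
    moreover have "0 \<le> t * sin t" using t assms by (intro mult_nonneg_nonneg sin_ge_zero) auto
    ultimately show "\<exists>y. ((\<lambda>x. sin x - x * cos x) has_real_derivative y) (at t) \<and> 0 \<le> y" by blast
  qed
  then show ?thesis by simp
qed

text \<open>A weak form of Jordan's inequality. Up to 1/6 it follows from x cos x \<le> sin x with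
  the cosine at least 1/2, beyond 1/6 from monotonicity of the sine.\<close>

lemma sin_pi_ge:
  assumes "0 \<le> z" "z \<le> 1 / 2"
  shows "z \<le> sin (pi * z)"
proof (cases "z \<le> 1 / 6")
  case True
  have b: "0 \<le> pi * z" "pi * z \<le> pi / 3" using True assms by (auto simp: field_simps)
  have "cos (pi / 3) \<le> cos (pi * z)" using b by (intro cos_monotone_0_pi_le) auto
  then have "1 / 2 \<le> cos (pi * z)" by (simp add: cos_60)
  then have "pi * z * (1 / 2) \<le> pi * z * cos (pi * z)" using b by (intro mult_left_mono) auto
  also have "\<dots> \<le> sin (pi * z)" using b pi_gt_zero by (intro mult_cos_le_sin) auto
  finally have "pi * z * (1 / 2) \<le> sin (pi * z)" .
  moreover have "2 * z \<le> pi * z" using pi_ge_two assms by (intro mult_right_mono) auto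
  ultimately show ?thesis by linarith
next
  case False
  have "sin (pi / 6) \<le> sin (pi * z)" using False assms by (intro sin_monotone_2pi_le) (auto simp: field_simps)
  then show ?thesis using assms by (simp add: sin_30)
qed

lemma norm_e2pi_minus_1_ge: "2 * nearest t \<le> norm (e2pi t - 1)"
proof -
  define s where "s = t - of_int (round t)"
  have s: "\<bar>s\<bar> = nearest t" by (simp add: s_def nearest_def)
  have "e2pi t = e2pi (s + of_int (round t))" by (simp add: s_def)
  then have es: "e2pi t = e2pi s" by (simp only: e2pi_add_int)
  have "norm (e2pi t - 1) = 2 * \<bar>sin (pi * s)\<bar>" by (simp add: es norm_e2pi_minus_1)
  moreover have "\<bar>s\<bar> \<le> \<bar>sin (pi * s)\<bar>"
    using sin_pi_ge[of s] sin_pi_ge[of "-s"] s nearest_le_half[of t] by (cases "s \<ge> 0") auto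
  ultimately show ?thesis using s by simp
qed

lemma norm_geometric_e2pi_le: "nearest t > 0 \<Longrightarrow> norm (\<Sum>k<n. e2pi t ^ k) \<le> 1 / nearest t"
proof -
  assume pos: "nearest t > 0"
  have ne: "e2pi t \<noteq> 1" using norm_e2pi_minus_1_ge[of t] pos by auto
  have "norm (\<Sum>k<n. e2pi t ^ k) = norm (e2pi t ^ n - 1) / norm (e2pi t - 1)"
    using ne by (simp add: geometric_sum norm_divide)
  also have "\<dots> \<le> 2 / (2 * nearest t)"
  proof (intro frac_le)
    show "norm (e2pi t ^ n - 1) \<le> 2" using norm_triangle_ineq4[of "e2pi t ^ n" 1] by (simp add: norm_power)
  qed (use pos norm_e2pi_minus_1_ge[of t] in auto)
  finally show ?thesis by simp
qed

definition esum :: "nat \<Rightarrow> real \<Rightarrow> complex" where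
  "esum Q t = (\<Sum>q=1..Q. e2pi (real q * t))"

text \<open>The weight q is the Jacobian of the substitution a = q x. It makes this the derivative
  of \<open>esum\<close> up to the factor 2 pi i.\<close>

definition esum1 :: "nat \<Rightarrow> real \<Rightarrow> complex" where
  "esum1 Q t = (\<Sum>q=1..Q. of_nat q * e2pi (real q * t))"

lemma norm_esum_le_nat: "norm (esum Q t) \<le> real Q"
proof -
  have "norm (esum Q t) \<le> (\<Sum>q=1..Q. norm (e2pi (real q * t)))" unfolding esum_def by (rule norm_sum)
  then show ?thesis by simp
qed

text \<open>The resonance of \<open>Q\<close> bounds every shorter sum as well; this uniformity is
  what partial summation in \<open>norm_esum1_le\<close> calls for.\<close>

lemma norm_esum_le:
  assumes "m \<le> Q" "Q > 0"
  shows "norm (esum m t) \<le> resonance Q t"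
proof (cases "nearest t \<le> 1 / real Q")
  case True
  have "norm (esum m t) \<le> real m" by (rule norm_esum_le_nat)
  also have "\<dots> \<le> real Q" using assms by simp
  finally show ?thesis using True by (simp add: resonance_def max_absorb1)
next
  case False
  then have pos: "nearest t > 0" using assms(2) by (smt (verit) divide_pos_pos of_nat_0_less_iff)
  have "esum m t = (\<Sum>k<m. e2pi t ^ Suc k)"
    unfolding esum_def e2pi_mult_nat
    by (rule sum.reindex_bij_witness[of _ Suc "\<lambda>q. q - 1"]) auto
  also have "\<dots> = e2pi t * (\<Sum>k<m. e2pi t ^ k)" by (simp add: sum_distrib_left)
  finally have "norm (esum m t) \<le> 1 / nearest t"
    using norm_geometric_e2pi_le[OF pos, of m] by (simp add: norm_mult)
  then show ?thesis using False by (simp add: resonance_def max_absorb2)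
qed

text \<open>Abel summation: Q times the full sum minus the sum of all shorter ones. Each of the two
  parts is at most Q times the resonance.\<close>

lemma norm_esum1_le:
  assumes "Q > 0"
  shows "norm (esum1 Q t) \<le> 2 * real Q * resonance Q t"
proof -
  have "esum1 m t = of_nat m * esum m t - (\<Sum>k<m. esum k t)" for m
    by (induction m) (simp_all add: esum1_def esum_def algebra_simps)
  then have "norm (esum1 Q t) \<le> norm (of_nat Q * esum Q t) + norm (\<Sum>k<Q. esum k t)"
    using norm_triangle_ineq4 by metis
  also have "norm (of_nat Q * esum Q t) \<le> real Q * resonance Q t"
    using norm_esum_le[OF order_refl assms, of t] by (simp add: norm_mult mult_left_mono)
  also have "norm (\<Sum>k<Q. esum k t) \<le> (\<Sum>k<Q. resonance Q t)"
    using norm_esum_le assms by (intro sum_norm_le) auto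
  finally show ?thesis by simp
qed

lemma continuous_on_esum [continuous_intros]: "continuous_on S g \<Longrightarrow> continuous_on S (\<lambda>x. esum Q (g x))"
  unfolding esum_def by (intro continuous_intros)
lemma continuous_on_esum1 [continuous_intros]: "continuous_on S g \<Longrightarrow> continuous_on S (\<lambda>x. esum1 Q (g x))"
  unfolding esum1_def by (intro continuous_intros)

section \<open>Fejer smoothing of sums over integers\<close>

definition fejer :: "nat \<Rightarrow> real \<Rightarrow> real" where
  "fejer H x = (norm (\<Sum>k<H. e2pi x ^ k))\<^sup>2 / real H"

lemma fejer_nonneg: "0 \<le> fejer H x" by (simp add: fejer_def)

lemma fejer_continuous [continuous_intros]: "continuous_on S g \<Longrightarrow> continuous_on S (\<lambda>x. fejer H (g x))"
  unfolding fejer_def by (cases "H = 0") (auto intro!: continuous_intros)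

lemma fejer_expand: "of_real (fejer H x) = (\<Sum>k<H. \<Sum>l<H. e2pi ((real k - real l) * x)) / of_nat H"
proof -
  have "complex_of_real ((norm (\<Sum>k<H. e2pi x ^ k))\<^sup>2) = (\<Sum>k<H. e2pi x ^ k) * cnj (\<Sum>k<H. e2pi x ^ k)"
    by (simp add: complex_norm_square del: of_real_power)
  also have "\<dots> = (\<Sum>k<H. \<Sum>l<H. e2pi x ^ k * cnj (e2pi x ^ l))"
    by (simp add: sum_product)
  also have "\<dots> = (\<Sum>k<H. \<Sum>l<H. e2pi ((real k - real l) * x))"
  proof (intro sum.cong refl)
    fix k l
    have "e2pi ((real k - real l) * x) = e2pi (real k * x + (- (real l * x)))" by (simp add: algebra_simps)
    also have "\<dots> = e2pi x ^ k * cnj (e2pi x ^ l)" by (simp only: e2pi_add e2pi_minus e2pi_mult_nat)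
    finally show "e2pi x ^ k * cnj (e2pi x ^ l) = e2pi ((real k - real l) * x)" by simp
  qed
  finally show ?thesis by (simp add: fejer_def)
qed

lemma fejer_le:
  assumes "\<tau> > 0" "\<tau> \<le> nearest x" "H > 0"
  shows "fejer H x \<le> 1 / (real H * \<tau>\<^sup>2)"
proof -
  have "norm (\<Sum>k<H. e2pi x ^ k) \<le> 1 / nearest x" using assms by (intro norm_geometric_e2pi_le) auto
  also have "\<dots> \<le> 1 / \<tau>" using assms by (intro divide_left_mono) auto
  finally have "(norm (\<Sum>k<H. e2pi x ^ k))\<^sup>2 \<le> (1 / \<tau>)\<^sup>2" by (intro power_mono) auto
  then have "fejer H x \<le> (1 / \<tau>)\<^sup>2 / real H" unfolding fejer_def by (intro divide_right_mono) auto
  then show ?thesis by (simp add: power_divide mult.commute)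
qed

lemma e2pi_has_integral_period:
  assumes "c \<noteq> 0"
  shows "((\<lambda>x. e2pi (of_int c * x)) has_integral 0) {a..a + 1}"
proof -
  have "((\<lambda>x. e2pi (of_int c * x)) has_integral
      (e2pi (of_int c * (a + 1)) / (2 * pi * \<i> * of_int c) - e2pi (of_int c * a) / (2 * pi * \<i> * of_int c))) {a..a + 1}"
  proof (rule fundamental_theorem_of_calculus)
    fix x assume "x \<in> {a..a+1}"
    have 1: "((\<lambda>x. real_of_int c * x) has_real_derivative real_of_int c) (at x within {a..a + 1})"
      by (auto intro!: derivative_eq_intros)
    have "((\<lambda>x. e2pi (of_int c * x) / (2 * pi * \<i> * of_int c)) has_vector_derivative
        ((2 * pi * of_int c) *\<^sub>R (\<i> * e2pi (of_int c * x))) / (2 * pi * \<i> * of_int c)) (at x within {a..a + 1})"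
      by (rule has_vector_derivative_divide[OF e2pi_has_vector_derivative[OF 1]])
    moreover have "((2 * pi * of_int c) *\<^sub>R (\<i> * e2pi (of_int c * x))) / (2 * pi * \<i> * of_int c) = e2pi (of_int c * x)"
      using assms by (simp add: scaleR_conv_of_real)
    ultimately show "((\<lambda>x. e2pi (of_int c * x) / (2 * pi * \<i> * of_int c)) has_vector_derivative e2pi (of_int c * x)) (at x within {a..a + 1})"
      by simp
  qed simp
  moreover have "e2pi (of_int c * (a + 1)) = e2pi (of_int c * a + of_int c)" by (simp add: distrib_left)
  then have "e2pi (of_int c * (a + 1)) = e2pi (of_int c * a)" by (simp only: e2pi_add_int)
  ultimately show ?thesis by simp
qed

lemma fejer_has_integral:
  assumes "H > 0"
  shows "(fejer H has_integral 1) {a..a + 1}"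
proof -
  have "((\<lambda>x. \<Sum>k<H. \<Sum>l<H. e2pi ((real k - real l) * x)) has_integral (\<Sum>k<H. \<Sum>l<H. if k = l then 1 else 0)) {a..a+1}"
  proof (intro has_integral_sum finite_lessThan)
    fix k l
    show "((\<lambda>x. e2pi ((real k - real l) * x)) has_integral (if k = l then 1 else 0)) {a..a+1}"
    proof (cases "k = l")
      case True
      then show ?thesis using has_integral_const_real[of "1::complex" a "a+1"] by simp
    next
      case False
      then show ?thesis using e2pi_has_integral_period[of "int k - int l" a] by simp
    qed
  qed
  also have "(\<Sum>k<H. \<Sum>l<H. if k = l then 1 else 0) = (of_nat H :: complex)" by simp
  finally have "((\<lambda>x. (\<Sum>k<H. \<Sum>l<H. e2pi ((real k - real l) * x)) / of_nat H) has_integral (of_nat H / of_nat H)) {a..a+1}"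
    by (rule has_integral_divide)
  then have "((\<lambda>x. of_real (fejer H x)) has_integral (1::complex)) {a..a+1}" using assms by (simp add: fejer_expand)
  then have "((\<lambda>x. Re (of_real (fejer H x))) has_integral Re 1) {a..a+1}" by (rule has_integral_Re)
  then show ?thesis by simp
qed

lemma nearest_eq: "\<bar>x - of_int a\<bar> \<le> 1 / 2 \<Longrightarrow> nearest x = \<bar>x - of_int a\<bar>"
proof -
  assume h: "\<bar>x - of_int a\<bar> \<le> 1 / 2"
  have 1: "nearest x \<le> \<bar>x - of_int a\<bar>" by (rule nearest_le)
  show ?thesis
  proof (cases "round x = a")
    case False
    then have "1 \<le> \<bar>round x - a\<bar>" by linarith
    then have "1 \<le> \<bar>real_of_int (round x) - of_int a\<bar>" by linarith
    then show ?thesis using h 1 unfolding nearest_def by linarith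
  qed (simp add: nearest_def)
qed

lemma nearest_eq': "of_int a - 1 / 2 \<le> x \<Longrightarrow> x \<le> of_int a + 1 / 2 \<Longrightarrow> nearest x = \<bar>x - of_int a\<bar>"
  by (rule nearest_eq) linarith

lemma integral_norm_le_const:
  fixes g :: "real \<Rightarrow> 'a::euclidean_space"
  assumes "c \<le> d" "g integrable_on {c..d}" "\<And>x. x \<in> {c..d} \<Longrightarrow> norm (g x) \<le> K"
  shows "norm (integral {c..d} g) \<le> K * (d - c)"
proof -
  have "norm (integral {c..d} g) \<le> integral {c..d} (\<lambda>x. K)"
    using assms by (intro integral_norm_bound_integral) auto
  then show ?thesis using assms(1) by (simp add: mult.commute)
qed

text \<open>For the pieces around an integer that is not summed: there the kernel is at most 1/(H
  \<tau>^2) throughout.\<close>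

lemma fejer_far:
  fixes g :: "real \<Rightarrow> complex"
  assumes "H > 0" "\<tau> > 0" "c \<le> d" "of_int a - 1 / 2 \<le> c" "d \<le> of_int a + 1 / 2"
    and g: "continuous_on {c..d} g" "\<And>x. x \<in> {c..d} \<Longrightarrow> norm (g x) \<le> 1"
    and far: "\<And>x. x \<in> {c..d} \<Longrightarrow> \<tau> \<le> \<bar>x - of_int a\<bar>"
  shows "norm (integral {c..d} (\<lambda>x. fejer H x *\<^sub>R g x)) \<le> 1 / (real H * \<tau>\<^sup>2) * (d - c)"
proof (rule integral_norm_le_const[OF assms(3)])
  show "(\<lambda>x. fejer H x *\<^sub>R g x) integrable_on {c..d}"
    by (intro integrable_continuous_real continuous_intros g)
  fix x assume x: "x \<in> {c..d}"
  have "nearest x = \<bar>x - of_int a\<bar>" using x assms(4,5) by (intro nearest_eq') auto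
  then have "fejer H x \<le> 1 / (real H * \<tau>\<^sup>2)" using far[OF x] assms(1,2) by (intro fejer_le) auto
  then have "fejer H x * norm (g x) \<le> 1 / (real H * \<tau>\<^sup>2) * 1"
    using g(2)[OF x] fejer_nonneg by (intro mult_mono) auto
  then show "norm (fejer H x *\<^sub>R g x) \<le> 1 / (real H * \<tau>\<^sup>2)" by (simp add: fejer_nonneg)
qed

text \<open>The kernel has mass 1 on the unit interval around \<open>a\<close> and is at most 1/(H
  \<tau>^2) at distance \<tau> or more, while within \<tau> the function changes by at most
  \<Lambda> \<tau>. Of the three tail terms one is the mass lost outside \<open>{c..d}\<close>, and
  two come from |g x - g a| \<le> 2 on the far part.\<close>

lemma fejer_near:
  fixes g :: "real \<Rightarrow> complex"
  assumes "H > 0" "\<tau> > 0" "of_int a - 1 / 2 \<le> c" "d \<le> of_int a + 1 / 2"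
    and cd: "c \<le> of_int a - \<tau>" "of_int a + \<tau> \<le> d"
    and g: "continuous_on {c..d} g" "\<And>x. x \<in> {c..d} \<Longrightarrow> norm (g x) \<le> 1"
    and lip: "\<And>x. x \<in> {c..d} \<Longrightarrow> norm (g x - g (of_int a)) \<le> \<Lambda> * \<bar>x - of_int a\<bar>" and "\<Lambda> \<ge> 0"
  shows "norm (integral {c..d} (\<lambda>x. fejer H x *\<^sub>R g x) - g (of_int a)) \<le> \<Lambda> * \<tau> + 3 / (real H * \<tau>\<^sup>2)"
proof -
  define a' where "a' = real_of_int a"
  define K where "K = 1 / (real H * \<tau>\<^sup>2)"
  have K: "K \<ge> 0" by (simp add: K_def)
  have le: "c \<le> d" "a' - 1/2 \<le> c" "d \<le> a' + 1/2" "c \<le> a' - \<tau>" "a' + \<tau> \<le> d"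
    using assms(1-6) by (auto simp: a'_def)
  have F_int: "fejer H integrable_on {u..v}" for u v
    by (intro integrable_continuous_real continuous_intros)
  have tot: "integral {a' - 1/2..a' + 1/2} (fejer H) = 1"
    using fejer_has_integral[OF assms(1), of "a' - 1/2"] by (simp add: integral_unique add.commute)
  have split: "integral {a' - 1/2..c} (fejer H) + (integral {c..d} (fejer H) + integral {d..a' + 1/2} (fejer H)) = 1"
    using Henstock_Kurzweil_Integration.integral_combine[of c d "a' + 1/2" "fejer H"]
       Henstock_Kurzweil_Integration.integral_combine[of "a' - 1/2" c "a' + 1/2" "fejer H"] F_int le tot by simp
  have out: "\<bar>integral {u..v} (fejer H)\<bar> \<le> K * (v - u)"
    if "a' - 1/2 \<le> u" "u \<le> v" "v \<le> a' + 1/2" "\<And>x. x \<in> {u..v} \<Longrightarrow> \<tau> \<le> \<bar>x - a'\<bar>" for u v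
  proof -
    have "norm (integral {u..v} (fejer H)) \<le> K * (v - u)"
    proof (rule integral_norm_le_const[OF that(2) F_int])
      fix x assume x: "x \<in> {u..v}"
      have "nearest x = \<bar>x - a'\<bar>" unfolding a'_def using x that(1-3) by (intro nearest_eq') (auto simp: a'_def)
      then show "norm (fejer H x) \<le> K"
        using that(4)[OF x] assms(1,2) fejer_le[of \<tau> x H] fejer_nonneg[of H x] by (simp add: K_def)
    qed
    then show ?thesis by simp
  qed
  have "\<bar>integral {a' - 1/2..c} (fejer H)\<bar> \<le> K * (c - (a' - 1/2))" using le assms(2) by (intro out) auto
  moreover have "\<bar>integral {d..a' + 1/2} (fejer H)\<bar> \<le> K * (a' + 1/2 - d)" using le assms(2) by (intro out) auto
  moreover have "K * (c - (a' - 1/2)) + K * (a' + 1/2 - d) \<le> K * 1"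
    unfolding distrib_left[symmetric] using le K assms(2) by (intro mult_left_mono) auto
  ultimately have mass: "\<bar>integral {c..d} (fejer H) - 1\<bar> \<le> K" using split by linarith
  have mass0: "0 \<le> integral {c..d} (fejer H)" by (intro integral_nonneg F_int) (simp add: fejer_nonneg)
  have mass1: "integral {c..d} (fejer H) \<le> 1"
  proof -
    have "0 \<le> integral {a' - 1/2..c} (fejer H)" "0 \<le> integral {d..a' + 1/2} (fejer H)"
      by (intro integral_nonneg F_int; simp add: fejer_nonneg)+
    then show ?thesis using split by linarith
  qed
  have gi: "(\<lambda>x. fejer H x *\<^sub>R g x) integrable_on {c..d}"
    by (intro integrable_continuous_real continuous_intros g)
  have ci: "(\<lambda>x. fejer H x *\<^sub>R g a') integrable_on {c..d}"
    by (intro integrable_continuous_real continuous_intros)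
  have "norm (integral {c..d} (\<lambda>x. fejer H x *\<^sub>R (g x - g a'))) \<le> integral {c..d} (\<lambda>x. \<Lambda> * \<tau> * fejer H x + 2 * K)"
  proof (rule integral_norm_bound_integral)
    show "(\<lambda>x. fejer H x *\<^sub>R (g x - g a')) integrable_on {c..d}"
      by (intro integrable_continuous_real continuous_intros g)
    show "(\<lambda>x. \<Lambda> * \<tau> * fejer H x + 2 * K) integrable_on {c..d}"
      by (intro integrable_continuous_real continuous_intros)
    fix x assume x: "x \<in> {c..d}"
    have ga: "norm (g x - g a') \<le> 2"
    proof -
      have "norm (g a') \<le> 1" using le assms(2) by (intro g(2)) auto
      then show ?thesis using g(2)[OF x] norm_triangle_ineq4[of "g x" "g a'"] by linarith
    qed
    have "fejer H x * norm (g x - g a') \<le> \<Lambda> * \<tau> * fejer H x + 2 * K"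
    proof (cases "\<bar>x - a'\<bar> \<le> \<tau>")
      case True
      have "norm (g x - g a') \<le> \<Lambda> * \<tau>" using lip[OF x] True \<open>\<Lambda> \<ge> 0\<close>
        by (smt (verit) a'_def mult_left_mono)
      then have "fejer H x * norm (g x - g a') \<le> fejer H x * (\<Lambda> * \<tau>)"
        by (intro mult_left_mono fejer_nonneg)
      then show ?thesis using K by (simp add: mult_ac)
    next
      case False
      have "nearest x = \<bar>x - a'\<bar>" unfolding a'_def using x le by (intro nearest_eq') (auto simp: a'_def)
      then have "fejer H x \<le> K" unfolding K_def using False assms(1,2) by (intro fejer_le) auto
      then have "fejer H x * norm (g x - g a') \<le> K * 2" using ga K by (intro mult_mono) auto
      moreover have "0 \<le> \<Lambda> * \<tau> * fejer H x" using \<open>\<Lambda> \<ge> 0\<close> assms(2) fejer_nonneg[of H x] by simp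
      ultimately show ?thesis by simp
    qed
    then show "norm (fejer H x *\<^sub>R (g x - g a')) \<le> \<Lambda> * \<tau> * fejer H x + 2 * K" by (simp add: fejer_nonneg)
  qed
  also have "\<dots> = \<Lambda> * \<tau> * integral {c..d} (fejer H) + 2 * K * (d - c)"
  proof (rule integral_unique)
    have "((\<lambda>x. 2 * K) has_integral 2 * K * (d - c)) {c..d}"
      using has_integral_const_real[of "2 * K" c d] le by (simp add: mult_ac)
    then show "((\<lambda>x. \<Lambda> * \<tau> * fejer H x + 2 * K) has_integral \<Lambda> * \<tau> * integral {c..d} (fejer H) + 2 * K * (d - c)) {c..d}"
      by (intro has_integral_add has_integral_mult_right integrable_integral F_int)
  qed
  also have "\<dots> \<le> \<Lambda> * \<tau> * 1 + 2 * K * 1"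
    using mass1 le K assms(2) \<open>\<Lambda> \<ge> 0\<close> by (intro add_mono mult_left_mono) auto
  finally have 1: "norm (integral {c..d} (\<lambda>x. fejer H x *\<^sub>R (g x - g a'))) \<le> \<Lambda> * \<tau> + 2 * K" by simp
  have "integral {c..d} (\<lambda>x. fejer H x *\<^sub>R (g x - g a')) =
      integral {c..d} (\<lambda>x. fejer H x *\<^sub>R g x) - integral {c..d} (\<lambda>x. fejer H x *\<^sub>R g a')"
    unfolding scaleR_diff_right by (rule integral_diff[OF gi ci])
  also have "integral {c..d} (\<lambda>x. fejer H x *\<^sub>R g a') = integral {c..d} (fejer H) *\<^sub>R g a'"
    by (rule integral_unique[OF has_integral_scaleR_left[OF integrable_integral[OF F_int]]])
  finally have eq: "integral {c..d} (\<lambda>x. fejer H x *\<^sub>R g x) - g a' =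
      integral {c..d} (\<lambda>x. fejer H x *\<^sub>R (g x - g a')) + (integral {c..d} (fejer H) - 1) *\<^sub>R g a'"
    by (simp add: scaleR_diff_left)
  have "norm ((integral {c..d} (fejer H) - 1) *\<^sub>R g a') \<le> K * 1"
  proof -
    have "norm (g a') \<le> 1" using le assms(2) by (intro g(2)) auto
    then show ?thesis unfolding norm_scaleR real_norm_def using mass K by (intro mult_mono) auto
  qed
  then have "norm (integral {c..d} (\<lambda>x. fejer H x *\<^sub>R g x) - g a') \<le> \<Lambda> * \<tau> + 2 * K + K"
    unfolding eq using 1 by (intro order_trans[OF norm_triangle_ineq] add_mono) auto
  then show ?thesis by (simp add: a'_def K_def)
qed

lemma integral_partition_sum:
  fixes g :: "real \<Rightarrow> complex" and P :: "nat \<Rightarrow> real"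
  assumes "incseq P" "continuous_on {P 0..P n} g"
  shows "integral {P 0..P n} g = (\<Sum>i<n. integral {P i..P (Suc i)} g)"
  using assms(2)
proof (induction n)
  case (Suc n)
  have le: "P 0 \<le> P n" "P n \<le> P (Suc n)" using assms(1) by (auto simp: incseq_def)
  have "continuous_on {P 0..P n} g" using Suc.prems by (rule continuous_on_subset) (use le in auto)
  moreover have "integral {P 0..P n} g + integral {P n..P (Suc n)} g = integral {P 0..P (Suc n)} g"
    using Henstock_Kurzweil_Integration.integral_combine[OF le integrable_continuous_real[OF Suc.prems]] .
  ultimately show ?case using Suc.IH by simp
qed simp

text \<open>A finite substitute for Poisson summation: the kernel is a trigonometric polynomial, so
  no question of convergence arises and the error is explicit. Since the endpoints keep the distance
  \<tau> from the integers, an integer of the interval has its whole \<tau>-neighbourhood inside,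
  and no boundary term is counted by a fraction.\<close>

lemma fejer_approximation:
  fixes g :: "real \<Rightarrow> complex"
  assumes H: "H > 0" and \<tau>: "\<tau> > 0" "\<tau> \<le> 1 / 2" and AB: "A \<le> B"
    and g: "continuous_on {A..B} g" "\<And>x. x \<in> {A..B} \<Longrightarrow> norm (g x) \<le> 1"
    and lip: "\<And>x y. x \<in> {A..B} \<Longrightarrow> y \<in> {A..B} \<Longrightarrow> norm (g x - g y) \<le> \<Lambda> * \<bar>x - y\<bar>" and \<Lambda>: "\<Lambda> \<ge> 0"
    and dist: "\<And>a. \<tau> \<le> \<bar>of_int a - A\<bar>" "\<And>a. \<tau> \<le> \<bar>of_int a - B\<bar>"
  shows "norm (integral {A..B} (\<lambda>x. fejer H x *\<^sub>R g x) - (\<Sum>a\<in>{\<lceil>A\<rceil>..\<lfloor>B\<rfloor>}. g (of_int a)))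
     \<le> (B - A + 3) * (\<Lambda> * \<tau> + 3 / (real H * \<tau>\<^sup>2))"
proof -
  define m where "m = \<lfloor>A\<rfloor>"
  define N where "N = nat (\<lceil>B\<rceil> - m) + 1"
  \<comment> \<open>Half-integers clamped to \<open>{A..B}\<close>: piece \<open>i\<close> surrounds
    the integer \<open>m + int i\<close>, and a piece beyond an endpoint degenerates to a
    point.\<close>
  define P where "P i = max A (min B (of_int m - 1 / 2 + real i))" for i
  define E where "E = \<Lambda> * \<tau> + 3 / (real H * \<tau>\<^sup>2)"
  have E: "0 \<le> E" "1 / (real H * \<tau>\<^sup>2) \<le> E"
  proof -
    have "0 \<le> \<Lambda> * \<tau>" using \<tau> \<Lambda> by simp
    define D where "D = 1 / (real H * \<tau>\<^sup>2)"
    have "0 \<le> D" by (simp add: D_def)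
    moreover have "E = \<Lambda> * \<tau> + 3 * D" by (simp add: E_def D_def)
    ultimately show "0 \<le> E" "1 / (real H * \<tau>\<^sup>2) \<le> E"
      using \<open>0 \<le> \<Lambda> * \<tau>\<close> unfolding D_def[symmetric] by linarith+
  qed
  have inc: "incseq P" unfolding incseq_def P_def by (auto intro!: max.mono min.mono)
  have P0: "P 0 = A" using AB by (simp add: P_def m_def) linarith
  have mB: "m \<le> \<lceil>B\<rceil>" using AB unfolding m_def by linarith
  have PN: "P N = B"
  proof -
    have "real N = of_int (\<lceil>B\<rceil> - m) + 1" unfolding N_def using mB by simp
    then have "B \<le> of_int m - 1 / 2 + real N" by simp linarith
    then show ?thesis using AB by (simp add: P_def)
  qed
  have Pin: "A \<le> P i" "P i \<le> B" for i using AB by (auto simp: P_def)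
  define G where "G i = (if A \<le> of_int (m + int i) \<and> of_int (m + int i) \<le> B then g (of_int (m + int i)) else 0)" for i
  have cont: "continuous_on {A..B} (\<lambda>x. fejer H x *\<^sub>R g x)" by (intro continuous_intros g)
  have "integral {A..B} (\<lambda>x. fejer H x *\<^sub>R g x) = (\<Sum>i<N. integral {P i..P (Suc i)} (\<lambda>x. fejer H x *\<^sub>R g x))"
    using integral_partition_sum[OF inc, of N "\<lambda>x. fejer H x *\<^sub>R g x"] cont by (simp add: P0 PN)
  moreover have "(\<Sum>a\<in>{\<lceil>A\<rceil>..\<lfloor>B\<rfloor>}. g (of_int a)) = (\<Sum>i<N. G i)"
  proof -
    have "(\<Sum>i<N. G i) = (\<Sum>i\<in>{i\<in>{..<N}. A \<le> of_int (m + int i) \<and> of_int (m + int i) \<le> B}. g (of_int (m + int i)))"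
      unfolding G_def by (rule sum.inter_filter[symmetric, OF finite_lessThan])
    also have "\<dots> = (\<Sum>a\<in>{\<lceil>A\<rceil>..\<lfloor>B\<rfloor>}. g (of_int a))"
    proof (rule sum.reindex_bij_witness[of _ "\<lambda>a. nat (a - m)" "\<lambda>i. m + int i"])
      fix i assume i: "i \<in> {i\<in>{..<N}. A \<le> of_int (m + int i) \<and> of_int (m + int i) \<le> B}"
      then show "m + int i \<in> {\<lceil>A\<rceil>..\<lfloor>B\<rfloor>}" by (simp add: ceiling_le_iff le_floor_iff)
    next
      fix a assume a: "a \<in> {\<lceil>A\<rceil>..\<lfloor>B\<rfloor>}"
      then have ab: "A \<le> of_int a" "of_int a \<le> B" by (simp_all add: ceiling_le_iff le_floor_iff)
      have ma: "m \<le> a" using ab(1) unfolding m_def by linarith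
      then show "m + int (nat (a - m)) = a" by simp
      have "a \<le> \<lceil>B\<rceil>" using ab(2) by linarith
      then have "nat (a - m) < N" unfolding N_def using ma by simp
      then show "nat (a - m) \<in> {i\<in>{..<N}. A \<le> of_int (m + int i) \<and> of_int (m + int i) \<le> B}"
        using ab ma by simp
    qed auto
    finally show ?thesis by simp
  qed
  ultimately have "norm (integral {A..B} (\<lambda>x. fejer H x *\<^sub>R g x) - (\<Sum>a\<in>{\<lceil>A\<rceil>..\<lfloor>B\<rfloor>}. g (of_int a))) =
     norm (\<Sum>i<N. integral {P i..P (Suc i)} (\<lambda>x. fejer H x *\<^sub>R g x) - G i)"
    by (simp add: sum_subtractf)
  also have "\<dots> \<le> (\<Sum>i<N. E)"
  proof (rule sum_norm_le)
    fix i
    define a where "a = m + int i"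
    have ar: "real_of_int a = of_int m + real i" by (simp add: a_def)
    show "norm (integral {P i..P (Suc i)} (\<lambda>x. fejer H x *\<^sub>R g x) - G i) \<le> E"
    proof (cases "A \<le> of_int a \<and> of_int a \<le> B")
      case True
      then have t: "A \<le> of_int a - \<tau>" "of_int a + \<tau> \<le> B" using dist(1)[of a] dist(2)[of a] by linarith+
      have b: "of_int a - 1 / 2 \<le> P i" "P i \<le> of_int a - \<tau>" "of_int a + \<tau> \<le> P (Suc i)" "P (Suc i) \<le> of_int a + 1 / 2"
        using t \<tau> by (auto simp: P_def ar)
      have sub: "{P i..P (Suc i)} \<subseteq> {A..B}" using Pin by auto
      have "norm (integral {P i..P (Suc i)} (\<lambda>x. fejer H x *\<^sub>R g x) - g (of_int a)) \<le> E" unfolding E_def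
        using b sub True by (intro fejer_near[OF H \<tau>(1)] continuous_on_subset[OF g(1) sub] \<Lambda>) (auto intro!: g(2) lip)
      then show ?thesis using True by (simp add: G_def a_def)
    next
      case False
      then have G0: "G i = 0" unfolding G_def a_def[symmetric] by (rule if_not_P)
      show ?thesis
      proof (cases "P i = P (Suc i)")
        case True then show ?thesis using G0 E by simp
      next
        case neq: False
        then have lt: "P i < P (Suc i)" using incseqD[OF inc, of i "Suc i"] by simp
        then have b: "of_int a - 1 / 2 \<le> P i" "P (Suc i) \<le> of_int a + 1 / 2"
          using AB by (auto simp: P_def ar max_def min_def split: if_splits)
        have sub: "{P i..P (Suc i)} \<subseteq> {A..B}" using Pin by auto
        have "norm (integral {P i..P (Suc i)} (\<lambda>x. fejer H x *\<^sub>R g x)) \<le> 1 / (real H * \<tau>\<^sup>2) * (P (Suc i) - P i)"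
        proof (rule fejer_far[OF H \<tau>(1) less_imp_le[OF lt] b continuous_on_subset[OF g(1) sub]])
          fix x assume x: "x \<in> {P i..P (Suc i)}"
          then have xAB: "x \<in> {A..B}" using sub by auto
          then show "norm (g x) \<le> 1" by (rule g(2))
          show "\<tau> \<le> \<bar>x - of_int a\<bar>" using False dist(1)[of a] dist(2)[of a] xAB by auto
        qed
        also have "\<dots> \<le> 1 / (real H * \<tau>\<^sup>2) * 1" using b by (intro mult_left_mono) auto
        also have "\<dots> \<le> E" using E by simp
        finally show ?thesis using G0 by simp
      qed
    qed
  qed
  also have "\<dots> = real N * E" by simp
  also have "\<dots> \<le> (B - A + 3) * E"
  proof (intro mult_right_mono E(1))
    have "real N = of_int (\<lceil>B\<rceil> - m) + 1" unfolding N_def using mB by simp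
    then show "real N \<le> B - A + 3" unfolding m_def by simp linarith
  qed
  finally show ?thesis by (simp add: E_def)
qed

text \<open>Each difference arises from at most H of the H^2 pairs. This removes the double sum in
  the expansion of the Fejer kernel.\<close>

lemma double_sum_difference_le:
  fixes w :: "int \<Rightarrow> real"
  assumes "\<And>h. 0 \<le> w h"
  shows "(\<Sum>k<H. \<Sum>l<H. w (int l - int k)) \<le> real H * (\<Sum>h\<in>{- int H..int H}. w h)"
proof -
  have "(\<Sum>l<H. w (int l - int k)) \<le> (\<Sum>h\<in>{- int H..int H}. w h)" if "k < H" for k
  proof -
    have "(\<Sum>l<H. w (int l - int k)) = (\<Sum>h\<in>(\<lambda>l. int l - int k) ` {..<H}. w h)"
      by (subst sum.reindex) (auto simp: inj_on_def)
    also have "\<dots> \<le> (\<Sum>h\<in>{- int H..int H}. w h)" using that assms by (intro sum_mono2) auto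
    finally show ?thesis .
  qed
  then have "(\<Sum>k<H. \<Sum>l<H. w (int l - int k)) \<le> (\<Sum>k<H. \<Sum>h\<in>{- int H..int H}. w h)"
    by (intro sum_mono) auto
  then show ?thesis by simp
qed

lemma fejer_integral_expand:
  fixes g :: "real \<Rightarrow> complex"
  assumes "continuous_on {A..B} g"
  shows "integral {A..B} (\<lambda>x. fejer H x *\<^sub>R g x) =
     (\<Sum>k<H. \<Sum>l<H. integral {A..B} (\<lambda>x. e2pi ((real k - real l) * x) * g x)) / of_nat H"
proof -
  have "integral {A..B} (\<lambda>x. fejer H x *\<^sub>R g x) =
      integral {A..B} (\<lambda>x. (\<Sum>k<H. \<Sum>l<H. e2pi ((real k - real l) * x) * g x) / of_nat H)"
    by (intro integral_cong) (simp add: scaleR_conv_of_real fejer_expand sum_distrib_right)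
  also have "\<dots> = integral {A..B} (\<lambda>x. (\<Sum>k<H. \<Sum>l<H. e2pi ((real k - real l) * x) * g x)) / of_nat H"
    by (rule integral_divide)
  also have "integral {A..B} (\<lambda>x. (\<Sum>k<H. \<Sum>l<H. e2pi ((real k - real l) * x) * g x)) =
      (\<Sum>k<H. \<Sum>l<H. integral {A..B} (\<lambda>x. e2pi ((real k - real l) * x) * g x))"
    by (subst integral_sum; (intro sum.cong refl integral_sum)?)
       (auto intro!: integrable_sum integrable_continuous_real continuous_intros assms)
  finally show ?thesis .
qed

text \<open>Each q is smoothed on its own interval, and a = q x then brings all q to the common
  interval \<open>{A..B}\<close>. The norm is taken only afterwards, so the sum over q stays inside
  the integral as \<open>esum1\<close> and its cancellation is preserved.\<close>

lemma exponential_sum_transfer: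
  fixes F :: "real \<Rightarrow> real"
  assumes AB: "A \<le> B" and H: "H > 0" and \<tau>: "\<tau> > 0" "\<tau> \<le> 1 / 2"
    and lip: "\<And>x y. x \<in> {A..B} \<Longrightarrow> y \<in> {A..B} \<Longrightarrow> \<bar>F x - F y\<bar> \<le> K * \<bar>x - y\<bar>" and K: "K \<ge> 0"
    and dist: "\<And>a q. 1 \<le> q \<Longrightarrow> q \<le> Q \<Longrightarrow> \<tau> \<le> \<bar>of_int a - real q * A\<bar>"
      "\<And>a q. 1 \<le> q \<Longrightarrow> q \<le> Q \<Longrightarrow> \<tau> \<le> \<bar>of_int a - real q * B\<bar>"
  shows "norm (\<Sum>q=1..Q. \<Sum>a\<in>{\<lceil>real q * A\<rceil>..\<lfloor>real q * B\<rfloor>}. e2pi (real q * F (of_int a / real q))) \<le>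
    (\<Sum>h\<in>{- int H..int H}. norm (integral {A..B} (\<lambda>x. esum1 Q (F x - of_int h * x)))) +
    real Q * ((real Q * (B - A) + 3) * (2 * pi * K * \<tau> + 3 / (real H * \<tau>\<^sup>2)))"
proof -
  define E where "E = 2 * pi * K * \<tau> + 3 / (real H * \<tau>\<^sup>2)"
  have E: "E \<ge> 0" using K \<tau> by (simp add: E_def)
  have contF: "continuous_on {A..B} F"
    by (rule lipschitz_on_continuous_on[of K]) (use lip K in \<open>auto intro!: lipschitz_onI simp: dist_real_def\<close>)
  define g where "g q x = e2pi (real q * F (x / real q))" for q x
  define S where "S q = (\<Sum>a\<in>{\<lceil>real q * A\<rceil>..\<lfloor>real q * B\<rfloor>}. g q (of_int a))" for q
  define T where "T q = integral {real q * A..real q * B} (\<lambda>x. fejer H x *\<^sub>R g q x)" for q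
  define I where "I h = integral {A..B} (\<lambda>x. esum1 Q (F x - of_int h * x))" for h
  have inr: "x / real q \<in> {A..B}" if "1 \<le> q" "x \<in> {real q * A..real q * B}" for q x
    using that by (auto simp: field_simps)
  have contg: "continuous_on {real q * A..real q * B} (g q)" if q: "1 \<le> q" for q
  proof -
    have "continuous_on {real q * A..real q * B} (\<lambda>x. F (x / real q))"
      using inr[OF q] q by (intro continuous_on_compose2[OF contF] continuous_intros) auto
    then show ?thesis unfolding g_def by (intro continuous_intros)
  qed
  have ST: "norm (T q - S q) \<le> (real Q * (B - A) + 3) * E" if q: "1 \<le> q" "q \<le> Q" for q
  proof -
    have "norm (T q - S q) \<le> (real q * B - real q * A + 3) * (2 * pi * K * \<tau> + 3 / (real H * \<tau>\<^sup>2))"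
      unfolding T_def S_def
    proof (rule fejer_approximation[OF H \<tau>])
      show "real q * A \<le> real q * B" using AB q by (intro mult_left_mono) auto
      show "continuous_on {real q * A..real q * B} (g q)" by (rule contg[OF q(1)])
      show "norm (g q x) \<le> 1" for x by (simp add: g_def)
      show "0 \<le> 2 * pi * K" using K by simp
      fix x y assume xy: "x \<in> {real q * A..real q * B}" "y \<in> {real q * A..real q * B}"
      have "norm (g q x - g q y) \<le> 2 * pi * \<bar>real q * F (x / real q) - real q * F (y / real q)\<bar>"
        unfolding g_def by (rule norm_e2pi_diff_le)
      also have "\<bar>real q * F (x / real q) - real q * F (y / real q)\<bar> = real q * \<bar>F (x / real q) - F (y / real q)\<bar>"
        by (simp add: abs_mult flip: right_diff_distrib)
      also have "\<bar>F (x / real q) - F (y / real q)\<bar> \<le> K * \<bar>x / real q - y / real q\<bar>"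
        by (intro lip inr q xy)
      also have "real q * (K * \<bar>x / real q - y / real q\<bar>) = K * \<bar>x - y\<bar>"
        using q by (simp add: abs_divide flip: diff_divide_distrib)
      finally show "norm (g q x - g q y) \<le> 2 * pi * K * \<bar>x - y\<bar>" by (simp add: mult_left_mono)
    qed (use dist q in auto)
    also have "\<dots> \<le> (real Q * (B - A) + 3) * E"
      unfolding E_def[symmetric] using q AB E
      by (intro mult_right_mono) (auto simp: mult_right_mono simp flip: right_diff_distrib)
    finally show ?thesis .
  qed
  \<comment> \<open>The frequency k - l of the kernel in the variable a becomes q (k - l) in x.
    Hence the whole phase is q times a function that does not depend on q, and the sum over q is
    geometric up to the weight.\<close>
  have Tq: "T q = (\<Sum>k<H. \<Sum>l<H. integral {A..B} (\<lambda>x. of_nat q * e2pi (real q * (F x - of_int (int l - int k) * x)))) / of_nat H"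
    if q: "1 \<le> q" for q
  proof -
    have "integral {real q * A..real q * B} (\<lambda>x. e2pi ((real k - real l) * x) * g q x) =
       integral {A..B} (\<lambda>x. of_nat q * e2pi (real q * (F x - of_int (int l - int k) * x)))" for k l
    proof -
      have "((\<lambda>y. real q *\<^sub>R (e2pi ((real k - real l) * (real q * y)) * g q (real q * y))) has_integral
         integral {real q * A..real q * B} (\<lambda>x. e2pi ((real k - real l) * x) * g q x)) {A..B}"
      proof (rule has_integral_substitution[OF AB])
        show "real q * A \<le> real q * B" using AB by (intro mult_left_mono) auto
        show "times (real q) ` {A..B} \<subseteq> {real q * A..real q * B}" by (auto intro!: mult_left_mono)
        show "continuous_on {real q * A..real q * B} (\<lambda>x. e2pi ((real k - real l) * x) * g q x)"
          by (intro continuous_intros contg q)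
      qed (auto intro!: derivative_eq_intros)
      moreover have "real q *\<^sub>R (e2pi ((real k - real l) * (real q * y)) * g q (real q * y)) =
         of_nat q * e2pi (real q * (F y - of_int (int l - int k) * y))" for y
      proof -
        have "e2pi ((real k - real l) * (real q * y)) * g q (real q * y) = e2pi ((real k - real l) * (real q * y) + real q * F y)"
          using q by (simp add: g_def flip: e2pi_add)
        also have "(real k - real l) * (real q * y) + real q * F y = real q * (F y - of_int (int l - int k) * y)"
          by (simp add: algebra_simps)
        finally show ?thesis by (simp add: scaleR_conv_of_real)
      qed
      ultimately have "((\<lambda>y. of_nat q * e2pi (real q * (F y - of_int (int l - int k) * y))) has_integral
         integral {real q * A..real q * B} (\<lambda>x. e2pi ((real k - real l) * x) * g q x)) {A..B}" by (simp only:)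
      then show ?thesis by (rule integral_unique[symmetric])
    qed
    then show ?thesis unfolding T_def fejer_integral_expand[OF contg[OF q]] by simp
  qed
  have "(\<Sum>q=1..Q. T q) = (\<Sum>k<H. \<Sum>l<H. I (int l - int k)) / of_nat H"
  proof -
    have "(\<Sum>q=1..Q. T q) = (\<Sum>q=1..Q. (\<Sum>k<H. \<Sum>l<H. integral {A..B} (\<lambda>x. of_nat q * e2pi (real q * (F x - of_int (int l - int k) * x)))) / of_nat H)"
      by (intro sum.cong refl Tq) auto
    also have "\<dots> = (\<Sum>q=1..Q. \<Sum>k<H. \<Sum>l<H. integral {A..B} (\<lambda>x. of_nat q * e2pi (real q * (F x - of_int (int l - int k) * x)))) / of_nat H"
      by (simp add: sum_divide_distrib)
    also have "(\<Sum>q=1..Q. \<Sum>k<H. \<Sum>l<H. integral {A..B} (\<lambda>x. of_nat q * e2pi (real q * (F x - of_int (int l - int k) * x)))) =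
       (\<Sum>k<H. \<Sum>q=1..Q. \<Sum>l<H. integral {A..B} (\<lambda>x. of_nat q * e2pi (real q * (F x - of_int (int l - int k) * x))))"
      by (rule sum.swap)
    also have "\<dots> = (\<Sum>k<H. \<Sum>l<H. \<Sum>q=1..Q. integral {A..B} (\<lambda>x. of_nat q * e2pi (real q * (F x - of_int (int l - int k) * x))))"
      by (rule sum.cong[OF refl], rule sum.swap)
    also have "\<dots> = (\<Sum>k<H. \<Sum>l<H. I (int l - int k))"
    proof (intro sum.cong refl)
      fix k l
      show "(\<Sum>q=1..Q. integral {A..B} (\<lambda>x. of_nat q * e2pi (real q * (F x - of_int (int l - int k) * x)))) = I (int l - int k)"
        unfolding I_def esum1_def
        by (rule integral_sum[symmetric]) (auto intro!: integrable_continuous_real continuous_intros contF)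
    qed
    finally show ?thesis .
  qed
  then have "norm (\<Sum>q=1..Q. T q) = norm (\<Sum>k<H. \<Sum>l<H. I (int l - int k)) / real H" by (simp add: norm_divide)
  also have "\<dots> \<le> (\<Sum>k<H. \<Sum>l<H. norm (I (int l - int k))) / real H"
    by (intro divide_right_mono sum_norm_le order_trans[OF norm_sum]) auto
  also have "\<dots> \<le> (real H * (\<Sum>h\<in>{- int H..int H}. norm (I h))) / real H"
    by (intro divide_right_mono double_sum_difference_le) auto
  also have "\<dots> = (\<Sum>h\<in>{- int H..int H}. norm (I h))" using H by simp
  finally have T: "norm (\<Sum>q=1..Q. T q) \<le> (\<Sum>h\<in>{- int H..int H}. norm (I h))" .
  have "norm (\<Sum>q=1..Q. S q) \<le> norm (\<Sum>q=1..Q. T q) + norm (\<Sum>q=1..Q. S q - T q)"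
    using norm_triangle_ineq[of "\<Sum>q=1..Q. T q" "\<Sum>q=1..Q. S q - T q"] by (simp add: sum_subtractf)
  also have "norm (\<Sum>q=1..Q. S q - T q) \<le> (\<Sum>q=1..Q. (real Q * (B - A) + 3) * E)"
    using ST by (intro sum_norm_le) (auto simp: norm_minus_commute)
  finally show ?thesis using T by (simp add: S_def g_def I_def E_def)
qed

section \<open>Oscillatory integrals along a curved arc\<close>

text \<open>Derivatives are prescribed on the arc only, whereas \<open>curv\<close> holds on the
  whole line, so that the inverse slope and the dual make sense without reference to the
  arc.\<close>

locale curved_arc =
  fixes c A B :: real and f f' f'' :: "real \<Rightarrow> real"
  assumes c: "0 < c" "c \<le> 1" and AB: "A < B" and cv: "curv c f f'"
    and deriv1: "\<And>x. x \<in> {A..B} \<Longrightarrow> (f has_real_derivative f' x) (at x within {A..B})"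
    and deriv2: "\<And>x. x \<in> {A..B} \<Longrightarrow> (f' has_real_derivative f'' x) (at x within {A..B})"
    and cont2: "continuous_on {A..B} f''"
    and bound2: "\<And>x. x \<in> {A..B} \<Longrightarrow> c \<le> f'' x \<and> f'' x \<le> 1 / c"
begin

lemma cont0: "continuous_on {A..B} f" and cont1: "continuous_on {A..B} f'"
  by (rule DERIV_continuous_on[OF deriv1], assumption) (rule DERIV_continuous_on[OF deriv2])

lemma esum_phase_derivative:
  assumes "{\<alpha>..\<beta>} \<subseteq> {A..B}" "x \<in> {\<alpha>..\<beta>}"
  shows "((\<lambda>x. esum Q (j * f x - h * x)) has_vector_derivative
     (2 * pi * (j * f' x - h)) *\<^sub>R (\<i> * esum1 Q (j * f x - h * x))) (at x within {\<alpha>..\<beta>})"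
proof -
  have f: "(f has_real_derivative f' x) (at x within {\<alpha>..\<beta>})"
    using DERIV_subset[OF deriv1 assms(1)] assms by auto
  have "((\<lambda>x. esum Q (j * f x - h * x)) has_vector_derivative
     (\<Sum>q=1..Q. (2 * pi * (real q * (j * f' x - h))) *\<^sub>R (\<i> * e2pi (real q * (j * f x - h * x))))) (at x within {\<alpha>..\<beta>})"
    unfolding esum_def
    by (intro has_vector_derivative_sum e2pi_has_vector_derivative) (use f in \<open>auto intro!: derivative_eq_intros\<close>)
  moreover have "(\<Sum>q=1..Q. (2 * pi * (real q * (j * f' x - h))) *\<^sub>R (\<i> * e2pi (real q * (j * f x - h * x)))) =
     (2 * pi * (j * f' x - h)) *\<^sub>R (\<i> * esum1 Q (j * f x - h * x))"
    unfolding esum1_def sum_distrib_left scaleR_sum_right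
    by (intro sum.cong refl) (simp add: scaleR_conv_of_real mult_ac)
  ultimately show ?thesis by simp
qed

text \<open>\<open>esum1\<close> is the derivative of \<open>esum\<close> divided by 2 pi i times
  the derivative of the phase. Where the latter does not vanish, one integration by parts moves the
  derivative onto its reciprocal; the factor 2 pi on the left is then dropped.\<close>

lemma integration_by_parts:
  assumes sub: "{\<alpha>..\<beta>} \<subseteq> {A..B}" "\<alpha> \<le> \<beta>" and nz: "\<And>x. x \<in> {\<alpha>..\<beta>} \<Longrightarrow> j * f' x - h \<noteq> 0" and j: "j > 0"
  shows "norm (integral {\<alpha>..\<beta>} (\<lambda>x. esum1 Q (j * f x - h * x))) \<le>
     norm (esum Q (j * f \<alpha> - h * \<alpha>)) / \<bar>j * f' \<alpha> - h\<bar> + norm (esum Q (j * f \<beta> - h * \<beta>)) / \<bar>j * f' \<beta> - h\<bar> +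
     integral {\<alpha>..\<beta>} (\<lambda>x. norm (esum Q (j * f x - h * x)) * (j * f'' x / (j * f' x - h)\<^sup>2))"
proof -
  define E where "E x = esum Q (j * f x - h * x)" for x
  define E1 where "E1 x = esum1 Q (j * f x - h * x)" for x
  define d where "d x = j * f' x - h" for x
  define G where "G x = (1 / d x) *\<^sub>R E x" for x
  have c0: "continuous_on {\<alpha>..\<beta>} f" "continuous_on {\<alpha>..\<beta>} f'" "continuous_on {\<alpha>..\<beta>} f''"
    using cont0 cont1 cont2 sub by (auto intro: continuous_on_subset)
  have nz': "d x \<noteq> 0" if "x \<in> {\<alpha>..\<beta>}" for x using nz that by (simp add: d_def)
  have contE: "continuous_on {\<alpha>..\<beta>} E" "continuous_on {\<alpha>..\<beta>} E1" "continuous_on {\<alpha>..\<beta>} d"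
    unfolding E_def E1_def d_def by (intro continuous_intros c0)+
  have cont_r: "continuous_on {\<alpha>..\<beta>} (\<lambda>x. (j * f'' x / (d x)\<^sup>2))"
    by (intro continuous_intros c0 contE) (use nz' in auto)
  have G': "(G has_vector_derivative ((2 * pi) *\<^sub>R (\<i> * E1 x) - (j * f'' x / (d x)\<^sup>2) *\<^sub>R E x)) (at x within {\<alpha>..\<beta>})"
    if x: "x \<in> {\<alpha>..\<beta>}" for x
  proof -
    have f': "(f' has_real_derivative f'' x) (at x within {\<alpha>..\<beta>})"
      using DERIV_subset[OF deriv2 sub(1)] sub x by auto
    have 1: "((\<lambda>x. 1 / d x) has_real_derivative - (j * f'' x / (d x)\<^sup>2)) (at x within {\<alpha>..\<beta>})"
      unfolding d_def using nz[OF x]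
      by (auto intro!: derivative_eq_intros f' simp: power2_eq_square divide_simps)
    have 2: "(E has_vector_derivative (2 * pi * d x) *\<^sub>R (\<i> * E1 x)) (at x within {\<alpha>..\<beta>})"
      unfolding E_def E1_def d_def by (rule esum_phase_derivative[OF sub(1) x])
    have "(G has_vector_derivative (1 / d x) *\<^sub>R ((2 * pi * d x) *\<^sub>R (\<i> * E1 x)) + (- (j * f'' x / (d x)\<^sup>2)) *\<^sub>R E x) (at x within {\<alpha>..\<beta>})"
      unfolding G_def by (rule has_vector_derivative_scaleR[OF 1 2])
    then show ?thesis using nz'[OF x] by simp
  qed
  have "((\<lambda>x. (2 * pi) *\<^sub>R (\<i> * E1 x) - (j * f'' x / (d x)\<^sup>2) *\<^sub>R E x) has_integral (G \<beta> - G \<alpha>)) {\<alpha>..\<beta>}"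
    by (rule fundamental_theorem_of_calculus[OF sub(2) G'])
  moreover have I2: "(\<lambda>x. (j * f'' x / (d x)\<^sup>2) *\<^sub>R E x) integrable_on {\<alpha>..\<beta>}"
    by (intro integrable_continuous_real continuous_intros cont_r contE)
  ultimately have "((\<lambda>x. ((2 * pi) *\<^sub>R (\<i> * E1 x) - (j * f'' x / (d x)\<^sup>2) *\<^sub>R E x) + (j * f'' x / (d x)\<^sup>2) *\<^sub>R E x) has_integral
      (G \<beta> - G \<alpha> + integral {\<alpha>..\<beta>} (\<lambda>x. (j * f'' x / (d x)\<^sup>2) *\<^sub>R E x))) {\<alpha>..\<beta>}"
    by (intro has_integral_add integrable_integral)
  then have h1: "((\<lambda>x. (2 * pi) *\<^sub>R (\<i> * E1 x)) has_integral
      (G \<beta> - G \<alpha> + integral {\<alpha>..\<beta>} (\<lambda>x. (j * f'' x / (d x)\<^sup>2) *\<^sub>R E x))) {\<alpha>..\<beta>}" by simp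
  have "((\<lambda>x. (2 * pi) *\<^sub>R (\<i> * E1 x)) has_integral ((2 * pi) *\<^sub>R (\<i> * integral {\<alpha>..\<beta>} E1))) {\<alpha>..\<beta>}"
    by (intro has_integral_cmul has_integral_mult_right integrable_integral integrable_continuous_real contE)
  then have "(2 * pi) *\<^sub>R (\<i> * integral {\<alpha>..\<beta>} E1) = G \<beta> - G \<alpha> + integral {\<alpha>..\<beta>} (\<lambda>x. (j * f'' x / (d x)\<^sup>2) *\<^sub>R E x)"
    using h1 by (rule has_integral_unique)
  then have "norm ((2 * pi) *\<^sub>R (\<i> * integral {\<alpha>..\<beta>} E1)) = norm (G \<beta> - G \<alpha> + integral {\<alpha>..\<beta>} (\<lambda>x. (j * f'' x / (d x)\<^sup>2) *\<^sub>R E x))"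
    by (simp only:)
  then have "2 * pi * norm (integral {\<alpha>..\<beta>} E1) = norm (G \<beta> - G \<alpha> + integral {\<alpha>..\<beta>} (\<lambda>x. (j * f'' x / (d x)\<^sup>2) *\<^sub>R E x))"
    by (simp add: norm_mult)
  also have "\<dots> \<le> norm (G \<beta>) + norm (G \<alpha>) + norm (integral {\<alpha>..\<beta>} (\<lambda>x. (j * f'' x / (d x)\<^sup>2) *\<^sub>R E x))"
    by (intro order_trans[OF norm_triangle_ineq] add_right_mono norm_triangle_ineq4)
  also have "norm (integral {\<alpha>..\<beta>} (\<lambda>x. (j * f'' x / (d x)\<^sup>2) *\<^sub>R E x)) \<le> integral {\<alpha>..\<beta>} (\<lambda>x. norm (E x) * (j * f'' x / (d x)\<^sup>2))"
  proof (rule integral_norm_bound_integral[OF I2])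
    show "(\<lambda>x. norm (E x) * (j * f'' x / (d x)\<^sup>2)) integrable_on {\<alpha>..\<beta>}"
      by (intro integrable_continuous_real continuous_intros cont_r contE)
    fix x assume x: "x \<in> {\<alpha>..\<beta>}"
    have "0 \<le> j * f'' x / (d x)\<^sup>2" using bound2[of x] c j x sub by (intro divide_nonneg_nonneg mult_nonneg_nonneg) auto
    then show "norm ((j * f'' x / (d x)\<^sup>2) *\<^sub>R E x) \<le> norm (E x) * (j * f'' x / (d x)\<^sup>2)"
      by (simp only: norm_scaleR real_norm_def abs_of_nonneg mult.commute order_refl)
  qed
  finally have "2 * pi * norm (integral {\<alpha>..\<beta>} E1) \<le> norm (G \<beta>) + norm (G \<alpha>) + integral {\<alpha>..\<beta>} (\<lambda>x. norm (E x) * (j * f'' x / (d x)\<^sup>2))" by simp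
  moreover have "1 * norm (integral {\<alpha>..\<beta>} E1) \<le> 2 * pi * norm (integral {\<alpha>..\<beta>} E1)"
    using pi_ge_two by (intro mult_right_mono) auto
  moreover have "norm (G x) = norm (E x) / \<bar>d x\<bar>" for x by (simp add: G_def)
  ultimately show ?thesis unfolding E_def[symmetric] E1_def[symmetric] d_def[symmetric] by simp
qed

lemma f'_mono: "x \<le> y \<Longrightarrow> f' x \<le> f' y"
proof -
  assume "x \<le> y"
  moreover from this have "0 \<le> c * (y - x)" using c by (intro mult_nonneg_nonneg) auto
  ultimately show ?thesis using curv_mono[OF cv, of x y] by linarith
qed

text \<open>With |esum| \<le> Q the remaining integrand j f'' / (j f' - h)^2 is an exact derivative,
  so only endpoint values survive. The sign condition keeps the increasing function j f' - h away
  from zero on the whole piece.\<close>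

lemma crude_bound:
  assumes sub: "{\<alpha>..\<beta>} \<subseteq> {A..B}" "\<alpha> \<le> \<beta>" and j: "j > 0"
    and sg: "j * f' \<alpha> - h > 0 \<or> j * f' \<beta> - h < 0"
  shows "norm (integral {\<alpha>..\<beta>} (\<lambda>x. esum1 Q (j * f x - h * x))) \<le>
     2 * real Q * (1 / \<bar>j * f' \<alpha> - h\<bar> + 1 / \<bar>j * f' \<beta> - h\<bar>)"
proof -
  define d where "d x = j * f' x - h" for x
  have dm: "d x \<le> d y" if "x \<le> y" for x y
    unfolding d_def using f'_mono[OF that] j by (simp add: mult_left_mono)
  have nz: "d x \<noteq> 0" if "x \<in> {\<alpha>..\<beta>}" for x
    using dm[of \<alpha> x] dm[of x \<beta>] that sg by (auto simp: d_def)
  have c0: "continuous_on {\<alpha>..\<beta>} f" "continuous_on {\<alpha>..\<beta>} f'" "continuous_on {\<alpha>..\<beta>} f''"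
    using cont0 cont1 cont2 sub by (auto intro: continuous_on_subset)
  have cont_r: "continuous_on {\<alpha>..\<beta>} (\<lambda>x. (j * f'' x / (d x)\<^sup>2))"
    unfolding d_def by (intro continuous_intros c0) (use nz in \<open>auto simp: d_def\<close>)
  have r: "((\<lambda>x. j * f'' x / (d x)\<^sup>2) has_integral (- (1 / d \<beta>) - (- (1 / d \<alpha>)))) {\<alpha>..\<beta>}"
  proof (rule fundamental_theorem_of_calculus[OF sub(2)])
    fix x assume x: "x \<in> {\<alpha>..\<beta>}"
    have f': "(f' has_real_derivative f'' x) (at x within {\<alpha>..\<beta>})"
      using DERIV_subset[OF deriv2 sub(1)] sub x by auto
    have "((\<lambda>x. - (1 / d x)) has_real_derivative (j * f'' x / (d x)\<^sup>2)) (at x within {\<alpha>..\<beta>})"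
      using nz[OF x] unfolding d_def by (auto intro!: derivative_eq_intros f' simp: power2_eq_square divide_simps)
    then show "((\<lambda>x. - (1 / d x)) has_vector_derivative j * f'' x / (d x)\<^sup>2) (at x within {\<alpha>..\<beta>})"
      by (simp add: has_real_derivative_iff_has_vector_derivative)
  qed
  have "integral {\<alpha>..\<beta>} (\<lambda>x. norm (esum Q (j * f x - h * x)) * (j * f'' x / (d x)\<^sup>2)) \<le>
     integral {\<alpha>..\<beta>} (\<lambda>x. real Q * (j * f'' x / (d x)\<^sup>2))"
  proof (rule integral_le)
    fix x assume x: "x \<in> {\<alpha>..\<beta>}"
    have "0 \<le> j * f'' x / (d x)\<^sup>2" using bound2[of x] c j x sub by (intro divide_nonneg_nonneg mult_nonneg_nonneg) auto
    then show "norm (esum Q (j * f x - h * x)) * (j * f'' x / (d x)\<^sup>2) \<le> real Q * (j * f'' x / (d x)\<^sup>2)"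
      by (intro mult_right_mono norm_esum_le_nat)
  qed (intro integrable_continuous_real continuous_intros cont_r c0)+
  also have "\<dots> = real Q * (- (1 / d \<beta>) - (- (1 / d \<alpha>)))"
    by (intro integral_unique has_integral_mult_right r)
  also have "\<dots> \<le> real Q * (1 / \<bar>d \<alpha>\<bar> + 1 / \<bar>d \<beta>\<bar>)"
  proof (intro mult_left_mono)
    have "\<bar>1 / d \<alpha>\<bar> = 1 / \<bar>d \<alpha>\<bar>" "\<bar>1 / d \<beta>\<bar> = 1 / \<bar>d \<beta>\<bar>" by (simp_all add: abs_divide)
    then show "- (1 / d \<beta>) - - (1 / d \<alpha>) \<le> 1 / \<bar>d \<alpha>\<bar> + 1 / \<bar>d \<beta>\<bar>" by linarith
  qed simp
  finally have I: "integral {\<alpha>..\<beta>} (\<lambda>x. norm (esum Q (j * f x - h * x)) * (j * f'' x / (d x)\<^sup>2)) \<le> real Q * (1 / \<bar>d \<alpha>\<bar> + 1 / \<bar>d \<beta>\<bar>)" .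
  have "norm (integral {\<alpha>..\<beta>} (\<lambda>x. esum1 Q (j * f x - h * x))) \<le>
     norm (esum Q (j * f \<alpha> - h * \<alpha>)) / \<bar>d \<alpha>\<bar> + norm (esum Q (j * f \<beta> - h * \<beta>)) / \<bar>d \<beta>\<bar> +
     integral {\<alpha>..\<beta>} (\<lambda>x. norm (esum Q (j * f x - h * x)) * (j * f'' x / (d x)\<^sup>2))"
    unfolding d_def by (rule integration_by_parts[OF sub _ j]) (use nz in \<open>auto simp: d_def\<close>)
  also have "\<dots> \<le> real Q / \<bar>d \<alpha>\<bar> + real Q / \<bar>d \<beta>\<bar> + real Q * (1 / \<bar>d \<alpha>\<bar> + 1 / \<bar>d \<beta>\<bar>)"
    by (intro add_mono divide_right_mono norm_esum_le_nat I) auto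
  also have "\<dots> = 2 * real Q * (1 / \<bar>d \<alpha>\<bar> + 1 / \<bar>d \<beta>\<bar>)" by (simp add: distrib_left)
  finally show ?thesis by (simp add: d_def)
qed

lemma central_bound:
  assumes sub: "{\<alpha>..\<beta>} \<subseteq> {A..B}" "\<alpha> \<le> \<beta>" and K: "\<And>x. x \<in> {\<alpha>..\<beta>} \<Longrightarrow> norm (esum1 Q (j * f x - h * x)) \<le> K"
  shows "norm (integral {\<alpha>..\<beta>} (\<lambda>x. esum1 Q (j * f x - h * x))) \<le> K * (\<beta> - \<alpha>)"
proof (rule integral_norm_le_const[OF sub(2) _ K])
  have "continuous_on {\<alpha>..\<beta>} f" using cont0 sub by (auto intro: continuous_on_subset)
  then show "(\<lambda>x. esum1 Q (j * f x - h * x)) integrable_on {\<alpha>..\<beta>}"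
    by (intro integrable_continuous_real continuous_intros)
qed

lemma integral_split:
  assumes "\<alpha> \<le> \<gamma>" "\<gamma> \<le> \<beta>" "{\<alpha>..\<beta>} \<subseteq> {A..B}"
  shows "norm (integral {\<alpha>..\<beta>} (\<lambda>x. esum1 Q (j * f x - h * x))) \<le>
     norm (integral {\<alpha>..\<gamma>} (\<lambda>x. esum1 Q (j * f x - h * x))) + norm (integral {\<gamma>..\<beta>} (\<lambda>x. esum1 Q (j * f x - h * x)))"
proof -
  have "continuous_on {\<alpha>..\<beta>} f" using cont0 assms by (auto intro: continuous_on_subset)
  then have "(\<lambda>x. esum1 Q (j * f x - h * x)) integrable_on {\<alpha>..\<beta>}"
    by (intro integrable_continuous_real continuous_intros)
  from Henstock_Kurzweil_Integration.integral_combine[OF assms(1,2) this] show ?thesis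
    by (metis norm_triangle_ineq)
qed

text \<open>The contribution of an endpoint, where \<open>m\<close> is the derivative of the phase
  there. Below sqrt(j / Q) the endpoint behaves like a stationary point and the contribution stops
  growing.\<close>

definition edge :: "nat \<Rightarrow> real \<Rightarrow> real \<Rightarrow> real" where
  "edge Q j m = real Q / max \<bar>m\<bar> (sqrt (j / real Q))"

lemma edge_nonneg: "0 \<le> edge Q j m" by (simp add: edge_def le_max_iff_disj)

lemma edge_le:
  assumes "Q > 0" "j > 0" "k > 0" "k \<le> 1" "k * sqrt (j / real Q) \<le> \<bar>m\<bar>"
  shows "real Q / \<bar>m\<bar> \<le> edge Q j m / k"
proof -
  have s: "sqrt (j / real Q) > 0" using assms by simp
  have "0 < k * sqrt (j / real Q)" using assms(3) s by (rule mult_pos_pos)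
  then have m: "\<bar>m\<bar> > 0" using assms(5) by linarith
  have "k * max \<bar>m\<bar> (sqrt (j / real Q)) \<le> \<bar>m\<bar>"
    using assms mult_right_mono[of k 1 "\<bar>m\<bar>"] by (auto simp: max_def)
  then have "real Q / \<bar>m\<bar> \<le> real Q / (k * max \<bar>m\<bar> (sqrt (j / real Q)))"
    using assms(3) s m by (intro divide_left_mono mult_pos_pos) (simp_all add: less_max_iff_disj)
  then show ?thesis by (simp add: edge_def mult.commute)
qed

lemma exterior_bound:
  assumes j: "j > 0" and Q: "Q > 0" and ext: "h \<le> j * f' A \<or> j * f' B \<le> h"
  shows "norm (integral {A..B} (\<lambda>x. esum1 Q (j * f x - h * x))) \<le>
     (2 + 4 / c) * (edge Q j (j * f' A - h) + edge Q j (j * f' B - h))"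
proof -
  define d where "d x = j * f' x - h" for x
  define r where "r = sqrt (j / real Q)"
  have r: "r > 0" "r * r = j / real Q" using j Q by (simp_all add: r_def)
  \<comment> \<open>The length \<open>s\<close> balances two bounds: on a piece of this length the
    trivial estimate gives 2 Q^2 s = 2 Q / r, and past it the derivative of the phase has grown to
    at least c r, because j s = r.\<close>
  define s where "s = 1 / (real Q * r)"
  have s: "s > 0" "j * s = r" using r Q j by (simp_all add: s_def field_simps)
  have dm: "d x + c * j * (y - x) \<le> d y" if "x \<le> y" for x y
    using mult_left_mono[OF curv_mono[OF cv that], of j] j by (simp add: d_def algebra_simps)
  have near: "norm (integral {\<alpha>..\<beta>} (\<lambda>x. esum1 Q (j * f x - h * x))) \<le> 2 * real Q / r"
    if "{\<alpha>..\<beta>} \<subseteq> {A..B}" "\<alpha> \<le> \<beta>" "\<beta> \<le> \<alpha> + s" for \<alpha> \<beta>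
  proof -
    have "norm (integral {\<alpha>..\<beta>} (\<lambda>x. esum1 Q (j * f x - h * x))) \<le> (2 * real Q * real Q) * (\<beta> - \<alpha>)"
      using norm_esum1_le[OF Q] resonance_le[OF Q]
      by (intro central_bound that) (meson mult_left_mono order_trans of_nat_0_le_iff mult_nonneg_nonneg zero_le_numeral)
    also have "\<dots> \<le> (2 * real Q * real Q) * s" using that by (intro mult_left_mono) auto
    also have "\<dots> = 2 * real Q / r" using Q r by (simp add: s_def)
    finally show ?thesis .
  qed
  have far: "norm (integral {\<alpha>..\<beta>} (\<lambda>x. esum1 Q (j * f x - h * x))) \<le> 4 / c * (real Q / r)"
    if "{\<alpha>..\<beta>} \<subseteq> {A..B}" "\<alpha> \<le> \<beta>" "c * r \<le> d \<alpha> \<or> d \<beta> \<le> - (c * r)" for \<alpha> \<beta>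
  proof -
    have cr: "c * r > 0" using c r by simp
    have "0 \<le> c * j * (\<beta> - \<alpha>)" using c j that(2) by (intro mult_nonneg_nonneg) auto
    then have m: "d \<alpha> \<le> d \<beta>" using dm[OF that(2)] by linarith
    have b: "c * r \<le> \<bar>d \<alpha>\<bar>" "c * r \<le> \<bar>d \<beta>\<bar>" using that(3) m by linarith+
    have "norm (integral {\<alpha>..\<beta>} (\<lambda>x. esum1 Q (j * f x - h * x))) \<le> 2 * real Q * (1 / \<bar>d \<alpha>\<bar> + 1 / \<bar>d \<beta>\<bar>)"
      unfolding d_def using that cr by (intro crude_bound j) (auto simp: d_def)
    also have "\<dots> \<le> 2 * real Q * (1 / (c * r) + 1 / (c * r))"
      using b cr by (intro mult_left_mono add_mono divide_left_mono) auto
    also have "\<dots> = 4 / c * (real Q / r)" by simp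
    finally show ?thesis .
  qed
  have kk: "(2 + 4 / c) * (real Q / r) = 2 * real Q / r + 4 / c * (real Q / r)"
    by (simp add: distrib_right add_divide_distrib)
  have main: "norm (integral {A..B} (\<lambda>x. esum1 Q (j * f x - h * x))) \<le> (2 + 4 / c) * (real Q / r)"
  proof (cases "B \<le> A + s")
    case True
    have "norm (integral {A..B} (\<lambda>x. esum1 Q (j * f x - h * x))) \<le> 2 * real Q / r" using True AB by (intro near) auto
    also have "2 * real Q / r = 2 * (real Q / r)" by simp
    also have "\<dots> \<le> (2 + 4 / c) * (real Q / r)" using c r by (intro mult_right_mono) auto
    finally show ?thesis .
  next
    case False
    from ext show ?thesis
    proof
      assume "h \<le> j * f' A"
      then have "c * r \<le> d (A + s)" using dm[of A "A + s"] s by (simp add: d_def mult.assoc)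
      then have "norm (integral {A + s..B} (\<lambda>x. esum1 Q (j * f x - h * x))) \<le> 4 / c * (real Q / r)"
        using False s by (intro far) auto
      moreover have "norm (integral {A..A + s} (\<lambda>x. esum1 Q (j * f x - h * x))) \<le> 2 * real Q / r"
        using False s by (intro near) auto
      moreover have "norm (integral {A..B} (\<lambda>x. esum1 Q (j * f x - h * x))) \<le>
         norm (integral {A..A + s} (\<lambda>x. esum1 Q (j * f x - h * x))) + norm (integral {A + s..B} (\<lambda>x. esum1 Q (j * f x - h * x)))"
        using False s by (intro integral_split) auto
      ultimately show ?thesis unfolding kk by linarith
    next
      assume "j * f' B \<le> h"
      then have "d (B - s) \<le> - (c * r)" using dm[of "B - s" B] s by (simp add: d_def mult.assoc)
      then have "norm (integral {A..B - s} (\<lambda>x. esum1 Q (j * f x - h * x))) \<le> 4 / c * (real Q / r)"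
        using False s by (intro far) auto
      moreover have "norm (integral {B - s..B} (\<lambda>x. esum1 Q (j * f x - h * x))) \<le> 2 * real Q / r"
        using False s by (intro near) auto
      moreover have "norm (integral {A..B} (\<lambda>x. esum1 Q (j * f x - h * x))) \<le>
         norm (integral {A..B - s} (\<lambda>x. esum1 Q (j * f x - h * x))) + norm (integral {B - s..B} (\<lambda>x. esum1 Q (j * f x - h * x)))"
        using False s by (intro integral_split) auto
      ultimately show ?thesis unfolding kk by linarith
    qed
  qed
  have k1: "1 \<le> 2 + 4 / c" using c by simp
  \<comment> \<open>If the derivative of the phase is at least \<open>r\<close> in size at both
    ends, the bound by endpoint values applies directly. Otherwise one of the two
    \<open>edge\<close> terms equals Q / r, and \<open>main\<close> suffices.\<close>
  show ?thesis
  proof (cases "r \<le> \<bar>d A\<bar> \<and> r \<le> \<bar>d B\<bar>")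
    case True
    have "0 \<le> c * j * (B - A)" using c j AB by (intro mult_nonneg_nonneg) auto
    then have "d A \<le> d B" using dm[of A B] AB by linarith
    then have "norm (integral {A..B} (\<lambda>x. esum1 Q (j * f x - h * x))) \<le> 2 * real Q * (1 / \<bar>d A\<bar> + 1 / \<bar>d B\<bar>)"
      unfolding d_def using True ext r AB by (intro crude_bound j) (auto simp: d_def)
    also have "\<dots> = 2 * (edge Q j (d A) + edge Q j (d B))"
      using True by (simp add: edge_def r_def max_absorb1 distrib_left)
    also have "\<dots> \<le> (2 + 4 / c) * (edge Q j (d A) + edge Q j (d B))"
      using edge_nonneg c by (intro mult_right_mono add_nonneg_nonneg) auto
    finally show ?thesis by (simp add: d_def)
  next
    case False
    then have "real Q / r \<le> edge Q j (d A) + edge Q j (d B)"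
      using edge_nonneg[of Q j "d A"] edge_nonneg[of Q j "d B"]
      by (auto simp: edge_def r_def[symmetric] max_absorb2)
    then have "(2 + 4 / c) * (real Q / r) \<le> (2 + 4 / c) * (edge Q j (d A) + edge Q j (d B))"
      using k1 by (intro mult_left_mono) auto
    then show ?thesis using main by (simp add: d_def)
  qed
qed

text \<open>Density of the tail in the variable \<tau> = f x - f x0 - f' x0 (x - x0). Since \<tau>
  is comparable to (f' x - f' x0)^2, the kernel f'' dx / (f' x - f' x0)^2 is bounded by a multiple
  of \<tau>^(-3/2) d\<tau>. The phase moves by j \<tau>, which amounts to a vertical translation by
  \<tau>.\<close>

definition tail_weight :: "nat \<Rightarrow> real \<Rightarrow> real \<Rightarrow> real \<Rightarrow> real" where
  "tail_weight Q j \<phi> \<tau> = \<tau> powr (- (3 / 2)) * norm (esum Q (\<phi> + j * \<tau>))"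

lemma tail_weight_nonneg: "0 \<le> tail_weight Q j \<phi> \<tau>" by (simp add: tail_weight_def)

lemma continuous_on_tail_weight: "0 < u \<Longrightarrow> continuous_on {u..v} (tail_weight Q j \<phi>)"
  unfolding tail_weight_def[abs_def] by (intro continuous_intros) auto

text \<open>The limits enclose the values of \<tau> on the arc outside the central interval. They
  depend on \<open>j\<close> but not on the stationary point, so that sums over h can be taken
  inside the integral.\<close>

definition tail_integral :: "nat \<Rightarrow> real \<Rightarrow> real \<Rightarrow> real" where
  "tail_integral Q j \<phi> = integral {c\<^sup>2 / (2 * j * real Q)..(B - A)\<^sup>2 / (2 * c)} (tail_weight Q j \<phi>)"

lemma side_bound:
  assumes sub: "{\<alpha>..\<beta>} \<subseteq> {A..B}" "\<alpha> \<le> \<beta>" and j: "j > 0" and Q: "Q > 0" and x0: "x0 \<in> {A..B}" "h = j * f' x0"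
    and side: "(\<forall>x\<in>{\<alpha>..\<beta>}. x0 \<le> x) \<or> (\<forall>x\<in>{\<alpha>..\<beta>}. x \<le> x0)"
    and dist: "\<And>x. x \<in> {\<alpha>..\<beta>} \<Longrightarrow> sqrt (c / (j * real Q)) \<le> \<bar>x - x0\<bar>"
  shows "norm (integral {\<alpha>..\<beta>} (\<lambda>x. esum1 Q (j * f x - h * x))) \<le>
     norm (esum Q (j * f \<alpha> - h * \<alpha>)) / \<bar>j * f' \<alpha> - h\<bar> + norm (esum Q (j * f \<beta> - h * \<beta>)) / \<bar>j * f' \<beta> - h\<bar> +
     1 / (c ^ 7 * j) * tail_integral Q j (j * f x0 - h * x0)"
proof -
  define \<phi> where "\<phi> = j * f x0 - h * x0"
  define P where "P x = f x - f x0 - f' x0 * (x - x0)" for x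
  define P' where "P' x = f' x - f' x0" for x
  define W where "W = tail_weight Q j \<phi>"
  define t0 where "t0 = c\<^sup>2 / (2 * j * real Q)"
  define t1 where "t1 = (B - A)\<^sup>2 / (2 * c)"
  have t0: "t0 > 0" using c j Q by (simp add: t0_def)
  have c0: "continuous_on {\<alpha>..\<beta>} f" "continuous_on {\<alpha>..\<beta>} f'" "continuous_on {\<alpha>..\<beta>} f''"
    using cont0 cont1 cont2 sub by (auto intro: continuous_on_subset)
  have s0: "0 < sqrt (c / (j * real Q))" using c j Q by simp
  have P_lower: "c / 2 * (x - x0)\<^sup>2 \<le> P x" and P_upper: "P x \<le> (x - x0)\<^sup>2 / (2 * c)" for x
    using curv_lower[OF cv, of x0 x] curv_upper[OF cv, of x x0] by (simp_all add: P_def)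
  have P'_abs: "c * \<bar>x - x0\<bar> \<le> \<bar>P' x\<bar>" for x
    using curv_mono[OF cv, of x0 x] curv_mono[OF cv, of x x0] by (cases "x0 \<le> x") (auto simp: P'_def abs_real_def)
  have P'_pos: "0 < \<bar>P' x\<bar>" if "x \<in> {\<alpha>..\<beta>}" for x
  proof -
    have "0 < c * \<bar>x - x0\<bar>" using dist[OF that] s0 c by (intro mult_pos_pos) linarith+
    then show ?thesis using P'_abs[of x] by linarith
  qed
  have Pt: "t0 \<le> P x" "P x \<le> t1" if x: "x \<in> {\<alpha>..\<beta>}" for x
  proof -
    have "(sqrt (c / (j * real Q)))\<^sup>2 \<le> \<bar>x - x0\<bar>\<^sup>2" using dist[OF x] s0 by (intro power_mono) auto
    then have "c / 2 * (c / (j * real Q)) \<le> c / 2 * (x - x0)\<^sup>2" using c j Q by (intro mult_left_mono) auto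
    then show "t0 \<le> P x" using P_lower[of x] by (simp add: t0_def power2_eq_square)
    have "\<bar>x - x0\<bar> \<le> B - A" using x sub x0 by (auto simp: abs_le_iff)
    then have "\<bar>x - x0\<bar>\<^sup>2 \<le> (B - A)\<^sup>2" by (intro power_mono) auto
    then have "(x - x0)\<^sup>2 / (2 * c) \<le> t1" unfolding t1_def using c by (intro divide_right_mono) auto
    then show "P x \<le> t1" using P_upper[of x] by linarith
  qed
  have phase: "j * f x - h * x = \<phi> + j * P x" for x
    by (simp add: \<phi>_def P_def x0(2) algebra_simps)
  have dP: "j * f' x - h = j * P' x" for x by (simp add: P'_def x0(2) algebra_simps)
  have contP: "continuous_on {\<alpha>..\<beta>} P" "continuous_on {\<alpha>..\<beta>} P'"
    unfolding P_def P'_def by (intro continuous_intros c0)+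
  have contW: "continuous_on {t0..t1} W" unfolding W_def by (rule continuous_on_tail_weight[OF t0])
  have contWP: "continuous_on {\<alpha>..\<beta>} (\<lambda>x. W (P x))"
    using Pt by (intro continuous_on_compose2[OF contW contP(1)]) auto
  have pointwise: "norm (esum Q (j * f x - h * x)) * (j * f'' x / (j * f' x - h)\<^sup>2) \<le> 1 / (c ^ 7 * j) * (\<bar>P' x\<bar> * W (P x))"
    if x: "x \<in> {\<alpha>..\<beta>}" for x
  proof -
    have Pp: "P x > 0" using Pt(1)[OF x] t0 by linarith
    define p where "p = \<bar>P' x\<bar>"
    have p: "p > 0" using P'_pos[OF x] by (simp add: p_def)
    have "\<bar>x - x0\<bar> \<le> p / c" using P'_abs[of x] c by (simp add: p_def pos_le_divide_eq mult.commute)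
    then have "\<bar>x - x0\<bar>\<^sup>2 \<le> (p / c)\<^sup>2" by (intro power_mono) auto
    then have "(x - x0)\<^sup>2 / (2 * c) \<le> (p / c)\<^sup>2 / (2 * c)" using c by (intro divide_right_mono) auto
    also have "\<dots> \<le> (p / c)\<^sup>2 / c" using c by (intro divide_left_mono) auto
    also have "\<dots> \<le> (p / c)\<^sup>2 / c\<^sup>2"
      using c power_decreasing[of 1 2 c] by (intro divide_left_mono) auto
    also have "\<dots> = (p / c\<^sup>2)\<^sup>2" by (simp add: power_divide)
    \<comment> \<open>Raised to the power 3/2 this yields the \<open>c ^ 6\<close> below; the bound
      1/c for \<open>f''\<close> completes it to \<open>c ^ 7\<close>.\<close>
    finally have "P x \<le> (p / c\<^sup>2)\<^sup>2" using P_upper[of x] by linarith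
    then have "P x powr (3 / 2) \<le> ((p / c\<^sup>2)\<^sup>2) powr (3 / 2)" using Pp by (intro powr_mono2) auto
    also have "\<dots> = (p / c\<^sup>2) powr (2 * (3 / 2))"
    proof -
      have "(p / c\<^sup>2)\<^sup>2 = (p / c\<^sup>2) powr 2" using p c by (simp add: powr_numeral)
      then show ?thesis by (simp only: powr_powr)
    qed
    also have "\<dots> = (p / c\<^sup>2) ^ 3" using p c by (simp add: powr_numeral)
    also have "\<dots> = p ^ 3 / c ^ 6" by (simp add: power_divide flip: power_mult)
    finally have "P x powr (3 / 2) \<le> p ^ 3 / c ^ 6" .
    then have "c ^ 6 * P x powr (3 / 2) \<le> p ^ 3" using c by (simp add: pos_le_divide_eq mult.commute)
    then have inv: "1 / p ^ 3 \<le> 1 / (c ^ 6 * P x powr (3 / 2))"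
      using Pp c p by (intro divide_left_mono) auto
    have "j * f'' x / (j * f' x - h)\<^sup>2 = f'' x / j * (p * (1 / p ^ 3))"
    proof -
      have "(j * P' x)\<^sup>2 = j * j * (p * p)" by (simp add: p_def power2_eq_square)
      then show ?thesis using j p by (simp add: dP power3_eq_cube)
    qed
    also have "\<dots> \<le> (1 / c) / j * (p * (1 / (c ^ 6 * P x powr (3 / 2))))"
      using bound2[of x] x sub c j p inv by (intro mult_mono divide_right_mono mult_left_mono) auto
    also have "\<dots> = 1 / (c ^ 7 * j) * (p * P x powr (- (3 / 2)))"
      using c by (simp add: powr_minus_divide power_numeral_reduce)
    finally have "norm (esum Q (\<phi> + j * P x)) * (j * f'' x / (j * f' x - h)\<^sup>2) \<le>
       norm (esum Q (\<phi> + j * P x)) * (1 / (c ^ 7 * j) * (p * P x powr (- (3 / 2))))"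
      by (intro mult_left_mono) auto
    then show ?thesis by (simp add: phase W_def tail_weight_def p_def mult_ac)
  qed
  \<comment> \<open>On one side of \<open>x0\<close> the slope difference \<open>P'\<close> keeps
    its sign, so the substitution \<tau> = P x is monotone and traverses the range of \<tau>
    once.\<close>
  obtain \<sigma> :: real where \<sigma>: "\<bar>\<sigma>\<bar> = 1" "\<And>x. x \<in> {\<alpha>..\<beta>} \<Longrightarrow> \<bar>P' x\<bar> = \<sigma> * P' x"
    using side
  proof
    assume s: "\<forall>x\<in>{\<alpha>..\<beta>}. x0 \<le> x"
    show ?thesis by (rule that[of 1]) (use s f'_mono in \<open>auto simp: P'_def\<close>)
  next
    assume s: "\<forall>x\<in>{\<alpha>..\<beta>}. x \<le> x0"
    show ?thesis by (rule that[of "-1"]) (use s f'_mono in \<open>auto simp: P'_def\<close>)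
  qed
  have subW: "0 \<le> integral {u..v} W \<and> integral {u..v} W \<le> integral {t0..t1} W" if "t0 \<le> u" "v \<le> t1" for u v
  proof -
    have i: "W integrable_on {t0..t1}" by (rule integrable_continuous_real[OF contW])
    have i': "W integrable_on {u..v}"
      using that by (intro integrable_continuous_real continuous_on_subset[OF contW]) auto
    show ?thesis using that i i' by (auto intro!: integral_nonneg integral_subset_le simp: W_def tail_weight_nonneg)
  qed
  \<comment> \<open>The general substitution rule yields a difference of two integrals with opposite
    limits, at most one of which is over a nondegenerate interval.\<close>
  have dif: "((\<lambda>x. P' x *\<^sub>R W (P x)) has_integral (integral {P \<alpha>..P \<beta>} W - integral {P \<beta>..P \<alpha>} W)) {\<alpha>..\<beta>}"
  proof (rule has_integral_substitution_general[of "{}" \<alpha> \<beta> P t0 t1 W P'])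
    show "P ` {\<alpha>..\<beta>} \<subseteq> {t0..t1}" using Pt by auto
    fix x assume x: "x \<in> {\<alpha>..\<beta>} - {}"
    have f: "(f has_real_derivative f' x) (at x within {\<alpha>..\<beta>})"
      using DERIV_subset[OF deriv1 sub(1)] sub x by auto
    show "(P has_real_derivative P' x) (at x within {\<alpha>..\<beta>})"
      unfolding P_def P'_def by (auto intro!: derivative_eq_intros f)
  qed (use sub contW contP in auto)
  have "integral {\<alpha>..\<beta>} (\<lambda>x. \<bar>P' x\<bar> * W (P x)) = integral {\<alpha>..\<beta>} (\<lambda>x. \<sigma> * (P' x *\<^sub>R W (P x)))"
    by (intro integral_cong) (simp add: \<sigma>)
  also have "\<dots> = \<sigma> * (integral {P \<alpha>..P \<beta>} W - integral {P \<beta>..P \<alpha>} W)"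
    by (intro integral_unique has_integral_mult_right dif)
  also have "\<dots> \<le> \<bar>\<sigma>\<bar> * \<bar>integral {P \<alpha>..P \<beta>} W - integral {P \<beta>..P \<alpha>} W\<bar>" by (metis abs_ge_self abs_mult)
  also have "\<dots> \<le> integral {t0..t1} W"
  proof -
    have "P \<alpha> \<in> {t0..t1}" "P \<beta> \<in> {t0..t1}" using Pt sub by auto
    then have "\<bar>integral {P \<alpha>..P \<beta>} W - integral {P \<beta>..P \<alpha>} W\<bar> \<le> integral {t0..t1} W"
      using subW[of "P \<alpha>" "P \<beta>"] subW[of "P \<beta>" "P \<alpha>"] by auto
    then show ?thesis using \<sigma>(1) by simp
  qed
  finally have I1: "integral {\<alpha>..\<beta>} (\<lambda>x. \<bar>P' x\<bar> * W (P x)) \<le> integral {t0..t1} W" .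
  have nz: "j * f' x - h \<noteq> 0" if "x \<in> {\<alpha>..\<beta>}" for x using P'_pos[OF that] j by (simp add: dP)
  have "integral {\<alpha>..\<beta>} (\<lambda>x. norm (esum Q (j * f x - h * x)) * (j * f'' x / (j * f' x - h)\<^sup>2)) \<le>
     integral {\<alpha>..\<beta>} (\<lambda>x. 1 / (c ^ 7 * j) * (\<bar>P' x\<bar> * W (P x)))"
    using pointwise nz by (intro integral_le integrable_continuous_real continuous_intros c0 contP contWP) auto
  also have "\<dots> = 1 / (c ^ 7 * j) * integral {\<alpha>..\<beta>} (\<lambda>x. \<bar>P' x\<bar> * W (P x))" by (rule integral_mult_right)
  also have "\<dots> \<le> 1 / (c ^ 7 * j) * integral {t0..t1} W" using I1 c j by (intro mult_left_mono) auto
  finally have "integral {\<alpha>..\<beta>} (\<lambda>x. norm (esum Q (j * f x - h * x)) * (j * f'' x / (j * f' x - h)\<^sup>2)) \<le>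
     1 / (c ^ 7 * j) * tail_integral Q j \<phi>" by (simp add: tail_integral_def t0_def t1_def W_def)
  then show ?thesis using integration_by_parts[OF sub nz j, of Q] unfolding \<phi>_def by simp
qed

lemma interior_bound:
  assumes j: "j > 0" and Q: "Q > 0" and x0: "x0 \<in> {A..B}" "h = j * f' x0"
  shows "norm (integral {A..B} (\<lambda>x. esum1 Q (j * f x - h * x))) \<le>
     (8 + 4 / c\<^sup>2) * (sqrt (real Q / j) * resonance Q (j * f x0 - h * x0)) +
     2 / (c ^ 7 * j) * tail_integral Q j (j * f x0 - h * x0) +
     1 / c\<^sup>2 * (edge Q j (j * f' A - h) + edge Q j (j * f' B - h))"
proof -
  define \<phi> where "\<phi> = j * f x0 - h * x0"
  define K where "K = resonance Q \<phi>"
  have K: "K > 0" unfolding K_def by (rule resonance_pos[OF Q])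
  define r where "r = sqrt (j / real Q)"
  have r: "r > 0" "r * r = j / real Q" using j Q by (simp_all add: r_def)
  have r_inv: "sqrt (real Q / j) = 1 / r" by (simp add: r_def real_sqrt_divide)
  \<comment> \<open>Within distance \<open>s\<close> of \<open>x0\<close> the phase changes by at
    most 1/(2 Q), so the resonance there is comparable to the one at \<open>x0\<close>. Beyond
    \<open>s\<close> the tails are left to \<open>side_bound\<close>.\<close>
  define s where "s = sqrt (c / (j * real Q))"
  have s: "s > 0" using c j Q by (simp add: s_def)
  have s2: "s\<^sup>2 = c / (j * real Q)" using c j Q by (simp add: s_def)
  have jsr: "j * s = sqrt c * r"
  proof -
    have "(j * s)\<^sup>2 = j * j * (c / (j * real Q))" unfolding power_mult_distrib s2 by (simp add: power2_eq_square)
    also have "\<dots> = c * (r * r)" using j unfolding r(2) by simp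
    also have "\<dots> = (sqrt c * r)\<^sup>2" using c by (simp add: power_mult_distrib power2_eq_square)
    finally have "(j * s)\<^sup>2 = (sqrt c * r)\<^sup>2" .
    then show ?thesis using j s c r by (intro power2_eq_imp_eq[of "j * s"]) auto
  qed
  have sc: "c \<le> sqrt c" "sqrt c \<le> 1" using c by (auto intro: real_le_rsqrt simp: power2_eq_square mult_left_le)
  have sQ: "real Q * s \<le> 1 / r"
  proof -
    have "real Q * s * (r * r) = sqrt c * r" using jsr Q by (simp add: r(2) mult_ac)
    then have "real Q * s * r = sqrt c" using r(1) by simp
    then show ?thesis using sc r by (simp add: pos_le_divide_eq)
  qed
  have ker: "resonance Q (j * f x - h * x) \<le> 2 * K" if "\<bar>x - x0\<bar> \<le> s" for x
  proof -
    define P where "P = f x - f x0 - f' x0 * (x - x0)"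
    have "0 \<le> c / 2 * (x - x0)\<^sup>2" using c by simp
    then have P0: "0 \<le> P" using curv_lower[OF cv, of x0 x] by (simp add: P_def)
    have "P \<le> (x - x0)\<^sup>2 / (2 * c)" using curv_upper[OF cv, of x x0] by (simp add: P_def)
    also have "\<dots> \<le> s\<^sup>2 / (2 * c)" using power_mono[OF that, of 2] c by (intro divide_right_mono) auto
    also have "\<dots> = 1 / (2 * j * real Q)" using c by (simp add: s2)
    finally have "j * P \<le> j * (1 / (2 * j * real Q))" using j by (intro mult_left_mono) auto
    also have "\<dots> \<le> 1 / real Q" using j Q by (simp add: field_simps)
    finally have "\<bar>j * P\<bar> \<le> 1 / real Q" using P0 j by simp
    moreover have "j * f x - h * x = \<phi> + j * P" by (simp add: \<phi>_def P_def x0(2) algebra_simps)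
    ultimately show ?thesis using resonance_shift[OF Q, of "j * P" \<phi>] by (simp add: K_def)
  qed
  define T where "T = tail_integral Q j \<phi>"
  define a where "a = max A (x0 - s)"
  define b where "b = min B (x0 + s)"
  have ab: "A \<le> a" "a \<le> x0" "x0 \<le> b" "b \<le> B" "b - a \<le> 2 * s" using x0 s by (auto simp: a_def b_def)
  have T0: "0 \<le> T"
    unfolding T_def tail_integral_def using c j Q
    by (intro integral_nonneg integrable_continuous_real continuous_on_tail_weight tail_weight_nonneg) auto
  have centre: "norm (integral {a..b} (\<lambda>x. esum1 Q (j * f x - h * x))) \<le> 8 * (K / r)"
  proof -
    have "norm (integral {a..b} (\<lambda>x. esum1 Q (j * f x - h * x))) \<le> (4 * real Q * K) * (b - a)"
    proof (rule central_bound)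
      fix x assume x: "x \<in> {a..b}"
      then have "\<bar>x - x0\<bar> \<le> s" by (auto simp: a_def b_def)
      from ker[OF this] have "2 * real Q * resonance Q (j * f x - h * x) \<le> 2 * real Q * (2 * K)" by (intro mult_left_mono) auto
      then show "norm (esum1 Q (j * f x - h * x)) \<le> 4 * real Q * K"
        using norm_esum1_le[OF Q, of "j * f x - h * x"] by linarith
    qed (use ab in auto)
    also have "\<dots> \<le> (4 * real Q * K) * (2 * s)" using ab K by (intro mult_left_mono) auto
    also have "\<dots> = 8 * K * (real Q * s)" by simp
    also have "\<dots> \<le> 8 * K * (1 / r)" using sQ K by (intro mult_left_mono) auto
    finally show ?thesis by simp
  qed
  have d_lower: "c * r * c \<le> \<bar>j * f' x - h\<bar>" if "s \<le> \<bar>x - x0\<bar>" for x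
  proof -
    have "c * \<bar>x - x0\<bar> \<le> \<bar>f' x - f' x0\<bar>"
      using curv_mono[OF cv, of x0 x] curv_mono[OF cv, of x x0] by (cases "x0 \<le> x") (auto simp: abs_real_def)
    moreover have "c * s \<le> c * \<bar>x - x0\<bar>" using that c by (intro mult_left_mono) auto
    ultimately have "j * (c * s) \<le> j * \<bar>f' x - f' x0\<bar>" using j by (intro mult_left_mono) auto
    moreover have "j * (c * s) = c * (sqrt c * r)" using jsr by simp
    moreover have "c * (c * r) \<le> c * (sqrt c * r)" using sc c r by (intro mult_left_mono mult_right_mono) auto
    moreover have "j * \<bar>f' x - f' x0\<bar> = \<bar>j * f' x - h\<bar>" using j by (simp add: x0(2) abs_mult flip: right_diff_distrib)
    ultimately have "c * (c * r) \<le> \<bar>j * f' x - h\<bar>" by linarith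
    then show ?thesis by (simp add: mult_ac)
  qed
  have bdy: "norm (esum Q (j * f x - h * x)) / \<bar>j * f' x - h\<bar> \<le> 2 / c\<^sup>2 * (K / r)" if "\<bar>x - x0\<bar> = s" for x
  proof -
    have "norm (esum Q (j * f x - h * x)) \<le> 2 * K"
      using norm_esum_le[OF order_refl Q, of "j * f x - h * x"] ker[of x] that by simp
    moreover have "c * r * c \<le> \<bar>j * f' x - h\<bar>" using that by (intro d_lower) simp
    ultimately have "norm (esum Q (j * f x - h * x)) / \<bar>j * f' x - h\<bar> \<le> 2 * K / (c * r * c)"
      using c r K by (intro frac_le) auto
    then show ?thesis by (simp add: power2_eq_square mult_ac)
  qed
  \<comment> \<open>At the ends of the arc no information about the resonance is available, so
    \<open>esum\<close> is estimated by Q. The result is charged to \<open>edge\<close>, whose sum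
    over h is harmonic.\<close>
  have bdy_edge: "norm (esum Q (j * f x - h * x)) / \<bar>j * f' x - h\<bar> \<le> 1 / c\<^sup>2 * edge Q j (j * f' x - h)" if "s \<le> \<bar>x - x0\<bar>" for x
  proof -
    have "norm (esum Q (j * f x - h * x)) / \<bar>j * f' x - h\<bar> \<le> real Q / \<bar>j * f' x - h\<bar>"
      by (intro divide_right_mono norm_esum_le_nat) auto
    also have "\<dots> \<le> edge Q j (j * f' x - h) / c\<^sup>2"
      using d_lower[OF that] c by (intro edge_le Q j) (auto simp: r_def[symmetric] power2_eq_square mult_ac power_le_one mult_le_one)
    finally show ?thesis by simp
  qed
  have right: "norm (integral {b..B} (\<lambda>x. esum1 Q (j * f x - h * x))) \<le>
     2 / c\<^sup>2 * (K / r) + 1 / c\<^sup>2 * edge Q j (j * f' B - h) + 1 / (c ^ 7 * j) * T"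
  proof (cases "b = B")
    case True
    have "0 \<le> 2 / c\<^sup>2 * (K / r)" "0 \<le> 1 / c\<^sup>2 * edge Q j (j * f' B - h)" "0 \<le> 1 / (c ^ 7 * j) * T"
      using K r c j T0 edge_nonneg by simp_all
    then show ?thesis using True by simp
  next
    case False
    then have b: "b = x0 + s" "b \<le> B" by (auto simp: b_def)
    have "norm (integral {b..B} (\<lambda>x. esum1 Q (j * f x - h * x))) \<le>
      norm (esum Q (j * f b - h * b)) / \<bar>j * f' b - h\<bar> + norm (esum Q (j * f B - h * B)) / \<bar>j * f' B - h\<bar> + 1 / (c ^ 7 * j) * T"
      unfolding T_def \<phi>_def using b ab s by (intro side_bound j Q x0) (auto simp: s_def[symmetric])
    also have "norm (esum Q (j * f b - h * b)) / \<bar>j * f' b - h\<bar> \<le> 2 / c\<^sup>2 * (K / r)" using b s by (intro bdy) auto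
    also have "norm (esum Q (j * f B - h * B)) / \<bar>j * f' B - h\<bar> \<le> 1 / c\<^sup>2 * edge Q j (j * f' B - h)"
      using b by (intro bdy_edge) auto
    finally show ?thesis by simp
  qed
  have left: "norm (integral {A..a} (\<lambda>x. esum1 Q (j * f x - h * x))) \<le>
     2 / c\<^sup>2 * (K / r) + 1 / c\<^sup>2 * edge Q j (j * f' A - h) + 1 / (c ^ 7 * j) * T"
  proof (cases "a = A")
    case True
    have "0 \<le> 2 / c\<^sup>2 * (K / r)" "0 \<le> 1 / c\<^sup>2 * edge Q j (j * f' A - h)" "0 \<le> 1 / (c ^ 7 * j) * T"
      using K r c j T0 edge_nonneg by simp_all
    then show ?thesis using True by simp
  next
    case False
    then have a: "a = x0 - s" "A \<le> a" by (auto simp: a_def)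
    have "norm (integral {A..a} (\<lambda>x. esum1 Q (j * f x - h * x))) \<le>
      norm (esum Q (j * f A - h * A)) / \<bar>j * f' A - h\<bar> + norm (esum Q (j * f a - h * a)) / \<bar>j * f' a - h\<bar> + 1 / (c ^ 7 * j) * T"
      unfolding T_def \<phi>_def using a ab s by (intro side_bound j Q x0) (auto simp: s_def[symmetric])
    also have "norm (esum Q (j * f a - h * a)) / \<bar>j * f' a - h\<bar> \<le> 2 / c\<^sup>2 * (K / r)" using a s by (intro bdy) auto
    also have "norm (esum Q (j * f A - h * A)) / \<bar>j * f' A - h\<bar> \<le> 1 / c\<^sup>2 * edge Q j (j * f' A - h)"
      using a by (intro bdy_edge) auto
    finally show ?thesis by simp
  qed
  have "norm (integral {A..B} (\<lambda>x. esum1 Q (j * f x - h * x))) \<le>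
     norm (integral {A..a} (\<lambda>x. esum1 Q (j * f x - h * x))) + norm (integral {a..B} (\<lambda>x. esum1 Q (j * f x - h * x)))"
    using ab by (intro integral_split) auto
  also have "norm (integral {a..B} (\<lambda>x. esum1 Q (j * f x - h * x))) \<le>
     norm (integral {a..b} (\<lambda>x. esum1 Q (j * f x - h * x))) + norm (integral {b..B} (\<lambda>x. esum1 Q (j * f x - h * x)))"
    using ab by (intro integral_split) auto
  finally have "norm (integral {A..B} (\<lambda>x. esum1 Q (j * f x - h * x))) \<le>
     2 / c\<^sup>2 * (K / r) + 1 / c\<^sup>2 * edge Q j (j * f' A - h) + 1 / (c ^ 7 * j) * T +
     (8 * (K / r) + (2 / c\<^sup>2 * (K / r) + 1 / c\<^sup>2 * edge Q j (j * f' B - h) + 1 / (c ^ 7 * j) * T))"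
    using left centre right by linarith
  also have "\<dots> = (8 + 4 / c\<^sup>2) * (K / r) + 2 / (c ^ 7 * j) * T + 1 / c\<^sup>2 * (edge Q j (j * f' A - h) + edge Q j (j * f' B - h))"
  proof -
    have "(8 + 4 / c\<^sup>2) * (K / r) = 8 * (K / r) + 2 * (2 / c\<^sup>2 * (K / r))" by (simp add: distrib_right add_divide_distrib)
    moreover have "2 / (c ^ 7 * j) * T = 2 * (1 / (c ^ 7 * j) * T)" by simp
    moreover have "1 / c\<^sup>2 * (edge Q j (j * f' A - h) + edge Q j (j * f' B - h)) =
      1 / c\<^sup>2 * edge Q j (j * f' A - h) + 1 / c\<^sup>2 * edge Q j (j * f' B - h)" by (rule distrib_left)
    ultimately show ?thesis by linarith
  qed
  finally show ?thesis by (simp add: K_def T_def \<phi>_def r_inv)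
qed

end

lemma nearest_minus [simp]: "nearest (- t) = nearest t"
proof -
  have "nearest (- s) \<le> nearest s" for s
    using nearest_le[of "- s" "- round s"] by (simp add: nearest_def abs_minus_commute)
  from this[of t] this[of "- t"] show ?thesis by simp
qed

lemma resonance_minus [simp]: "resonance Q (- t) = resonance Q t"
  by (simp add: resonance_def)

text \<open>Sorted by distance from \<gamma>, at most two integers h belong to each unit range. The
  nearest two cost the truncated value Q sqrt(Q / j), the others form harmonic sums.\<close>

lemma (in curved_arc) edge_sum_bound:
  assumes j: "j > 0" and Q: "Q > 0" and H: "H > 0" and g: "0 \<le> \<gamma>" "\<gamma> \<le> real H"
  shows "(\<Sum>h\<in>{- int H..int H}. edge Q j (\<gamma> - of_int h)) \<le>
     2 * real Q * sqrt (real Q / j) + 2 * real Q * (1 + ln (2 * real H))"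
proof -
  define r where "r = sqrt (j / real Q)"
  have r: "r > 0" using j Q by (simp add: r_def)
  define e where "e i = (if i = 0 then real Q / r else real Q / real i)" for i :: nat
  have e0: "0 \<le> e i" for i using r by (simp add: e_def)
  have le: "edge Q j (\<gamma> - of_int h) \<le> e i" if "real i \<le> \<bar>\<gamma> - of_int h\<bar>" for h i
  proof (cases "i = 0")
    case True
    have "real Q / max \<bar>\<gamma> - of_int h\<bar> r \<le> real Q / r" using r by (intro divide_left_mono mult_pos_pos) auto
    then show ?thesis using True by (simp add: edge_def e_def r_def)
  next
    case False
    have "real Q / max \<bar>\<gamma> - of_int h\<bar> r \<le> real Q / real i"
      using r that False by (intro divide_left_mono mult_pos_pos) (auto simp: less_max_iff_disj)
    then show ?thesis using False by (simp add: edge_def e_def r_def)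
  qed
  define m where "m = \<lfloor>\<gamma>\<rfloor>"
  have m: "0 \<le> m" "m \<le> int H" using g unfolding m_def by linarith+
  have "(\<Sum>h\<in>{- int H..int H}. edge Q j (\<gamma> - of_int h)) =
     (\<Sum>h\<in>{- int H..m}. edge Q j (\<gamma> - of_int h)) + (\<Sum>h\<in>{m + 1..int H}. edge Q j (\<gamma> - of_int h))"
  proof -
    have "{- int H..int H} = {- int H..m} \<union> {m + 1..int H}" using m by auto
    then show ?thesis by (simp add: sum.union_disjoint)
  qed
  also have "(\<Sum>h\<in>{- int H..m}. edge Q j (\<gamma> - of_int h)) \<le> (\<Sum>i\<le>2 * H. e i)"
  proof -
    have "(\<Sum>h\<in>{- int H..m}. edge Q j (\<gamma> - of_int h)) \<le> (\<Sum>h\<in>{- int H..m}. e (nat (m - h)))"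
    proof (intro sum_mono le)
      fix h assume "h \<in> {- int H..m}"
      then have "real (nat (m - h)) = of_int m - of_int h" by simp
      moreover have "of_int m \<le> \<gamma>" by (simp add: m_def)
      ultimately show "real (nat (m - h)) \<le> \<bar>\<gamma> - of_int h\<bar>" by linarith
    qed
    also have "\<dots> = (\<Sum>i\<in>(\<lambda>h. nat (m - h)) ` {- int H..m}. e i)"
      by (subst sum.reindex) (auto simp: inj_on_def)
    also have "\<dots> \<le> (\<Sum>i\<le>2 * H. e i)" using m e0 by (intro sum_mono2) auto
    finally show ?thesis .
  qed
  also have "(\<Sum>h\<in>{m + 1..int H}. edge Q j (\<gamma> - of_int h)) \<le> (\<Sum>i\<le>2 * H. e i)"
  proof -
    have "(\<Sum>h\<in>{m + 1..int H}. edge Q j (\<gamma> - of_int h)) \<le> (\<Sum>h\<in>{m + 1..int H}. e (nat (h - m - 1)))"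
    proof (intro sum_mono le)
      fix h assume "h \<in> {m + 1..int H}"
      then have "real (nat (h - m - 1)) = of_int h - of_int m - 1" by simp
      moreover have "\<gamma> < of_int m + 1" by (simp add: m_def)
      ultimately show "real (nat (h - m - 1)) \<le> \<bar>\<gamma> - of_int h\<bar>" by linarith
    qed
    also have "\<dots> = (\<Sum>i\<in>(\<lambda>h. nat (h - m - 1)) ` {m + 1..int H}. e i)"
      by (subst sum.reindex) (auto simp: inj_on_def)
    also have "\<dots> \<le> (\<Sum>i\<le>2 * H. e i)" using m e0 by (intro sum_mono2) auto
    finally show ?thesis .
  qed
  also have "(\<Sum>i\<le>2 * H. e i) = real Q / r + real Q * (\<Sum>i=1..2 * H. 1 / real i)"
  proof -
    have "{..2 * H} = insert 0 {1..2 * H}" by auto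
    then have "(\<Sum>i\<le>2 * H. e i) = e 0 + (\<Sum>i=1..2 * H. e i)" by simp
    also have "(\<Sum>i=1..2 * H. e i) = (\<Sum>i=1..2 * H. real Q * (1 / real i))"
      by (intro sum.cong) (auto simp: e_def)
    finally show ?thesis by (simp add: e_def sum_distrib_left)
  qed
  finally have "(\<Sum>h\<in>{- int H..int H}. edge Q j (\<gamma> - of_int h)) \<le>
      2 * (real Q / r) + 2 * (real Q * (\<Sum>i=1..2 * H. 1 / real i))" by simp
  also have "(\<Sum>i=1..2 * H. 1 / real i) \<le> 1 + ln (2 * real H)"
    using sum_inverse_le_ln[of "2 * H"] H by simp
  finally have "(\<Sum>h\<in>{- int H..int H}. edge Q j (\<gamma> - of_int h)) \<le>
      2 * (real Q / r) + 2 * (real Q * (1 + ln (2 * real H)))" by (simp add: mult_left_mono)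
  moreover have "real Q / r = real Q * sqrt (real Q / j)" by (simp add: r_def real_sqrt_divide)
  ultimately show ?thesis by simp
qed

section \<open>Exponential sums over the fractions of an arc\<close>

definition curve_sum :: "(real \<Rightarrow> real) \<Rightarrow> real \<Rightarrow> real \<Rightarrow> nat \<Rightarrow> nat \<Rightarrow> complex" where
  "curve_sum f A B Q j = (\<Sum>q=1..Q. \<Sum>a\<in>{\<lceil>real q * A\<rceil>..\<lfloor>real q * B\<rfloor>}. e2pi (real q * (real j * f (of_int a / real q))))"

text \<open>With the end slopes of an arc for \<open>u\<close> and \<open>v\<close>, these are the h
  for which the phase j f x - h x has a stationary point on the arc.\<close>

definition interior :: "real \<Rightarrow> real \<Rightarrow> nat \<Rightarrow> int set" where
  "interior u v j = {h. u \<le> of_int h / real j \<and> of_int h / real j \<le> v}"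

lemma finite_interior:
  assumes "j > 0"
  shows "finite (interior u v j)"
proof -
  have "interior u v j = {h. u * real j \<le> of_int h \<and> of_int h \<le> v * real j}"
    using assms by (auto simp: interior_def pos_le_divide_eq pos_divide_le_eq)
  then show ?thesis by (simp add: finite_int_real_interval)
qed

text \<open>Holds for $A = m / 2^k$ with $m$ odd and $Q < 2^k \le 2Q$; it keeps the endpoints of the arc away
  from the fractions being counted, so that the smoothing of \<open>exponential_sum_transfer\<close> is harmless there.\<close>
definition avoids :: "real \<Rightarrow> nat \<Rightarrow> bool" where
  "avoids A Q \<longleftrightarrow> (\<forall>a q. 1 \<le> q \<longrightarrow> q \<le> Q \<longrightarrow> 1 / (2 * real Q) \<le> \<bar>of_int a - real q * A\<bar>)"

text \<open>The normalisation of the initial slope bounds all slopes on the arc by \<open>D\<close>.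
  This gives the Lipschitz constant of the phase and keeps the end values j f' A and j f' B within
  the range demanded by \<open>edge_sum_bound\<close>. The remaining work is to choose the smoothing
  parameters.\<close>

lemma (in curved_arc) curve_sum_bound:
  assumes Q: "Q > 0" and j: "j > 0" and dist: "avoids A Q" "avoids B Q"
    and fA: "0 \<le> f' A" "f' A \<le> 1" and l: "B - A \<le> l"
  defines "D \<equiv> 2 + l / c"
  shows "norm (curve_sum f A B Q j) \<le>
    (\<Sum>h\<in>interior (f' A) (f' B) j. (8 + 4 / c\<^sup>2) * (sqrt (real Q / real j) * resonance Q (real j * legendre f f' (of_int h / real j))) +
       2 / (c ^ 7 * real j) * tail_integral Q (real j) (- (real j * legendre f f' (of_int h / real j)))) +
    (2 + 4 / c + 1 / c\<^sup>2) * (4 * real Q * sqrt (real Q / real j) + 4 * real Q * (1 + ln (2 * D) + 2 * ln (real j) + 3 * ln (real Q))) +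
    real Q * ((l + 3) * (2 * pi * D + 12))"
proof -
  have l0: "l > 0" using l AB by simp
  define m where "m = nat \<lfloor>D\<rfloor>"
  have D: "D \<ge> 2" using l0 c by (simp add: D_def)
  have m: "real m \<le> D" "D \<le> real m + 1" "m > 0" unfolding m_def using D by linarith+
  have fB: "f' B \<le> real m"
  proof -
    have "f' B - f' A \<le> (B - A) / c" using curv_lipschitz[OF cv, of A B] AB by simp
    also have "\<dots> \<le> l / c" using l c by (intro divide_right_mono) auto
    finally show ?thesis using fA m(2) unfolding D_def by linarith
  qed
  have f'r: "0 \<le> f' x" "f' x \<le> real m" if "x \<in> {A..B}" for x
    using f'_mono[of A x] f'_mono[of x B] that fA fB by auto
  \<comment> \<open>With the \<open>\<tau>\<close> chosen below, 3 / (H \<tau>^2) is O(1/Q), and the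
    1/j in \<open>\<tau>\<close> offsets the Lipschitz constant j m of the phase; the smoothing
    error summed over q is therefore O(Q). The large \<open>H\<close> is cheap, since it enters the
    result only through its logarithm.\<close>
  define H where "H = m * j\<^sup>2 * Q ^ 3"
  have H: "H > 0" using m j Q by (simp add: H_def)
  define \<tau> where "\<tau> = 1 / (2 * real j * real Q)"
  have \<tau>: "\<tau> > 0" "\<tau> \<le> 1 / 2" "\<tau> \<le> 1 / (2 * real Q)"
  proof -
    show "\<tau> > 0" using j Q by (simp add: \<tau>_def)
    have "1 \<le> real j" "1 \<le> real Q" using j Q by simp_all
    then have "1 * 1 \<le> real j * real Q" by (intro mult_mono) auto
    then show "\<tau> \<le> 1 / 2" unfolding \<tau>_def by (intro divide_left_mono) auto
    show "\<tau> \<le> 1 / (2 * real Q)" unfolding \<tau>_def using j Q by (intro divide_left_mono) auto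
  qed
  have lipf: "\<bar>f x - f y\<bar> \<le> real m * \<bar>x - y\<bar>" if "x \<in> {A..B}" "y \<in> {A..B}" for x y
  proof -
    have *: "0 \<le> f y - f x \<and> f y - f x \<le> real m * (y - x)" if "x \<in> {A..B}" "y \<in> {A..B}" "x \<le> y" for x y
    proof -
      have nn: "0 \<le> c / 2 * (x - y)\<^sup>2" "0 \<le> c / 2 * (y - x)\<^sup>2" using c by simp_all
      have "f x + f' x * (y - x) \<le> f y" using curv_lower[OF cv, of x y] nn by linarith
      moreover have "f y + f' y * (x - y) \<le> f x" using curv_lower[OF cv, of y x] nn by linarith
      moreover have "0 \<le> f' x * (y - x)" using f'r that by (intro mult_nonneg_nonneg) auto
      moreover have "f' y * (y - x) \<le> real m * (y - x)" using f'r that by (intro mult_right_mono) auto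
      moreover have "f' y * (x - y) = - (f' y * (y - x))" by (simp add: algebra_simps)
      ultimately show ?thesis by linarith
    qed
    show ?thesis using *[OF that] *[OF that(2,1)] by (cases "x \<le> y") (auto simp: abs_if)
  qed
  define I where "I h = norm (integral {A..B} (\<lambda>x. esum1 Q (real j * f x - of_int h * x)))" for h
  define main where "main h = (8 + 4 / c\<^sup>2) * (sqrt (real Q / real j) * resonance Q (real j * legendre f f' (of_int h / real j))) +
       2 / (c ^ 7 * real j) * tail_integral Q (real j) (- (real j * legendre f f' (of_int h / real j)))" for h
  define C3 where "C3 = 2 + 4 / c + 1 / c\<^sup>2"
  define ed where "ed h = edge Q (real j) (real j * f' A - of_int h) + edge Q (real j) (real j * f' B - of_int h)" for h
  have C3: "2 + 4 / c \<le> C3" "1 / c\<^sup>2 \<le> C3" "C3 > 0" using c by (simp_all add: C3_def add_pos_nonneg)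
  have ed0: "0 \<le> ed h" for h by (simp add: ed_def edge_nonneg)
  have tail0: "0 \<le> tail_integral Q (real j) \<phi>" for \<phi>
    unfolding tail_integral_def using c j Q
    by (intro integral_nonneg integrable_continuous_real continuous_on_tail_weight tail_weight_nonneg) auto
  have main0: "0 \<le> main h" for h
    unfolding main_def using c tail0 resonance_pos[OF Q] by (intro add_nonneg_nonneg mult_nonneg_nonneg) (auto intro: less_imp_le)
  have Ih: "I h \<le> (if h \<in> interior (f' A) (f' B) j then main h else 0) + C3 * ed h" for h
  proof (cases "h \<in> interior (f' A) (f' B) j")
    case True
    then have hb: "f' A \<le> of_int h / real j" "of_int h / real j \<le> f' B" by (auto simp: interior_def)
    obtain x0 where x0: "A \<le> x0" "x0 \<le> B" "f' x0 = of_int h / real j"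
      using IVT'[OF hb _ cont1] AB by auto
    have hj: "of_int h = real j * f' x0" using j x0 by simp
    have inv: "inv f' (of_int h / real j) = x0" using x0(3) curv_inj[OF cv c(1)] by (metis inv_f_f)
    have "real j * (of_int h / real j * x0 - f x0) = of_int h * x0 - real j * f x0"
      using j by (simp add: right_diff_distrib)
    then have leg: "real j * f x0 - of_int h * x0 = - (real j * legendre f f' (of_int h / real j))"
      unfolding legendre_def inv by simp
    have "x0 \<in> {A..B}" "real j > 0" using x0 j by auto
    from interior_bound[OF this(2) Q this(1) hj] have "I h \<le> main h + 1 / c\<^sup>2 * ed h"
      unfolding I_def main_def ed_def leg resonance_minus .
    also have "1 / c\<^sup>2 * ed h \<le> C3 * ed h" using C3 ed0 by (intro mult_right_mono) auto
    finally show ?thesis using True by simp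
  next
    case False
    have "of_int h \<le> real j * f' A \<or> real j * f' B \<le> of_int h"
      using False j by (auto simp: interior_def pos_le_divide_eq pos_divide_le_eq not_le mult.commute)
    then have "I h \<le> (2 + 4 / c) * ed h"
      unfolding I_def ed_def using j Q by (intro exterior_bound) auto
    also have "\<dots> \<le> C3 * ed h" using C3 ed0 by (intro mult_right_mono) auto
    finally show ?thesis using False by simp
  qed
  have "norm (curve_sum f A B Q j) \<le> (\<Sum>h\<in>{- int H..int H}. I h) +
     real Q * ((real Q * (B - A) + 3) * (2 * pi * (real j * real m) * \<tau> + 3 / (real H * \<tau>\<^sup>2)))"
    unfolding curve_sum_def I_def
  proof (rule exponential_sum_transfer[OF less_imp_le[OF AB] H \<tau>(1,2)])
    fix x y assume xy: "x \<in> {A..B}" "y \<in> {A..B}"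
    have "\<bar>real j * f x - real j * f y\<bar> = real j * \<bar>f x - f y\<bar>" by (simp add: abs_mult flip: right_diff_distrib)
    also have "\<dots> \<le> real j * (real m * \<bar>x - y\<bar>)" by (intro mult_left_mono lipf xy) auto
    finally show "\<bar>real j * f x - real j * f y\<bar> \<le> real j * real m * \<bar>x - y\<bar>" by simp
  next
    fix a q assume "1 \<le> q" "q \<le> Q"
    then show "\<tau> \<le> \<bar>of_int a - real q * A\<bar>" "\<tau> \<le> \<bar>of_int a - real q * B\<bar>"
      using dist \<tau>(3) unfolding avoids_def by (meson order_trans)+
  qed simp
  also have "real Q * ((real Q * (B - A) + 3) * (2 * pi * (real j * real m) * \<tau> + 3 / (real H * \<tau>\<^sup>2))) \<le>
     real Q * ((l + 3) * (2 * pi * D + 12))"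
  proof -
    have "2 * pi * (real j * real m) * \<tau> = pi * real m / real Q" using j Q by (simp add: \<tau>_def)
    also have "\<dots> \<le> 2 * pi * D / real Q" using m D pi_gt_zero by (intro divide_right_mono mult_mono) auto
    finally have 1: "2 * pi * (real j * real m) * \<tau> \<le> 2 * pi * D / real Q" .
    have "3 / (real H * \<tau>\<^sup>2) = 12 / (real m * real Q)"
      using j Q m by (simp add: H_def \<tau>_def power_divide power2_eq_square power3_eq_cube)
    also have "\<dots> \<le> 12 / (1 * real Q)" using m Q by (intro divide_left_mono mult_right_mono) auto
    finally have "2 * pi * (real j * real m) * \<tau> + 3 / (real H * \<tau>\<^sup>2) \<le> (2 * pi * D + 12) / real Q"
      using 1 by (simp add: add_divide_distrib)
    then have "(real Q * (B - A) + 3) * (2 * pi * (real j * real m) * \<tau> + 3 / (real H * \<tau>\<^sup>2)) \<le>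
       (real Q * (l + 3)) * ((2 * pi * D + 12) / real Q)"
    proof (intro mult_mono)
      have "real Q * (B - A) + 3 * 1 \<le> real Q * l + 3 * real Q" using l Q by (intro add_mono mult_left_mono) auto
      then show "real Q * (B - A) + 3 \<le> real Q * (l + 3)" by (simp add: algebra_simps)
    qed (use l0 \<tau> in auto)
    also have "\<dots> = (l + 3) * (2 * pi * D + 12)" using Q by simp
    finally show ?thesis by (intro mult_left_mono) auto
  qed
  also have "(\<Sum>h\<in>{- int H..int H}. I h) \<le>
     (\<Sum>h\<in>{- int H..int H}. (if h \<in> interior (f' A) (f' B) j then main h else 0) + C3 * ed h)"
    by (intro sum_mono Ih)
  also have "\<dots> = (\<Sum>h\<in>{- int H..int H} \<inter> interior (f' A) (f' B) j. main h) + C3 * (\<Sum>h\<in>{- int H..int H}. ed h)"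
    by (simp add: sum.distrib sum_distrib_left sum.inter_restrict)
  also have "(\<Sum>h\<in>{- int H..int H} \<inter> interior (f' A) (f' B) j. main h) \<le> (\<Sum>h\<in>interior (f' A) (f' B) j. main h)"
    using main0 by (intro sum_mono2 finite_interior j) auto
  also have "C3 * (\<Sum>h\<in>{- int H..int H}. ed h) \<le>
     C3 * (4 * real Q * sqrt (real Q / real j) + 4 * real Q * (1 + ln (2 * D) + 2 * ln (real j) + 3 * ln (real Q)))"
  proof (intro mult_left_mono)
    have mjH: "real j * real m \<le> real H"
    proof -
      have "m * j * 1 \<le> m * j * (j * Q ^ 3)" using j Q by (intro mult_left_mono) auto
      then have "real (m * j) \<le> real H" unfolding of_nat_le_iff by (simp add: H_def power2_eq_square mult_ac)
      then show ?thesis by (simp add: mult.commute)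
    qed
    have gb: "0 \<le> real j * f' x \<and> real j * f' x \<le> real H" if "x \<in> {A..B}" for x
    proof -
      have "real j * f' x \<le> real j * real m" using f'r[OF that] by (intro mult_left_mono) auto
      then show ?thesis using mjH f'r[OF that] by auto
    qed
    have jr: "real j > 0" using j by simp
    have "(\<Sum>h\<in>{- int H..int H}. ed h) \<le>
       (2 * real Q * sqrt (real Q / real j) + 2 * real Q * (1 + ln (2 * real H))) +
       (2 * real Q * sqrt (real Q / real j) + 2 * real Q * (1 + ln (2 * real H)))"
      unfolding ed_def sum.distrib
      using gb[of A] gb[of B] AB by (intro add_mono edge_sum_bound[OF jr Q H]) auto
    also have "\<dots> = 4 * real Q * sqrt (real Q / real j) + 4 * real Q * (1 + ln (2 * real H))" by simp
    also have "ln (2 * real H) \<le> ln (2 * D) + 2 * ln (real j) + 3 * ln (real Q)"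
    proof -
      have "ln (2 * real H) = ln ((2 * real m) * (real j)\<^sup>2 * real Q ^ 3)" by (simp add: H_def mult_ac)
      also have "\<dots> = ln (2 * real m) + 2 * ln (real j) + 3 * ln (real Q)"
        using m j Q by (simp add: ln_mult ln_realpow)
      also have "ln (2 * real m) \<le> ln (2 * D)" using m by simp
      finally show ?thesis by simp
    qed
    finally show "(\<Sum>h\<in>{- int H..int H}. ed h) \<le>
       4 * real Q * sqrt (real Q / real j) + 4 * real Q * (1 + ln (2 * D) + 2 * ln (real j) + 3 * ln (real Q))"
      by (simp add: mult_left_mono add.assoc)
  qed (use C3 in simp)
  finally show ?thesis unfolding main_def C3_def by linarith
qed

section \<open>Summation over a dyadic block of frequencies\<close>

definition dyadic_block :: "nat \<Rightarrow> nat set" where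
  "dyadic_block M = {j. 2 ^ M < 2 * j \<and> j \<le> 2 ^ M}"

lemma finite_dyadic_block: "finite (dyadic_block M)"
  by (rule finite_subset[of _ "{..2 ^ M}"]) (auto simp: dyadic_block_def)

lemma dyadic_block_real:
  assumes "j \<in> dyadic_block M"
  shows "j > 0" "2 ^ M < 2 * real j" "real j \<le> 2 ^ M"
proof -
  have h: "2 ^ M < 2 * j" "j \<le> 2 ^ M" using assms by (auto simp: dyadic_block_def)
  then show "j > 0" by auto
  have "real (2 ^ M) < real (2 * j)" "real j \<le> real (2 ^ M)" using h by (simp_all only: of_nat_less_iff of_nat_le_iff)
  then show "2 ^ M < 2 * real j" "real j \<le> 2 ^ M" by simp_all
qed

text \<open>The counting bounds are stated for unit windows of slopes. The slopes of the arc are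
  covered by \<open>m0 + 1\<close> such windows, and overlaps are harmless because the summands are
  nonnegative.\<close>

lemma interior_sum_le_slopes_sum:
  fixes w :: "int \<Rightarrow> int \<Rightarrow> real"
  assumes w: "\<And>j h. 0 \<le> w j h" and v: "v < u + real m0 + 1"
  shows "(\<Sum>j\<in>dyadic_block M. \<Sum>h\<in>interior u v j. w (int j) h) \<le>
     (\<Sum>m\<le>m0. \<Sum>(j, h)\<in>slopes (u + real m) M. w j h)"
proof -
  define X where "X = (SIGMA j:dyadic_block M. interior u v j)"
  have finX: "finite X"
    unfolding X_def by (intro finite_SigmaI finite_dyadic_block finite_interior dyadic_block_real(1))
  define g where "g p = (int (fst p), snd p)" for p :: "nat \<times> int"
  define W where "W p = w (fst p) (snd p)" for p :: "int \<times> int"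
  have "(\<Sum>j\<in>dyadic_block M. \<Sum>h\<in>interior u v j. w (int j) h) = (\<Sum>p\<in>X. W (g p))"
    unfolding X_def W_def g_def
    by (subst sum.Sigma) (auto intro: finite_dyadic_block finite_interior dyadic_block_real(1) simp: case_prod_unfold)
  also have "\<dots> = (\<Sum>p\<in>g ` X. W p)"
    by (subst sum.reindex) (auto simp: inj_on_def g_def prod_eq_iff)
  also have "\<dots> \<le> (\<Sum>p\<in>g ` X. \<Sum>m\<le>m0. if p \<in> slopes (u + real m) M then W p else 0)"
  proof (rule sum_mono)
    fix p assume "p \<in> g ` X"
    then obtain j h where p: "p = (int j, h)" "j \<in> dyadic_block M" "h \<in> interior u v j"
      by (auto simp: X_def g_def)
    define t where "t = of_int h / real j - u"
    have t: "0 \<le> t" "t < real m0 + 1" using p(3) v by (auto simp: t_def interior_def)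
    define m where "m = nat \<lfloor>t\<rfloor>"
    have m: "real m \<le> t" "t \<le> real m + 1" "m \<le> m0" unfolding m_def using t by linarith+
    have "1 \<le> j" "j \<le> 2 ^ M" using dyadic_block_real(1)[OF p(2)] p(2) by (auto simp: dyadic_block_def)
    then have "int j \<le> int (2 ^ M)" by (simp only: of_nat_le_iff)
    then have "p \<in> slopes (u + real m) M"
      using m \<open>1 \<le> j\<close> by (auto simp: slopes_def p t_def)
    then have "W p = (if p \<in> slopes (u + real m) M then W p else 0)" by simp
    also have "\<dots> \<le> (\<Sum>m\<le>m0. if p \<in> slopes (u + real m) M then W p else 0)"
      using m(3) w by (intro member_le_sum) (auto simp: W_def)
    finally show "W p \<le> (\<Sum>m\<le>m0. if p \<in> slopes (u + real m) M then W p else 0)" .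
  qed
  also have "\<dots> = (\<Sum>m\<le>m0. \<Sum>p\<in>g ` X. if p \<in> slopes (u + real m) M then W p else 0)" by (rule sum.swap)
  also have "\<dots> = (\<Sum>m\<le>m0. \<Sum>p\<in>g ` X \<inter> slopes (u + real m) M. W p)"
    using finX by (simp add: sum.inter_restrict)
  also have "\<dots> \<le> (\<Sum>m\<le>m0. \<Sum>p\<in>slopes (u + real m) M. W p)"
    using w by (intro sum_mono sum_mono2 finite_slopes) (auto simp: W_def)
  finally show ?thesis by (simp add: W_def case_prod_unfold)
qed

lemma integral_powr_three_halves:
  assumes "0 < u"
  shows "integral {u..v} (\<lambda>t. t powr (- (3 / 2))) \<le> 2 / sqrt u"
proof (cases "u \<le> v")
  case True
  have "((\<lambda>t. t powr (- (3 / 2))) has_integral (- 2 * v powr (- (1 / 2)) - (- 2 * u powr (- (1 / 2))))) {u..v}"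
  proof (rule fundamental_theorem_of_calculus[OF True])
    fix t assume "t \<in> {u..v}"
    then have t: "t > 0" using assms by auto
    have "((\<lambda>t. - 2 * t powr (- (1 / 2))) has_real_derivative - 2 * ((- (1 / 2)) * t powr (- (1 / 2) - 1))) (at t within {u..v})"
      using t by (intro DERIV_cmult has_field_derivative_at_within[OF has_real_derivative_powr])
    then show "((\<lambda>t. - 2 * t powr (- (1 / 2))) has_vector_derivative t powr (- (3 / 2))) (at t within {u..v})"
      by (simp add: has_real_derivative_iff_has_vector_derivative)
  qed
  then have "integral {u..v} (\<lambda>t. t powr (- (3 / 2))) = 2 * u powr (- (1 / 2)) - 2 * v powr (- (1 / 2))"
    by (simp add: integral_unique)
  also have "\<dots> \<le> 2 * u powr (- (1 / 2))" by simp
  also have "\<dots> = 2 / sqrt u" using assms by (simp add: powr_minus_divide powr_half_sqrt)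
  finally show ?thesis .
qed (use assms in simp)

lemma sqrt_divide_mult:
  assumes "J > 0"
  shows "sqrt (x / J) * J = sqrt (x * J)" "sqrt (x * J) / J = sqrt (x / J)"
proof -
  have "sqrt (x / J) * sqrt (J\<^sup>2) = sqrt (x / J * J\<^sup>2)" by (simp only: real_sqrt_mult)
  also have "x / J * J\<^sup>2 = x * J" using assms by (simp add: power2_eq_square)
  finally show 1: "sqrt (x / J) * J = sqrt (x * J)" using assms by simp
  show "sqrt (x * J) / J = sqrt (x / J)" unfolding 1[symmetric] using assms by simp
qed

text \<open>The resonance sum over the block is at most the same \<open>Z\<close> for every vertical
  translate of the dual. Integrating \<tau>^(-3/2) from a lower limit of order 1/(J Q) contributes
  sqrt(J Q), and division by J turns this into the factor sqrt(Q / J) that the central parts carry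
  as well. So the tails cost no more than the neighbourhoods of the stationary points.\<close>

lemma block_bound:
  assumes c: "0 < c" "c \<le> 1" and b: "b > 1" and l: "l > 0"
  shows "\<exists>C>0. \<forall>A B f f' f'' Q M. curved_arc c A B f f' f'' \<longrightarrow> B - A \<le> l \<longrightarrow> 0 \<le> f' A \<longrightarrow> f' A \<le> 1 \<longrightarrow>
     avoids A Q \<longrightarrow> avoids B Q \<longrightarrow> 0 < Q \<longrightarrow>
     (\<Sum>j\<in>dyadic_block M. norm (curve_sum f A B Q j)) \<le>
       C * (real Q * sqrt (real Q * 2 ^ M) * (1 + real M) + sqrt (real Q / 2 ^ M) * (1 + ln (real Q)) * 4 ^ M * b ^ M +
            2 ^ M * real Q * (1 + real M + ln (real Q)))"
proof -
  obtain C where C: "C > 0" and ker: "\<And>f f' u M Q. curv c f f' \<Longrightarrow> 0 < Q \<Longrightarrow>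
     (\<Sum>(j, h)\<in>slopes u M. resonance Q (of_int j * f (of_int h / of_int j)))
       \<le> C * (real Q * 2 ^ M * (1 + real M) + (1 + ln (real Q)) * 4 ^ M * b ^ M)"
    using resonance_sum_bound[OF c b] by blast
  define m0 where "m0 = nat \<lfloor>l / c\<rfloor>"
  define D where "D = 2 + l / c"
  have D: "D \<ge> 2" using l c by (simp add: D_def)
  define C1 where "C1 = (16 + 8 / c\<^sup>2 + 16 / c ^ 8) * ((real m0 + 1) * C)"
  define C3 where "C3 = 2 + 4 / c + 1 / c\<^sup>2"
  define C4 where "C4 = C3 * (12 + 4 * ln (2 * D)) + (l + 3) * (2 * pi * D + 12)"
  have pos: "C1 > 0" "C3 > 0" "C4 > 0"
  proof -
    have "0 < 16 + 8 / c\<^sup>2 + 16 / c ^ 8" using c by (intro add_pos_nonneg) auto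
    moreover have "0 < (real m0 + 1) * C" using C by simp
    ultimately show "C1 > 0" unfolding C1_def by (rule mult_pos_pos)
    show C3: "C3 > 0" unfolding C3_def using c by (intro add_pos_nonneg) auto
    have "0 \<le> ln (2 * D)" using D by simp
    then show "C4 > 0" unfolding C4_def using C3 l D by (intro add_pos_pos mult_pos_pos add_pos_nonneg) (auto intro: add_nonneg_pos)
  qed
  define CC where "CC = C1 + 8 * C3 + C4"
  have "(\<Sum>j\<in>dyadic_block M. norm (curve_sum f A B Q j)) \<le>
       CC * (real Q * sqrt (real Q * 2 ^ M) * (1 + real M) + sqrt (real Q / 2 ^ M) * (1 + ln (real Q)) * 4 ^ M * b ^ M +
            2 ^ M * real Q * (1 + real M + ln (real Q)))"
    if arc: "curved_arc c A B f f' f''" and lAB: "B - A \<le> l" and fA: "0 \<le> f' A" "f' A \<le> 1"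
      and av: "avoids A Q" "avoids B Q" and Q: "0 < Q" for A B f f' f'' Q M
  proof -
    interpret curved_arc c A B f f' f'' by (rule arc)
    define J :: real where "J = 2 ^ M"
    have J: "J \<ge> 1" by (simp add: J_def)
    have Qr: "real Q \<ge> 1" using Q by simp
    have lnQ: "0 \<le> ln (real Q)" using Qr by simp
    define Y where "Y = real Q * 2 ^ M * (1 + real M) + (1 + ln (real Q)) * 4 ^ M * b ^ M"
    have Y0: "0 \<le> Y" unfolding Y_def using lnQ b by (intro add_nonneg_nonneg mult_nonneg_nonneg) auto
    define Z where "Z = (real m0 + 1) * (C * Y)"
    have Z0: "0 \<le> Z" using C Y0 by (simp add: Z_def)
    define g where "g = legendre f f'"
    define h' where "h' = inv f'"
    have cg: "curv c g h'" unfolding g_def h'_def by (rule curv_legendre[OF cv c(1)])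
    define X where "X = dyadic_block M"
    define N where "N j = interior (f' A) (f' B) j" for j
    have m0: "f' B < f' A + real m0 + 1"
    proof -
      have "f' B - f' A \<le> (B - A) / c" using curv_lipschitz[OF cv, of A B] AB by simp
      also have "\<dots> \<le> l / c" using lAB c by (intro divide_right_mono) auto
      also have "l / c < real m0 + 1" unfolding m0_def using l c by (auto simp: less_floor_iff) linarith?
      finally show ?thesis by simp
    qed
    have kerZ: "(\<Sum>j\<in>X. \<Sum>h\<in>N j. resonance Q (real j * (g (of_int h / real j) + t))) \<le> Z" for t
    proof -
      have "(\<Sum>j\<in>X. \<Sum>h\<in>N j. resonance Q (real j * (g (of_int h / real j) + t))) \<le>
         (\<Sum>m\<le>m0. \<Sum>(j, h)\<in>slopes (f' A + real m) M. resonance Q (of_int j * (g (of_int h / of_int j) + t)))"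
        using interior_sum_le_slopes_sum[of "\<lambda>j h. resonance Q (of_int j * (g (of_int h / of_int j) + t))" "f' B" "f' A" m0 M] m0
          resonance_pos[OF Q] by (simp add: X_def N_def less_imp_le)
      also have "\<dots> \<le> (\<Sum>m\<le>m0. C * Y)"
        unfolding Y_def by (intro sum_mono ker[OF curv_shift[OF cg] Q])
      finally show ?thesis by (simp add: Z_def add.commute)
    qed
    have blk: "j > 0" "J < 2 * real j" "real j \<le> J" if "j \<in> X" for j
      using dyadic_block_real[of j M] that by (simp_all add: X_def J_def)
    have sq: "sqrt (real Q / real j) \<le> 2 * sqrt (real Q / J)" if "j \<in> X" for j
    proof -
      have "real Q / real j \<le> real Q / (J / 4)" using blk[OF that] J by (intro divide_left_mono) auto
      then have "sqrt (real Q / real j) \<le> sqrt (4 * (real Q / J))" by (intro real_sqrt_le_mono) (simp add: mult.commute)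
      then show ?thesis by (simp only: real_sqrt_mult real_sqrt_four)
    qed
    \<comment> \<open>A lower limit below those of all j in the block: the integrands are
      nonnegative, so all tails may be extended to a common interval before sum and integral are
      exchanged.\<close>
    define u where "u = c\<^sup>2 / (2 * J * real Q)"
    have u: "u > 0" using c J Q by (simp add: u_def)
    define v where "v = (B - A)\<^sup>2 / (2 * c)"
    have tails: "(\<Sum>j\<in>X. \<Sum>h\<in>N j. 2 / (c ^ 7 * real j) * tail_integral Q (real j) (- (real j * g (of_int h / real j)))) \<le>
       16 / c ^ 8 * (sqrt (real Q / J) * Z)"
    proof -
      let ?W = "\<lambda>j h. tail_weight Q (real j) (- (real j * g (of_int h / real j)))"
      have intW: "?W j h integrable_on {u'..v}" if "u' > 0" for j h u'
        by (rule integrable_continuous_real[OF continuous_on_tail_weight[OF that]])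
      have "(\<Sum>j\<in>X. \<Sum>h\<in>N j. 2 / (c ^ 7 * real j) * tail_integral Q (real j) (- (real j * g (of_int h / real j)))) \<le>
         (\<Sum>j\<in>X. \<Sum>h\<in>N j. 4 / (c ^ 7 * J) * integral {u..v} (?W j h))"
      proof (intro sum_mono mult_mono)
        fix j h assume j: "j \<in> X"
        show "2 / (c ^ 7 * real j) \<le> 4 / (c ^ 7 * J)"
        proof -
          have "4 / (c ^ 7 * (2 * real j)) \<le> 4 / (c ^ 7 * J)"
            using blk[OF j] c J by (intro divide_left_mono mult_left_mono) auto
          then show ?thesis by (simp add: mult.commute)
        qed
        have ju: "u \<le> c\<^sup>2 / (2 * real j * real Q)" unfolding u_def
          using blk[OF j] c J Q by (intro divide_left_mono mult_right_mono) auto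
        show "tail_integral Q (real j) (- (real j * g (of_int h / real j))) \<le> integral {u..v} (?W j h)"
          unfolding tail_integral_def v_def[symmetric]
          using u ju by (intro integral_subset_le intW) (auto simp: tail_weight_nonneg)
        show "0 \<le> tail_integral Q (real j) (- (real j * g (of_int h / real j)))"
          unfolding tail_integral_def v_def[symmetric]
          using u ju by (intro integral_nonneg intW) (auto simp: tail_weight_nonneg)
      qed (use c J in auto)
      also have "\<dots> = 4 / (c ^ 7 * J) * (\<Sum>j\<in>X. \<Sum>h\<in>N j. integral {u..v} (?W j h))"
        by (simp add: sum_distrib_left)
      also have "(\<Sum>j\<in>X. \<Sum>h\<in>N j. integral {u..v} (?W j h)) = integral {u..v} (\<lambda>t. \<Sum>j\<in>X. \<Sum>h\<in>N j. ?W j h t)"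
      proof -
        have "((\<lambda>t. \<Sum>j\<in>X. \<Sum>h\<in>N j. ?W j h t) has_integral (\<Sum>j\<in>X. \<Sum>h\<in>N j. integral {u..v} (?W j h))) {u..v}"
          using blk unfolding X_def N_def
          by (intro has_integral_sum finite_dyadic_block finite_interior integrable_integral intW u) auto
        then show ?thesis by (simp add: integral_unique)
      qed
      finally have step: "(\<Sum>j\<in>X. \<Sum>h\<in>N j. 2 / (c ^ 7 * real j) * tail_integral Q (real j) (- (real j * g (of_int h / real j)))) \<le>
         4 / (c ^ 7 * J) * integral {u..v} (\<lambda>t. \<Sum>j\<in>X. \<Sum>h\<in>N j. ?W j h t)" .
      have "integral {u..v} (\<lambda>t. \<Sum>j\<in>X. \<Sum>h\<in>N j. ?W j h t) \<le> integral {u..v} (\<lambda>t. t powr (- (3 / 2)) * Z)"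
      proof (rule integral_le)
        show "(\<lambda>t. \<Sum>j\<in>X. \<Sum>h\<in>N j. ?W j h t) integrable_on {u..v}"
          using blk unfolding X_def N_def by (intro integrable_sum finite_dyadic_block finite_interior intW u) auto
        show "(\<lambda>t. t powr (- (3 / 2)) * Z) integrable_on {u..v}"
          using u by (intro integrable_continuous_real continuous_intros) auto
        fix t
        have "(\<Sum>j\<in>X. \<Sum>h\<in>N j. ?W j h t) \<le> (\<Sum>j\<in>X. \<Sum>h\<in>N j. t powr (- (3 / 2)) * resonance Q (real j * (g (of_int h / real j) + - t)))"
        proof (intro sum_mono)
          fix j h
          \<comment> \<open>The phase at the stationary point is minus j times the dual value, so
            translating the curve up translates the dual down. The overall sign is irrelevant
            because \<open>resonance\<close> is even.\<close>
          have "- (real j * g (of_int h / real j)) + real j * t = - (real j * (g (of_int h / real j) + - t))"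
            by (simp add: algebra_simps)
          then have "norm (esum Q (- (real j * g (of_int h / real j)) + real j * t)) \<le> resonance Q (real j * (g (of_int h / real j) + - t))"
            using norm_esum_le[OF order_refl Q] by (metis resonance_minus)
          then show "?W j h t \<le> t powr (- (3 / 2)) * resonance Q (real j * (g (of_int h / real j) + - t))"
            unfolding tail_weight_def by (intro mult_left_mono) auto
        qed
        also have "\<dots> = t powr (- (3 / 2)) * (\<Sum>j\<in>X. \<Sum>h\<in>N j. resonance Q (real j * (g (of_int h / real j) + - t)))"
          by (simp add: sum_distrib_left)
        also have "\<dots> \<le> t powr (- (3 / 2)) * Z" by (intro mult_left_mono kerZ) auto
        finally show "(\<Sum>j\<in>X. \<Sum>h\<in>N j. ?W j h t) \<le> t powr (- (3 / 2)) * Z" .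
      qed
      also have "\<dots> = integral {u..v} (\<lambda>t. t powr (- (3 / 2))) * Z" by (rule integral_mult_left)
      also have "\<dots> \<le> 2 / sqrt u * Z" by (intro mult_right_mono integral_powr_three_halves u Z0)
      also have "\<dots> \<le> 4 * sqrt (real Q * J) / c * Z"
      proof (rule mult_right_mono[OF _ Z0])
        have "sqrt u = c / sqrt (2 * (J * real Q))" using c by (simp add: u_def real_sqrt_divide)
        then have "2 / sqrt u = 2 * sqrt (2 * (real Q * J)) / c" using c by (simp add: mult_ac)
        also have "\<dots> \<le> 2 * sqrt (4 * (real Q * J)) / c"
          using c J by (intro divide_right_mono mult_left_mono real_sqrt_le_mono mult_right_mono) auto
        also have "\<dots> = 4 * sqrt (real Q * J) / c" by (simp only: real_sqrt_mult real_sqrt_four)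
        finally show "2 / sqrt u \<le> 4 * sqrt (real Q * J) / c" .
      qed
      finally have "4 / (c ^ 7 * J) * integral {u..v} (\<lambda>t. \<Sum>j\<in>X. \<Sum>h\<in>N j. ?W j h t) \<le>
         4 / (c ^ 7 * J) * (4 * sqrt (real Q * J) / c * Z)"
        using c J by (intro mult_left_mono) auto
      with step have "(\<Sum>j\<in>X. \<Sum>h\<in>N j. 2 / (c ^ 7 * real j) * tail_integral Q (real j) (- (real j * g (of_int h / real j)))) \<le>
         4 / (c ^ 7 * J) * (4 * sqrt (real Q * J) / c * Z)" by (rule order_trans)
      also have "4 / (c ^ 7 * J) * (4 * sqrt (real Q * J) / c * Z) = 16 / c ^ 8 * (sqrt (real Q * J) / J * Z)"
        by (simp add: power_numeral_reduce)
      also have "sqrt (real Q * J) / J = sqrt (real Q / J)"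
        using J by (intro sqrt_divide_mult) auto
      finally show ?thesis .
    qed
    have kers: "(\<Sum>j\<in>X. \<Sum>h\<in>N j. (8 + 4 / c\<^sup>2) * (sqrt (real Q / real j) * resonance Q (real j * g (of_int h / real j)))) \<le>
       (16 + 8 / c\<^sup>2) * (sqrt (real Q / J) * Z)"
    proof -
      have "(\<Sum>j\<in>X. \<Sum>h\<in>N j. (8 + 4 / c\<^sup>2) * (sqrt (real Q / real j) * resonance Q (real j * g (of_int h / real j)))) \<le>
         (\<Sum>j\<in>X. \<Sum>h\<in>N j. (8 + 4 / c\<^sup>2) * ((2 * sqrt (real Q / J)) * resonance Q (real j * (g (of_int h / real j) + 0))))"
        using sq c J resonance_pos[OF Q] by (intro sum_mono mult_left_mono mult_mono) (auto intro: less_imp_le)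
      also have "\<dots> = (16 + 8 / c\<^sup>2) * sqrt (real Q / J) * (\<Sum>j\<in>X. \<Sum>h\<in>N j. resonance Q (real j * (g (of_int h / real j) + 0)))"
        unfolding sum_distrib_left by (intro sum.cong refl) (simp add: distrib_right distrib_left mult_ac)
      also have "\<dots> \<le> (16 + 8 / c\<^sup>2) * sqrt (real Q / J) * Z"
        using c J by (intro mult_left_mono kerZ) auto
      finally show ?thesis by (simp add: mult.assoc)
    qed
    have each: "norm (curve_sum f A B Q j) \<le>
      (\<Sum>h\<in>N j. (8 + 4 / c\<^sup>2) * (sqrt (real Q / real j) * resonance Q (real j * g (of_int h / real j)))) +
      (\<Sum>h\<in>N j. 2 / (c ^ 7 * real j) * tail_integral Q (real j) (- (real j * g (of_int h / real j)))) +
      (C3 * (8 * real Q * sqrt (real Q / J)) + C4 * (real Q * (1 + real M + ln (real Q))))" if j: "j \<in> X" for j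
    proof -
      have lnj: "ln (real j) \<le> real M"
      proof -
        have "ln (real j) \<le> ln J" using blk[OF j] by simp
        also have "\<dots> = real M * ln 2" by (simp add: J_def ln_realpow)
        also have "\<dots> \<le> real M * 1" using ln_2_less_1 by (intro mult_left_mono) auto
        finally show ?thesis by simp
      qed
      have lnj0: "0 \<le> ln (real j)" using blk(1)[OF j] by simp
      have lnD: "0 \<le> ln (2 * D)" using D by simp
      have "C3 * (4 * real Q * sqrt (real Q / real j) + 4 * real Q * (1 + ln (2 * D) + 2 * ln (real j) + 3 * ln (real Q))) \<le>
         C3 * (8 * real Q * sqrt (real Q / J) + (12 + 4 * ln (2 * D)) * (real Q * (1 + real M + ln (real Q))))"
      proof (intro mult_left_mono add_mono)
        have "4 * real Q * sqrt (real Q / real j) \<le> 4 * real Q * (2 * sqrt (real Q / J))" by (intro mult_left_mono sq j) auto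
        then show "4 * real Q * sqrt (real Q / real j) \<le> 8 * real Q * sqrt (real Q / J)" by simp
        have "4 * (1 + ln (2 * D) + 2 * ln (real j) + 3 * ln (real Q)) \<le> 12 * (1 + real M + ln (real Q)) + 4 * ln (2 * D) * 1"
          using lnj lnQ by simp
        also have "4 * ln (2 * D) * 1 \<le> 4 * ln (2 * D) * (1 + real M + ln (real Q))"
          using lnD lnQ by (intro mult_left_mono) auto
        finally have "4 * (1 + ln (2 * D) + 2 * ln (real j) + 3 * ln (real Q)) \<le> (12 + 4 * ln (2 * D)) * (1 + real M + ln (real Q))"
          by (simp add: distrib_right)
        then have "real Q * (4 * (1 + ln (2 * D) + 2 * ln (real j) + 3 * ln (real Q))) \<le> real Q * ((12 + 4 * ln (2 * D)) * (1 + real M + ln (real Q)))"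
          by (intro mult_left_mono) auto
        then show "4 * real Q * (1 + ln (2 * D) + 2 * ln (real j) + 3 * ln (real Q)) \<le> (12 + 4 * ln (2 * D)) * (real Q * (1 + real M + ln (real Q)))"
          by (simp add: mult_ac)
      qed (use pos in auto)
      moreover have "real Q * ((l + 3) * (2 * pi * D + 12)) \<le> ((l + 3) * (2 * pi * D + 12)) * (real Q * (1 + real M + ln (real Q)))"
      proof -
        have "real Q * 1 \<le> real Q * (1 + real M + ln (real Q))" using lnQ by (intro mult_left_mono) auto
        moreover have "0 \<le> (l + 3) * (2 * pi * D + 12)" using l D by (intro mult_nonneg_nonneg add_nonneg_nonneg) auto
        ultimately have "((l + 3) * (2 * pi * D + 12)) * (real Q * 1) \<le> ((l + 3) * (2 * pi * D + 12)) * (real Q * (1 + real M + ln (real Q)))"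
          by (rule mult_left_mono)
        then show ?thesis by (simp add: mult_ac)
      qed
      moreover have "C4 * (real Q * (1 + real M + ln (real Q))) =
         C3 * ((12 + 4 * ln (2 * D)) * (real Q * (1 + real M + ln (real Q)))) + ((l + 3) * (2 * pi * D + 12)) * (real Q * (1 + real M + ln (real Q)))"
        unfolding C4_def by (simp only: distrib_right mult.assoc)
      ultimately show ?thesis
        using curve_sum_bound[OF Q blk(1)[OF j] av fA lAB]
        unfolding sum.distrib g_def[symmetric] N_def[symmetric] C3_def[symmetric] D_def[symmetric] distrib_left[of C3]
        by linarith
    qed
    have cardX: "real (card X) \<le> J"
    proof -
      have "X \<subseteq> {1..2 ^ M}" using blk(1) by (fastforce simp: X_def dyadic_block_def)
      then have "card X \<le> 2 ^ M" using card_mono[of "{1..2 ^ M}" X] by simp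
      then have "real (card X) \<le> real (2 ^ M)" by (simp only: of_nat_le_iff)
      then show ?thesis by (simp add: J_def)
    qed
    define R where "R = C3 * (8 * real Q * sqrt (real Q / J)) + C4 * (real Q * (1 + real M + ln (real Q)))"
    have R0: "0 \<le> R" unfolding R_def using pos lnQ J by (intro add_nonneg_nonneg mult_nonneg_nonneg) auto
    have "(\<Sum>j\<in>X. norm (curve_sum f A B Q j)) \<le> (16 + 8 / c\<^sup>2) * (sqrt (real Q / J) * Z) + 16 / c ^ 8 * (sqrt (real Q / J) * Z) + J * R"
    proof -
      have "(\<Sum>j\<in>X. norm (curve_sum f A B Q j)) \<le>
       (\<Sum>j\<in>X. (\<Sum>h\<in>N j. (8 + 4 / c\<^sup>2) * (sqrt (real Q / real j) * resonance Q (real j * g (of_int h / real j)))) +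
      (\<Sum>h\<in>N j. 2 / (c ^ 7 * real j) * tail_integral Q (real j) (- (real j * g (of_int h / real j)))) + R)"
        unfolding R_def by (intro sum_mono each)
      also have "\<dots> = (\<Sum>j\<in>X. \<Sum>h\<in>N j. (8 + 4 / c\<^sup>2) * (sqrt (real Q / real j) * resonance Q (real j * g (of_int h / real j)))) +
         (\<Sum>j\<in>X. \<Sum>h\<in>N j. 2 / (c ^ 7 * real j) * tail_integral Q (real j) (- (real j * g (of_int h / real j)))) + real (card X) * R"
        by (simp only: sum.distrib sum_constant)
      also have "real (card X) * R \<le> J * R" using cardX R0 by (intro mult_right_mono)
      finally show ?thesis using kers tails by linarith
    qed
    also have "\<dots> = C1 * (sqrt (real Q / J) * Y) + J * R"
    proof -
      have "(16 + 8 / c\<^sup>2) * (sqrt (real Q / J) * Z) + 16 / c ^ 8 * (sqrt (real Q / J) * Z) =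
         (16 + 8 / c\<^sup>2 + 16 / c ^ 8) * (sqrt (real Q / J) * Z)" by (simp only: distrib_right)
      then show ?thesis unfolding C1_def Z_def by (simp only: mult_ac)
    qed
    also have "sqrt (real Q / J) * Y = real Q * sqrt (real Q * J) * (1 + real M) + sqrt (real Q / J) * (1 + ln (real Q)) * 4 ^ M * b ^ M"
    proof -
      have "sqrt (real Q / J) * J = sqrt (real Q * J)"
        using J by (intro sqrt_divide_mult) auto
      then have *: "sqrt (real Q / J) * (real Q * J * (1 + real M)) = real Q * sqrt (real Q * J) * (1 + real M)"
        by (metis mult.assoc mult.commute)
      have "sqrt (real Q / J) * Y = sqrt (real Q / J) * (real Q * J * (1 + real M)) + sqrt (real Q / J) * ((1 + ln (real Q)) * 4 ^ M * b ^ M)"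
        unfolding Y_def J_def[symmetric] by (rule distrib_left)
      then show ?thesis unfolding * by (simp only: mult.assoc)
    qed
    also have "J * R = 8 * C3 * (real Q * sqrt (real Q * J)) + C4 * (J * real Q * (1 + real M + ln (real Q)))"
    proof -
      have "sqrt (real Q / J) * J = sqrt (real Q * J)"
        using J by (intro sqrt_divide_mult) auto
      then have "8 * C3 * (real Q * (sqrt (real Q / J) * J)) = 8 * C3 * (real Q * sqrt (real Q * J))" by simp
      then have "J * (C3 * (8 * real Q * sqrt (real Q / J))) = 8 * C3 * (real Q * sqrt (real Q * J))" by (simp only: mult_ac)
      then show ?thesis unfolding R_def distrib_left[of J] by (simp only: mult_ac)
    qed
    finally have fin: "(\<Sum>j\<in>X. norm (curve_sum f A B Q j)) \<le>
       C1 * (real Q * sqrt (real Q * J) * (1 + real M) + sqrt (real Q / J) * (1 + ln (real Q)) * 4 ^ M * b ^ M) +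
       (8 * C3 * (real Q * sqrt (real Q * J)) + C4 * (J * real Q * (1 + real M + ln (real Q))))" .
    define T1 where "T1 = real Q * sqrt (real Q * J) * (1 + real M)"
    define T2 where "T2 = sqrt (real Q / J) * (1 + ln (real Q)) * 4 ^ M * b ^ M"
    define T3 where "T3 = J * real Q * (1 + real M + ln (real Q))"
    have T: "0 \<le> T1" "0 \<le> T2" "0 \<le> T3" "real Q * sqrt (real Q * J) \<le> T1"
      unfolding T1_def T2_def T3_def using lnQ b J by (auto simp: distrib_left)
    have "(\<Sum>j\<in>X. norm (curve_sum f A B Q j)) \<le> C1 * (T1 + T2) + (8 * C3 * T1 + C4 * T3)"
    proof -
      have "8 * C3 * (real Q * sqrt (real Q * J)) \<le> 8 * C3 * T1" using T(4) pos by (intro mult_left_mono) auto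
      then show ?thesis using fin unfolding T1_def[symmetric] T2_def[symmetric] T3_def[symmetric] by linarith
    qed
    also have "\<dots> \<le> CC * (T1 + T2 + T3)"
    proof -
      have nn: "0 \<le> C1 * T3" "0 \<le> 8 * C3 * T2" "0 \<le> 8 * C3 * T3" "0 \<le> C4 * T1" "0 \<le> C4 * T2" using T pos by simp_all
      show ?thesis unfolding CC_def distrib_left distrib_right using nn by linarith
    qed
    finally show ?thesis by (simp add: X_def T1_def T2_def T3_def J_def)
  qed
  moreover have "CC > 0" using pos by (simp add: CC_def)
  ultimately show ?thesis by blast
qed

text \<open>Subtracting a linear function affects neither curvature nor smoothness. With an integer
  slope it does not affect \<open>curve_sum\<close> either, because the phase changes by an integer;
  this reduces every arc to one whose initial slope lies between 0 and 1.\<close>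

lemma curved_arc_shift:
  assumes "curved_arc c A B f f' f''"
  shows "curved_arc c A B (\<lambda>x. f x - k * x) (\<lambda>x. f' x - k) f''"
proof -
  interpret curved_arc c A B f f' f'' by (rule assms)
  have "surj (\<lambda>x. f' x - k)"
  proof (rule surjI)
    show "f' (inv f' (y + k)) - k = y" for y by (simp add: curv_inv[OF cv])
  qed
  then have "curv c (\<lambda>x. f x - k * x) (\<lambda>x. f' x - k)"
    using cv unfolding curv_def by (auto simp: algebra_simps)
  then show ?thesis
    using c AB cont2 bound2 deriv1 deriv2 by unfold_locales (auto intro!: derivative_eq_intros)
qed

lemma curve_sum_shift:
  "curve_sum (\<lambda>x. f x - of_int m * x) A B Q j = curve_sum f A B Q j"
  unfolding curve_sum_def
proof (intro sum.cong refl)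
  fix q :: nat and a :: int assume q: "q \<in> {1..Q}"
  have "real q * (real j * (f (of_int a / real q) - of_int m * (of_int a / real q))) =
     real q * (real j * f (of_int a / real q)) + of_int (- (int j * m * a))"
    using q by (simp add: algebra_simps)
  then show "e2pi (real q * (real j * (f (of_int a / real q) - of_int m * (of_int a / real q)))) =
     e2pi (real q * (real j * f (of_int a / real q)))" by (simp only: e2pi_add_int)
qed

lemma block_bound':
  assumes c: "0 < c" "c \<le> 1" and b: "b > 1" and l: "l > 0"
  shows "\<exists>C>0. \<forall>A B f f' f'' Q M. curved_arc c A B f f' f'' \<longrightarrow> B - A \<le> l \<longrightarrow>
     avoids A Q \<longrightarrow> avoids B Q \<longrightarrow> 0 < Q \<longrightarrow>
     (\<Sum>j\<in>dyadic_block M. norm (curve_sum f A B Q j)) \<le>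
       C * (real Q * sqrt (real Q * 2 ^ M) * (1 + real M) + sqrt (real Q / 2 ^ M) * (1 + ln (real Q)) * 4 ^ M * b ^ M +
            2 ^ M * real Q * (1 + real M + ln (real Q)))"
proof -
  obtain C where C: "C > 0" and bd: "\<And>A B f f' f'' Q M. curved_arc c A B f f' f'' \<Longrightarrow> B - A \<le> l \<Longrightarrow> 0 \<le> f' A \<Longrightarrow> f' A \<le> 1 \<Longrightarrow>
     avoids A Q \<Longrightarrow> avoids B Q \<Longrightarrow> 0 < Q \<Longrightarrow>
     (\<Sum>j\<in>dyadic_block M. norm (curve_sum f A B Q j)) \<le>
       C * (real Q * sqrt (real Q * 2 ^ M) * (1 + real M) + sqrt (real Q / 2 ^ M) * (1 + ln (real Q)) * 4 ^ M * b ^ M +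
            2 ^ M * real Q * (1 + real M + ln (real Q)))"
    using block_bound[OF c b l] by blast
  show ?thesis
  proof (intro exI[of _ C] conjI allI impI C)
    fix A B f f' f'' Q M
    assume h: "curved_arc c A B f f' f''" "B - A \<le> l" "avoids A Q" "avoids B Q" "0 < Q"
    define m where "m = \<lfloor>f' A\<rfloor>"
    have "0 \<le> f' A - of_int m" "f' A - of_int m \<le> 1" unfolding m_def by linarith+
    from bd[OF curved_arc_shift[OF h(1), of "of_int m"] h(2) this h(3-5)]
    show "(\<Sum>j\<in>dyadic_block M. norm (curve_sum f A B Q j)) \<le>
       C * (real Q * sqrt (real Q * 2 ^ M) * (1 + real M) + sqrt (real Q / 2 ^ M) * (1 + ln (real Q)) * 4 ^ M * b ^ M +
            2 ^ M * real Q * (1 + real M + ln (real Q)))" unfolding curve_sum_shift .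
  qed
qed

section \<open>Summation against the Fourier weights of the trapezoid\<close>

lemma sum_linear_geometric_le:
  fixes s :: real
  assumes "0 \<le> s" "s < 1"
  shows "(\<Sum>k<K. (1 + real k) * s ^ k) \<le> 1 / (1 - s)\<^sup>2"
proof -
  have "(1 - s)\<^sup>2 * (\<Sum>k<K. (1 + real k) * s ^ k) = 1 - (1 + real K) * s ^ K + real K * s ^ Suc K"
    by (induction K) (simp_all add: algebra_simps power2_eq_square)
  also have "\<dots> \<le> 1"
  proof -
    have "real K * s ^ Suc K \<le> real K * s ^ K" using assms by (intro mult_left_mono) (auto simp: mult_left_le_one_le)
    moreover have "0 \<le> s ^ K" using assms by simp
    ultimately show ?thesis by (simp add: distrib_right)
  qed
  finally show ?thesis using assms by (simp add: pos_le_divide_eq mult.commute)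
qed

lemma sum_two_sided_geometric_le:
  fixes s :: real
  assumes s: "0 \<le> s" "s < 1"
  shows "(\<Sum>M<K. (1 + \<bar>real M - real N\<bar>) * s ^ (if M \<le> N then N - M else M - N)) \<le> 2 / (1 - s)\<^sup>2"
proof -
  define F where "F k = (1 + real k) * s ^ k" for k
  have F: "0 \<le> F k" for k using s by (simp add: F_def)
  have "(\<Sum>M<K. (1 + \<bar>real M - real N\<bar>) * s ^ (if M \<le> N then N - M else M - N)) \<le>
     (\<Sum>M\<in>{..N} \<union> {N<..<K}. (1 + \<bar>real M - real N\<bar>) * s ^ (if M \<le> N then N - M else M - N))"
    using s by (intro sum_mono2) auto
  also have "\<dots> = (\<Sum>M\<le>N. F (N - M)) + (\<Sum>M\<in>{N<..<K}. F (M - N))"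
    by (subst sum.union_disjoint) (auto simp: F_def of_nat_diff intro!: arg_cong2[of _ _ _ _ "(+)"] sum.cong)
  also have "(\<Sum>M\<le>N. F (N - M)) = (\<Sum>k<Suc N. F k)"
    by (rule sum.reindex_bij_witness[of _ "\<lambda>k. N - k" "\<lambda>M. N - M"]) auto
  also have "(\<Sum>M\<in>{N<..<K}. F (M - N)) = (\<Sum>k\<in>(\<lambda>M. M - N) ` {N<..<K}. F k)"
    by (subst sum.reindex) (auto simp: inj_on_def)
  also have "\<dots> \<le> (\<Sum>k<K. F k)" using F by (intro sum_mono2) auto
  also have "(\<Sum>k<Suc N. F k) \<le> 1 / (1 - s)\<^sup>2" unfolding F_def by (rule sum_linear_geometric_le[OF s])
  also have "(\<Sum>k<K. F k) \<le> 1 / (1 - s)\<^sup>2" unfolding F_def by (rule sum_linear_geometric_le[OF s])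
  finally show ?thesis by simp
qed

lemma dyadic_log_bounds:
  assumes "1 \<le> (x::real)"
  obtains N where "2 ^ N \<le> x" "x \<le> 2 ^ (N + 1)"
proof -
  have "1 \<le> nat \<lfloor>x\<rfloor>" using assms by linarith
  then obtain N where N: "2 ^ N \<le> nat \<lfloor>x\<rfloor>" "nat \<lfloor>x\<rfloor> < 2 ^ (N + 1)"
    using ex_power_ivl1[of 2 "nat \<lfloor>x\<rfloor>"] by auto
  have "real (2 ^ N) \<le> real (nat \<lfloor>x\<rfloor>)" "real (nat \<lfloor>x\<rfloor> + 1) \<le> real (2 ^ (N + 1))"
    using N by (simp_all only: of_nat_le_iff)
  then have "2 ^ N \<le> real (nat \<lfloor>x\<rfloor>)" "real (nat \<lfloor>x\<rfloor>) + 1 \<le> 2 ^ (N + 1)" by simp_all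
  then show ?thesis using assms by (intro that[of N]) linarith+
qed

text \<open>The factor in front of \<open>1 + real M\<close> peaks where 2^M is about 1/d, and on
  either side it is dominated by a geometric decay with ratio sqrt(1/2). Splitting
  \<open>1 + real M\<close> into (1 + N)(1 + |M - N|) evaluates the logarithm at the peak and leaves
  a convergent sum. Hence log(1/d) appears and not the number of terms.\<close>

lemma main_weight_sum:
  assumes d: "0 < d" "d \<le> 1 / 2"
  shows "(\<Sum>M<K. min d (2 / 2 ^ M) * sqrt (2 ^ M) * (1 + real M)) \<le> 384 * (sqrt d * ln (1 / d))"
proof -
  define s where "s = sqrt (1 / 2)"
  have s: "0 < s" "s < 1" "s \<le> 3 / 4" "s * s = 1 / 2"
  proof -
    show "0 < s" "s < 1" "s * s = 1 / 2" by (simp_all add: s_def)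
    show "s \<le> 3 / 4" unfolding s_def by (rule real_le_lsqrt) (auto simp: power2_eq_square)
  qed
  obtain N where N: "2 ^ N \<le> 1 / d" "1 / d \<le> 2 ^ (N + 1)" using dyadic_log_bounds[of "1 / d"] d by auto
  have each: "min d (2 / 2 ^ M) * sqrt (2 ^ M) * (1 + real M) \<le>
     (4 * sqrt d * (1 + real N)) * ((1 + \<bar>real M - real N\<bar>) * s ^ (if M \<le> N then N - M else M - N))" for M
  proof -
    have 1: "min d (2 / 2 ^ M) * sqrt (2 ^ M) \<le> 4 * sqrt d * s ^ (if M \<le> N then N - M else M - N)"
    proof (cases "M \<le> N")
      case True
      define k where "k = N - M"
      have NM: "N = M + k" using True by (simp add: k_def)
      have "d * 2 ^ M = d * 2 ^ N * (1 / 2) ^ k" by (simp add: NM power_add power_divide)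
      also have "\<dots> \<le> 1 * (1 / 2) ^ k" using N(1) d by (intro mult_right_mono) (auto simp: pos_le_divide_eq mult.commute)
      finally have "sqrt (d * 2 ^ M) \<le> sqrt ((1 / 2) ^ k)" by (intro real_sqrt_le_mono) simp
      also have "\<dots> = s ^ k" by (simp add: s_def real_sqrt_power)
      finally have x: "sqrt d * sqrt (2 ^ M) \<le> s ^ k" by (simp add: real_sqrt_mult)
      have "min d (2 / 2 ^ M) * sqrt (2 ^ M) \<le> (sqrt d * sqrt d) * sqrt (2 ^ M)" using d by (intro mult_right_mono) auto
      also have "\<dots> = sqrt d * (sqrt d * sqrt (2 ^ M))" by simp
      also have "\<dots> \<le> sqrt d * s ^ k" using x d by (intro mult_left_mono) auto
      also have "\<dots> \<le> 4 * sqrt d * s ^ k" using d s by simp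
      finally show ?thesis using True by (simp add: k_def)
    next
      case False
      define k where "k = M - N"
      have MN: "M = N + k" using False by (simp add: k_def)
      have "(1::real) / 2 ^ M = (1 / 2 ^ (N + 1)) * 2 * (1 / 2) ^ k" by (simp add: MN power_add power_divide)
      also have "\<dots> \<le> d * 2 * (1 / 2) ^ k"
      proof (intro mult_right_mono)
        show "1 / 2 ^ (N + 1) \<le> d" using N(2) d by (simp add: field_simps)
      qed auto
      finally have "sqrt (1 / 2 ^ M) \<le> sqrt (d * 2 * (1 / 2) ^ k)" by (rule real_sqrt_le_mono)
      also have "\<dots> = sqrt d * sqrt 2 * s ^ k" by (simp add: s_def real_sqrt_mult real_sqrt_power)
      also have "\<dots> \<le> sqrt d * 2 * s ^ k"
        using d s by (intro mult_right_mono mult_left_mono) (auto intro: real_le_lsqrt)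
      finally have x: "1 / sqrt (2 ^ M) \<le> sqrt d * 2 * s ^ k" by (simp add: real_sqrt_divide)
      have "min d (2 / 2 ^ M) * sqrt (2 ^ M) \<le> 2 / 2 ^ M * sqrt (2 ^ M)" by (intro mult_right_mono) auto
      also have "\<dots> = 2 * (1 / sqrt (2 ^ M))"
      proof -
        have "(2::real) ^ M = sqrt (2 ^ M) * sqrt (2 ^ M)" by simp
        then show ?thesis by (simp add: divide_simps)
      qed
      also have "\<dots> \<le> 2 * (sqrt d * 2 * s ^ k)" using x by (intro mult_left_mono) auto
      finally show ?thesis using False by (simp add: k_def)
    qed
    have 2: "1 + real M \<le> (1 + real N) * (1 + \<bar>real M - real N\<bar>)"
    proof -
      have "0 \<le> real N * \<bar>real M - real N\<bar>" by simp
      moreover have "(1 + real N) * (1 + \<bar>real M - real N\<bar>) = 1 + real N + \<bar>real M - real N\<bar> + real N * \<bar>real M - real N\<bar>"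
        by (simp add: distrib_left distrib_right)
      ultimately show ?thesis by linarith
    qed
    have "min d (2 / 2 ^ M) * sqrt (2 ^ M) * (1 + real M) \<le>
       (4 * sqrt d * s ^ (if M \<le> N then N - M else M - N)) * ((1 + real N) * (1 + \<bar>real M - real N\<bar>))"
      by (rule mult_mono[OF 1 2]) (use d s in auto)
    then show ?thesis by (simp only: mult_ac)
  qed
  have "(\<Sum>M<K. min d (2 / 2 ^ M) * sqrt (2 ^ M) * (1 + real M)) \<le>
     (\<Sum>M<K. (4 * sqrt d * (1 + real N)) * ((1 + \<bar>real M - real N\<bar>) * s ^ (if M \<le> N then N - M else M - N)))"
    by (intro sum_mono each)
  also have "\<dots> = (4 * sqrt d * (1 + real N)) * (\<Sum>M<K. (1 + \<bar>real M - real N\<bar>) * s ^ (if M \<le> N then N - M else M - N))"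
    by (simp add: sum_distrib_left)
  \<comment> \<open>The 32 is 2 / (1/4)^2, from s \<le> 3/4. The final 384 is 4 times 32 times 3,
    where 1 + N \<le> 3 ln(1/d) relies on d \<le> 1/2.\<close>
  also have "\<dots> \<le> (4 * sqrt d * (1 + real N)) * 32"
  proof (intro mult_left_mono)
    have "(\<Sum>M<K. (1 + \<bar>real M - real N\<bar>) * s ^ (if M \<le> N then N - M else M - N)) \<le> 2 / (1 - s)\<^sup>2"
      using s by (intro sum_two_sided_geometric_le) auto
    also have "\<dots> \<le> 2 / (1 / 4)\<^sup>2" using s by (intro divide_left_mono power_mono mult_pos_pos) auto
    finally show "(\<Sum>M<K. (1 + \<bar>real M - real N\<bar>) * s ^ (if M \<le> N then N - M else M - N)) \<le> 32"
      by (simp add: power2_eq_square)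
  qed (use d in auto)
  also have "\<dots> = 128 * (sqrt d * (1 + real N))" by simp
  also have "\<dots> \<le> 128 * (sqrt d * (3 * ln (1 / d)))"
  proof (intro mult_left_mono)
    have "ln (2 ^ N) \<le> ln (1 / d)" using N(1) d by (subst ln_le_cancel_iff) auto
    then have "real N * ln 2 \<le> ln (1 / d)" by (simp add: ln_realpow)
    moreover have "ln 2 \<le> ln (1 / d)" using d by (subst ln_le_cancel_iff) (auto simp: field_simps)
    moreover have "(1 + real N) * (2 / 3) \<le> (1 + real N) * ln 2" using ln2_ge_two_thirds by (intro mult_left_mono) auto
    ultimately show "1 + real N \<le> 3 * ln (1 / d)" by (simp add: distrib_right)
  qed (use d in auto)
  finally show ?thesis by simp
qed

text \<open>Replaces a peak at x = 1 by one small power. With x = Q / 2^M the right side is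
  geometric in M, so the sums over M are bounded regardless of their length, at the cost of a factor
  Q^t.\<close>

lemma min_sqrt_le_powr:
  fixes x t :: real
  assumes "x > 0" "0 \<le> t" "t \<le> 1 / 2"
  shows "min (sqrt (1 / x)) (sqrt x) \<le> x powr t" "min 1 x \<le> x powr t"
proof -
  show "min (sqrt (1 / x)) (sqrt x) \<le> x powr t"
  proof (cases "x \<ge> 1")
    case True
    have "sqrt (1 / x) \<le> sqrt 1" using True by (intro real_sqrt_le_mono) simp
    also have "\<dots> \<le> x powr t" using True assms by (simp add: ge_one_powr_ge_zero)
    finally show ?thesis by (simp add: min_le_iff_disj)
  next
    case False
    have "sqrt x = x powr (1 / 2)" using assms by (simp add: powr_half_sqrt)
    also have "\<dots> \<le> x powr t" using False assms by (intro powr_mono') auto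
    finally show ?thesis by (simp add: min_le_iff_disj)
  qed
  show "min 1 x \<le> x powr t"
  proof (cases "x \<ge> 1")
    case True
    then show ?thesis using assms by (simp add: ge_one_powr_ge_zero min_le_iff_disj)
  next
    case False
    have "x = x powr 1" using assms by simp
    also have "\<dots> \<le> x powr t" using False assms by (intro powr_mono') auto
    finally show ?thesis by (simp add: min_le_iff_disj)
  qed
qed

lemma sum_le_sum_dyadic_blocks:
  fixes w :: "nat \<Rightarrow> real"
  assumes "\<And>j. 0 \<le> w j"
  shows "(\<Sum>j=1..K. w j) \<le> (\<Sum>M<K + 1. \<Sum>j\<in>dyadic_block M. w j)"
proof -
  have "(\<Sum>j=1..K. w j) \<le> (\<Sum>j=1..K. \<Sum>M<K + 1. if j \<in> dyadic_block M then w j else 0)"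
  proof (rule sum_mono)
    fix j assume j: "j \<in> {1..K}"
    then obtain M where M: "2 ^ M < 2 * int j" "int j \<le> 2 ^ M" using ex_dyadic[of "int j"] by auto
    have "int (2 ^ M) < int (2 * j)" "int j \<le> int (2 ^ M)" using M by simp_all
    then have M': "2 ^ M < 2 * j" "j \<le> 2 ^ M" by (simp_all only: of_nat_less_iff of_nat_le_iff)
    have "M < K + 1"
    proof (cases M)
      case (Suc k)
      have "2 ^ k < j" using M'(1) Suc by simp
      then have "k < j" by (rule less_trans[OF less_exp])
      then show ?thesis using j Suc by simp
    qed simp
    then have "w j = (\<Sum>M'\<in>{M}. if j \<in> dyadic_block M' then w j else 0)" using M' by (simp add: dyadic_block_def)
    also have "\<dots> \<le> (\<Sum>M<K + 1. if j \<in> dyadic_block M then w j else 0)"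
      using \<open>M < K + 1\<close> assms by (intro sum_mono2) auto
    finally show "w j \<le> (\<Sum>M<K + 1. if j \<in> dyadic_block M then w j else 0)" .
  qed
  also have "\<dots> = (\<Sum>M<K + 1. \<Sum>j=1..K. if j \<in> dyadic_block M then w j else 0)" by (rule sum.swap)
  also have "\<dots> = (\<Sum>M<K + 1. \<Sum>j\<in>{1..K} \<inter> dyadic_block M. w j)" by (simp add: sum.inter_restrict)
  also have "\<dots> \<le> (\<Sum>M<K + 1. \<Sum>j\<in>dyadic_block M. w j)"
    using assms by (intro sum_mono sum_mono2 finite_dyadic_block) auto
  finally show ?thesis .
qed

text \<open>Independence of \<open>K\<close> is essential, since the Fourier truncation is later
  sent to infinity. The main term uses the part min(d, 1/j) of the weight; the two other terms use
  min(1/j, Q/j^2), whose branches cross at j = Q.\<close>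

lemma weighted_curve_sums:
  assumes c: "0 < c" "c \<le> 1" and l: "l > 0" and eps: "\<epsilon> > 0"
  shows "\<exists>C>0. \<forall>A B f f' f'' Q d K. curved_arc c A B f f' f'' \<longrightarrow> B - A \<le> l \<longrightarrow>
     avoids A Q \<longrightarrow> avoids B Q \<longrightarrow> 0 < Q \<longrightarrow> 0 < d \<longrightarrow> d \<le> 1 / 2 \<longrightarrow>
     (\<Sum>j=1..K. min d (min (1 / real j) (real Q / (real j)\<^sup>2)) * norm (curve_sum f A B Q j)) \<le>
       C * (sqrt d * ln (1 / d) * real Q powr (3 / 2) + real Q powr (1 + \<epsilon>))"
proof -
  \<comment> \<open>One power Q^t pays for the interpolation between the two branches of the weight,
    another for the factor 1 + ln Q; hence the requirement 2 t \<le> \<epsilon>.\<close>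
  define t where "t = min (\<epsilon> / 2) (1 / 2)"
  have t: "t > 0" "t \<le> 1 / 2" "2 * t \<le> \<epsilon>" using eps by (auto simp: t_def min_def)
  \<comment> \<open>The loss \<open>b\<close> per level of the counting bound must stay below the
    gain 1/p per level of the weights: here b p = 2^(-t/2) < 1.\<close>
  define b where "b = 2 powr (t / 2)"
  define p where "p = 2 powr (- t)"
  have b: "b > 1" using t by (simp add: b_def)
  have p: "0 < p" "p < 1" "0 < b * p" "b * p < 1"
  proof -
    show "0 < p" by (simp add: p_def)
    show "p < 1" using t powr_less_cancel_iff[of 2 "- t" 0] by (simp add: p_def)
    have bp: "b * p = 2 powr (- (t / 2))" by (simp add: b_def p_def flip: powr_add)
    show "0 < b * p" unfolding bp by simp
    show "b * p < 1" unfolding bp using t powr_less_cancel_iff[of 2 "- (t / 2)" 0] by simp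
  qed
  obtain C where C: "C > 0" and bd: "\<And>A B f f' f'' Q M. curved_arc c A B f f' f'' \<Longrightarrow> B - A \<le> l \<Longrightarrow>
     avoids A Q \<Longrightarrow> avoids B Q \<Longrightarrow> 0 < Q \<Longrightarrow>
     (\<Sum>j\<in>dyadic_block M. norm (curve_sum f A B Q j)) \<le>
       C * (real Q * sqrt (real Q * 2 ^ M) * (1 + real M) + sqrt (real Q / 2 ^ M) * (1 + ln (real Q)) * 4 ^ M * b ^ M +
            2 ^ M * real Q * (1 + real M + ln (real Q)))"
    using block_bound'[OF c b l] by blast
  define C5 where "C5 = 4 * (1 + 1 / t) * (1 / (1 - b * p) + 1 / (1 - p)\<^sup>2)"
  have C5: "C5 > 0" unfolding C5_def using t p by (intro mult_pos_pos add_pos_pos) auto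
  have "(\<Sum>j=1..K. min d (min (1 / real j) (real Q / (real j)\<^sup>2)) * norm (curve_sum f A B Q j)) \<le>
       C * (384 + C5) * (sqrt d * ln (1 / d) * real Q powr (3 / 2) + real Q powr (1 + \<epsilon>))"
    if h: "curved_arc c A B f f' f''" "B - A \<le> l" "avoids A Q" "avoids B Q" "0 < Q" and d: "0 < d" "d \<le> 1 / 2"
    for A B f f' f'' Q d K
  proof -
    have Q: "real Q \<ge> 1" using h(5) by simp
    have lnQ: "0 \<le> ln (real Q)" using Q by simp
    define w where "w M = min d (min (2 / 2 ^ M) (4 * real Q / 4 ^ M))" for M :: nat
    have w0: "0 \<le> w M" for M using d by (simp add: w_def)
    have "(\<Sum>j=1..K. min d (min (1 / real j) (real Q / (real j)\<^sup>2)) * norm (curve_sum f A B Q j)) \<le>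
       (\<Sum>M<K + 1. \<Sum>j\<in>dyadic_block M. min d (min (1 / real j) (real Q / (real j)\<^sup>2)) * norm (curve_sum f A B Q j))"
      using d by (intro sum_le_sum_dyadic_blocks mult_nonneg_nonneg) auto
    also have "\<dots> \<le> (\<Sum>M<K + 1. \<Sum>j\<in>dyadic_block M. w M * norm (curve_sum f A B Q j))"
    proof (intro sum_mono mult_right_mono)
      fix M j assume "j \<in> dyadic_block M"
      note j = dyadic_block_real[OF this]
      have j0: "real j > 0" using j(1) by simp
      have 1: "1 / real j \<le> 2 / 2 ^ M" using j j0 by (simp add: field_simps)
      have "(4::real) ^ M = 2 ^ M * 2 ^ M" by (simp flip: power_mult_distrib)
      also have "\<dots> \<le> (2 * real j) * (2 * real j)" using j(2) by (intro mult_mono) auto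
      also have "\<dots> = 4 * (real j)\<^sup>2" by (simp add: power2_eq_square)
      finally have "4 * real Q / (4 * (real j)\<^sup>2) \<le> 4 * real Q / 4 ^ M" using j0 by (intro divide_left_mono) auto
      then have 2: "real Q / (real j)\<^sup>2 \<le> 4 * real Q / 4 ^ M" by simp
      show "min d (min (1 / real j) (real Q / (real j)\<^sup>2)) \<le> w M" unfolding w_def using 1 2 by (intro min.mono) auto
    qed simp
    also have "\<dots> = (\<Sum>M<K + 1. w M * (\<Sum>j\<in>dyadic_block M. norm (curve_sum f A B Q j)))"
      by (simp only: sum_distrib_left)
    also have "\<dots> \<le> (\<Sum>M<K + 1. w M * (C * (real Q * sqrt (real Q * 2 ^ M) * (1 + real M) + sqrt (real Q / 2 ^ M) * (1 + ln (real Q)) * 4 ^ M * b ^ M +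
            2 ^ M * real Q * (1 + real M + ln (real Q)))))"
      by (intro sum_mono mult_left_mono bd[OF h] w0)
    also have "\<dots> \<le> (\<Sum>M<K + 1. C * (real Q powr (3 / 2) * (min d (2 / 2 ^ M) * sqrt (2 ^ M) * (1 + real M)) +
         4 * real Q powr (1 + t) * (1 + ln (real Q)) * (b * p) ^ M + 4 * real Q powr (1 + t) * (1 + ln (real Q)) * ((1 + real M) * p ^ M)))"
    proof (rule sum_mono)
      fix M
      define J :: real where "J = 2 ^ M"
      have J: "J > 0" by (simp add: J_def)
      have J4: "(4::real) ^ M = J * J" by (simp add: J_def flip: power_mult_distrib)
      define x where "x = real Q / J"
      have x: "x > 0" using Q J by (simp add: x_def)
      have xp: "x powr t = real Q powr t * p ^ M"
      proof -
        have "p ^ M = p powr real M" using p by (simp add: powr_realpow)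
        also have "\<dots> = 2 powr (- (t * real M))" by (simp add: p_def powr_powr)
        also have "\<dots> = J powr (- t)" by (simp add: J_def powr_powr flip: powr_realpow) (simp add: mult.commute)
        finally show ?thesis using Q J by (simp add: x_def powr_divide powr_minus_divide)
      qed
      have Qp: "real Q * real Q powr t = real Q powr (1 + t)" using Q by (simp add: powr_add)
      have TA: "w M * (real Q * sqrt (real Q * 2 ^ M) * (1 + real M)) \<le> real Q powr (3 / 2) * (min d (2 / 2 ^ M) * sqrt (2 ^ M) * (1 + real M))"
      proof -
        have "real Q powr (3 / 2) = real Q powr (1 + 1 / 2)" by simp
        also have "\<dots> = real Q * sqrt (real Q)" using Q by (simp only: powr_add powr_half_sqrt) simp
        finally have q: "real Q powr (3 / 2) = real Q * sqrt (real Q)" .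
        have "w M \<le> min d (2 / 2 ^ M)" by (simp add: w_def)
        then have "w M * (real Q * sqrt (real Q * 2 ^ M) * (1 + real M)) \<le> min d (2 / 2 ^ M) * (real Q * sqrt (real Q * 2 ^ M) * (1 + real M))"
          by (intro mult_right_mono) auto
        also have "\<dots> = real Q powr (3 / 2) * (min d (2 / 2 ^ M) * sqrt (2 ^ M) * (1 + real M))"
          unfolding q real_sqrt_mult by (simp only: mult_ac)
        finally show ?thesis .
      qed
      have w2: "w M \<le> min (2 / J) (4 * real Q / (J * J))" unfolding w_def J4 J_def[symmetric] by (rule min.cobounded2)
      have TB: "w M * (sqrt (real Q / 2 ^ M) * (1 + ln (real Q)) * 4 ^ M * b ^ M) \<le> 4 * real Q powr (1 + t) * (1 + ln (real Q)) * (b * p) ^ M"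
      proof -
        have "min (2 / J) (4 * real Q / (J * J)) * (sqrt x * (J * J)) \<le> 4 * real Q * min (sqrt (1 / x)) (sqrt x)"
        proof -
          have "2 / J * (sqrt x * (J * J)) = 2 * (J * sqrt x)" using J by simp
          also have "J * sqrt x = real Q * sqrt (1 / x)"
          proof -
            have "J * sqrt x = sqrt (real Q * J)" using sqrt_divide_mult(1)[OF J, of "real Q"] by (simp add: x_def mult.commute)
            also have "\<dots> = real Q * sqrt (J / real Q)" using sqrt_divide_mult(1)[of "real Q" J] Q by (simp add: mult.commute)
            finally show ?thesis by (simp add: x_def)
          qed
          also have "2 * (real Q * sqrt (1 / x)) \<le> 4 * real Q * sqrt (1 / x)" using x by simp
          finally have 1: "2 / J * (sqrt x * (J * J)) \<le> 4 * real Q * sqrt (1 / x)" .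
          have 2: "4 * real Q / (J * J) * (sqrt x * (J * J)) = 4 * real Q * sqrt x" using J by simp
          define u where "u = sqrt (1 / x)"
          define v where "v = sqrt x"
          have nn: "0 \<le> sqrt x * (J * J)" using x J by simp
          have "min (2 / J) (4 * real Q / (J * J)) * (sqrt x * (J * J)) \<le> 4 * real Q * u"
            using mult_right_mono[OF min.cobounded1 nn] 1 unfolding u_def by (rule order_trans)
          moreover have "min (2 / J) (4 * real Q / (J * J)) * (sqrt x * (J * J)) \<le> 4 * real Q * v"
            using mult_right_mono[OF min.cobounded2[of "2 / J" "4 * real Q / (J * J)"] nn] unfolding 2 v_def .
          ultimately show ?thesis unfolding u_def[symmetric] v_def[symmetric]
            by (cases "u \<le> v") (simp_all only: min_absorb1 min_absorb2 linear not_le less_imp_le)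
        qed
        also have "\<dots> \<le> 4 * real Q * x powr t" using min_sqrt_le_powr(1)[OF x, of t] t by (intro mult_left_mono) auto
        finally have m: "min (2 / J) (4 * real Q / (J * J)) * (sqrt x * (J * J)) \<le> 4 * real Q * x powr t" .
        have "w M * (sqrt x * (J * J)) \<le> min (2 / J) (4 * real Q / (J * J)) * (sqrt x * (J * J))"
          using w2 x J by (intro mult_right_mono) auto
        then have "w M * (sqrt x * (J * J)) \<le> 4 * real Q * x powr t" using m by linarith
        then have "w M * (sqrt x * (J * J)) * ((1 + ln (real Q)) * b ^ M) \<le> 4 * real Q * x powr t * ((1 + ln (real Q)) * b ^ M)"
          using lnQ b by (intro mult_right_mono) auto
        also have "\<dots> = 4 * real Q powr (1 + t) * (1 + ln (real Q)) * (b * p) ^ M"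
          by (simp add: xp power_mult_distrib flip: Qp)
        finally show ?thesis unfolding J4 J_def[symmetric] x_def[symmetric] by (simp only: mult_ac)
      qed
      have TC: "w M * (2 ^ M * real Q * (1 + real M + ln (real Q))) \<le> 4 * real Q powr (1 + t) * (1 + ln (real Q)) * ((1 + real M) * p ^ M)"
      proof -
        have "w M * J \<le> min (2 / J) (4 * real Q / (J * J)) * J" using w2 J by (intro mult_right_mono) auto
        also have "\<dots> = min 2 (4 * x)" using J by (simp add: min_mult_distrib_right x_def)
        also have "\<dots> \<le> 4 * min 1 x" by (simp add: min_def)
        also have "\<dots> \<le> 4 * x powr t" using min_sqrt_le_powr(2)[OF x, of t] t by (intro mult_left_mono) auto
        finally have 1: "w M * J \<le> 4 * x powr t" .
        have 2: "real Q * (1 + real M + ln (real Q)) \<le> real Q * ((1 + ln (real Q)) * (1 + real M))"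
          using lnQ by (intro mult_left_mono) (auto simp: distrib_left distrib_right)
        have "w M * J * (real Q * (1 + real M + ln (real Q))) \<le> 4 * x powr t * (real Q * ((1 + ln (real Q)) * (1 + real M)))"
          by (rule mult_mono[OF 1 2]) (use lnQ x in auto)
        also have "\<dots> = 4 * real Q powr (1 + t) * (1 + ln (real Q)) * ((1 + real M) * p ^ M)"
          unfolding xp Qp[symmetric] by (simp only: mult_ac)
        finally show ?thesis unfolding J_def[symmetric] by (simp only: mult_ac)
      qed
      have "w M * (real Q * sqrt (real Q * 2 ^ M) * (1 + real M) + sqrt (real Q / 2 ^ M) * (1 + ln (real Q)) * 4 ^ M * b ^ M +
            2 ^ M * real Q * (1 + real M + ln (real Q))) \<le>
          real Q powr (3 / 2) * (min d (2 / 2 ^ M) * sqrt (2 ^ M) * (1 + real M)) +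
         4 * real Q powr (1 + t) * (1 + ln (real Q)) * (b * p) ^ M + 4 * real Q powr (1 + t) * (1 + ln (real Q)) * ((1 + real M) * p ^ M)"
        unfolding distrib_left[of "w M"] by (intro add_mono TA TB TC)
      then have "C * (w M * (real Q * sqrt (real Q * 2 ^ M) * (1 + real M) + sqrt (real Q / 2 ^ M) * (1 + ln (real Q)) * 4 ^ M * b ^ M +
            2 ^ M * real Q * (1 + real M + ln (real Q)))) \<le>
          C * (real Q powr (3 / 2) * (min d (2 / 2 ^ M) * sqrt (2 ^ M) * (1 + real M)) +
         4 * real Q powr (1 + t) * (1 + ln (real Q)) * (b * p) ^ M + 4 * real Q powr (1 + t) * (1 + ln (real Q)) * ((1 + real M) * p ^ M))"
        using C by (intro mult_left_mono) auto
      then show "w M * (C * (real Q * sqrt (real Q * 2 ^ M) * (1 + real M) + sqrt (real Q / 2 ^ M) * (1 + ln (real Q)) * 4 ^ M * b ^ M +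
            2 ^ M * real Q * (1 + real M + ln (real Q)))) \<le>
          C * (real Q powr (3 / 2) * (min d (2 / 2 ^ M) * sqrt (2 ^ M) * (1 + real M)) +
         4 * real Q powr (1 + t) * (1 + ln (real Q)) * (b * p) ^ M + 4 * real Q powr (1 + t) * (1 + ln (real Q)) * ((1 + real M) * p ^ M))"
        by (simp only: mult.left_commute)
    qed
    also have "\<dots> = C * (real Q powr (3 / 2) * (\<Sum>M<K + 1. min d (2 / 2 ^ M) * sqrt (2 ^ M) * (1 + real M)) +
         4 * real Q powr (1 + t) * (1 + ln (real Q)) * (\<Sum>M<K + 1. (b * p) ^ M) +
         4 * real Q powr (1 + t) * (1 + ln (real Q)) * (\<Sum>M<K + 1. (1 + real M) * p ^ M))"
      by (simp only: sum_distrib_left sum.distrib distrib_left)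
    also have "\<dots> \<le> C * (real Q powr (3 / 2) * (384 * (sqrt d * ln (1 / d))) +
         4 * real Q powr (1 + t) * (1 + ln (real Q)) * (1 / (1 - b * p)) +
         4 * real Q powr (1 + t) * (1 + ln (real Q)) * (1 / (1 - p)\<^sup>2))"
    proof (intro mult_left_mono add_mono main_weight_sum d)
      have "(\<Sum>M<K + 1. (b * p) ^ M) = (1 - (b * p) ^ (K + 1)) / (1 - b * p)"
        using p sum_gp_strict[of "b * p" "K + 1"] by simp
      also have "\<dots> \<le> 1 / (1 - b * p)" using p by (intro divide_right_mono) (auto intro: zero_le_power simp del: power_Suc)
      finally show "(\<Sum>M<K + 1. (b * p) ^ M) \<le> 1 / (1 - b * p)" .
      show "(\<Sum>M<K + 1. (1 + real M) * p ^ M) \<le> 1 / (1 - p)\<^sup>2" using p by (intro sum_linear_geometric_le) auto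
    qed (use lnQ C in auto)
    also have "\<dots> = C * (384 * (sqrt d * ln (1 / d) * real Q powr (3 / 2)) +
         (1 / (1 - b * p) + 1 / (1 - p)\<^sup>2) * (4 * (real Q powr (1 + t) * (1 + ln (real Q)))))"
      by (simp add: distrib_right distrib_left mult_ac)
    also have "\<dots> \<le> C * (384 * (sqrt d * ln (1 / d) * real Q powr (3 / 2)) + C5 * real Q powr (1 + \<epsilon>))"
    proof (intro mult_left_mono add_left_mono)
      have "ln (real Q) \<le> real Q powr t / t" using Q t by (intro ln_powr_bound) auto
      moreover have "1 \<le> real Q powr t" using Q t by (intro ge_one_powr_ge_zero) auto
      ultimately have "1 + ln (real Q) \<le> (1 + 1 / t) * real Q powr t" by (simp add: distrib_right)
      then have "real Q powr (1 + t) * (1 + ln (real Q)) \<le> real Q powr (1 + t) * ((1 + 1 / t) * real Q powr t)"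
        by (intro mult_left_mono) auto
      also have "\<dots> = (1 + 1 / t) * real Q powr (1 + 2 * t)"
      proof -
        have "real Q powr (1 + t) * real Q powr t = real Q powr (1 + t + t)" by (simp only: powr_add)
        also have "1 + t + t = 1 + 2 * t" by simp
        finally have "real Q powr (1 + t) * real Q powr t = real Q powr (1 + 2 * t)" .
        then show ?thesis by (metis mult.left_commute)
      qed
      also have "\<dots> \<le> (1 + 1 / t) * real Q powr (1 + \<epsilon>)" using Q t by (intro mult_left_mono powr_mono) auto
      finally have "(1 / (1 - b * p) + 1 / (1 - p)\<^sup>2) * (4 * (real Q powr (1 + t) * (1 + ln (real Q)))) \<le>
         (1 / (1 - b * p) + 1 / (1 - p)\<^sup>2) * (4 * ((1 + 1 / t) * real Q powr (1 + \<epsilon>)))"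
        using p by (intro mult_left_mono) auto
      then show "(1 / (1 - b * p) + 1 / (1 - p)\<^sup>2) * (4 * (real Q powr (1 + t) * (1 + ln (real Q)))) \<le> C5 * real Q powr (1 + \<epsilon>)"
        unfolding C5_def by (simp only: mult_ac)
    qed (use C in auto)
    also have "\<dots> \<le> C * ((384 + C5) * (sqrt d * ln (1 / d) * real Q powr (3 / 2)) + (384 + C5) * real Q powr (1 + \<epsilon>))"
      using C C5 d by (intro mult_left_mono add_mono mult_right_mono) auto
    also have "\<dots> = C * (384 + C5) * (sqrt d * ln (1 / d) * real Q powr (3 / 2) + real Q powr (1 + \<epsilon>))"
      by (simp only: distrib_left[of "384 + C5"] mult.assoc)
    finally show ?thesis .
  qed
  moreover have "C * (384 + C5) > 0" using C C5 by simp
  ultimately show ?thesis by blast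
qed

section \<open>Trapezoids and counting\<close>

definition tri :: "real \<Rightarrow> real \<Rightarrow> real" where
  "tri r x = max 0 (r - \<bar>x\<bar>)"

text \<open>A squared sinc function: the Fourier transform of \<open>tri r\<close> at the integer
  \<open>h\<close>.\<close>

definition tri_coeff :: "real \<Rightarrow> int \<Rightarrow> real" where
  "tri_coeff r h = (if h = 0 then r\<^sup>2 else (sin (pi * of_int h * r) / (pi * of_int h))\<^sup>2)"

lemma has_integral_linear_e2pi:
  assumes "h \<noteq> 0" "u \<le> v"
  defines "w \<equiv> 2 * pi * real_of_int h"
  shows "((\<lambda>x. of_real (\<alpha> + \<beta> * x) * e2pi (of_int h * x)) has_integral
     ((of_real (\<alpha> + \<beta> * v) / (\<i> * of_real w) + of_real (\<beta> / w\<^sup>2)) * e2pi (of_int h * v) -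
      (of_real (\<alpha> + \<beta> * u) / (\<i> * of_real w) + of_real (\<beta> / w\<^sup>2)) * e2pi (of_int h * u))) {u..v}"
proof (rule fundamental_theorem_of_calculus[OF assms(2)])
  have w: "w \<noteq> 0" using assms(1) by (simp add: w_def)
  fix x assume "x \<in> {u..v}"
  have "((\<lambda>x. of_int h * x) has_real_derivative of_int h) (at x within {u..v})"
    by (auto intro!: derivative_eq_intros)
  note e = e2pi_has_vector_derivative[OF this]
  have "((\<lambda>x. \<alpha> + \<beta> * x) has_real_derivative \<beta>) (at x within {u..v})"
    by (auto intro!: derivative_eq_intros)
  then have l: "((\<lambda>x. complex_of_real (\<alpha> + \<beta> * x) / (\<i> * of_real w) + of_real (\<beta> / w\<^sup>2)) has_vector_derivative of_real \<beta> / (\<i> * of_real w)) (at x within {u..v})"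
    by (intro has_vector_derivative_add_const[THEN iffD2] has_vector_derivative_divide has_vector_derivative_of_real)
  have "(((\<lambda>x. (complex_of_real (\<alpha> + \<beta> * x) / (\<i> * of_real w) + of_real (\<beta> / w\<^sup>2)) * e2pi (of_int h * x))) has_vector_derivative
     (complex_of_real (\<alpha> + \<beta> * x) / (\<i> * of_real w) + of_real (\<beta> / w\<^sup>2)) * (w *\<^sub>R (\<i> * e2pi (of_int h * x))) +
     of_real \<beta> / (\<i> * of_real w) * e2pi (of_int h * x)) (at x within {u..v})"
    using has_vector_derivative_mult[OF l e] by (simp add: w_def)
  moreover have "(complex_of_real (\<alpha> + \<beta> * x) / (\<i> * of_real w) + of_real (\<beta> / w\<^sup>2)) * (w *\<^sub>R (\<i> * e2pi (of_int h * x))) +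
     of_real \<beta> / (\<i> * of_real w) * e2pi (of_int h * x) = of_real (\<alpha> + \<beta> * x) * e2pi (of_int h * x)"
  proof -
    have "(complex_of_real (\<alpha> + \<beta> * x) / (\<i> * of_real w) + of_real (\<beta> / w\<^sup>2)) * (of_real w * \<i>) + of_real \<beta> / (\<i> * of_real w) = of_real (\<alpha> + \<beta> * x)"
      using w by (simp add: field_simps power2_eq_square)
    moreover have "X * (w *\<^sub>R (\<i> * E)) + Y * E = (X * (of_real w * \<i>) + Y) * E" for X Y E
      by (simp only: scaleR_conv_of_real distrib_right mult.assoc)
    ultimately show ?thesis by (simp only:)
  qed
  ultimately show "((\<lambda>x. (complex_of_real (\<alpha> + \<beta> * x) / (\<i> * of_real w) + of_real (\<beta> / w\<^sup>2)) * e2pi (of_int h * x)) has_vector_derivative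
      of_real (\<alpha> + \<beta> * x) * e2pi (of_int h * x)) (at x within {u..v})" by simp
qed

text \<open>On the two linear pieces the boundary terms with 1/w cancel at the apex and vanish at
  the feet. The terms with 1/w^2 form a second difference of the exponential, which is its value at
  t times 2 - 2 cos(w r).\<close>

lemma tri_transform:
  assumes r: "0 \<le> r" and A: "A \<le> t - r" and B: "t + r \<le> B"
  shows "((\<lambda>x. of_real (tri r (t - x)) * e2pi (of_int h * x)) has_integral of_real (tri_coeff r h) * e2pi (of_int h * t)) {A..B}"
proof -
  let ?g = "\<lambda>x. complex_of_real (tri r (t - x)) * e2pi (of_int h * x)"
  have combine: "(?g has_integral I) {A..B}" if I: "I = 0 + (I1 + (I2 + 0))"
    and 1: "((\<lambda>x. complex_of_real ((r - t) + 1 * x) * e2pi (of_int h * x)) has_integral I1) {t - r..t}"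
    and 2: "((\<lambda>x. complex_of_real ((r + t) + (-1) * x) * e2pi (of_int h * x)) has_integral I2) {t..t + r}" for I I1 I2
  proof -
    have "(?g has_integral 0) {A..t - r}" by (rule has_integral_is_0) (auto simp: tri_def)
    moreover have "(?g has_integral I1) {t - r..t}"
      by (rule has_integral_eq[OF _ 1]) (auto simp: tri_def)
    moreover have "(?g has_integral I2) {t..t + r}"
      by (rule has_integral_eq[OF _ 2]) (auto simp: tri_def)
    moreover have "(?g has_integral 0) {t + r..B}" by (rule has_integral_is_0) (auto simp: tri_def)
    ultimately show ?thesis unfolding I
      using r A B by (intro has_integral_combine[of A "t - r" B] has_integral_combine[of "t - r" t B] has_integral_combine[of t "t + r" B]) auto
  qed
  show ?thesis
  proof (cases "h = 0")
    case True
    have 1: "((\<lambda>x. (r - t) + 1 * x) has_integral ((r - t) * t + t\<^sup>2 / 2) - ((r - t) * (t - r) + (t - r)\<^sup>2 / 2)) {t - r..t}"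
      using r by (intro fundamental_theorem_of_calculus)
        (auto intro!: derivative_eq_intros simp flip: has_real_derivative_iff_has_vector_derivative)
    have 2: "((\<lambda>x. (r + t) + (-1) * x) has_integral ((r + t) * (t + r) - (t + r)\<^sup>2 / 2) - ((r + t) * t - t\<^sup>2 / 2)) {t..t + r}"
      using r by (intro fundamental_theorem_of_calculus)
        (auto intro!: derivative_eq_intros simp flip: has_real_derivative_iff_has_vector_derivative)
    have v: "((r - t) * t + t\<^sup>2 / 2) - ((r - t) * (t - r) + (t - r)\<^sup>2 / 2) = r\<^sup>2 / 2"
      "((r + t) * (t + r) - (t + r)\<^sup>2 / 2) - ((r + t) * t - t\<^sup>2 / 2) = r\<^sup>2 / 2"
      by (simp_all add: power2_eq_square field_simps)
    have "(?g has_integral complex_of_real (r\<^sup>2)) {A..B}"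
    proof (rule combine)
      show "complex_of_real (r\<^sup>2) = 0 + (of_real (r\<^sup>2 / 2) + (of_real (r\<^sup>2 / 2) + 0))"
        by (simp flip: of_real_add)
    qed (use True has_integral_of_real[OF 1[unfolded v], where 'b = complex] has_integral_of_real[OF 2[unfolded v], where 'b = complex] in simp_all)
    then show ?thesis using True by (simp add: tri_coeff_def)
  next
    case False
    define w where "w = 2 * pi * real_of_int h"
    have w: "w \<noteq> 0" using False by (simp add: w_def)
    have e1: "e2pi (of_int h * (t - r)) = e2pi (of_int h * t) * e2pi (- (of_int h * r))"
      by (simp add: right_diff_distrib flip: e2pi_add)
    have e2: "e2pi (of_int h * (t + r)) = e2pi (of_int h * t) * e2pi (of_int h * r)"
      by (simp add: distrib_left flip: e2pi_add)
    have cc: "e2pi (of_int h * r) + e2pi (- (of_int h * r)) = of_real (2 * cos (w * r))"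
      by (simp add: e2pi_def complex_eq_iff w_def mult_ac)
    have "tri_coeff r h = (2 - 2 * cos (w * r)) / w\<^sup>2"
    proof -
      have "cos (w * r) = cos (2 * (pi * of_int h * r))" by (simp add: w_def mult_ac)
      then have "2 - 2 * cos (w * r) = 4 * (sin (pi * of_int h * r))\<^sup>2"
        by (simp add: cos_double_sin)
      then show ?thesis using False by (simp add: tri_coeff_def w_def power_divide power_mult_distrib)
    qed
    then have coef: "complex_of_real (tri_coeff r h) = of_real (1 / w\<^sup>2) * (2 - (e2pi (of_int h * r) + e2pi (- (of_int h * r))))"
      unfolding cc by simp
    have tc: "of_real (tri_coeff r h) * e2pi (of_int h * t) =
       of_real (1 / w\<^sup>2) * (2 * e2pi (of_int h * t) - (e2pi (of_int h * (t + r)) + e2pi (of_int h * (t - r))))"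
      unfolding e1 e2 coef by (simp only: algebra_simps)
    have v: "r - t + 1 * t = r" "r - t + 1 * (t - r) = 0" "r + t + - 1 * (t + r) = 0" "r + t + - 1 * t = r"
      "complex_of_real (- 1 / w\<^sup>2) = - of_real (1 / w\<^sup>2)" by simp_all
    have le: "t - r \<le> t" "t \<le> t + r" using r by simp_all
    have aux: "K * (2 * E - (E2 + E1)) = 0 + ((X + K) * E - (of_real 0 / Y + K) * E1 + ((of_real 0 / Y + - K) * E2 - (X + - K) * E + 0))"
      for K E E1 E2 X Y :: complex by (simp add: algebra_simps)
    show ?thesis unfolding tc
      by (rule combine[OF aux has_integral_linear_e2pi[OF False le(1), of "r - t" 1, folded w_def, unfolded v]
        has_integral_linear_e2pi[OF False le(2), of "r + t" "- 1", folded w_def, unfolded v]])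
  qed
qed

lemma tri_lipschitz: "\<bar>tri r x - tri r y\<bar> \<le> \<bar>x - y\<bar>"
  by (auto simp: tri_def max_def)

lemma continuous_on_tri [continuous_intros]: "continuous_on S g \<Longrightarrow> continuous_on S (\<lambda>x. tri r (g x))"
  unfolding tri_def by (intro continuous_intros)

text \<open>These four integers include all those within distance less than 1 of \<open>t\<close>,
  so for r \<le> 1 the sum is the full periodisation. The outer two make room for half-integer
  endpoints around the support.\<close>

definition periodic_tri :: "real \<Rightarrow> real \<Rightarrow> real" where
  "periodic_tri r t = (\<Sum>b\<in>{\<lfloor>t\<rfloor> - 1..\<lfloor>t\<rfloor> + 2}. tri r (t - of_int b))"

text \<open>Cesaro convergence of the Fourier series of the periodised triangle, with a rate. It is
  \<open>fejer_approximation\<close> for a triangle centred at \<open>t\<close>, read with the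
  integral evaluated frequency by frequency. The 7 is the length 4 of the interval plus 3, and
  half-integer endpoints keep the required distance from the integers.\<close>

lemma periodic_tri_approximation:
  assumes r: "0 \<le> r" "r \<le> 1" and H: "H > 0" and \<tau>: "\<tau> > 0" "\<tau> \<le> 1 / 2"
  shows "norm ((\<Sum>k<H. \<Sum>l<H. of_real (tri_coeff r (int k - int l)) * e2pi (of_int (int k - int l) * t)) / of_nat H -
      of_real (periodic_tri r t)) \<le> 7 * (\<tau> + 3 / (real H * \<tau>\<^sup>2))"
proof -
  define A where "A = of_int \<lfloor>t\<rfloor> - 3 / (2::real)"
  define B where "B = of_int \<lfloor>t\<rfloor> + 5 / (2::real)"
  define g where "g x = complex_of_real (tri r (t - x))" for x
  have cg: "continuous_on {A..B} g" unfolding g_def by (intro continuous_intros)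
  have AB: "A \<le> t - r" "t + r \<le> B" using r unfolding A_def B_def by linarith+
  have "norm (integral {A..B} (\<lambda>x. fejer H x *\<^sub>R g x) - (\<Sum>a\<in>{\<lceil>A\<rceil>..\<lfloor>B\<rfloor>}. g (of_int a))) \<le> (B - A + 3) * (1 * \<tau> + 3 / (real H * \<tau>\<^sup>2))"
  proof (rule fejer_approximation[OF H \<tau> _ cg])
    show "A \<le> B" by (simp add: A_def B_def)
    show "norm (g x) \<le> 1" for x using r by (auto simp: g_def tri_def)
    show "norm (g x - g y) \<le> 1 * \<bar>x - y\<bar>" for x y
      using tri_lipschitz[of r "t - x" "t - y"] by (simp add: g_def abs_minus_commute flip: of_real_diff)
    fix a :: int
    have half: "1 / 2 \<le> \<bar>of_int k + 1 / (2::real)\<bar>" for k :: int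
    proof (cases "0 \<le> k")
      case True then show ?thesis by simp
    next
      case False
      then have "k \<le> -1" by simp
      then have "of_int k \<le> (-1 :: real)" by linarith
      then show ?thesis by linarith
    qed
    have "of_int a - A = of_int (a - \<lfloor>t\<rfloor> + 1) + 1 / 2" by (simp add: A_def)
    then show "\<tau> \<le> \<bar>of_int a - A\<bar>" using half[of "a - \<lfloor>t\<rfloor> + 1"] \<tau> by linarith
    have "of_int a - B = of_int (a - \<lfloor>t\<rfloor> - 3) + 1 / 2" by (simp add: B_def)
    then show "\<tau> \<le> \<bar>of_int a - B\<bar>" using half[of "a - \<lfloor>t\<rfloor> - 3"] \<tau> by linarith
  qed simp
  moreover have "B - A + 3 = 7" by (simp add: A_def B_def)
  moreover have "\<lceil>A\<rceil> = \<lfloor>t\<rfloor> - 1" "\<lfloor>B\<rfloor> = \<lfloor>t\<rfloor> + 2" unfolding A_def B_def by linarith+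
  moreover have "integral {A..B} (\<lambda>x. fejer H x *\<^sub>R g x) =
     (\<Sum>k<H. \<Sum>l<H. of_real (tri_coeff r (int k - int l)) * e2pi (of_int (int k - int l) * t)) / of_nat H"
  proof -
    have "integral {A..B} (\<lambda>x. e2pi ((real k - real l) * x) * g x) = of_real (tri_coeff r (int k - int l)) * e2pi (of_int (int k - int l) * t)" for k l
      using integral_unique[OF tri_transform[OF r(1) AB, of "int k - int l"]] by (simp add: g_def mult.commute)
    then show ?thesis unfolding fejer_integral_expand[OF cg] by (simp only:)
  qed
  ultimately show ?thesis by (simp add: periodic_tri_def g_def)
qed

text \<open>A difference of triangles scaled to height 1: it majorises or minorises the indicator of a
  neighbourhood of the integers, and its Fourier coefficients decay quadratically.\<close>
definition trapezoid :: "nat \<Rightarrow> real \<Rightarrow> real \<Rightarrow> real" where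
  "trapezoid Q r t = real Q * (periodic_tri r t - periodic_tri (r - 1 / real Q) t)"

definition trapezoid_coeff :: "nat \<Rightarrow> real \<Rightarrow> int \<Rightarrow> real" where
  "trapezoid_coeff Q r h = real Q * (tri_coeff r h - tri_coeff (r - 1 / real Q) h)"

lemma trapezoid_coeff_0:
  "Q > 0 \<Longrightarrow> trapezoid_coeff Q r 0 = 2 * r - 1 / real Q"
  by (simp add: trapezoid_coeff_def tri_coeff_def power2_eq_square field_simps)

lemma sin_squared_diff: "(sin a)\<^sup>2 - (sin b)\<^sup>2 = sin (a - b) * sin (a + b)" for a b :: real
proof -
  have "sin (a - b) * sin (a + b) = (sin a)\<^sup>2 * (cos b)\<^sup>2 - (cos a)\<^sup>2 * (sin b)\<^sup>2"
    by (simp add: sin_add sin_diff power2_eq_square algebra_simps)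
  also have "\<dots> = (sin a)\<^sup>2 - (sin b)\<^sup>2" by (simp add: cos_squared_eq algebra_simps)
  finally show ?thesis by simp
qed

text \<open>The difference of squared sines factors into sin(k / Q) and sin(k (r + s)). Estimating
  both factors by their arguments, only the first one, or neither gives the three entries of the
  minimum.\<close>

lemma trapezoid_coeff_bound:
  assumes Q: "Q > 0" and r: "1 / real Q \<le> r" and h: "h \<noteq> 0"
  shows "\<bar>trapezoid_coeff Q r h\<bar> \<le> min (2 * r) (min (1 / \<bar>real_of_int h\<bar>) (real Q / (real_of_int h)\<^sup>2))"
proof -
  define k where "k = pi * real_of_int h"
  have k: "\<bar>k\<bar> > 0" "\<bar>k\<bar> \<ge> \<bar>real_of_int h\<bar>"
  proof -
    have "1 * \<bar>real_of_int h\<bar> \<le> pi * \<bar>real_of_int h\<bar>" using pi_ge_two by (intro mult_right_mono) auto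
    then show "\<bar>k\<bar> \<ge> \<bar>real_of_int h\<bar>" by (simp add: k_def abs_mult)
    show "\<bar>k\<bar> > 0" using h by (simp add: k_def)
  qed
  have h0: "\<bar>real_of_int h\<bar> > 0" using h by simp
  define s where "s = r - 1 / real Q"
  have "trapezoid_coeff Q r h = real Q * ((sin (k * r))\<^sup>2 - (sin (k * s))\<^sup>2) / k\<^sup>2"
    using h by (simp add: trapezoid_coeff_def tri_coeff_def k_def s_def power_divide diff_divide_distrib right_diff_distrib)
  also have "\<dots> = real Q * (sin (k * r - k * s) * sin (k * r + k * s)) / k\<^sup>2" by (simp only: sin_squared_diff)
  finally have eq: "\<bar>trapezoid_coeff Q r h\<bar> = real Q * \<bar>sin (k * r - k * s)\<bar> * \<bar>sin (k * r + k * s)\<bar> / k\<^sup>2"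
    by (simp add: abs_mult)
  have rs: "k * r - k * s = k * (1 / real Q)" by (simp add: s_def algebra_simps)
  have b1: "\<bar>sin (k * r - k * s)\<bar> \<le> \<bar>k\<bar> / real Q"
    using abs_sin_x_le_abs_x[of "k * r - k * s"] by (simp add: rs abs_mult)
  have b2: "\<bar>sin (k * r + k * s)\<bar> \<le> \<bar>k\<bar> * (2 * r)"
  proof -
    have "\<bar>sin (k * r + k * s)\<bar> \<le> \<bar>k * r + k * s\<bar>" by (rule abs_sin_x_le_abs_x)
    also have "\<dots> = \<bar>k\<bar> * \<bar>r + s\<bar>" by (simp add: abs_mult flip: distrib_left)
    also have "\<dots> \<le> \<bar>k\<bar> * (2 * r)"
    proof (intro mult_left_mono)
      have "0 < 1 / real Q" using Q by simp
      then show "\<bar>r + s\<bar> \<le> 2 * r" using r unfolding s_def by linarith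
    qed simp
    finally show ?thesis .
  qed
  have kk: "k\<^sup>2 = \<bar>k\<bar> * \<bar>k\<bar>" by (simp add: power2_eq_square)
  have 1: "\<bar>trapezoid_coeff Q r h\<bar> \<le> 2 * r"
  proof -
    have "real Q * \<bar>sin (k * r - k * s)\<bar> * \<bar>sin (k * r + k * s)\<bar> \<le> real Q * (\<bar>k\<bar> / real Q) * (\<bar>k\<bar> * (2 * r))"
      using b1 b2 by (intro mult_mono mult_left_mono) auto
    also have "\<dots> = 2 * r * k\<^sup>2" using Q by (simp add: kk)
    finally show ?thesis unfolding eq using k by (simp add: pos_divide_le_eq)
  qed
  have 2: "\<bar>trapezoid_coeff Q r h\<bar> \<le> 1 / \<bar>real_of_int h\<bar>"
  proof -
    have "real Q * \<bar>sin (k * r - k * s)\<bar> * \<bar>sin (k * r + k * s)\<bar> \<le> real Q * (\<bar>k\<bar> / real Q) * 1"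
      using b1 by (intro mult_mono mult_left_mono) auto
    also have "\<dots> = 1 / \<bar>k\<bar> * k\<^sup>2"
    proof -
      define m where "m = \<bar>k\<bar>"
      have "m > 0" "k\<^sup>2 = m * m" using k(1) by (simp_all add: m_def power2_eq_square)
      then show ?thesis using Q by (simp flip: m_def)
    qed
    finally have "\<bar>trapezoid_coeff Q r h\<bar> \<le> 1 / \<bar>k\<bar>" unfolding eq using k by (subst pos_divide_le_eq) auto
    also have "\<dots> \<le> 1 / \<bar>real_of_int h\<bar>" using k h0 by (intro divide_left_mono) auto
    finally show ?thesis .
  qed
  have 3: "\<bar>trapezoid_coeff Q r h\<bar> \<le> real Q / (real_of_int h)\<^sup>2"
  proof -
    have "real Q * \<bar>sin (k * r - k * s)\<bar> * \<bar>sin (k * r + k * s)\<bar> \<le> real Q * 1 * 1"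
      by (intro mult_mono mult_left_mono) auto
    then have "\<bar>trapezoid_coeff Q r h\<bar> \<le> real Q / k\<^sup>2" unfolding eq by (intro divide_right_mono) auto
    also have "\<dots> \<le> real Q / (real_of_int h)\<^sup>2"
    proof (intro divide_left_mono)
      show "(real_of_int h)\<^sup>2 \<le> k\<^sup>2" using k(2) by (simp add: abs_le_square_iff)
    qed (use k h0 in auto)
    finally show ?thesis .
  qed
  show ?thesis using 1 2 3 by simp
qed

lemma trapezoid_approximation:
  assumes r: "1 / real Q \<le> r" "r \<le> 1" and Q: "Q > 0" and H: "H > 0" and \<tau>: "\<tau> > 0" "\<tau> \<le> 1 / 2"
  shows "norm ((\<Sum>k<H. \<Sum>l<H. of_real (trapezoid_coeff Q r (int k - int l)) * e2pi (of_int (int k - int l) * t)) / of_nat H -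
      of_real (trapezoid Q r t)) \<le> 14 * real Q * (\<tau> + 3 / (real H * \<tau>\<^sup>2))"
proof -
  define s where "s = r - 1 / real Q"
  have s: "0 \<le> s" "s \<le> 1" using r by (auto simp: s_def intro: order_trans[of _ r])
  have r0: "0 \<le> r" using r(1) by (rule order_trans[rotated]) simp
  let ?D = "\<lambda>r. (\<Sum>k<H. \<Sum>l<H. of_real (tri_coeff r (int k - int l)) * e2pi (of_int (int k - int l) * t)) / of_nat H -
      of_real (periodic_tri r t)"
  have "(\<Sum>k<H. \<Sum>l<H. of_real (trapezoid_coeff Q r (int k - int l)) * e2pi (of_int (int k - int l) * t)) / of_nat H -
      of_real (trapezoid Q r t) = of_nat Q * (?D r - ?D s)"
    by (simp add: trapezoid_coeff_def trapezoid_def s_def[symmetric] algebra_simps sum_subtractf diff_divide_distrib sum_distrib_left)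
  then have "norm ((\<Sum>k<H. \<Sum>l<H. of_real (trapezoid_coeff Q r (int k - int l)) * e2pi (of_int (int k - int l) * t)) / of_nat H -
      of_real (trapezoid Q r t)) = real Q * norm (?D r - ?D s)" by (simp add: norm_mult)
  also have "\<dots> \<le> real Q * (norm (?D r) + norm (?D s))" by (intro mult_left_mono norm_triangle_ineq4) auto
  also have "\<dots> \<le> real Q * (7 * (\<tau> + 3 / (real H * \<tau>\<^sup>2)) + 7 * (\<tau> + 3 / (real H * \<tau>\<^sup>2)))"
    using r r0 s by (intro mult_left_mono add_mono periodic_tri_approximation H \<tau>) auto
  also have "\<dots> = 14 * real Q * (\<tau> + 3 / (real H * \<tau>\<^sup>2))" by (simp add: algebra_simps)
  finally show ?thesis .
qed

section \<open>From smooth weights to counts on an arc\<close>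

definition near_count :: "real \<Rightarrow> real \<Rightarrow> nat" where
  "near_count d t = card {b::int. \<bar>t - of_int b\<bar> < d}"

lemma near_count_set: "d \<le> 1 \<Longrightarrow> {b::int. \<bar>t - of_int b\<bar> < d} = {b\<in>{\<lfloor>t\<rfloor> - 1..\<lfloor>t\<rfloor> + 2}. \<bar>t - of_int b\<bar> < d}" for t d :: real
proof (intro set_eqI iffI)
  fix b assume d: "d \<le> 1" and "b \<in> {b::int. \<bar>t - of_int b\<bar> < d}"
  then have "\<bar>t - of_int b\<bar> < d" by simp
  moreover have "of_int \<lfloor>t\<rfloor> \<le> t" "t < of_int \<lfloor>t\<rfloor> + 1" by linarith+
  ultimately have "real_of_int (\<lfloor>t\<rfloor> - 1) \<le> of_int b" "real_of_int b \<le> of_int (\<lfloor>t\<rfloor> + 2)"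
    using d unfolding of_int_diff of_int_add of_int_numeral of_int_1 by linarith+
  then have "\<lfloor>t\<rfloor> - 1 \<le> b" "b \<le> \<lfloor>t\<rfloor> + 2" by (simp_all only: of_int_le_iff)
  then show "b \<in> {b\<in>{\<lfloor>t\<rfloor> - 1..\<lfloor>t\<rfloor> + 2}. \<bar>t - of_int b\<bar> < d}" using \<open>\<bar>t - of_int b\<bar> < d\<close> by simp
qed simp

lemma near_count_eq_sum:
  assumes "d \<le> 1"
  shows "real (near_count d t) = (\<Sum>b\<in>{\<lfloor>t\<rfloor> - 1..\<lfloor>t\<rfloor> + 2}. if \<bar>t - of_int b\<bar> < d then 1 else 0)"
  unfolding near_count_def near_count_set[OF assms]
  by (subst sum.inter_filter[symmetric]) auto

lemma trapezoid_eq_sum: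
  "trapezoid Q r t = (\<Sum>b\<in>{\<lfloor>t\<rfloor> - 1..\<lfloor>t\<rfloor> + 2}. real Q * (tri r (t - of_int b) - tri (r - 1 / real Q) (t - of_int b)))"
  unfolding trapezoid_def periodic_tri_def sum_subtractf[symmetric] sum_distrib_left by (rule refl)

lemma tri_mono: "r \<le> s \<Longrightarrow> tri r x \<le> tri s x"
  unfolding tri_def by (intro max.mono) auto

lemma tri_diff_inside: "\<bar>x\<bar> < d \<Longrightarrow> 0 \<le> u \<Longrightarrow> tri (d + u) x - tri (d + u - u) x = u"
  by (simp add: tri_def max_absorb2)

lemma tri_diff_outside: "\<not> \<bar>x\<bar> < d \<Longrightarrow> 0 \<le> u \<Longrightarrow> tri d x - tri (d - u) x = 0"
  by (simp add: tri_def max_absorb1)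

text \<open>With outer radius d + 1/Q the plateau of height 1 covers the d-neighbourhood; the
  matching minorant has outer radius d. The mean value of either trapezoid differs from 2 d by 1/Q,
  which costs only O(Q) over the roughly Q^2 fractions of an arc.\<close>

lemma near_count_le_trapezoid:
  assumes "Q > 0" "0 \<le> d" "d \<le> 1"
  shows "real (near_count d t) \<le> trapezoid Q (d + 1 / real Q) t"
  unfolding near_count_eq_sum[OF assms(3)] trapezoid_eq_sum
proof (rule sum_mono)
  fix b
  show "(if \<bar>t - of_int b\<bar> < d then 1 else 0) \<le> real Q * (tri (d + 1 / real Q) (t - of_int b) - tri (d + 1 / real Q - 1 / real Q) (t - of_int b))"
  proof (cases "\<bar>t - of_int b\<bar> < d")
    case True
    have "tri (d + 1 / real Q) (t - of_int b) - tri (d + 1 / real Q - 1 / real Q) (t - of_int b) = 1 / real Q"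
      by (rule tri_diff_inside[OF True]) simp
    then show ?thesis using True assms by simp
  next
    case False
    have "0 \<le> tri (d + 1 / real Q) (t - of_int b) - tri (d + 1 / real Q - 1 / real Q) (t - of_int b)"
      using tri_mono[of "d + 1 / real Q - 1 / real Q" "d + 1 / real Q"] by simp
    then show ?thesis using False by simp
  qed
qed

lemma trapezoid_le_near_count:
  assumes "Q > 0" "1 / real Q \<le> d" "d \<le> 1"
  shows "trapezoid Q d t \<le> real (near_count d t)"
  unfolding near_count_eq_sum[OF assms(3)] trapezoid_eq_sum
proof (rule sum_mono)
  fix b
  show "real Q * (tri d (t - of_int b) - tri (d - 1 / real Q) (t - of_int b)) \<le> (if \<bar>t - of_int b\<bar> < d then 1 else 0)"
  proof (cases "\<bar>t - of_int b\<bar> < d")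
    case True
    have "tri d (t - of_int b) - tri (d - 1 / real Q) (t - of_int b) \<le> 1 / real Q"
      using True assms by (simp add: tri_def)
    then have "real Q * (tri d (t - of_int b) - tri (d - 1 / real Q) (t - of_int b)) \<le> real Q * (1 / real Q)"
      by (intro mult_left_mono) auto
    then show ?thesis using True assms by simp
  next
    case False
    have "tri d (t - of_int b) - tri (d - 1 / real Q) (t - of_int b) = 0"
      by (rule tri_diff_outside[OF False]) simp
    then show ?thesis using False by simp
  qed
qed

definition arc_points :: "real \<Rightarrow> real \<Rightarrow> nat \<Rightarrow> (nat \<times> int) set" where
  "arc_points A B Q = (SIGMA q:{1..Q}. {\<lceil>real q * A\<rceil>..\<lfloor>real q * B\<rfloor>})"

lemma finite_arc_points: "finite (arc_points A B Q)" by (simp add: arc_points_def)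

definition height :: "(real \<Rightarrow> real) \<Rightarrow> nat \<times> int \<Rightarrow> real" where
  "height f p = real (fst p) * f (of_int (snd p) / real (fst p))"

definition arc_count :: "(real \<Rightarrow> real) \<Rightarrow> real \<Rightarrow> real \<Rightarrow> nat \<Rightarrow> real \<Rightarrow> nat" where
  "arc_count f A B Q d = (\<Sum>p\<in>arc_points A B Q. near_count d (height f p))"

lemma curve_sum_eq: "curve_sum f A B Q j = (\<Sum>p\<in>arc_points A B Q. e2pi (of_nat j * height f p))"
  unfolding curve_sum_def arc_points_def height_def
  by (subst sum.Sigma) (auto intro!: sum.cong simp: mult.left_commute case_prod_unfold)

text \<open>Opposite frequencies give conjugate sums, so only positive j need estimates.\<close>

lemma norm_curve_sum_int:
  "norm (\<Sum>p\<in>arc_points A B Q. e2pi (of_int h * height f p)) = norm (curve_sum f A B Q (nat \<bar>h\<bar>))"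
proof (cases "h \<ge> 0")
  case True
  then have "of_int h = real (nat \<bar>h\<bar>)" by simp
  then show ?thesis unfolding curve_sum_eq by (simp only:)
next
  case False
  then have h: "real_of_int h = - real (nat \<bar>h\<bar>)" by simp
  have "(\<Sum>p\<in>arc_points A B Q. e2pi (of_int h * height f p)) = cnj (curve_sum f A B Q (nat \<bar>h\<bar>))"
    unfolding curve_sum_eq cnj_sum h by (simp only: mult_minus_left e2pi_minus)
  then show ?thesis by simp
qed

text \<open>The smoothing parameters are internal, so with \<open>Q\<close> and the arc fixed the
  truncation error can be pushed below any \<open>e\<close>; the bound \<open>X\<close> for every
  \<open>K\<close> makes this free of charge. Frequency 0 is the main term. The 8 is 2 for the sign
  of h times 4 from min (2 r) y \<le> 4 min d y, which is where r \<le> 2 d enters.\<close>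

lemma trapezoid_sum_bound:
  assumes Q: "Q > 0" and r: "1 / real Q \<le> r" "r \<le> 1" "r \<le> 2 * d"
    and X: "\<And>K. (\<Sum>j=1..K. min d (min (1 / real j) (real Q / (real j)\<^sup>2)) * norm (curve_sum f A B Q j)) \<le> X"
  shows "\<bar>(\<Sum>p\<in>arc_points A B Q. trapezoid Q r (height f p)) - (2 * r - 1 / real Q) * real (card (arc_points A B Q))\<bar> \<le> 8 * X"
proof (rule field_le_epsilon)
  fix e :: real assume e: "e > 0"
  define P where "P = arc_points A B Q"
  \<comment> \<open>The added 1 keeps \<open>n\<close> positive when the arc contains no
    fractions.\<close>
  define n where "n = 14 * real Q * real (card P) + 1"
  have n: "n > 0" by (simp add: n_def add_nonneg_pos)
  define \<tau> where "\<tau> = min (1 / 2) (e / (2 * n))"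
  have \<tau>: "\<tau> > 0" "\<tau> \<le> 1 / 2" "\<tau> \<le> e / (2 * n)" using e n by (auto simp: \<tau>_def)
  define H where "H = nat \<lceil>6 * n / (e * \<tau>\<^sup>2)\<rceil> + 1"
  have H: "H > 0" by (simp add: H_def)
  have err: "n * (\<tau> + 3 / (real H * \<tau>\<^sup>2)) \<le> e"
  proof -
    have "6 * n / (e * \<tau>\<^sup>2) \<le> real H" unfolding H_def by linarith
    then have "6 * n \<le> real H * \<tau>\<^sup>2 * e" using e \<tau> by (simp add: pos_divide_le_eq mult_ac)
    then have "n * (3 / (real H * \<tau>\<^sup>2)) \<le> e / 2" using H \<tau> by (simp add: divide_simps mult_ac)
    moreover have "n * \<tau> \<le> e / 2" using \<tau>(3) n by (simp add: field_simps)
    ultimately show ?thesis unfolding distrib_left by linarith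
  qed
  define U where "U h = (\<Sum>p\<in>P. e2pi (of_int h * height f p))" for h :: int
  define co where "co h = complex_of_real (trapezoid_coeff Q r h)" for h
  define w where "w h = (if h = 0 then 0 else \<bar>trapezoid_coeff Q r h\<bar> * norm (U h))" for h
  have w0: "0 \<le> w h" for h by (simp add: w_def)
  have U0: "U 0 = of_nat (card P)" by (simp add: U_def)
  let ?T = "\<lambda>t. (\<Sum>k<H. \<Sum>l<H. co (int k - int l) * e2pi (of_int (int k - int l) * t)) / of_nat H"
  have "norm ((\<Sum>p\<in>P. ?T (height f p)) - of_real (\<Sum>p\<in>P. trapezoid Q r (height f p))) \<le> e"
  proof -
    have "norm ((\<Sum>p\<in>P. ?T (height f p)) - of_real (\<Sum>p\<in>P. trapezoid Q r (height f p))) =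
       norm (\<Sum>p\<in>P. ?T (height f p) - of_real (trapezoid Q r (height f p)))" by (simp add: sum_subtractf)
    also have "\<dots> \<le> (\<Sum>p\<in>P. 14 * real Q * (\<tau> + 3 / (real H * \<tau>\<^sup>2)))"
      unfolding co_def by (intro sum_norm_le trapezoid_approximation r Q H \<tau>)
    also have "\<dots> = (14 * real Q * real (card P)) * (\<tau> + 3 / (real H * \<tau>\<^sup>2))" by simp
    also have "\<dots> \<le> n * (\<tau> + 3 / (real H * \<tau>\<^sup>2))"
      using \<tau> by (intro mult_right_mono add_nonneg_nonneg) (auto simp: n_def)
    finally show ?thesis using err by linarith
  qed
  moreover have "norm ((\<Sum>p\<in>P. ?T (height f p)) - co 0 * U 0) \<le> 8 * X"
  proof -
    have "(\<Sum>p\<in>P. ?T (height f p)) = (\<Sum>p\<in>P. \<Sum>k<H. \<Sum>l<H. co (int k - int l) * e2pi (of_int (int k - int l) * height f p)) / of_nat H"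
      by (simp add: sum_divide_distrib)
    also have "(\<Sum>p\<in>P. \<Sum>k<H. \<Sum>l<H. co (int k - int l) * e2pi (of_int (int k - int l) * height f p)) =
       (\<Sum>k<H. \<Sum>p\<in>P. \<Sum>l<H. co (int k - int l) * e2pi (of_int (int k - int l) * height f p))" by (rule sum.swap)
    also have "\<dots> = (\<Sum>k<H. \<Sum>l<H. \<Sum>p\<in>P. co (int k - int l) * e2pi (of_int (int k - int l) * height f p))"
      by (rule sum.cong[OF refl], rule sum.swap)
    also have "\<dots> = (\<Sum>k<H. \<Sum>l<H. co (int k - int l) * U (int k - int l))"
      by (simp only: U_def sum_distrib_left)
    also have "\<dots> = (\<Sum>k<H. \<Sum>l<H. (if k = l then co 0 * U 0 else 0) + (if k = l then 0 else co (int k - int l) * U (int k - int l)))"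
      by (intro sum.cong refl) auto
    also have "\<dots> = of_nat H * (co 0 * U 0) + (\<Sum>k<H. \<Sum>l<H. if k = l then 0 else co (int k - int l) * U (int k - int l))"
      by (simp add: sum.distrib)
    finally have "(\<Sum>p\<in>P. ?T (height f p)) - co 0 * U 0 =
       (\<Sum>k<H. \<Sum>l<H. if k = l then 0 else co (int k - int l) * U (int k - int l)) / of_nat H"
      using H by (simp add: add_divide_distrib)
    then have "norm ((\<Sum>p\<in>P. ?T (height f p)) - co 0 * U 0) =
       norm (\<Sum>k<H. \<Sum>l<H. if k = l then 0 else co (int k - int l) * U (int k - int l)) / real H"
      by (simp add: norm_divide)
    also have "\<dots> \<le> (\<Sum>k<H. \<Sum>l<H. w (int k - int l)) / real H"
    proof (intro divide_right_mono sum_norm_le order_trans[OF norm_sum] sum_mono)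
      fix k l
      show "norm (if k = l then 0 else co (int k - int l) * U (int k - int l)) \<le> w (int k - int l)"
        by (simp add: w_def co_def norm_mult)
    qed auto
    also have "(\<Sum>k<H. \<Sum>l<H. w (int k - int l)) = (\<Sum>k<H. \<Sum>l<H. w (int l - int k))" by (rule sum.swap)
    also have "\<dots> / real H \<le> (real H * (\<Sum>h\<in>{- int H..int H}. w h)) / real H"
      by (intro divide_right_mono double_sum_difference_le w0) auto
    also have "\<dots> = (\<Sum>h\<in>{- int H..int H}. w h)" using H by simp
    also have "\<dots> \<le> (\<Sum>h\<in>{- int H..int H}. (if h = 0 then 0 else 4 * min d (min (1 / \<bar>real_of_int h\<bar>) (real Q / (real_of_int h)\<^sup>2)) * norm (curve_sum f A B Q (nat \<bar>h\<bar>))))"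
    proof (rule sum_mono)
      fix h
      show "w h \<le> (if h = 0 then 0 else 4 * min d (min (1 / \<bar>real_of_int h\<bar>) (real Q / (real_of_int h)\<^sup>2)) * norm (curve_sum f A B Q (nat \<bar>h\<bar>)))"
      proof (cases "h = 0")
        case False
        define y where "y = min (1 / \<bar>real_of_int h\<bar>) (real Q / (real_of_int h)\<^sup>2)"
        have y: "y \<ge> 0" by (simp add: y_def)
        have "\<bar>trapezoid_coeff Q r h\<bar> \<le> min (2 * r) y" unfolding y_def by (rule trapezoid_coeff_bound[OF Q r(1) False])
        also have "\<dots> \<le> 4 * min d y" using r y by (auto simp: min_def)
        finally have "\<bar>trapezoid_coeff Q r h\<bar> * norm (U h) \<le> 4 * min d y * norm (U h)" by (intro mult_right_mono) auto
        then show ?thesis using False norm_curve_sum_int[of h f A B Q] by (simp add: w_def U_def P_def y_def)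
      qed (simp add: w_def)
    qed
    also have "\<dots> \<le> 8 * X"
    proof -
      define z where "z h = (if h = 0 then 0 else 4 * min d (min (1 / \<bar>real_of_int h\<bar>) (real Q / (real_of_int h)\<^sup>2)) * norm (curve_sum f A B Q (nat \<bar>h\<bar>)))" for h :: int
      have zp: "(\<Sum>h\<in>{1..int H}. z h) \<le> 4 * X"
      proof -
        have "(\<Sum>h\<in>{1..int H}. z h) = (\<Sum>j=1..H. 4 * (min d (min (1 / real j) (real Q / (real j)\<^sup>2)) * norm (curve_sum f A B Q j)))"
          by (rule sum.reindex_bij_witness[of _ int nat]) (auto simp: z_def mult.assoc)
        also have "\<dots> = 4 * (\<Sum>j=1..H. min d (min (1 / real j) (real Q / (real j)\<^sup>2)) * norm (curve_sum f A B Q j))"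
          by (simp only: sum_distrib_left)
        also have "\<dots> \<le> 4 * X" by (intro mult_left_mono X) auto
        finally show ?thesis .
      qed
      have "(\<Sum>h\<in>{- int H..-1}. z h) = (\<Sum>h\<in>{1..int H}. z h)"
        by (rule sum.reindex_bij_witness[of _ uminus uminus]) (auto simp: z_def)
      moreover have "{- int H..int H} = {- int H..-1} \<union> ({0} \<union> {1..int H})" by auto
      then have "(\<Sum>h\<in>{- int H..int H}. z h) = (\<Sum>h\<in>{- int H..-1}. z h) + (z 0 + (\<Sum>h\<in>{1..int H}. z h))"
        by (simp only:) (subst sum.union_disjoint, auto)
      moreover have "z 0 = 0" by (simp add: z_def)
      ultimately show ?thesis using zp unfolding z_def[symmetric] by linarith
    qed
    finally show ?thesis .
  qed
  ultimately have "norm (complex_of_real (\<Sum>p\<in>P. trapezoid Q r (height f p)) - co 0 * U 0) \<le> 8 * X + e"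
    using norm_triangle_ineq4[of "(\<Sum>p\<in>P. ?T (height f p)) - co 0 * U 0" "(\<Sum>p\<in>P. ?T (height f p)) - of_real (\<Sum>p\<in>P. trapezoid Q r (height f p))"]
    by (simp add: algebra_simps)
  moreover have "complex_of_real (\<Sum>p\<in>P. trapezoid Q r (height f p)) - co 0 * U 0 =
     of_real ((\<Sum>p\<in>P. trapezoid Q r (height f p)) - (2 * r - 1 / real Q) * real (card P))"
    by (simp add: co_def U0 trapezoid_coeff_0[OF Q])
  ultimately have "norm (complex_of_real ((\<Sum>p\<in>P. trapezoid Q r (height f p)) - (2 * r - 1 / real Q) * real (card P))) \<le> 8 * X + e" by (simp only:)
  then show "\<bar>(\<Sum>p\<in>arc_points A B Q. trapezoid Q r (height f p)) - (2 * r - 1 / real Q) * real (card (arc_points A B Q))\<bar> \<le> 8 * X + e"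
    by (simp only: norm_of_real P_def)
qed

lemma card_arc_points_bound:
  assumes "A \<le> B"
  shows "\<bar>real (card (arc_points A B Q)) - (B - A) * (real Q * (real Q + 1) / 2)\<bar> \<le> real Q"
proof -
  have "real (card (arc_points A B Q)) - (B - A) * (real Q * (real Q + 1) / 2) =
     (\<Sum>q=1..Q. real (card {\<lceil>real q * A\<rceil>..\<lfloor>real q * B\<rfloor>}) - (B - A) * real q)"
  proof -
    have "(\<Sum>q=1..Q. real q) = real Q * (real Q + 1) / 2"
      by (induction Q) (simp_all add: field_simps)
    then show ?thesis by (simp add: arc_points_def sum_subtractf flip: sum_distrib_left)
  qed
  also have "\<bar>\<dots>\<bar> \<le> (\<Sum>q=1..Q. 1)"
  proof (rule order_trans[OF sum_abs sum_mono])
    fix q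
    have qAB: "real q * A \<le> real q * B" using assms by (intro mult_left_mono) auto
    have "0 \<le> \<lfloor>real q * B\<rfloor> + 1 - \<lceil>real q * A\<rceil>" using qAB by linarith
    then have "real (card {\<lceil>real q * A\<rceil>..\<lfloor>real q * B\<rfloor>}) = of_int (\<lfloor>real q * B\<rfloor> + 1 - \<lceil>real q * A\<rceil>)" by simp
    moreover have "(B - A) * real q = real q * B - real q * A" by (simp add: algebra_simps)
    ultimately show "\<bar>real (card {\<lceil>real q * A\<rceil>..\<lfloor>real q * B\<rfloor>}) - (B - A) * real q\<bar> \<le> 1" by simp linarith
  qed
  finally show ?thesis by simp
qed

text \<open>The count is squeezed between two trapezoid sums. The hypothesis 1/Q \<le> d makes the
  larger radius d + 1/Q at most 2 d, so that the same weighted sums control both.\<close>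

lemma arc_count_bound:
  assumes c: "0 < c" "c \<le> 1" and l: "l > 0" and eps: "\<epsilon> > 0"
  shows "\<exists>C>0. \<forall>A B f f' f'' Q d. curved_arc c A B f f' f'' \<longrightarrow> B - A \<le> l \<longrightarrow>
     avoids A Q \<longrightarrow> avoids B Q \<longrightarrow> 2 \<le> Q \<longrightarrow> 1 / real Q \<le> d \<longrightarrow> d \<le> 1 / 2 \<longrightarrow>
     \<bar>real (arc_count f A B Q d) - (B - A) * d * (real Q)\<^sup>2\<bar> \<le>
       C * (sqrt d * ln (1 / d) * real Q powr (3 / 2) + real Q powr (1 + \<epsilon>))"
proof -
  obtain C where C: "C > 0" and bd: "\<And>A B f f' f'' Q d K. curved_arc c A B f f' f'' \<Longrightarrow> B - A \<le> l \<Longrightarrow>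
     avoids A Q \<Longrightarrow> avoids B Q \<Longrightarrow> 0 < Q \<Longrightarrow> 0 < d \<Longrightarrow> d \<le> 1 / 2 \<Longrightarrow>
     (\<Sum>j=1..K. min d (min (1 / real j) (real Q / (real j)\<^sup>2)) * norm (curve_sum f A B Q j)) \<le>
       C * (sqrt d * ln (1 / d) * real Q powr (3 / 2) + real Q powr (1 + \<epsilon>))"
    using weighted_curve_sums[OF c l eps] by blast
  have "\<bar>real (arc_count f A B Q d) - (B - A) * d * (real Q)\<^sup>2\<bar> \<le>
       (8 * C + 2 * l + 2) * (sqrt d * ln (1 / d) * real Q powr (3 / 2) + real Q powr (1 + \<epsilon>))"
    if h: "curved_arc c A B f f' f''" "B - A \<le> l" "avoids A Q" "avoids B Q" "2 \<le> Q" "1 / real Q \<le> d" "d \<le> 1 / 2"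
    for A B f f' f'' Q d
  proof -
    have AB: "A < B" using h(1) by (simp add: curved_arc_def)
    have Q: "Q > 0" "real Q \<ge> 2" using h(5) by auto
    have Q1: "1 / real Q \<le> 1 / 2" using Q by (simp add: field_simps)
    have d: "d > 0" using h(6) Q by (smt (verit) divide_pos_pos of_nat_0_less_iff)
    define X where "X = C * (sqrt d * ln (1 / d) * real Q powr (3 / 2) + real Q powr (1 + \<epsilon>))"
    note XX = bd[OF h(1-4) Q(1) d h(7), folded X_def]
    define n where "n = real (card (arc_points A B Q))"
    have up: "real (arc_count f A B Q d) \<le> (2 * d + 1 / real Q) * n + 8 * X"
    proof -
      have "real (arc_count f A B Q d) \<le> (\<Sum>p\<in>arc_points A B Q. trapezoid Q (d + 1 / real Q) (height f p))"
        unfolding arc_count_def of_nat_sum using d h Q by (intro sum_mono near_count_le_trapezoid) auto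
      moreover have "\<bar>(\<Sum>p\<in>arc_points A B Q. trapezoid Q (d + 1 / real Q) (height f p)) - (2 * (d + 1 / real Q) - 1 / real Q) * n\<bar> \<le> 8 * X"
        unfolding n_def using d h Q Q1 by (intro trapezoid_sum_bound[where d = d] XX) auto
      ultimately show ?thesis by (simp add: distrib_left distrib_right left_diff_distrib)
    qed
    have low: "(2 * d - 1 / real Q) * n - 8 * X \<le> real (arc_count f A B Q d)"
    proof -
      have "(\<Sum>p\<in>arc_points A B Q. trapezoid Q d (height f p)) \<le> real (arc_count f A B Q d)"
        unfolding arc_count_def of_nat_sum using d h Q by (intro sum_mono trapezoid_le_near_count) auto
      moreover have "\<bar>(\<Sum>p\<in>arc_points A B Q. trapezoid Q d (height f p)) - (2 * d - 1 / real Q) * n\<bar> \<le> 8 * X"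
        unfolding n_def using d h Q Q1 by (intro trapezoid_sum_bound[where d = d] XX) auto
      ultimately show ?thesis by linarith
    qed
    define N where "N = (B - A) * (real Q * (real Q + 1) / 2)"
    have nN: "\<bar>n - N\<bar> \<le> real Q" unfolding n_def N_def using AB by (intro card_arc_points_bound) auto
    have BA: "0 \<le> B - A" "B - A \<le> l" using AB h(2) by auto
    have "n / real Q \<le> (l + 1) * real Q"
    proof -
      have "N \<le> l * (real Q * (real Q + 1) / 2)" unfolding N_def using BA by (intro mult_right_mono) auto
      also have "\<dots> \<le> l * (real Q * real Q)" using l Q by (intro mult_left_mono) auto
      finally have "n \<le> l * (real Q * real Q) + real Q * 1" using nN by linarith
      also have "real Q * 1 \<le> real Q * real Q" using Q by (intro mult_left_mono) auto
      finally have "n \<le> (l + 1) * real Q * real Q" by (simp add: algebra_simps)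
      then show ?thesis using Q by (simp add: pos_divide_le_eq)
    qed
    moreover have "\<bar>2 * d * n - (B - A) * d * (real Q)\<^sup>2\<bar> \<le> (l + 1) * real Q"
    proof -
      have "2 * d * n - (B - A) * d * (real Q)\<^sup>2 = 2 * d * (n - N) + (B - A) * d * real Q"
        by (simp add: N_def power2_eq_square field_simps)
      also have "\<bar>\<dots>\<bar> \<le> \<bar>2 * d * (n - N)\<bar> + \<bar>(B - A) * d * real Q\<bar>" by (rule abs_triangle_ineq)
      also have "\<bar>2 * d * (n - N)\<bar> \<le> 1 * real Q" unfolding abs_mult using nN d h(7) by (intro mult_mono) auto
      also have "\<bar>(B - A) * d * real Q\<bar> \<le> l * 1 * real Q" unfolding abs_mult using BA d h(7) by (intro mult_mono) auto
      finally show ?thesis by (simp add: distrib_right)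
    qed
    moreover have "real (arc_count f A B Q d) \<le> 2 * d * n + n / real Q + 8 * X" using up by (simp add: distrib_right)
    moreover have "2 * d * n - n / real Q - 8 * X \<le> real (arc_count f A B Q d)" using low by (simp add: left_diff_distrib)
    ultimately have "\<bar>real (arc_count f A B Q d) - (B - A) * d * (real Q)\<^sup>2\<bar> \<le> 8 * X + 2 * ((l + 1) * real Q)"
      by linarith
    moreover have "real Q \<le> sqrt d * ln (1 / d) * real Q powr (3 / 2) + real Q powr (1 + \<epsilon>)"
    proof -
      have "0 \<le> sqrt d * ln (1 / d) * real Q powr (3 / 2)" using d h(7) by simp
      then show ?thesis using Q eps powr_mono[of 1 "1 + \<epsilon>" "real Q"] by simp
    qed
    then have "(l + 1) * real Q \<le> (l + 1) * (sqrt d * ln (1 / d) * real Q powr (3 / 2) + real Q powr (1 + \<epsilon>))"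
      using l by (intro mult_left_mono) auto
    ultimately have "\<bar>real (arc_count f A B Q d) - (B - A) * d * (real Q)\<^sup>2\<bar> \<le>
       8 * X + 2 * ((l + 1) * (sqrt d * ln (1 / d) * real Q powr (3 / 2) + real Q powr (1 + \<epsilon>)))" by linarith
    then show ?thesis by (simp add: X_def algebra_simps)
  qed
  then show ?thesis using C l by (intro exI[of _ "8 * C + 2 * l + 2"]) auto
qed

lemma finite_near: "d \<le> 1 \<Longrightarrow> finite {b::int. \<bar>t - of_int b\<bar> < d}" for t d :: real
  unfolding near_count_set by (rule finite_subset[of _ "{\<lfloor>t\<rfloor> - 1..\<lfloor>t\<rfloor> + 2}"]) auto

lemma near_count_le_1:
  assumes "d \<le> 1 / 2"
  shows "near_count d t \<le> 1"
proof -
  have "a = b" if "\<bar>t - of_int a\<bar> < d" "\<bar>t - of_int b\<bar> < d" for a b :: int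
  proof -
    have "\<bar>real_of_int a - of_int b\<bar> < 1" using that assms by linarith
    then show ?thesis by linarith
  qed
  moreover have "finite {b::int. \<bar>t - of_int b\<bar> < d}" using assms by (intro finite_near) auto
  ultimately show ?thesis unfolding near_count_def by (subst card_le_Suc0_iff_eq[unfolded One_nat_def[symmetric]]) auto
qed

lemma near_count_mono: "d \<le> d' \<Longrightarrow> d' \<le> 1 \<Longrightarrow> near_count d t \<le> near_count d' t"
  unfolding near_count_def by (intro card_mono finite_near) auto

lemma arc_count_mono: "d \<le> d' \<Longrightarrow> d' \<le> 1 \<Longrightarrow> arc_count f A B Q d \<le> arc_count f A B Q d'"
  unfolding arc_count_def by (intro sum_mono near_count_mono)

lemma arc_count_trivial:
  assumes "A \<le> B" "d \<le> 1 / 2"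
  shows "real (arc_count f A B Q d) \<le> (B - A) * (real Q * (real Q + 1) / 2) + real Q"
proof -
  have "arc_count f A B Q d \<le> (\<Sum>p\<in>arc_points A B Q. 1)"
    unfolding arc_count_def using assms by (intro sum_mono near_count_le_1)
  then have "real (arc_count f A B Q d) \<le> real (card (arc_points A B Q))" by simp
  then show ?thesis using card_arc_points_bound[OF assms(1), of Q] by linarith
qed

text \<open>Moving an endpoint by at most 2/Q moves q times the endpoint by at most 2, which affects
  at most three numerators per denominator at each end.\<close>

lemma arc_count_subarc:
  assumes "\<eta> \<le> A" "A \<le> B" "B \<le> \<xi>" "d \<le> 1 / 2" "A - \<eta> \<le> 2 / real Q" "\<xi> - B \<le> 2 / real Q"
  shows "arc_count f A B Q d \<le> arc_count f \<eta> \<xi> Q d"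
    "real (arc_count f \<eta> \<xi> Q d) \<le> real (arc_count f A B Q d) + 6 * real Q"
proof -
  have sub: "arc_points A B Q \<subseteq> arc_points \<eta> \<xi> Q"
  proof -
    have "\<lceil>real q * \<eta>\<rceil> \<le> \<lceil>real q * A\<rceil>" "\<lfloor>real q * B\<rfloor> \<le> \<lfloor>real q * \<xi>\<rfloor>" for q
      using assms by (auto intro!: ceiling_mono floor_mono mult_left_mono)
    then show ?thesis unfolding arc_points_def by (intro Sigma_mono) auto
  qed
  then show "arc_count f A B Q d \<le> arc_count f \<eta> \<xi> Q d"
    unfolding arc_count_def by (intro sum_mono2 finite_arc_points) auto
  have "arc_count f \<eta> \<xi> Q d = arc_count f A B Q d + (\<Sum>p\<in>arc_points \<eta> \<xi> Q - arc_points A B Q. near_count d (height f p))"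
    unfolding arc_count_def using sum.subset_diff[OF sub finite_arc_points] by (simp add: add.commute)
  also have "(\<Sum>p\<in>arc_points \<eta> \<xi> Q - arc_points A B Q. near_count d (height f p)) \<le> (\<Sum>p\<in>arc_points \<eta> \<xi> Q - arc_points A B Q. 1)"
    using assms by (intro sum_mono near_count_le_1)
  also have "\<dots> = card (arc_points \<eta> \<xi> Q - arc_points A B Q)" by simp
  also have "\<dots> \<le> card (SIGMA q:{1..Q}. {\<lceil>real q * \<eta>\<rceil>..<\<lceil>real q * A\<rceil>} \<union> {\<lfloor>real q * B\<rfloor><..\<lfloor>real q * \<xi>\<rfloor>})"
    by (intro card_mono finite_SigmaI) (auto simp: arc_points_def)
  also have "\<dots> = (\<Sum>q=1..Q. card ({\<lceil>real q * \<eta>\<rceil>..<\<lceil>real q * A\<rceil>} \<union> {\<lfloor>real q * B\<rfloor><..\<lfloor>real q * \<xi>\<rfloor>}))" by simp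
  also have "\<dots> \<le> (\<Sum>q=1..Q. 6)"
  proof (rule sum_mono)
    fix q assume q: "q \<in> {1..Q}"
    have e: "real q * y \<le> 2" if "y \<le> 2 / real Q" "0 \<le> y" for y
    proof -
      have "real q * y \<le> real Q * (2 / real Q)" using q that by (intro mult_mono) auto
      then show ?thesis using q by simp
    qed
    have "real q * A - real q * \<eta> \<le> 2" using e[of "A - \<eta>"] assms by (simp add: right_diff_distrib)
    then have 1: "\<lceil>real q * A\<rceil> - \<lceil>real q * \<eta>\<rceil> \<le> 3" by linarith
    have "real q * \<xi> - real q * B \<le> 2" using e[of "\<xi> - B"] assms by (simp add: right_diff_distrib)
    then have 2: "\<lfloor>real q * \<xi>\<rfloor> - \<lfloor>real q * B\<rfloor> \<le> 3" by linarith
    have "card ({\<lceil>real q * \<eta>\<rceil>..<\<lceil>real q * A\<rceil>} \<union> {\<lfloor>real q * B\<rfloor><..\<lfloor>real q * \<xi>\<rfloor>}) \<le>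
       card {\<lceil>real q * \<eta>\<rceil>..<\<lceil>real q * A\<rceil>} + card {\<lfloor>real q * B\<rfloor><..\<lfloor>real q * \<xi>\<rfloor>}" by (rule card_Un_le)
    then show "card ({\<lceil>real q * \<eta>\<rceil>..<\<lceil>real q * A\<rceil>} \<union> {\<lfloor>real q * B\<rfloor><..\<lfloor>real q * \<xi>\<rfloor>}) \<le> 6" using 1 2 by simp
  qed
  also have "\<dots> = 6 * Q" by simp
  finally have "real (arc_count f \<eta> \<xi> Q d) \<le> real (arc_count f A B Q d + 6 * Q)"
    by (simp only: of_nat_le_iff add_le_cancel_left)
  then show "real (arc_count f \<eta> \<xi> Q d) \<le> real (arc_count f A B Q d) + 6 * real Q" by simp
qed

lemma ex_avoiding:
  assumes Q: "Q > 0"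
  shows "\<exists>A\<ge>\<eta>. A \<le> \<eta> + 2 / real Q \<and> avoids A Q"
proof -
  obtain k where k: "2 ^ k \<le> real Q" "real Q \<le> 2 ^ (k + 1)" using dyadic_log_bounds[of "real Q"] Q by auto
  have "\<exists>k. real Q < 2 ^ k \<and> 2 ^ k \<le> 2 * real Q"
  proof (cases "real Q < 2 ^ (k + 1)")
    case True then show ?thesis using k by (intro exI[of _ "k + 1"]) auto
  next
    case False then show ?thesis using k Q by (intro exI[of _ "k + 2"]) auto
  qed
  then obtain k where k: "real Q < 2 ^ k" "2 ^ k \<le> 2 * real Q" by blast
  define P :: real where "P = 2 ^ k"
  have P: "P > 0" "P \<ge> real Q" using k by (simp_all add: P_def)
  define m where "m = 2 * \<lceil>(\<eta> * P - 1) / 2\<rceil> + 1"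
  have m: "\<eta> * P \<le> of_int m" "of_int m \<le> \<eta> * P + 2" "odd m"
  proof -
    define y z where "y = \<eta> * P" and "z = real_of_int \<lceil>(\<eta> * P - 1) / 2\<rceil>"
    have z: "(y - 1) / 2 \<le> z" "z < (y - 1) / 2 + 1" using ceiling_correct[of "(y - 1) / 2"] unfolding y_def z_def by linarith+
    have mz: "real_of_int m = 2 * z + 1" by (simp add: m_def z_def)
    show "\<eta> * P \<le> of_int m" using z(1) unfolding mz y_def[symmetric] by simp
    show "of_int m \<le> \<eta> * P + 2" using z(2) unfolding mz y_def[symmetric] by (simp add: field_simps)
    show "odd m" by (simp add: m_def)
  qed
  define A where "A = of_int m / P"
  show ?thesis
  proof (intro exI conjI)
    show "\<eta> \<le> A" using m P by (simp add: A_def pos_le_divide_eq)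
    have "A \<le> (\<eta> * P + 2) / P" unfolding A_def using m P by (intro divide_right_mono) auto
    also have "\<dots> = \<eta> + 2 / P" using P by (simp add: add_divide_distrib)
    also have "2 / P \<le> 2 / real Q" using P Q by (intro divide_left_mono) auto
    finally show "A \<le> \<eta> + 2 / real Q" by simp
    show "avoids A Q" unfolding avoids_def
    proof (intro allI impI)
      fix a :: int and q :: nat assume q: "1 \<le> q" "q \<le> Q"
      \<comment> \<open>Equality would force 2^k to divide q, as \<open>m\<close> is odd, although q
        \<le> Q < 2^k. A nonzero integer divided by P then has size at least 1/P \<ge> 1/(2
        Q).\<close>
      have "a * 2 ^ k \<noteq> int q * m"
      proof
        assume "a * 2 ^ k = int q * m"
        then have "2 ^ k dvd int q * m" by (metis dvd_triv_right)
        moreover have "coprime (2 ^ k) m" using m(3) by simp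
        ultimately have "2 ^ k dvd int q" using coprime_dvd_mult_left_iff by blast
        then have "2 ^ k \<le> int q" using q by (intro zdvd_imp_le) auto
        then have "real_of_int (2 ^ k) \<le> of_int (int q)" by (simp only: of_int_le_iff)
        then show False using k q by simp
      qed
      then have "1 \<le> \<bar>a * 2 ^ k - int q * m\<bar>" by linarith
      then have "1 \<le> \<bar>real_of_int (a * 2 ^ k - int q * m)\<bar>" by linarith
      also have "real_of_int (a * 2 ^ k - int q * m) = P * (of_int a - real q * A)"
        using P by (simp add: A_def P_def right_diff_distrib)
      also have "\<bar>\<dots>\<bar> = P * \<bar>of_int a - real q * A\<bar>" using P by (simp add: abs_mult)
      also have "\<dots> \<le> (2 * real Q) * \<bar>of_int a - real q * A\<bar>" using k by (intro mult_right_mono) (auto simp: P_def)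
      finally show "1 / (2 * real Q) \<le> \<bar>of_int a - real q * A\<bar>" using Q by (simp add: pos_divide_le_eq mult.commute)
    qed
  qed
qed

lemma curved_arc_restrict:
  assumes "curved_arc c \<eta> \<xi> f f' f''" "\<eta> \<le> A" "A < B" "B \<le> \<xi>"
  shows "curved_arc c A B f f' f''"
proof -
  interpret curved_arc c \<eta> \<xi> f f' f'' by fact
  have sub: "{A..B} \<subseteq> {\<eta>..\<xi>}" using assms by auto
  show ?thesis
  proof
    show "continuous_on {A..B} f''" by (rule continuous_on_subset[OF cont2 sub])
    fix x assume "x \<in> {A..B}"
    then have x: "x \<in> {\<eta>..\<xi>}" using sub by blast
    show "(f has_real_derivative f' x) (at x within {A..B})" by (rule DERIV_subset[OF deriv1[OF x] sub])
    show "(f' has_real_derivative f'' x) (at x within {A..B})" by (rule DERIV_subset[OF deriv2[OF x] sub])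
    show "c \<le> f'' x \<and> f'' x \<le> 1 / c" by (rule bound2[OF x])
  qed (use c cv assms in auto)
qed

section \<open>Arbitrary endpoints and arbitrarily small widths\<close>

definition error_size :: "real \<Rightarrow> nat \<Rightarrow> real \<Rightarrow> real" where
  "error_size \<epsilon> Q d = sqrt d * ln (1 / d) * real Q powr (3 / 2) + real Q powr (1 + \<epsilon>)"

lemma error_size_ge:
  assumes "\<epsilon> > 0" "1 \<le> Q" "0 < d" "d \<le> 1"
  shows "real Q powr (1 + \<epsilon>) \<le> error_size \<epsilon> Q d" "real Q \<le> error_size \<epsilon> Q d" "0 \<le> error_size \<epsilon> Q d"
proof -
  have "0 \<le> sqrt d * ln (1 / d) * real Q powr (3 / 2)" using assms by simp
  then show "real Q powr (1 + \<epsilon>) \<le> error_size \<epsilon> Q d" by (simp add: error_size_def)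
  then show "real Q \<le> error_size \<epsilon> Q d" using powr_mono[of 1 "1 + \<epsilon>" "real Q"] assms by simp
  then show "0 \<le> error_size \<epsilon> Q d" using assms by linarith
qed

text \<open>At d = 1/Q the first error term is Q log Q, hence O(Q^(1+\<epsilon>)). This is what
  makes widths below 1/Q follow from the width 1/Q.\<close>

lemma error_size_inverse:
  assumes "\<epsilon> > 0" "1 \<le> Q"
  shows "error_size \<epsilon> Q (1 / real Q) \<le> (1 / \<epsilon> + 1) * real Q powr (1 + \<epsilon>)"
proof -
  have Q: "real Q > 0" "real Q \<ge> 1" using assms by auto
  have "sqrt (1 / real Q) * real Q powr (3 / 2) = real Q powr (- (1 / 2)) * real Q powr (3 / 2)"
    unfolding powr_minus powr_half_sqrt[OF less_imp_le[OF Q(1)]] by (simp add: real_sqrt_divide inverse_eq_divide)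
  also have "\<dots> = real Q" using Q by (simp flip: powr_add)
  finally have "sqrt (1 / real Q) * ln (1 / (1 / real Q)) * real Q powr (3 / 2) = real Q * ln (real Q)"
    by (simp add: mult_ac)
  also have "\<dots> \<le> real Q * (real Q powr \<epsilon> / \<epsilon>)"
    using Q assms ln_powr_bound[of "real Q" \<epsilon>] by (intro mult_left_mono) auto
  also have "\<dots> = real Q powr (1 + \<epsilon>) / \<epsilon>" using Q by (simp add: powr_add)
  finally show ?thesis unfolding error_size_def by (simp add: distrib_right)
qed

text \<open>For d < 1/Q the count is at most the count at 1/Q, and the main term is at most l Q;
  both are within the error. If l Q \<le> 4, the arc may be too short for its endpoints to be moved,
  but then the trivial count is already O(Q).\<close>

lemma full_arc_count:
  assumes c: "0 < c" "c \<le> 1" and l: "l > 0" and eps: "\<epsilon> > 0"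
  shows "\<exists>C>0. \<forall>\<eta> \<xi> f f' f'' Q d. curved_arc c \<eta> \<xi> f f' f'' \<longrightarrow> \<xi> - \<eta> = l \<longrightarrow> 1 \<le> Q \<longrightarrow> 0 < d \<longrightarrow> d \<le> 1 / 2 \<longrightarrow>
     \<bar>real (arc_count f \<eta> \<xi> Q d) - l * d * (real Q)\<^sup>2\<bar> \<le> C * error_size \<epsilon> Q d"
proof -
  obtain C0 where C0: "C0 > 0" and bd: "\<And>A B f f' f'' Q d. curved_arc c A B f f' f'' \<Longrightarrow> B - A \<le> l \<Longrightarrow>
     avoids A Q \<Longrightarrow> avoids B Q \<Longrightarrow> 2 \<le> Q \<Longrightarrow> 1 / real Q \<le> d \<Longrightarrow> d \<le> 1 / 2 \<Longrightarrow>
     \<bar>real (arc_count f A B Q d) - (B - A) * d * (real Q)\<^sup>2\<bar> \<le> C0 * error_size \<epsilon> Q d"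
    using arc_count_bound[OF c l eps] unfolding error_size_def by blast
  define C1 where "C1 = C0 + l + 8"
  have C1: "C1 > 0" "l + 5 \<le> C1" using C0 l by (simp_all add: C1_def)
  have large: "\<bar>real (arc_count f \<eta> \<xi> Q d) - l * d * (real Q)\<^sup>2\<bar> \<le> C1 * error_size \<epsilon> Q d"
    if arc: "curved_arc c \<eta> \<xi> f f' f''" and len: "\<xi> - \<eta> = l" and Q: "1 \<le> Q" and d: "1 / real Q \<le> d" "d \<le> 1 / 2"
    for \<eta> \<xi> f f' f'' Q d
  proof -
    have Q0: "real Q > 0" using Q by simp
    have "0 < 1 / real Q" using Q0 by simp
    then have d0: "d > 0" using d(1) by linarith
    note E = error_size_ge[OF eps Q d0]
    have dQ: "l * d * (real Q)\<^sup>2 \<le> l * 1 * (real Q)\<^sup>2" using l d by (intro mult_right_mono mult_left_mono) auto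
    show ?thesis
    proof (cases "l * real Q \<le> 4 \<or> Q = 1")
      case True
      have lQ: "l * (real Q)\<^sup>2 \<le> (l + 4) * real Q"
      proof (cases "Q = 1")
        case False
        then have "l * real Q * real Q \<le> (l + 4) * real Q" using True l by (intro mult_right_mono) auto
        then show ?thesis by (simp add: power2_eq_square mult_ac)
      qed simp
      have "l * (real Q * (real Q + 1) / 2) \<le> l * (real Q)\<^sup>2"
        using l Q by (intro mult_left_mono) (auto simp: power2_eq_square)
      then have "real (arc_count f \<eta> \<xi> Q d) \<le> l * (real Q)\<^sup>2 + real Q"
        using arc_count_trivial[of \<eta> \<xi> d f Q, unfolded len] len l d by linarith
      moreover have "0 \<le> l * d * (real Q)\<^sup>2" using l d0 by simp
      ultimately have "\<bar>real (arc_count f \<eta> \<xi> Q d) - l * d * (real Q)\<^sup>2\<bar> \<le> (l + 5) * real Q"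
        using dQ lQ by (simp add: distrib_right)
      also have "\<dots> \<le> C1 * error_size \<epsilon> Q d" using C1 l E(2) d by (intro mult_mono) auto
      finally show ?thesis .
    next
      case False
      obtain A where A: "\<eta> \<le> A" "A \<le> \<eta> + 2 / real Q" "avoids A Q" using ex_avoiding[of Q \<eta>] Q by auto
      \<comment> \<open>\<open>ex_avoiding\<close> moves a point to the right, so starting from
        \<xi> - 2/Q keeps the new endpoint inside the arc.\<close>
      obtain B where B: "\<xi> - 2 / real Q \<le> B" "B \<le> \<xi> - 2 / real Q + 2 / real Q" "avoids B Q"
        using ex_avoiding[of Q "\<xi> - 2 / real Q"] Q by auto
      have r: "4 / real Q = 2 / real Q + 2 / real Q" by simp
      have "4 / real Q < l" using False Q0 by (simp add: pos_divide_less_eq)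
      then have AB: "A < B" "B \<le> \<xi>" "B - A \<le> l" using A(1,2) B(1,2) len r by linarith+
      have arc': "curved_arc c A B f f' f''" by (rule curved_arc_restrict[OF arc]) (use A AB in auto)
      have 1: "\<bar>real (arc_count f A B Q d) - (B - A) * d * (real Q)\<^sup>2\<bar> \<le> C0 * error_size \<epsilon> Q d"
        using False Q d by (intro bd[OF arc'] A B AB) auto
      have 2: "arc_count f A B Q d \<le> arc_count f \<eta> \<xi> Q d" "real (arc_count f \<eta> \<xi> Q d) \<le> real (arc_count f A B Q d) + 6 * real Q"
        using arc_count_subarc[of \<eta> A B \<xi> d Q f] A B AB d by auto
      have gap: "0 \<le> l - (B - A)" "l - (B - A) \<le> 4 / real Q" using A(1,2) B(1,2) AB len r by linarith+
      have 3: "0 \<le> (l - (B - A)) * d * (real Q)\<^sup>2" using gap d0 by simp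
      have "(l - (B - A)) * d * (real Q)\<^sup>2 \<le> 4 / real Q * (1 / 2) * (real Q)\<^sup>2"
        using gap d d0 by (intro mult_right_mono mult_mono) auto
      then have 4: "(l - (B - A)) * d * (real Q)\<^sup>2 \<le> 2 * real Q" using Q0 by (simp add: power2_eq_square)
      have "\<bar>real (arc_count f \<eta> \<xi> Q d) - l * d * (real Q)\<^sup>2\<bar> \<le> C0 * error_size \<epsilon> Q d + 8 * real Q"
        using 1 2 3 4 by (simp add: left_diff_distrib)
      also have "\<dots> \<le> C0 * error_size \<epsilon> Q d + 8 * error_size \<epsilon> Q d" using E(2) d by simp
      also have "\<dots> \<le> C1 * error_size \<epsilon> Q d" using E(3) d l by (simp add: C1_def distrib_right)
      finally show ?thesis .
    qed
  qed
  define C where "C = C1 * (1 / \<epsilon> + 1) + l + C1"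
  have "\<bar>real (arc_count f \<eta> \<xi> Q d) - l * d * (real Q)\<^sup>2\<bar> \<le> C * error_size \<epsilon> Q d"
    if arc: "curved_arc c \<eta> \<xi> f f' f''" and len: "\<xi> - \<eta> = l" and Q: "1 \<le> Q" and d: "0 < d" "d \<le> 1 / 2"
    for \<eta> \<xi> f f' f'' Q d
  proof -
    have Q0: "real Q > 0" using Q by simp
    note E = error_size_ge[OF eps Q d(1)]
    consider "1 / real Q \<le> d" | "d < 1 / real Q" "Q = 1" | "d < 1 / real Q" "2 \<le> Q" using Q by linarith
    then show ?thesis
    proof cases
      case 1
      have "C1 * error_size \<epsilon> Q d \<le> C * error_size \<epsilon> Q d"
        using E(3) d C1 l eps by (intro mult_right_mono) (auto simp: C_def)
      then show ?thesis using large[OF arc len Q 1 d(2)] by linarith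
    next
      case 2
      have "real (arc_count f \<eta> \<xi> Q d) \<le> l + 1" using arc_count_trivial[of \<eta> \<xi> d f Q] len l d 2 by simp
      moreover have "0 \<le> l * d" "l * d \<le> l * 1" using l d by (auto intro!: mult_left_mono)
      ultimately have "\<bar>real (arc_count f \<eta> \<xi> Q d) - l * d * (real Q)\<^sup>2\<bar> \<le> (l + C1) * real Q" using 2 C1 by simp
      also have "\<dots> \<le> C * error_size \<epsilon> Q d" using C1 l E(2) d eps by (intro mult_mono) (auto simp: C_def)
      finally show ?thesis .
    next
      case 3
      have Q2: "1 / real Q \<le> 1 / 2" using 3 by simp
      have "arc_count f \<eta> \<xi> Q d \<le> arc_count f \<eta> \<xi> Q (1 / real Q)" using 3 by (intro arc_count_mono) auto
      then have "real (arc_count f \<eta> \<xi> Q d) \<le> real (arc_count f \<eta> \<xi> Q (1 / real Q))" by simp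
      moreover have "l * (1 / real Q) * (real Q)\<^sup>2 = l * real Q" by (simp add: power2_eq_square)
      moreover have "\<bar>real (arc_count f \<eta> \<xi> Q (1 / real Q)) - l * (1 / real Q) * (real Q)\<^sup>2\<bar> \<le> C1 * error_size \<epsilon> Q (1 / real Q)"
        by (rule large[OF arc len Q _ Q2]) simp
      ultimately have "real (arc_count f \<eta> \<xi> Q d) \<le> l * real Q + C1 * error_size \<epsilon> Q (1 / real Q)" by linarith
      moreover have "0 \<le> l * d * (real Q)\<^sup>2" using l d by simp
      moreover have "l * d * (real Q)\<^sup>2 \<le> l * (1 / real Q) * (real Q)\<^sup>2" using l 3 by (intro mult_right_mono mult_left_mono) auto
      then have "l * d * (real Q)\<^sup>2 \<le> l * real Q" using Q0 by (simp add: power2_eq_square)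
      moreover have "C1 * error_size \<epsilon> Q (1 / real Q) \<le> C1 * ((1 / \<epsilon> + 1) * real Q powr (1 + \<epsilon>))"
        using error_size_inverse[OF eps Q] C1 by (intro mult_left_mono) auto
      moreover have "0 \<le> C1 * error_size \<epsilon> Q (1 / real Q)"
        using error_size_ge(3)[OF eps Q, of "1 / real Q"] Q C1 by simp
      ultimately have "\<bar>real (arc_count f \<eta> \<xi> Q d) - l * d * (real Q)\<^sup>2\<bar> \<le>
         l * real Q + C1 * ((1 / \<epsilon> + 1) * real Q powr (1 + \<epsilon>))" by linarith
      also have "\<dots> \<le> l * error_size \<epsilon> Q d + C1 * ((1 / \<epsilon> + 1) * error_size \<epsilon> Q d)"
        using E(1,2) d l C1 eps by (intro add_mono mult_left_mono) auto
      also have "\<dots> \<le> C * error_size \<epsilon> Q d" using mult_nonneg_nonneg[of C1 "error_size \<epsilon> Q d"] E(3) d C1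
        by (simp add: C_def algebra_simps)
      finally show ?thesis .
    qed
  qed
  moreover have "C > 0" using C1 l eps by (simp add: C_def add_pos_pos)
  ultimately show ?thesis by blast
qed

section \<open>Reduction to curved arcs\<close>

text \<open>Off a closed set the filter is trivial, so every number is a derivative there. Combined
  with the rule for unions, this glues a function from closed pieces without a case distinction at
  the joints.\<close>

lemma has_derivative_within_closed_trivial:
  fixes F :: "real \<Rightarrow> real"
  assumes "closed S" "x \<notin> S"
  shows "(F has_real_derivative D) (at x within S)"
proof -
  have "at x within S = bot" using assms by (simp add: at_within_eq_bot_iff)
  then show ?thesis by (simp add: has_field_derivative_iff)
qed

lemma has_derivative_within_Un:
  fixes F :: "real \<Rightarrow> real"
  assumes "(F has_real_derivative D) (at x within S)" "(F has_real_derivative D) (at x within T)"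
  shows "(F has_real_derivative D) (at x within S \<union> T)"
  using assms unfolding has_field_derivative_iff by (subst at_within_union) (rule filterlim_sup)

text \<open>The quadratic bounds say that F minus a parabola has a minimum at x for the coefficient
  c/2 and a maximum at x for 1/(2c), after removing the tangent slope. Surjectivity holds because
  the slope is continuous and grows at least linearly in both directions.\<close>

lemma curvI:
  assumes c: "0 < c"
    and der: "\<And>x. (F has_real_derivative F' x) (at x)"
    and lo: "\<And>x y. x \<le> y \<Longrightarrow> c * (y - x) \<le> F' y - F' x"
    and hi: "\<And>x y. x \<le> y \<Longrightarrow> F' y - F' x \<le> (y - x) / c"
  shows "curv c F F'"
  unfolding curv_def
proof (intro conjI allI)
  have "continuous_on UNIV F'"
  proof -
    have "(1/c)-lipschitz_on UNIV F'"
    proof (rule lipschitz_onI)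
      fix x y
      have "\<bar>F' y - F' x\<bar> \<le> \<bar>y - x\<bar> / c" if "x \<le> y" for x y
      proof -
        have "0 \<le> c * (y - x)" using c that by simp
        then have "0 \<le> F' y - F' x" using lo[OF that] by linarith
        then show ?thesis using hi[OF that] that by simp
      qed
      from this[of x y] this[of y x] show "dist (F' x) (F' y) \<le> 1 / c * dist x y"
        by (cases "x \<le> y") (auto simp: dist_real_def abs_minus_commute)
    qed (use c in simp)
    then show ?thesis by (rule lipschitz_on_continuous_on)
  qed
  then have cont: "continuous_on S F'" for S by (rule continuous_on_subset) simp
  have "\<exists>x. p = F' x" for p
  proof -
    define M where "M = \<bar>p - F' 0\<bar> / c"
    have M: "M \<ge> 0" "c * M = \<bar>p - F' 0\<bar>" using c by (auto simp: M_def)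
    have "F' (- M) \<le> p" using lo[of "- M" 0] M by simp
    moreover have "p \<le> F' M" using lo[of 0 M] M by simp
    ultimately obtain x where "F' x = p" using IVT'[of F' "- M" p M] M cont by auto
    then show ?thesis by blast
  qed
  then show "surj F'" by (simp add: surj_def)
next
  fix x y
  let ?\<phi> = "\<lambda>t. F t - F' x * t - c / 2 * (t - x)\<^sup>2"
  have d: "(?\<phi> has_real_derivative (F' t - F' x - c * (t - x))) (at t)" for t
    by (rule derivative_eq_intros der refl | simp)+
  have "?\<phi> x \<le> ?\<phi> y"
  proof (cases "x \<le> y")
    case True
    then show ?thesis
      by (rule DERIV_nonneg_imp_nondecreasing) (use d lo[of x] in \<open>fastforce simp: algebra_simps\<close>)
  next
    case False
    then have "y \<le> x" by simp
    then show ?thesis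
      by (rule DERIV_nonpos_imp_nonincreasing) (use d lo[of _ x] in \<open>fastforce simp: algebra_simps\<close>)
  qed
  then show "F x + F' x * (y - x) + c / 2 * (y - x)\<^sup>2 \<le> F y" by (simp add: algebra_simps)
next
  fix x y
  let ?\<phi> = "\<lambda>t. F t - F' x * t - (1 / c) / 2 * (t - x)\<^sup>2"
  have d: "(?\<phi> has_real_derivative (F' t - F' x - (1 / c) * (t - x))) (at t)" for t
    by (rule derivative_eq_intros der refl | use c in \<open>simp add: field_simps\<close>)+
  have "?\<phi> y \<le> ?\<phi> x"
  proof (cases "x \<le> y")
    case True
    then show ?thesis
      by (rule DERIV_nonpos_imp_nonincreasing) (use d hi[of x] in fastforce)
  next
    case False
    then have "y \<le> x" by simp
    then show ?thesis
      by (rule DERIV_nonneg_imp_nondecreasing) (use d hi[of _ x] in \<open>fastforce simp: diff_divide_distrib\<close>)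
  qed
  moreover have "(y - x)\<^sup>2 / (2 * c) = (1 / c) / 2 * (y - x)\<^sup>2" by simp
  ultimately show "F y \<le> F x + F' x * (y - x) + (y - x)\<^sup>2 / (2 * c)" by (simp only:) (simp add: algebra_simps)
qed

text \<open>Beyond each end the function continues as a parabola with second derivative 1, a value
  between c and 1/c because c \<le> 1. The clamp \<open>k\<close> gives one formula for all three
  pieces and makes the slope estimates a sum of the part inside the arc and the part
  outside.\<close>

lemma curved_extension:
  fixes f f' f'' :: "real \<Rightarrow> real"
  assumes c: "0 < c" "c \<le> 1" and AB: "A < B"
    and d1: "\<And>x. x \<in> {A..B} \<Longrightarrow> (f has_real_derivative f' x) (at x within {A..B})"
    and d2: "\<And>x. x \<in> {A..B} \<Longrightarrow> (f' has_real_derivative f'' x) (at x within {A..B})"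
    and cont: "continuous_on {A..B} f''"
    and bd: "\<And>x. x \<in> {A..B} \<Longrightarrow> c \<le> f'' x \<and> f'' x \<le> 1 / c"
  shows "\<exists>F F'. curved_arc c A B F F' f'' \<and> (\<forall>x\<in>{A..B}. F x = f x)"
proof -
  define k where "k x = max A (min B x)" for x
  define F' where "F' x = f' (k x) + (x - k x)" for x
  define F where "F x = f (k x) + f' (k x) * (x - k x) + (x - k x)\<^sup>2 / 2" for x
  have k: "k x \<in> {A..B}" for x using AB by (auto simp: k_def)
  have kid: "k x = x" if "x \<in> {A..B}" for x using that by (auto simp: k_def)
  have FF: "F x = f x" "F' x = f' x" if "x \<in> {A..B}" for x using kid[OF that] by (simp_all add: F_def F'_def)
  have mvt: "c * (y - x) \<le> f' y - f' x" "f' y - f' x \<le> (y - x) / c"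
    if xy: "x \<in> {A..B}" "y \<in> {A..B}" "x \<le> y" for x y
  proof -
    have "{x..y} \<subseteq> {A..B}" using xy by auto
    then have "(f' has_derivative times (f'' t)) (at t within {x..y})" if "t \<in> {x..y}" for t
      using DERIV_subset[OF d2] that unfolding has_field_derivative_def by blast
    then obtain t where t: "t \<in> {x..y}" "f' y - f' x = f'' t * (y - x)"
      using mvt_very_simple[OF xy(3), of f' "\<lambda>t. times (f'' t)"] by (metis atLeastAtMost_iff)
    have "t \<in> {A..B}" using t xy by auto
    from bd[OF this] have b: "c \<le> f'' t" "f'' t \<le> 1 / c" by auto
    show "c * (y - x) \<le> f' y - f' x" unfolding t(2) using b xy by (intro mult_right_mono) auto
    have "f'' t * (y - x) \<le> 1 / c * (y - x)" using b xy by (intro mult_right_mono) auto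
    then show "f' y - f' x \<le> (y - x) / c" unfolding t(2) by simp
  qed
  have "(F has_real_derivative F' x) (at x within {..A} \<union> ({A..B} \<union> {B..}))" for x
  proof (intro has_derivative_within_Un)
    show "(F has_real_derivative F' x) (at x within {..A})"
    proof (cases "x \<in> {..A}")
      case True
      have e: "k y = A" if "y \<in> {..A}" for y using that AB by (auto simp: k_def)
      have "((\<lambda>y. f A + f' A * (y - A) + (y - A)\<^sup>2 / 2) has_real_derivative F' x) (at x within {..A})"
        using e[OF True] by (auto intro!: derivative_eq_intros simp: F'_def)
      then show ?thesis
        by (rule has_field_derivative_transform_within[of _ _ _ _ 1]) (use True e in \<open>auto simp: F_def\<close>)
    qed (simp add: has_derivative_within_closed_trivial)
    show "(F has_real_derivative F' x) (at x within {B..})"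
    proof (cases "x \<in> {B..}")
      case True
      have e: "k y = B" if "y \<in> {B..}" for y using that AB by (auto simp: k_def)
      have "((\<lambda>y. f B + f' B * (y - B) + (y - B)\<^sup>2 / 2) has_real_derivative F' x) (at x within {B..})"
        using e[OF True] by (auto intro!: derivative_eq_intros simp: F'_def)
      then show ?thesis
        by (rule has_field_derivative_transform_within[of _ _ _ _ 1]) (use True e in \<open>auto simp: F_def\<close>)
    qed (simp add: has_derivative_within_closed_trivial)
    show "(F has_real_derivative F' x) (at x within {A..B})"
    proof (cases "x \<in> {A..B}")
      case True
      have "(f has_real_derivative F' x) (at x within {A..B})" using d1[OF True] FF[OF True] by simp
      then show ?thesis
        by (rule has_field_derivative_transform_within[of _ _ _ _ 1]) (use True FF in auto)
    qed (simp add: has_derivative_within_closed_trivial)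
  qed
  moreover have "{..A} \<union> ({A..B} \<union> {B..}) = UNIV" by auto
  ultimately have der: "(F has_real_derivative F' x) (at x)" for x by simp
  have cv: "curv c F F'"
  proof (rule curvI[OF c(1) der])
    fix x y :: real assume xy: "x \<le> y"
    define s t where "s = k y - k x" and "t = (y - k y) - (x - k x)"
    have st: "s \<ge> 0" "t \<ge> 0" "y - x = s + t" using xy AB by (auto simp: s_def t_def k_def max_def min_def)
    have e: "F' y - F' x = (f' (k y) - f' (k x)) + t" by (simp add: F'_def t_def)
    have kk: "k x \<le> k y" using st by (simp add: s_def)
    note m = mvt[OF k k kk, folded s_def]
    have "c * t \<le> 1 * t" using c st by (intro mult_right_mono) auto
    then show "c * (y - x) \<le> F' y - F' x" unfolding e st(3) using m by (simp add: distrib_left)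
    have "t \<le> t / c" using c st by (simp add: pos_le_divide_eq mult_left_le)
    then show "F' y - F' x \<le> (y - x) / c" unfolding e st(3) using m by (simp add: add_divide_distrib)
  qed
  have "curved_arc c A B F F' f''"
  proof
    show "(F has_real_derivative F' x) (at x within {A..B})" for x by (rule has_field_derivative_at_within[OF der])
    show "(F' has_real_derivative f'' x) (at x within {A..B})" if "x \<in> {A..B}" for x
      by (rule has_field_derivative_transform_within[OF d2[OF that], of 1]) (use that FF in auto)
  qed (use c AB cv cont bd in auto)
  then show ?thesis using FF by blast
qed

lemma arc_count_cong:
  assumes "\<And>x. x \<in> {A..B} \<Longrightarrow> f x = g x"
  shows "arc_count f A B Q d = arc_count g A B Q d"
  unfolding arc_count_def
proof (rule sum.cong[OF refl])
  fix p assume "p \<in> arc_points A B Q"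
  then obtain q a where p: "p = (q, a)" "1 \<le> q" "\<lceil>real q * A\<rceil> \<le> a" "a \<le> \<lfloor>real q * B\<rfloor>" by (auto simp: arc_points_def)
  then have "of_int a / real q \<in> {A..B}" by (simp add: ceiling_le_iff le_floor_iff field_simps)
  then show "near_count d (height f p) = near_count d (height g p)" using assms by (simp add: height_def p)
qed

lemma near_count_minus: "near_count d (- t) = near_count d t"
  unfolding near_count_def
  by (rule bij_betw_same_card[of uminus], rule bij_betwI[of _ _ _ uminus]) auto

lemma arc_count_minus: "arc_count (\<lambda>x. - f x) A B Q d = arc_count f A B Q d"
  unfolding arc_count_def height_def by (simp add: near_count_minus)

text \<open>A continuous second derivative that never vanishes has constant sign on an interval. The
  concave case becomes the convex one for -f, which has the same counts since the nearness condition
  is symmetric in sign.\<close>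

lemma curved_functions_count:
  assumes AB: "\<eta> < \<xi>" and c12: "0 < c1" "c1 \<le> c2" and eps: "\<epsilon> > 0"
  shows "\<exists>C>0. \<forall>f\<in>curved_functions {\<eta>..\<xi>} c1 c2. \<forall>Q d. 1 \<le> Q \<longrightarrow> 0 < d \<longrightarrow> d \<le> 1 / 2 \<longrightarrow>
     \<bar>real (arc_count f \<eta> \<xi> Q d) - (\<xi> - \<eta>) * d * (real Q)\<^sup>2\<bar> \<le> C * error_size \<epsilon> Q d"
proof -
  define c where "c = min 1 (min c1 (1 / c2))"
  have c: "0 < c" "c \<le> 1" "c \<le> c1" using c12 by (auto simp: c_def)
  have "c \<le> 1 / c2" by (simp add: c_def)
  then have c2: "c2 \<le> 1 / c" using c c12 by (simp add: field_simps)
  obtain C where C: "C > 0" and bd: "\<And>f f' f'' Q d. curved_arc c \<eta> \<xi> f f' f'' \<Longrightarrow> 1 \<le> Q \<Longrightarrow> 0 < d \<Longrightarrow> d \<le> 1 / 2 \<Longrightarrow>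
     \<bar>real (arc_count f \<eta> \<xi> Q d) - (\<xi> - \<eta>) * d * (real Q)\<^sup>2\<bar> \<le> C * error_size \<epsilon> Q d"
    using full_arc_count[OF c(1,2) _ eps, of "\<xi> - \<eta>"] AB by (metis diff_gt_0_iff_gt)
  have "\<bar>real (arc_count f \<eta> \<xi> Q d) - (\<xi> - \<eta>) * d * (real Q)\<^sup>2\<bar> \<le> C * error_size \<epsilon> Q d"
    if f: "f \<in> curved_functions {\<eta>..\<xi>} c1 c2" and Qd: "1 \<le> Q" "0 < d" "d \<le> 1 / 2" for f Q d
  proof -
    define I where "I = {\<eta>..\<xi>}"
    define f' where "f' = deriv_on I f"
    define f'' where "f'' = deriv_on I f'"
    have C2: "f differentiable_on I" "f' differentiable_on I" "continuous_on I f''"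
      and b: "\<And>x. x \<in> I \<Longrightarrow> c1 \<le> \<bar>f'' x\<bar> \<and> \<bar>f'' x\<bar> \<le> c2"
      using f unfolding curved_functions_def C2_on_def f'_def f''_def I_def by auto
    have der: "(g has_real_derivative deriv_on I g x) (at x within I)" if "g differentiable_on I" "x \<in> I" for g x
      using that unfolding deriv_on_def differentiable_on_def has_real_derivative_iff_has_vector_derivative
      by (simp flip: vector_derivative_works)
    have d1: "(f has_real_derivative f' x) (at x within I)" and d2: "(f' has_real_derivative f'' x) (at x within I)"
      if "x \<in> I" for x using der C2 that by (auto simp: f'_def f''_def)
    have "(\<forall>x\<in>I. f'' x > 0) \<or> (\<forall>x\<in>I. f'' x < 0)"
    proof (rule ccontr)
      assume "\<not> ?thesis"
      then obtain x y where xy: "x \<in> I" "y \<in> I" "f'' x \<le> 0" "0 \<le> f'' y" by (meson not_less)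
      have "connected (f'' ` I)" using C2(3) by (intro connected_continuous_image) (auto simp: I_def)
      then have "0 \<in> f'' ` I" using xy connectedD_interval[of "f'' ` I" "f'' x" "f'' y" 0] by auto
      then show False using b c12 by fastforce
    qed
    then show ?thesis
    proof
      assume pos: "\<forall>x\<in>I. f'' x > 0"
      have "c \<le> f'' x \<and> f'' x \<le> 1 / c" if "x \<in> I" for x using b[OF that] bspec[OF pos that] c(3) c2 by auto
      then obtain F F' where F: "curved_arc c \<eta> \<xi> F F' f''" "\<forall>x\<in>I. F x = f x"
        using curved_extension[OF c(1,2) AB, of f f' f''] d1 d2 C2(3) unfolding I_def by blast
      then have "arc_count f \<eta> \<xi> Q d = arc_count F \<eta> \<xi> Q d" by (intro arc_count_cong) (auto simp: I_def)
      then show ?thesis using bd[OF F(1) Qd] by simp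
    next
      assume neg: "\<forall>x\<in>I. f'' x < 0"
      have "c \<le> - f'' x \<and> - f'' x \<le> 1 / c" if "x \<in> I" for x using b[OF that] bspec[OF neg that] c(3) c2 by auto
      then obtain F F' where F: "curved_arc c \<eta> \<xi> F F' (\<lambda>x. - f'' x)" "\<forall>x\<in>I. F x = - f x"
        using curved_extension[OF c(1,2) AB, of "\<lambda>x. - f x" "\<lambda>x. - f' x" "\<lambda>x. - f'' x"]
          DERIV_minus[OF d1] DERIV_minus[OF d2] continuous_on_minus[OF C2(3)] unfolding I_def by blast
      have "arc_count (\<lambda>x. - f x) \<eta> \<xi> Q d = arc_count F \<eta> \<xi> Q d" using F by (intro arc_count_cong) (auto simp: I_def)
      then show ?thesis using bd[OF F(1) Qd] by (simp add: arc_count_minus)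
    qed
  qed
  then show ?thesis using C by blast
qed

section \<open>Primitive points\<close>

definition moebius :: "nat \<Rightarrow> real" where
  "moebius n = (if squarefree n then (- 1) ^ card (prime_factors n) else 0)"

lemma abs_moebius_le_1: "\<bar>moebius n\<bar> \<le> 1"
  by (simp add: moebius_def power_abs)

lemma moebius_mult_prime:
  assumes p: "prime p" "\<not> p dvd n" and n: "n > 0"
  shows "moebius (p * n) = - moebius n"
proof -
  have "coprime p n" using p by (simp add: prime_imp_coprime)
  then have "squarefree (p * n) \<longleftrightarrow> squarefree n"
    using squarefree_mult_coprime[of p n] squarefree_multD(2)[of p n] squarefree_prime[OF p(1)] by blast
  moreover have "prime_factors (p * n) = insert p (prime_factors n)"
    using p n by (auto simp: prime_factors_product prime_prime_factors)
  moreover have "p \<notin> prime_factors n" using p by (auto simp: prime_factors_dvd)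
  ultimately show ?thesis by (simp add: moebius_def)
qed

text \<open>For a fixed prime factor p, the divisors not divisible by p cancel against their
  products with p. The divisors that remain are multiples of p^2, where the Moebius function
  vanishes.\<close>

lemma sum_moebius_divisors:
  assumes "n > 0"
  shows "(\<Sum>d | d dvd n. moebius d) = (if n = 1 then 1 else 0)"
proof (cases "n = 1")
  case True
  then show ?thesis by (simp add: moebius_def)
next
  case False
  then obtain p where p: "prime p" "p dvd n" using prime_factor_nat by blast
  define D where "D = {d. d dvd n}"
  define E where "E = {d \<in> D. \<not> p dvd d}"
  have fin: "finite D" using assms by (simp add: D_def)
  have inj: "inj_on (times p) E" using p(1) by (auto simp: inj_on_def)
  have pos: "d > 0" if "d \<in> D" for d using that assms by (auto simp: D_def intro: Nat.gr0I)
  have img: "times p ` E \<subseteq> D - E"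
  proof
    fix x assume "x \<in> times p ` E"
    then obtain e where e: "x = p * e" "e dvd n" "\<not> p dvd e" by (auto simp: E_def D_def)
    have "coprime p e" using p(1) e(3) by (simp add: prime_imp_coprime)
    then have "p * e dvd n" using p(2) e(2) by (simp add: divides_mult)
    then show "x \<in> D - E" by (simp add: D_def E_def e(1))
  qed
  have "(\<Sum>d\<in>D - E. moebius d) = (\<Sum>d\<in>times p ` E. moebius d)"
  proof (rule sum.mono_neutral_right[OF _ img])
    show "\<forall>d\<in>D - E - times p ` E. moebius d = 0"
    proof
      fix d assume d: "d \<in> D - E - times p ` E"
      then obtain e where e: "d = p * e" by (auto simp: E_def)
      have "e dvd n" using d by (auto simp: D_def e intro: dvd_trans[OF dvd_triv_right])
      then have "p dvd e" using d by (auto simp: e E_def D_def)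
      then have "p\<^sup>2 dvd d" by (simp add: e power2_eq_square)
      then have "\<not> squarefree d" using p(1) by (auto simp: squarefree_def)
      then show "moebius d = 0" by (simp add: moebius_def)
    qed
  qed (use fin in auto)
  also have "\<dots> = (\<Sum>d\<in>E. moebius (p * d))" by (simp add: sum.reindex[OF inj])
  also have "\<dots> = (\<Sum>d\<in>E. - moebius d)"
    by (rule sum.cong[OF refl], rule moebius_mult_prime) (use p pos in \<open>auto simp: E_def\<close>)
  also have "\<dots> = - (\<Sum>d\<in>E. moebius d)" by (rule sum_negf)
  finally have "(\<Sum>d\<in>D - E. moebius d) + (\<Sum>d\<in>E. moebius d) = 0" by simp
  moreover have "(\<Sum>d\<in>D. moebius d) = (\<Sum>d\<in>D - E. moebius d) + (\<Sum>d\<in>E. moebius d)"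
    by (rule sum.subset_diff) (use fin in \<open>auto simp: E_def\<close>)
  ultimately show ?thesis using False by (simp add: D_def)
qed

lemma sum_moebius_upto:
  assumes "0 < n" "n \<le> Q"
  shows "(\<Sum>m\<in>{m\<in>{1..Q}. m dvd n}. moebius m) = (if n = 1 then 1 else 0)"
proof -
  have "{m\<in>{1..Q}. m dvd n} = {d. d dvd n}" using assms by (auto dest: dvd_imp_le intro: Suc_leI dvd_pos_nat)
  then show ?thesis using sum_moebius_divisors[OF assms(1)] by simp
qed

definition arc_triples :: "(real \<Rightarrow> real) \<Rightarrow> real \<Rightarrow> real \<Rightarrow> nat \<Rightarrow> real \<Rightarrow> ((nat \<times> int) \<times> int) set" where
  "arc_triples f A B Q d = (SIGMA p:arc_points A B Q. {b. \<bar>height f p - of_int b\<bar> < d})"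

fun content :: "(nat \<times> int) \<times> int \<Rightarrow> nat" where
  "content ((q, a), b) = nat (gcd (gcd a b) (int q))"

fun scale_triple :: "nat \<Rightarrow> (nat \<times> int) \<times> int \<Rightarrow> (nat \<times> int) \<times> int" where
  "scale_triple m ((q, a), b) = ((m * q, int m * a), int m * b)"

lemma finite_arc_triples: "d \<le> 1 \<Longrightarrow> finite (arc_triples f A B Q d)"
  unfolding arc_triples_def by (intro finite_SigmaI finite_arc_points finite_near)

lemma card_arc_triples: "d \<le> 1 \<Longrightarrow> card (arc_triples f A B Q d) = arc_count f A B Q d"
  unfolding arc_triples_def arc_count_def near_count_def
  by (subst card_SigmaI) (auto intro: finite_arc_points finite_near)

lemma arc_triples_iff:
  "((q, a), b) \<in> arc_triples f A B Q d \<longleftrightarrow>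
     1 \<le> q \<and> q \<le> Q \<and> real q * A \<le> of_int a \<and> of_int a \<le> real q * B \<and> \<bar>real q * f (of_int a / real q) - of_int b\<bar> < d"
  by (auto simp: arc_triples_def arc_points_def height_def ceiling_le_iff le_floor_iff)

lemma content_pos_le:
  assumes "v \<in> arc_triples f A B Q d"
  shows "0 < content v" "content v \<le> Q"
proof -
  obtain q a b where v: "v = ((q, a), b)" by (metis prod.exhaust)
  have q: "1 \<le> q" "q \<le> Q" using assms unfolding v arc_triples_iff by auto
  then have "gcd (gcd a b) (int q) \<le> int q" by (intro zdvd_imp_le) auto
  then have "gcd (gcd a b) (int q) \<le> int Q" using q by linarith
  moreover have "gcd (gcd a b) (int q) > 0" using q by simp
  ultimately show "0 < content v" "content v \<le> Q" using q by (auto simp: v nat_le_iff)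
qed

lemma scale_triple_mem:
  assumes m: "m > 0"
  shows "scale_triple m v \<in> arc_triples f A B Q d \<longleftrightarrow> v \<in> arc_triples f A B (Q div m) (d / real m)"
proof -
  obtain q a b where v: "v = ((q, a), b)" by (metis prod.exhaust)
  have m': "real m > 0" using m by simp
  have "1 \<le> m * q \<longleftrightarrow> 1 \<le> q" using m by (cases q) auto
  moreover have "m * q \<le> Q \<longleftrightarrow> q \<le> Q div m" using m by (simp add: less_eq_div_iff_mult_less_eq mult.commute)
  moreover have "real (m * q) * A \<le> of_int (int m * a) \<longleftrightarrow> real q * A \<le> of_int a"
    "of_int (int m * a) \<le> real (m * q) * B \<longleftrightarrow> of_int a \<le> real q * B" using m' by (simp_all add: mult.assoc)
  moreover have "\<bar>real (m * q) * f (of_int (int m * a) / real (m * q)) - of_int (int m * b)\<bar> < d \<longleftrightarrow>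
     \<bar>real q * f (of_int a / real q) - of_int b\<bar> < d / real m"
  proof -
    have "real (m * q) * f (of_int (int m * a) / real (m * q)) - of_int (int m * b) =
       real m * (real q * f (of_int a / real q) - of_int b)" using m' by (simp add: right_diff_distrib)
    then have "\<bar>real (m * q) * f (of_int (int m * a) / real (m * q)) - of_int (int m * b)\<bar> =
       real m * \<bar>real q * f (of_int a / real q) - of_int b\<bar>" by (simp add: abs_mult)
    then show ?thesis using m' by (simp add: pos_less_divide_eq mult.commute)
  qed
  ultimately show ?thesis unfolding v scale_triple.simps arc_triples_iff by (simp only:)
qed

text \<open>Dividing a triple by \<open>m\<close> divides both the bound on the denominator and the
  width by \<open>m\<close>. The main term \<delta> Q^2 thereby acquires the factor 1/m^3, which is
  the source of zeta(3).\<close>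

lemma card_content_multiples:
  assumes m: "m > 0" and d: "d \<le> 1"
  shows "card {v \<in> arc_triples f A B Q d. m dvd content v} = arc_count f A B (Q div m) (d / real m)"
proof -
  have dm: "d / real m \<le> 1"
  proof (cases "d \<ge> 0")
    case True
    have "d / real m \<le> d / 1" using True m by (intro divide_left_mono) auto
    then show ?thesis using d by simp
  next
    case False
    then have "d / real m \<le> 0" by (simp add: divide_nonpos_nonneg)
    then show ?thesis by simp
  qed
  have "bij_betw (scale_triple m) (arc_triples f A B (Q div m) (d / real m)) {v \<in> arc_triples f A B Q d. m dvd content v}"
  proof (rule bij_betw_imageI)
    show "inj_on (scale_triple m) (arc_triples f A B (Q div m) (d / real m))"
      using m by (auto simp: inj_on_def)
    have dvd: "m dvd content (scale_triple m v)" for v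
    proof -
      obtain q a b where v: "v = ((q, a), b)" by (metis prod.exhaust)
      have "int m dvd gcd (gcd (int m * a) (int m * b)) (int (m * q))" by simp
      then have "int m dvd int (content (scale_triple m v))" by (simp add: v)
      then show ?thesis by (simp only: of_nat_dvd_iff)
    qed
    show "scale_triple m ` arc_triples f A B (Q div m) (d / real m) = {v \<in> arc_triples f A B Q d. m dvd content v}"
    proof (intro equalityI subsetI)
      fix v assume "v \<in> scale_triple m ` arc_triples f A B (Q div m) (d / real m)"
      then show "v \<in> {v \<in> arc_triples f A B Q d. m dvd content v}" using scale_triple_mem[OF m] dvd by auto
    next
      fix v assume v: "v \<in> {v \<in> arc_triples f A B Q d. m dvd content v}"
      obtain q a b where vq: "v = ((q, a), b)" by (metis prod.exhaust)
      have "int m dvd int (content v)" using v by simp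
      then have "int m dvd gcd (gcd a b) (int q)" by (simp add: vq)
      then have "int m dvd a" "int m dvd b" "m dvd q" by auto
      then obtain a' b' q' where "a = int m * a'" "b = int m * b'" "q = m * q'" by (auto elim!: dvdE)
      then have e: "v = scale_triple m ((q', a'), b')" by (simp add: vq)
      then have "((q', a'), b') \<in> arc_triples f A B (Q div m) (d / real m)" using v scale_triple_mem[OF m] by auto
      then show "v \<in> scale_triple m ` arc_triples f A B (Q div m) (d / real m)" unfolding e by (rule imageI)
    qed
  qed
  then show ?thesis by (simp add: bij_betw_same_card[symmetric] card_arc_triples[OF dm])
qed

text \<open>\<open>N_hat\<close> counts pairs of rationals, the right side integer triples. They
  correspond because a primitive triple with positive q is recovered from its pair of fractions, q
  being their least common denominator.\<close>

lemma N_hat_eq_card: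
  assumes "d \<le> 1"
  shows "N_hat f {A..B} (real Q) d = card {v \<in> arc_triples f A B Q d. content v = 1}"
proof -
  define \<phi> :: "(nat \<times> int) \<times> int \<Rightarrow> rat \<times> rat" where
    "\<phi> = (\<lambda>((q, a), b). (of_int a / of_nat q, of_int b / of_nat q))"
  define V where "V = {v \<in> arc_triples f A B Q d. content v = 1}"
  have V: "((q, a), b) \<in> V \<longleftrightarrow> q > 0 \<and> real q \<le> real Q \<and> of_int a / real q \<in> {A..B} \<and> gcd (gcd a b) (int q) = 1 \<and>
       \<bar>f (of_int a / real q) - of_int b / real q\<bar> < d / real q" for q a b
  proof (cases "q > 0")
    case True
    then have "real q * A \<le> of_int a \<longleftrightarrow> A \<le> of_int a / real q" "of_int a \<le> real q * B \<longleftrightarrow> of_int a / real q \<le> B"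
      by (simp_all add: pos_le_divide_eq pos_divide_le_eq mult.commute)
    moreover have "\<bar>real q * f (of_int a / real q) - of_int b\<bar> < d \<longleftrightarrow> \<bar>f (of_int a / real q) - of_int b / real q\<bar> < d / real q"
    proof -
      have "real q * f (of_int a / real q) - of_int b = real q * (f (of_int a / real q) - of_int b / real q)"
        using True by (simp add: right_diff_distrib)
      then have "\<bar>real q * f (of_int a / real q) - of_int b\<bar> = real q * \<bar>f (of_int a / real q) - of_int b / real q\<bar>"
        by (simp add: abs_mult)
      then show ?thesis using True by (simp add: pos_less_divide_eq mult.commute)
    qed
    moreover have "nat (gcd (gcd a b) (int q)) = 1 \<longleftrightarrow> gcd (gcd a b) (int q) = 1" by (simp add: nat_eq_iff)
    ultimately show ?thesis unfolding V_def using True by (auto simp: arc_triples_iff)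
  qed (auto simp: V_def arc_triples_iff)
  have "near_points f {A..B} (real Q) d = \<phi> ` V"
  proof (intro equalityI subsetI)
    fix z assume "z \<in> near_points f {A..B} (real Q) d"
    then have "\<exists>a b q. z = (of_int a / of_nat q, of_int b / of_nat q) \<and> ((q, a), b) \<in> V"
      by (simp only: near_points_def V mem_Collect_eq)
    then obtain q a b where "z = (of_int a / of_nat q, of_int b / of_nat q)" "((q, a), b) \<in> V" by blast
    then show "z \<in> \<phi> ` V" by (intro rev_image_eqI[of "((q, a), b)"]) (auto simp: \<phi>_def)
  next
    fix z assume "z \<in> \<phi> ` V"
    then obtain q a b where qab: "((q, a), b) \<in> V" "z = \<phi> ((q, a), b)" by auto
    then have z: "z = (of_int a / of_nat q, of_int b / of_nat q)" by (simp add: \<phi>_def)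
    show "z \<in> near_points f {A..B} (real Q) d"
      unfolding near_points_def mem_Collect_eq
      by (rule exI[of _ a], rule exI[of _ b], rule exI[of _ q], rule conjI[OF z qab(1)[unfolded V]])
  qed
  moreover have "inj_on \<phi> V"
  proof (rule inj_onI)
    fix v v' assume vv: "v \<in> V" "v' \<in> V" "\<phi> v = \<phi> v'"
    obtain q a b q' a' b' where v: "v = ((q, a), b)" "v' = ((q', a'), b')" by (metis prod.exhaust)
    have q: "q > 0" "q' > 0" and g: "gcd (gcd a b) (int q) = 1" "gcd (gcd a' b') (int q') = 1"
      using vv unfolding v V by auto
    have "(of_int a :: rat) / of_nat q = of_int a' / of_nat q'" "(of_int b :: rat) / of_nat q = of_int b' / of_nat q'"
      using vv(3) by (simp_all add: v \<phi>_def)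
    then have "(of_int (a * int q') :: rat) = of_int (a' * int q)" "(of_int (b * int q') :: rat) = of_int (b' * int q)"
      using q by (simp_all add: frac_eq_eq)
    then have e: "int q' * a = int q * a'" "int q' * b = int q * b'" by (simp_all only: of_int_eq_iff mult.commute)
    \<comment> \<open>The triple of q scaled by q' coincides with the triple of q' scaled by q. By
      primitivity the gcds of the two sides are the scale factors themselves.\<close>
    have "int q' = gcd (int q' * a) (gcd (int q' * b) (int q' * int q))"
      using g by (simp add: gcd3_mult_left gcd.assoc)
    also have "\<dots> = gcd (int q * a') (gcd (int q * b') (int q * int q'))" unfolding e by (simp only: mult.commute[of "int q'" "int q"])
    also have "\<dots> = int q" using g by (simp add: gcd3_mult_left gcd.assoc)
    finally have "q' = q" by simp
    then show "v = v'" using e q by (simp add: v)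
  qed
  ultimately show ?thesis by (simp add: N_hat_def card_image V_def)
qed

lemma N_hat_moebius:
  assumes d: "d \<le> 1"
  shows "real (N_hat f {A..B} (real Q) d) = (\<Sum>m=1..Q. moebius m * real (arc_count f A B (Q div m) (d / real m)))"
proof -
  define T where "T = arc_triples f A B Q d"
  have fin: "finite T" unfolding T_def by (rule finite_arc_triples[OF d])
  have "real (N_hat f {A..B} (real Q) d) = (\<Sum>v\<in>T. if content v = 1 then 1 else 0)"
    unfolding N_hat_eq_card[OF d] T_def[symmetric] using fin by (simp add: sum.If_cases Int_def)
  also have "\<dots> = (\<Sum>v\<in>T. \<Sum>m\<in>{m\<in>{1..Q}. m dvd content v}. moebius m)"
    by (rule sum.cong[OF refl], rule sum_moebius_upto[symmetric]) (auto simp: T_def content_pos_le)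
  also have "\<dots> = (\<Sum>v\<in>T. \<Sum>m\<in>{1..Q}. if m dvd content v then moebius m else 0)"
    by (simp only: sum.inter_filter finite_atLeastAtMost)
  also have "\<dots> = (\<Sum>m\<in>{1..Q}. \<Sum>v\<in>T. if m dvd content v then moebius m else 0)" by (rule sum.swap)
  also have "\<dots> = (\<Sum>m\<in>{1..Q}. moebius m * real (arc_count f A B (Q div m) (d / real m)))"
  proof (rule sum.cong[OF refl])
    fix m assume "m \<in> {1..Q}"
    then have m: "m > 0" by auto
    have "(\<Sum>v\<in>T. if m dvd content v then moebius m else 0) = moebius m * real (card {v\<in>T. m dvd content v})"
      using fin by (simp add: sum.If_cases Int_def)
    then show "(\<Sum>v\<in>T. if m dvd content v then moebius m else 0) = moebius m * real (arc_count f A B (Q div m) (d / real m))"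
      unfolding T_def card_content_multiples[OF m d] .
  qed
  finally show ?thesis .
qed

section \<open>Convergent sums and the constant 1 / zeta 3\<close>

lemma sum_powr_bounded:
  assumes "s > 1"
  shows "\<exists>K>0. \<forall>n. (\<Sum>m=1..n. real m powr (- s)) \<le> K"
proof -
  have sm: "summable (\<lambda>n. real n powr (- s))" using summable_real_powr_iff[of "- s"] assms by simp
  have "(\<Sum>m=1..n. real m powr (- s)) \<le> (\<Sum>n. real n powr (- s)) + 1" for n
  proof -
    have "(\<Sum>m=1..n. real m powr (- s)) \<le> (\<Sum>n. real n powr (- s))" by (rule sum_le_suminf[OF sm]) auto
    then show ?thesis by simp
  qed
  moreover have "(\<Sum>n. real n powr (- s)) + 1 > 0" using suminf_nonneg[OF sm] by (simp add: add_nonneg_pos)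
  ultimately show ?thesis by blast
qed

text \<open>Telescoping with 1/(n+1)^3 \<le> 1/n - 1/(n+1). The true tail is of order 1/k^2, but 1/k
  suffices for an error O(Q).\<close>

lemma sum_inverse_cube_diff_le:
  assumes "1 \<le> k" "k \<le> n"
  shows "(\<Sum>m=1..n. 1 / real m ^ 3) \<le> (\<Sum>m=1..k. 1 / real m ^ 3) + (1 / real k - 1 / real n)"
  using assms(2)
proof (induction n rule: dec_induct)
  case (step n)
  have n: "real n > 0" using step assms by simp
  have "1 / real (Suc n) ^ 3 \<le> 1 / (real n * real (Suc n))"
  proof (rule divide_left_mono)
    have "real n * real (Suc n) \<le> real (Suc n) ^ 2 * 1" by (simp add: power2_eq_square)
    also have "\<dots> \<le> real (Suc n) ^ 2 * real (Suc n)" by (intro mult_left_mono) auto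
    finally show "real n * real (Suc n) \<le> real (Suc n) ^ 3" by (simp add: power2_eq_square power3_eq_cube)
  qed (use n in auto)
  also have "\<dots> = 1 / real n - 1 / real (Suc n)" using n by (simp add: field_simps)
  finally show ?case using step.IH by simp
qed simp

lemma zeta_3_bounds:
  assumes "1 \<le> k"
  shows "(\<Sum>m=1..k. 1 / real m ^ 3) \<le> zeta 3" "zeta 3 \<le> (\<Sum>m=1..k. 1 / real m ^ 3) + 1 / real k"
proof -
  define a where "a n = 1 / real (Suc n) ^ 3" for n
  have z: "zeta 3 = suminf a" unfolding zeta_def a_def by (simp add: powr_numeral del: of_nat_Suc)
  have part: "(\<Sum>m=1..n. 1 / real m ^ 3) = sum a {..<n}" for n
    using sum.atLeast1_atMost_eq[of "\<lambda>m. 1 / real m ^ 3" n] by (simp add: a_def del: of_nat_Suc)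
  have pos: "0 \<le> a n" for n by (simp add: a_def)
  have up: "sum a {..<n} \<le> sum a {..<k} + 1 / real k" for n
  proof (cases "k \<le> n")
    case True
    then show ?thesis using sum_inverse_cube_diff_le[OF assms True] unfolding part by (smt (verit) divide_nonneg_nonneg of_nat_0_le_iff)
  next
    case False
    then have "sum a {..<n} \<le> sum a {..<k}" using pos by (intro sum_mono2) auto
    then show ?thesis by (simp add: add_increasing2)
  qed
  have sm: "summable a" by (rule summableI_nonneg_bounded[OF pos up])
  show "(\<Sum>m=1..k. 1 / real m ^ 3) \<le> zeta 3" unfolding z part using pos by (intro sum_le_suminf[OF sm]) auto
  show "zeta 3 \<le> (\<Sum>m=1..k. 1 / real m ^ 3) + 1 / real k" unfolding z part by (rule suminf_le_const[OF sm up])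
qed

text \<open>Grouping by k = m n turns the double sum into divisor sums of the Moebius function,
  which vanish for k > 1. The truncation n \<le> Q div m says exactly m n \<le> Q, so the identity
  has no remainder.\<close>

lemma moebius_cube_convolution:
  assumes "1 \<le> Q"
  shows "(\<Sum>m=1..Q. moebius m / real m ^ 3 * (\<Sum>n=1..Q div m. 1 / real n ^ 3)) = 1"
proof -
  have "(\<Sum>m=1..Q. moebius m / real m ^ 3 * (\<Sum>n=1..Q div m. 1 / real n ^ 3)) =
     (\<Sum>m=1..Q. \<Sum>k=1..Q. if m dvd k then moebius m / real k ^ 3 else 0)"
  proof (rule sum.cong[OF refl])
    fix m assume "m \<in> {1..Q}"
    then have m: "m > 0" by auto
    have "moebius m / real m ^ 3 * (\<Sum>n=1..Q div m. 1 / real n ^ 3) = (\<Sum>n=1..Q div m. moebius m / real (m * n) ^ 3)"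
      by (simp add: sum_distrib_left power_mult_distrib)
    also have "\<dots> = (\<Sum>k\<in>{k\<in>{1..Q}. m dvd k}. moebius m / real k ^ 3)"
    proof (rule sum.reindex_bij_witness[of _ "\<lambda>k. k div m" "\<lambda>n. m * n"])
      fix n assume n: "n \<in> {1..Q div m}"
      then have "m * n \<le> m * (Q div m)" by (intro mult_left_mono) auto
      also have "\<dots> \<le> Q" by simp
      finally show "m * n \<in> {k\<in>{1..Q}. m dvd k}" using m n by auto
    next
      fix k assume "k \<in> {k\<in>{1..Q}. m dvd k}"
      then show "k div m \<in> {1..Q div m}" using m by (auto simp: div_le_mono elim!: dvdE)
    qed (use m in auto)
    also have "\<dots> = (\<Sum>k=1..Q. if m dvd k then moebius m / real k ^ 3 else 0)"
      by (simp only: sum.inter_filter finite_atLeastAtMost)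
    finally show "moebius m / real m ^ 3 * (\<Sum>n=1..Q div m. 1 / real n ^ 3) = (\<Sum>k=1..Q. if m dvd k then moebius m / real k ^ 3 else 0)" .
  qed
  also have "\<dots> = (\<Sum>k=1..Q. \<Sum>m=1..Q. if m dvd k then moebius m / real k ^ 3 else 0)" by (rule sum.swap)
  also have "\<dots> = (\<Sum>k=1..Q. if k = 1 then 1 else 0)"
  proof (rule sum.cong[OF refl])
    fix k assume k: "k \<in> {1..Q}"
    have "(\<Sum>m=1..Q. if m dvd k then moebius m / real k ^ 3 else 0) = (\<Sum>m\<in>{m\<in>{1..Q}. m dvd k}. moebius m / real k ^ 3)"
      by (simp only: sum.inter_filter finite_atLeastAtMost)
    also have "\<dots> = (\<Sum>m\<in>{m\<in>{1..Q}. m dvd k}. moebius m) / real k ^ 3" by (simp only: sum_divide_distrib)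
    also have "\<dots> = (if k = 1 then 1 else 0)" using sum_moebius_upto[of k Q] k by simp
    finally show "(\<Sum>m=1..Q. if m dvd k then moebius m / real k ^ 3 else 0) = (if k = 1 then 1 else 0)" .
  qed
  also have "\<dots> = 1" using assms by simp
  finally show ?thesis .
qed

text \<open>In the truncated convolution identity the inner sums fall short of zeta(3) by at most 1
  / (Q div m) \<le> 2 m / Q. Against 1/m^3 this leaves the convergent series of 1/m^2, times
  2/Q.\<close>

lemma moebius_cube_sum:
  shows "\<exists>K>0. \<forall>Q\<ge>1. \<bar>(\<Sum>m=1..Q. moebius m / real m ^ 3) - 1 / zeta 3\<bar> \<le> K / real Q"
proof -
  obtain K where K: "K > 0" "\<And>n. (\<Sum>m=1..n. real m powr (- 2)) \<le> K" using sum_powr_bounded[of 2] by auto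
  have "\<bar>(\<Sum>m=1..Q. moebius m / real m ^ 3) - 1 / zeta 3\<bar> \<le> (2 * K) / real Q" if Q: "1 \<le> Q" for Q
  proof -
    define S where "S = (\<Sum>m=1..Q. moebius m / real m ^ 3)"
    have z1: "zeta 3 \<ge> 1" using zeta_3_bounds(1)[of 1] by simp
    have "zeta 3 * S - 1 = (\<Sum>m=1..Q. moebius m / real m ^ 3 * (zeta 3 - (\<Sum>n=1..Q div m. 1 / real n ^ 3)))"
    proof -
      have "(\<Sum>m=1..Q. moebius m / real m ^ 3 * (zeta 3 - (\<Sum>n=1..Q div m. 1 / real n ^ 3))) =
        (\<Sum>m=1..Q. moebius m / real m ^ 3) * zeta 3 - (\<Sum>m=1..Q. moebius m / real m ^ 3 * (\<Sum>n=1..Q div m. 1 / real n ^ 3))"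
        by (simp only: right_diff_distrib sum_subtractf sum_distrib_right)
      then show ?thesis unfolding moebius_cube_convolution[OF Q] S_def by (simp only: mult.commute)
    qed
    also have "\<bar>\<dots>\<bar> \<le> (\<Sum>m=1..Q. 2 / real Q * real m powr (- 2))"
    proof (rule order_trans[OF sum_abs sum_mono])
      fix m assume m: "m \<in> {1..Q}"
      define k where "k = Q div m"
      have k: "1 \<le> k" using m by (simp add: k_def div_greater_zero_iff Suc_le_eq)
      have "Q < (k + 1) * m" using m dividend_less_div_times[of m Q] by (simp add: k_def)
      also have "\<dots> \<le> (2 * k) * m" using k by (intro mult_right_mono) auto
      finally have "real Q \<le> real (2 * k * m)" by (simp only: of_nat_le_iff)
      then have "1 / real k \<le> 2 * real m / real Q" using k Q by (simp add: field_simps)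
      then have "\<bar>zeta 3 - (\<Sum>n=1..k. 1 / real n ^ 3)\<bar> \<le> 2 * real m / real Q" using zeta_3_bounds[OF k] by linarith
      moreover have "\<bar>moebius m / real m ^ 3\<bar> \<le> 1 / real m ^ 3"
        using abs_moebius_le_1[of m] by (simp add: divide_right_mono)
      ultimately have "\<bar>moebius m / real m ^ 3\<bar> * \<bar>zeta 3 - (\<Sum>n=1..k. 1 / real n ^ 3)\<bar> \<le> 1 / real m ^ 3 * (2 * real m / real Q)"
        by (intro mult_mono) auto
      also have "\<dots> = 2 / real Q * real m powr (- 2)"
        using m by (simp add: powr_minus powr_numeral field_simps power3_eq_cube power2_eq_square)
      finally show "\<bar>moebius m / real m ^ 3 * (zeta 3 - (\<Sum>n=1..Q div m. 1 / real n ^ 3))\<bar> \<le> 2 / real Q * real m powr (- 2)"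
        by (simp add: abs_mult k_def)
    qed
    also have "\<dots> = 2 / real Q * (\<Sum>m=1..Q. real m powr (- 2))" by (simp only: sum_distrib_left)
    also have "\<dots> \<le> 2 / real Q * K" by (intro mult_left_mono K) auto
    finally have b: "\<bar>zeta 3 * S - 1\<bar> \<le> 2 / real Q * K" .
    have "S - 1 / zeta 3 = (zeta 3 * S - 1) / zeta 3" using z1 by (simp add: field_simps)
    then have "\<bar>S - 1 / zeta 3\<bar> = \<bar>zeta 3 * S - 1\<bar> / zeta 3" using z1 by (simp add: abs_divide)
    also have "\<dots> \<le> \<bar>zeta 3 * S - 1\<bar> / 1" using z1 by (intro divide_left_mono) auto
    finally show ?thesis using b by (simp add: S_def)
  qed
  then show ?thesis using K(1) by (intro exI[of _ "2 * K"]) auto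
qed

text \<open>Scaling by m multiplies the first error term by m^(-1/2) m^(-3/2) = m^(-2), except that
  its logarithm grows by ln m. Giving up half a power through ln m \<le> 2 sqrt m leaves m^(-3/2),
  still summable.\<close>

lemma error_size_scaled:
  assumes "\<epsilon> > 0" "0 < \<delta>" "\<delta> \<le> 1 / 2" "1 \<le> m" "m \<le> Q"
  shows "error_size \<epsilon> (Q div m) (\<delta> / real m) \<le>
     9 * (sqrt \<delta> * ln (1 / \<delta>) * real Q powr (3 / 2)) * real m powr (- (3 / 2)) + real Q powr (1 + \<epsilon>) * real m powr (- (1 + \<epsilon>))"
proof -
  define y where "y = real Q / real m"
  have m: "real m > 0" "real m \<ge> 1" using assms by auto
  have Q: "real Q > 0" using assms by auto
  have y: "y > 0" using m Q by (simp add: y_def)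
  have k: "real (Q div m) \<le> y" unfolding y_def by (rule of_nat_div_le_of_nat)
  have pw: "real (Q div m) powr s \<le> real Q powr s * real m powr (- s)" if "s \<ge> 0" for s
  proof -
    have "real (Q div m) powr s \<le> y powr s" using k that by (intro powr_mono2) auto
    also have "\<dots> = real Q powr s * real m powr (- s)" using m Q by (simp add: y_def powr_divide powr_minus_divide)
    finally show ?thesis .
  qed
  define a where "a = ln (1 / \<delta>)"
  \<comment> \<open>The bound \<delta> \<le> 1/2 keeps the logarithm away from zero, so that the
    additive ln m can be absorbed into a multiple of it.\<close>
  have a: "a \<ge> 1 / 2"
  proof -
    have "1 / 2 \<le> ln (2::real)" using ln2_ge_two_thirds by simp
    also have "\<dots> \<le> a" unfolding a_def using assms by (subst ln_le_cancel_iff) (auto simp: field_simps)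
    finally show ?thesis .
  qed
  have lm: "ln (real m) \<le> 2 * sqrt (real m)" using ln_powr_bound[of "real m" "1 / 2"] m by (simp add: powr_half_sqrt)
  have sm: "sqrt (real m) \<ge> 1" using m by simp
  have "ln (1 / (\<delta> / real m)) = a + ln (real m)" using assms m by (simp add: a_def ln_div)
  also have "\<dots> \<le> a * sqrt (real m) + 4 * (1 / 2) * sqrt (real m)"
  proof -
    have "a * 1 \<le> a * sqrt (real m)" using sm a by (intro mult_left_mono) auto
    then show ?thesis using lm by linarith
  qed
  also have "\<dots> \<le> a * sqrt (real m) + 4 * a * sqrt (real m)" using a sm by (intro add_left_mono mult_right_mono mult_left_mono) auto
  also have "\<dots> \<le> 9 * a * sqrt (real m)" using a sm by (simp add: mult_right_mono)
  finally have l: "ln (1 / (\<delta> / real m)) \<le> 9 * a * sqrt (real m)" .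
  have "sqrt (\<delta> / real m) * ln (1 / (\<delta> / real m)) * real (Q div m) powr (3 / 2) \<le>
     (sqrt (\<delta> / real m) * (9 * a * sqrt (real m))) * (real Q powr (3 / 2) * real m powr (- (3 / 2)))"
    using l pw[of "3 / 2"] assms a m by (intro mult_mono mult_left_mono mult_nonneg_nonneg) auto
  also have "sqrt (\<delta> / real m) * (9 * a * sqrt (real m)) = 9 * (sqrt \<delta> * a)" using m by (simp add: real_sqrt_divide)
  finally have "sqrt (\<delta> / real m) * ln (1 / (\<delta> / real m)) * real (Q div m) powr (3 / 2) \<le>
     9 * (sqrt \<delta> * ln (1 / \<delta>) * real Q powr (3 / 2)) * real m powr (- (3 / 2))" by (simp only: a_def mult_ac)
  moreover have "real (Q div m) powr (1 + \<epsilon>) \<le> real Q powr (1 + \<epsilon>) * real m powr (- (1 + \<epsilon>))" using assms by (intro pw) auto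
  ultimately show ?thesis unfolding error_size_def by linarith
qed

lemma floor_square_gap:
  assumes "m > 0"
  shows "\<bar>(real (Q div m))\<^sup>2 - (real Q / real m)\<^sup>2\<bar> \<le> 2 * (real Q / real m)"
proof -
  define y k where "y = real Q / real m" and "k = real (Q div m)"
  have 1: "k \<le> y" unfolding y_def k_def by (rule of_nat_div_le_of_nat)
  have "real Q < (k + 1) * real m"
  proof -
    have "Q < (Q div m + 1) * m" using assms dividend_less_div_times[of m Q] by simp
    then have "real Q < real ((Q div m + 1) * m)" by (simp only: of_nat_less_iff)
    then show ?thesis by (simp add: k_def distrib_right)
  qed
  then have 2: "y \<le> k + 1" using assms by (simp add: y_def pos_divide_le_eq)
  have k: "k \<ge> 0" by (simp add: k_def)
  have "(y - k) * (y + k) \<le> 1 * (2 * y)" using 1 2 k by (intro mult_mono) auto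
  moreover have "0 \<le> (y - k) * (y + k)" using 1 k by simp
  ultimately show ?thesis unfolding y_def[symmetric] k_def[symmetric] by (simp add: power2_eq_square algebra_simps)
qed

theorem theorem1:
  fixes \<eta> \<xi> c1 c2 L \<epsilon> :: real
  assumes "\<eta> < \<xi>" and "0 < c1" and "c1 \<le> c2" and "\<epsilon> > 0"
  shows "\<exists>C. \<forall>f \<in> curved_functions {\<eta>..\<xi>} c1 c2.
           L-lipschitz_on {\<eta>..\<xi>} (deriv_on {\<eta>..\<xi>} (deriv_on {\<eta>..\<xi>} f)) \<longrightarrow>
           (\<forall>(\<delta>::real) (Q::nat). 0 < \<delta> \<and> \<delta> \<le> 1/2 \<and> Q > 1 \<longrightarrow>
              \<bar>real (N_hat f {\<eta>..\<xi>} (real Q) \<delta>) - 1 / zeta 3 * (\<xi> - \<eta>) * \<delta> * real Q ^ 2\<bar>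
                \<le> C * (\<delta> powr (1/2) * ln (1/\<delta>) * real Q powr (3/2) + real Q powr (1 + \<epsilon>)))"
proof -
  define l where "l = \<xi> - \<eta>"
  have l: "l > 0" using assms by (simp add: l_def)
  obtain C where C: "C > 0" and bd: "\<And>f Q d. f \<in> curved_functions {\<eta>..\<xi>} c1 c2 \<Longrightarrow> 1 \<le> Q \<Longrightarrow> 0 < d \<Longrightarrow> d \<le> 1 / 2 \<Longrightarrow>
     \<bar>real (arc_count f \<eta> \<xi> Q d) - l * d * (real Q)\<^sup>2\<bar> \<le> C * error_size \<epsilon> Q d"
    using curved_functions_count[OF assms] unfolding l_def by blast
  obtain K1 where K1: "K1 > 0" "\<And>n. (\<Sum>m=1..n. real m powr (- (3 / 2))) \<le> K1" using sum_powr_bounded[of "3 / 2"] by auto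
  obtain K2 where K2: "K2 > 0" "\<And>n. (\<Sum>m=1..n. real m powr (- (1 + \<epsilon>))) \<le> K2" using sum_powr_bounded[of "1 + \<epsilon>"] assms by auto
  obtain K3 where K3: "K3 > 0" "\<And>n. (\<Sum>m=1..n. real m powr (- 2)) \<le> K3" using sum_powr_bounded[of 2] by auto
  obtain K4 where K4: "K4 > 0" "\<And>Q. 1 \<le> Q \<Longrightarrow> \<bar>(\<Sum>m=1..Q. moebius m / real m ^ 3) - 1 / zeta 3\<bar> \<le> K4 / real Q"
    using moebius_cube_sum by blast
  \<comment> \<open>One summand for each of the three replacements below: counts by their main
    terms, Q div m by Q / m, and the finite Moebius sum by 1 / zeta 3.\<close>
  define C' where "C' = C * (9 * K1 + K2) + 2 * l * K3 + l * K4"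
  show ?thesis
  proof (intro exI[of _ C'] ballI impI allI, elim conjE)
    fix f :: "real \<Rightarrow> real" and \<delta> :: real and Q :: nat
    assume f: "f \<in> curved_functions {\<eta>..\<xi>} c1 c2" and d: "0 < \<delta>" "\<delta> \<le> 1 / 2" and Q: "Q > 1"
    have Q0: "real Q > 0" using Q by simp
    define X Y where "X = sqrt \<delta> * ln (1 / \<delta>) * real Q powr (3 / 2)" and "Y = real Q powr (1 + \<epsilon>)"
    have X: "X \<ge> 0" using d by (simp add: X_def)
    have Y: "real Q \<le> Y" using powr_mono[of 1 "1 + \<epsilon>" "real Q"] Q assms by (simp add: Y_def)
    define M where "M m = l * (\<delta> / real m) * (real (Q div m))\<^sup>2" for m
    have 1: "\<bar>real (N_hat f {\<eta>..\<xi>} (real Q) \<delta>) - (\<Sum>m=1..Q. moebius m * M m)\<bar> \<le> C * (9 * K1 + K2) * (X + Y)"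
    proof -
      have "real (N_hat f {\<eta>..\<xi>} (real Q) \<delta>) - (\<Sum>m=1..Q. moebius m * M m) =
         (\<Sum>m=1..Q. moebius m * (real (arc_count f \<eta> \<xi> (Q div m) (\<delta> / real m)) - M m))"
        using d by (simp add: N_hat_moebius right_diff_distrib sum_subtractf)
      also have "\<bar>\<dots>\<bar> \<le> (\<Sum>m=1..Q. C * (9 * X * real m powr (- (3 / 2)) + Y * real m powr (- (1 + \<epsilon>))))"
      proof (rule order_trans[OF sum_abs sum_mono])
        fix m assume "m \<in> {1..Q}"
        then have m: "1 \<le> m" "m \<le> Q" by auto
        have k: "1 \<le> Q div m" using m by (simp add: div_greater_zero_iff Suc_le_eq)
        have "\<delta> / real m \<le> \<delta> / 1" using m d by (intro divide_left_mono) auto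
        then have dm: "0 < \<delta> / real m" "\<delta> / real m \<le> 1 / 2" using d m by auto
        have "\<bar>moebius m * (real (arc_count f \<eta> \<xi> (Q div m) (\<delta> / real m)) - M m)\<bar> \<le>
           1 * \<bar>real (arc_count f \<eta> \<xi> (Q div m) (\<delta> / real m)) - M m\<bar>"
          unfolding abs_mult by (intro mult_right_mono abs_moebius_le_1) auto
        also have "\<dots> \<le> C * error_size \<epsilon> (Q div m) (\<delta> / real m)" using bd[OF f k dm] by (simp add: M_def)
        also have "\<dots> \<le> C * (9 * X * real m powr (- (3 / 2)) + Y * real m powr (- (1 + \<epsilon>)))"
          unfolding X_def Y_def using C by (intro mult_left_mono error_size_scaled assms(4) d m) auto
        finally show "\<bar>moebius m * (real (arc_count f \<eta> \<xi> (Q div m) (\<delta> / real m)) - M m)\<bar> \<le>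
           C * (9 * X * real m powr (- (3 / 2)) + Y * real m powr (- (1 + \<epsilon>)))" .
      qed
      also have "\<dots> = C * (9 * X * (\<Sum>m=1..Q. real m powr (- (3 / 2))) + Y * (\<Sum>m=1..Q. real m powr (- (1 + \<epsilon>))))"
        by (simp only: sum_distrib_left[symmetric] sum.distrib)
      also have "\<dots> \<le> C * (9 * X * K1 + Y * K2)"
        using C X Y by (intro mult_left_mono add_mono K1 K2) auto
      also have "\<dots> \<le> C * ((9 * K1 + K2) * (X + Y))"
        using C K1(1) K2(1) X Y by (intro mult_left_mono) (auto simp: algebra_simps)
      finally show ?thesis by (simp only: mult.assoc)
    qed
    \<comment> \<open>Rounding Q / m down changes the square by at most 2 Q / m. With the weight l
      \<delta> / m this leaves Q times a convergent sum.\<close>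
    have 2: "\<bar>(\<Sum>m=1..Q. moebius m * M m) - l * \<delta> * (real Q)\<^sup>2 * (\<Sum>m=1..Q. moebius m / real m ^ 3)\<bar> \<le> 2 * l * K3 * real Q"
    proof -
      have "(\<Sum>m=1..Q. moebius m * M m) - l * \<delta> * (real Q)\<^sup>2 * (\<Sum>m=1..Q. moebius m / real m ^ 3) =
         (\<Sum>m=1..Q. moebius m * (l * (\<delta> / real m)) * ((real (Q div m))\<^sup>2 - (real Q / real m)\<^sup>2))"
        unfolding sum_distrib_left sum_subtractf[symmetric]
        by (rule sum.cong[OF refl]) (auto simp: M_def field_simps power2_eq_square power3_eq_cube)
      also have "\<bar>\<dots>\<bar> \<le> (\<Sum>m=1..Q. 2 * l * real Q * real m powr (- 2))"
      proof (rule order_trans[OF sum_abs sum_mono])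
        fix m assume "m \<in> {1..Q}"
        then have m: "m > 0" by auto
        have "\<bar>moebius m\<bar> * (l * (\<delta> / real m)) * \<bar>(real (Q div m))\<^sup>2 - (real Q / real m)\<^sup>2\<bar> \<le>
           1 * (l * (1 / real m)) * (2 * (real Q / real m))"
          using l d m by (intro mult_mono abs_moebius_le_1 floor_square_gap mult_nonneg_nonneg divide_right_mono) auto
        also have "\<dots> = 2 * l * real Q * real m powr (- 2)"
          using m by (simp add: powr_minus powr_numeral field_simps power2_eq_square)
        finally show "\<bar>moebius m * (l * (\<delta> / real m)) * ((real (Q div m))\<^sup>2 - (real Q / real m)\<^sup>2)\<bar> \<le> 2 * l * real Q * real m powr (- 2)"
          using l d by (simp add: abs_mult)
      qed
      also have "\<dots> = 2 * l * real Q * (\<Sum>m=1..Q. real m powr (- 2))" by (simp only: sum_distrib_left)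
      also have "\<dots> \<le> 2 * l * real Q * K3" using l by (intro mult_left_mono K3) auto
      finally show ?thesis by (simp only: mult_ac)
    qed
    \<comment> \<open>The Moebius sum misses its limit by O(1/Q), so against Q^2 the loss is again
      O(Q), which Q^(1+\<epsilon>) covers.\<close>
    have 3: "\<bar>l * \<delta> * (real Q)\<^sup>2 * (\<Sum>m=1..Q. moebius m / real m ^ 3) - l * \<delta> * (real Q)\<^sup>2 * (1 / zeta 3)\<bar> \<le> l * K4 * real Q"
    proof -
      have "\<bar>l * \<delta> * (real Q)\<^sup>2 * (\<Sum>m=1..Q. moebius m / real m ^ 3) - l * \<delta> * (real Q)\<^sup>2 * (1 / zeta 3)\<bar> =
         l * \<delta> * (real Q)\<^sup>2 * \<bar>(\<Sum>m=1..Q. moebius m / real m ^ 3) - 1 / zeta 3\<bar>"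
        using l d unfolding right_diff_distrib[symmetric] by (simp add: abs_mult)
      also have "\<dots> \<le> l * 1 * (real Q)\<^sup>2 * (K4 / real Q)"
        using l d Q K4(1) by (intro mult_mono K4(2)) auto
      also have "\<dots> = l * K4 * real Q" using Q0 by (simp add: power2_eq_square)
      finally show ?thesis .
    qed
    have "\<bar>real (N_hat f {\<eta>..\<xi>} (real Q) \<delta>) - l * \<delta> * (real Q)\<^sup>2 * (1 / zeta 3)\<bar> \<le>
       C * (9 * K1 + K2) * (X + Y) + (2 * l * K3 * real Q + l * K4 * real Q)" using 1 2 3 by linarith
    moreover have "2 * l * K3 * real Q \<le> 2 * l * K3 * (X + Y)" "l * K4 * real Q \<le> l * K4 * (X + Y)"
      using X Y l K3(1) K4(1) by (auto intro!: mult_left_mono)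
    ultimately have "\<bar>real (N_hat f {\<eta>..\<xi>} (real Q) \<delta>) - l * \<delta> * (real Q)\<^sup>2 * (1 / zeta 3)\<bar> \<le> C' * (X + Y)"
      unfolding C'_def distrib_right[of _ _ "X + Y"] by linarith
    moreover have "\<delta> powr (1 / 2) = sqrt \<delta>" using d by (simp add: powr_half_sqrt)
    ultimately show "\<bar>real (N_hat f {\<eta>..\<xi>} (real Q) \<delta>) - 1 / zeta 3 * (\<xi> - \<eta>) * \<delta> * real Q ^ 2\<bar>
      \<le> C' * (\<delta> powr (1/2) * ln (1/\<delta>) * real Q powr (3/2) + real Q powr (1 + \<epsilon>))"
      by (simp add: X_def Y_def l_def mult_ac)
  qed
qed

end
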